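(* There exist $\rho>0$ and $R>0$ such that: (i) for every $(a_0,u_0)\in(PM^{d-1}\cap PM^{d})\times PM^{d-1}$ with $\|(a_0,|D|a_0,u_0)\|_{PM^{d-1}}\le\rho$ there exists a unique solution $(a,u)\in X_\infty$ of the Cauchy problem (NSK) with initial condition $(a,u)|_{t=0}=(a_0,u_0)$ such that $\|(a,u)\|_{X_\infty}\le R$; (ii) for every $(a_0,u_0)\in(PM^{d-1}\cap PM^{d})\times PM^{d-1}$ such that $$\|(a_0,|D|a_0,u_0)\|_{PM^{d-1}}\le\frac{\rho}{2e^{2c_0}},$$ the solution given by (i) is analytic in space for every time $t>0$, with a radius of analyticity bounded below by $c_0\sqrt t$, i.e. $\operatorname{rad}(a(t),u(t))\ge c_0\sqrt t$.
   Context: Standing assumptions: $d\ge 2$ is an integer, $p>2$ is real with $d-3+\frac4p>0$; $\mu,\nu,\kappa,\alpha$ are real constants with $\mu>0$, $\mu+\nu>0$, $\kappa>0$, $\alpha>0$. Spaces. $\widehat{g}$ is the Fourier transform in the space variable and $m(D)$ the Fourier multiplier with symbol $m(\xi)$. For $r\ge0$, $PM^r=PM^r(\mathbb R^d)$ is the set of $g\in\mathcal S'(\mathbb R^d)$ with $\widehat g\in L^1_{loc}$ and $\|g\|_{PM^r}:=\sup_{\xi}|\xi|^r|\widehat g(\xi)|<\infty$ (essential supremum); for vector-valued $g$, $|\widehat g|$ is the Euclidean norm. In particular $\|(a_0,|D|a_0,u_0)\|_{PM^{r}}=\sup_\xi |\xi|^{r}|(\widehat a_0,|\xi|\widehat a_0,\widehat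 u_0)(\xi)|$. For $r>0$, $K^{p,r}_\infty$ is the space of continuous $u:\,]0,+\infty[\to PM^{r+2/p}$ with $\|u\|_{K^{p,r}_\infty}:=\sup_{t>0}t^{1/p}\|u(t)\|_{PM^{r+2/p}}<\infty$. $X_\infty$ is the space of $(a,u)\in(K^{p,d-1}_\infty\cap K^{p,d}_\infty)\times K^{p,d-1}_\infty$ ($a$ scalar, $u$ with $d$ components) with norm $\|(a,u)\|_{X_\infty}:=\max\{\|a\|_{K^{p,d-1}_\infty},\|a\|_{K^{p,d}_\infty}\}+\|u\|_{K^{p,d-1}_\infty}$. System (NSK): $$\partial_t a+\operatorname{div}u=f(u,a),\qquad \partial_t u-\mu\Delta u-(\mu+\nu)\nabla\operatorname{div}u+\alpha\nabla a-\kappa\nabla\Delta a=g(u,a),$$ with $f(u,a)=-u\cdot\nabla a$ and $g(u,a)=-u\cdot\nabla u+\mu\nabla a\cdot\nabla u+(\mu+\nu)\nabla a\cdot Du+\frac{\kappa}{2}\nabla(\nabla a\cdot\nabla a)$, where $(\nabla a\cdot\nabla u)_j=\sum_i\partial_i a\,\partial_i u_j$ and $(\nabla a\cdot Du)_j=\sum_i\partial_i a\,\partial_j u_i$. Products are understood through convolution of Fourier transforms. Solutions are mild solutions: $(a,u)\in X_\infty$ is a solution with data $(a_0,u_0)$ if for all $t>0$ $$(a,u)(t)=W(t)(a_0,u_0)+\int_0^tW(t-s)\big(f(u,a)(s),g(u,a)(s)\big)ds,$$ where $W(t)=e^{-tA(D)}$ and, for $b\in\mathbb C$, $w\in\mathbb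 C^d$, $A(\xi)(b,w)=\big(i\xi\cdot w,\ i(\alpha+\kappa|\xi|^2)b\,\xi+\mu|\xi|^2w+(\mu+\nu)(\xi\cdot w)\xi\big)$. The constant $c_0$. $c_0>0$ is a fixed constant (such a constant exists), depending only on the parameters of the system, for which there is $C>0$ such that for all $t\ge0$, $\xi\in\mathbb R^d$, $(b_0,w_0)\in\mathbb C\times\mathbb C^d$, setting $(b,w)=e^{-tA(\xi)}(b_0,w_0)$, one has $|(b,|\xi|b,w)|\le Ce^{-c_0t|\xi|^2}|(b_0,|\xi|b_0,w_0)|$. Radius of analyticity. For $r<d$ and $v\in PM^r$, $\operatorname{rad}(v):=\sup\{\sigma>0: e^{\sigma|D|}v\in PM^r\}$ (with $\sup\emptyset=0$); for a vector, $\operatorname{rad}$ is the minimum over the components. For $(a(t),u(t))$ one takes $r=d-1+\frac2p$ (which is $<d$). *)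

theory Defs
  imports "HOL-Analysis.Analysis" "HOL-Probability.Essential_Supremum"
begin

section \<open>Schwartz functions and tempered distributions\<close>

definition partial_deriv :: "'n::finite \<Rightarrow> (real^'n \<Rightarrow> complex) \<Rightarrow> real^'n \<Rightarrow> complex" where
  "partial_deriv i \<phi> = (\<lambda>x. frechet_derivative \<phi> (at x) (axis i 1))"

definition iter_deriv :: "'n::finite list \<Rightarrow> (real^'n \<Rightarrow> complex) \<Rightarrow> real^'n \<Rightarrow> complex" where
  "iter_deriv js \<phi> = foldr partial_deriv js \<phi>"

text \<open>Differentiability of all iterated partial derivatives at every point is smoothness.\<close>

definition schwartz_space :: "(real^'n::finite \<Rightarrow> complex) set" where
  "schwartz_space = {\<phi>. (\<forall>js x. iter_deriv js \<phi> differentiable (at x)) \<and>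
     (\<forall>k js. bdd_above (range (\<lambda>x. norm x ^ k * norm (iter_deriv js \<phi> x))))}"

definition schwartz_seminorm ::
  "nat \<Rightarrow> 'n::finite list \<Rightarrow> (real^'n \<Rightarrow> complex) \<Rightarrow> real" where
  "schwartz_seminorm k js \<phi> = (SUP x. norm x ^ k * norm (iter_deriv js \<phi> x))"

type_synonym 'n functional = "(real^'n \<Rightarrow> complex) \<Rightarrow> complex"

text \<open>A tempered distribution is a continuous linear functional on the Schwartz space. It is
  encoded as a functional on all functions that vanishes outside the Schwartz space, so that
  equality of functionals is equality of distributions.\<close>

definition tempered :: "'n::finite functional set" where
  "tempered = {T. (\<forall>\<phi>. \<phi> \<notin> schwartz_space \<longrightarrow> T \<phi> = 0) \<and>
     (\<forall>\<phi>\<in>schwartz_space. \<forall>\<psi>\<in>schwartz_space. T (\<lambda>x. \<phi> x + \<psi> x) = T \<phi> + T \<psi>) \<and>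
     (\<forall>c. \<forall>\<phi>\<in>schwartz_space. T (\<lambda>x. c * \<phi> x) = c * T \<phi>) \<and>
     (\<exists>C N. \<forall>\<phi>\<in>schwartz_space.
        norm (T \<phi>) \<le> C * (\<Sum>k\<le>N. \<Sum>js | length js \<le> N. schwartz_seminorm k js \<phi>))}"

section \<open>Fourier transform\<close>

text \<open>Convention: the transform of \<open>\<phi>\<close> at \<open>\<xi>\<close> is the integral of \<open>exp (- \<i> x \<bullet> \<xi>) \<phi> x\<close>, so that
  \<open>\<partial>\<^sub>j\<close> has symbol \<open>\<i> \<xi>\<^sub>j\<close> and the transform of a product is \<open>(2\<pi>)\<close> to the power \<open>-d\<close> times the
  convolution of the transforms.\<close>

definition fourier :: "(real^'n::finite \<Rightarrow> complex) \<Rightarrow> real^'n \<Rightarrow> complex" where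
  "fourier \<phi> \<xi> = (LINT x|lborel. exp (- \<i> * complex_of_real (x \<bullet> \<xi>)) * \<phi> x)"

definition fourier_functional :: "'n::finite functional \<Rightarrow> 'n functional" where
  "fourier_functional T = (\<lambda>\<phi>. if \<phi> \<in> schwartz_space then T (fourier \<phi>) else 0)"

definition locally_integrable :: "(real^'n::finite \<Rightarrow> complex) \<Rightarrow> bool" where
  "locally_integrable h \<longleftrightarrow> (\<forall>K. compact K \<longrightarrow> set_integrable lborel K h)"

definition represents :: "(real^'n::finite \<Rightarrow> complex) \<Rightarrow> 'n functional \<Rightarrow> bool" where
  "represents h T \<longleftrightarrow> (\<forall>\<phi>\<in>schwartz_space.
     integrable lborel (\<lambda>\<xi>. h \<xi> * \<phi> \<xi>) \<and> T \<phi> = (LINT \<xi>|lborel. h \<xi> * \<phi> \<xi>))"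

definition has_fourier_function :: "'n::finite functional \<Rightarrow> (real^'n \<Rightarrow> complex) \<Rightarrow> bool" where
  "has_fourier_function T h \<longleftrightarrow> locally_integrable h \<and> represents h (fourier_functional T)"

text \<open>The Fourier transform as a function, determined up to null sets.\<close>

definition hat :: "'n::finite functional \<Rightarrow> real^'n \<Rightarrow> complex" where
  "hat T = (SOME h. has_fourier_function T h)"

definition hatv :: "('n::finite functional)^'n \<Rightarrow> real^'n \<Rightarrow> complex^'n" where
  "hatv T = (\<lambda>\<xi>. \<chi> j. hat (T $ j) \<xi>)"

section \<open>The function spaces\<close>

definition weighted_sup :: "real \<Rightarrow> (real^'n::finite \<Rightarrow> 'b::real_normed_vector) \<Rightarrow> ennreal" where
  "weighted_sup r h = esssup lborel (\<lambda>\<xi>. ennreal (norm \<xi> powr r * norm (h \<xi>)))"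

definition PM_norm :: "real \<Rightarrow> 'n::finite functional \<Rightarrow> ennreal" where
  "PM_norm r T = weighted_sup r (hat T)"

definition PMv_norm :: "real \<Rightarrow> ('n::finite functional)^'n \<Rightarrow> ennreal" where
  "PMv_norm r T = weighted_sup r (hatv T)"

definition PM :: "real \<Rightarrow> 'n::finite functional set" where
  "PM r = {T \<in> tempered. (\<exists>h. has_fourier_function T h) \<and> PM_norm r T < \<infinity>}"

definition PMv :: "real \<Rightarrow> (('n::finite functional)^'n) set" where
  "PMv r = {T. (\<forall>j. T $ j \<in> tempered \<and> (\<exists>h. has_fourier_function (T $ j) h)) \<and>
     PMv_norm r T < \<infinity>}"

text \<open>The norm of \<open>(a\<^sub>0, |D|a\<^sub>0, u\<^sub>0)\<close>; the norm of a product type is the Euclidean one.\<close>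

definition data_norm ::
  "real \<Rightarrow> 'n::finite functional \<Rightarrow> ('n functional)^'n \<Rightarrow> ennreal" where
  "data_norm r a u = weighted_sup r (\<lambda>\<xi>. (hat a \<xi>, complex_of_real (norm \<xi>) * hat a \<xi>, hatv u \<xi>))"

text \<open>The spaces \<open>K\<close>, for scalar curves (with \<open>PM\<close>, \<open>PM_norm\<close>) and for vector curves (with
  \<open>PMv\<close>, \<open>PMv_norm\<close>). Values of a curve at times \<open>t \<le> 0\<close> are irrelevant.\<close>

definition K_norm ::
  "(real \<Rightarrow> 'x \<Rightarrow> ennreal) \<Rightarrow> real \<Rightarrow> real \<Rightarrow> (real \<Rightarrow> 'x) \<Rightarrow> ennreal" where
  "K_norm N p r u = (SUP t\<in>{0<..}. ennreal (t powr (1 / p)) * N (r + 2 / p) (u t))"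

definition K_space ::
  "(real \<Rightarrow> 'x::minus set) \<Rightarrow> (real \<Rightarrow> 'x \<Rightarrow> ennreal) \<Rightarrow> real \<Rightarrow> real \<Rightarrow> (real \<Rightarrow> 'x) set" where
  "K_space V N p r = {u. (\<forall>t>0. u t \<in> V (r + 2 / p)) \<and>
     (\<forall>t>0. ((\<lambda>s. N (r + 2 / p) (u s - u t)) \<longlongrightarrow> 0) (at t)) \<and>
     K_norm N p r u < \<infinity>}"

definition X_space ::
  "real \<Rightarrow> ((real \<Rightarrow> 'n::finite functional) \<times> (real \<Rightarrow> ('n functional)^'n)) set" where
  "X_space p = (K_space PM PM_norm p (real CARD('n) - 1) \<inter> K_space PM PM_norm p (real CARD('n)))
     \<times> K_space PMv PMv_norm p (real CARD('n) - 1)"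

definition X_norm ::
  "real \<Rightarrow> (real \<Rightarrow> 'n::finite functional) \<Rightarrow> (real \<Rightarrow> ('n functional)^'n) \<Rightarrow> ennreal" where
  "X_norm p a u =
     max (K_norm PM_norm p (real CARD('n) - 1) a) (K_norm PM_norm p (real CARD('n)) a)
     + K_norm PMv_norm p (real CARD('n) - 1) u"

section \<open>The system\<close>

definition cdot :: "real^'n::finite \<Rightarrow> complex^'n \<Rightarrow> complex" where
  "cdot \<xi> w = (\<Sum>j\<in>UNIV. complex_of_real (\<xi> $ j) * w $ j)"

definition A_symbol :: "real \<Rightarrow> real \<Rightarrow> real \<Rightarrow> real \<Rightarrow> real^'n::finite
    \<Rightarrow> complex \<times> (complex^'n) \<Rightarrow> complex \<times> (complex^'n)" where
  "A_symbol \<mu> \<nu> \<kappa> \<alpha> \<xi> = (\<lambda>(b, w).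
     (\<i> * cdot \<xi> w,
      \<chi> j. \<i> * complex_of_real (\<alpha> + \<kappa> * (norm \<xi>)\<^sup>2) * b * complex_of_real (\<xi> $ j)
          + complex_of_real (\<mu> * (norm \<xi>)\<^sup>2) * w $ j
          + complex_of_real (\<mu> + \<nu>) * cdot \<xi> w * complex_of_real (\<xi> $ j)))"

text \<open>The symbol \<open>exp (- t A(\<xi>))\<close> of \<open>W(t)\<close>, by the exponential series of the linear map \<open>A(\<xi>)\<close>.\<close>

definition W_symbol :: "real \<Rightarrow> real \<Rightarrow> real \<Rightarrow> real \<Rightarrow> real \<Rightarrow> real^'n::finite
    \<Rightarrow> complex \<times> (complex^'n) \<Rightarrow> complex \<times> (complex^'n)" where
  "W_symbol \<mu> \<nu> \<kappa> \<alpha> t \<xi> v =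
     (\<Sum>k. ((- t) ^ k / fact k) *\<^sub>R ((A_symbol \<mu> \<nu> \<kappa> \<alpha> \<xi> ^^ k) v))"

text \<open>The next definitions act on Fourier transforms: \<open>dsym j\<close> is \<open>\<partial>\<^sub>j\<close> and \<open>hprod\<close> is the product.
  The value of \<open>hprod\<close> at each point does not depend on the chosen representatives.\<close>

definition dsym :: "'n::finite \<Rightarrow> (real^'n \<Rightarrow> complex) \<Rightarrow> real^'n \<Rightarrow> complex" where
  "dsym j h = (\<lambda>\<xi>. \<i> * complex_of_real (\<xi> $ j) * h \<xi>)"

definition hprod ::
  "(real^'n::finite \<Rightarrow> complex) \<Rightarrow> (real^'n \<Rightarrow> complex) \<Rightarrow> real^'n \<Rightarrow> complex" where
  "hprod h k = (\<lambda>\<xi>. complex_of_real (1 / (2 * pi) ^ CARD('n)) *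
     (LINT \<eta>|lborel. h (\<xi> - \<eta>) * k \<eta>))"

definition f_hat ::
  "(real^'n::finite \<Rightarrow> complex^'n) \<Rightarrow> (real^'n \<Rightarrow> complex) \<Rightarrow> real^'n \<Rightarrow> complex" where
  "f_hat u a \<xi> = - (\<Sum>i\<in>UNIV. hprod (\<lambda>\<zeta>. u \<zeta> $ i) (dsym i a) \<xi>)"

definition g_hat :: "real \<Rightarrow> real \<Rightarrow> real
    \<Rightarrow> (real^'n::finite \<Rightarrow> complex^'n) \<Rightarrow> (real^'n \<Rightarrow> complex) \<Rightarrow> real^'n \<Rightarrow> complex^'n" where
  "g_hat \<mu> \<nu> \<kappa> u a \<xi> = (\<chi> j.
     - (\<Sum>i\<in>UNIV. hprod (\<lambda>\<zeta>. u \<zeta> $ i) (dsym i (\<lambda>\<zeta>. u \<zeta> $ j)) \<xi>)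
     + complex_of_real \<mu> * (\<Sum>i\<in>UNIV. hprod (dsym i a) (dsym i (\<lambda>\<zeta>. u \<zeta> $ j)) \<xi>)
     + complex_of_real (\<mu> + \<nu>) * (\<Sum>i\<in>UNIV. hprod (dsym i a) (dsym j (\<lambda>\<zeta>. u \<zeta> $ i)) \<xi>)
     + complex_of_real (\<kappa> / 2) * dsym j (\<lambda>\<zeta>. \<Sum>i\<in>UNIV. hprod (dsym i a) (dsym i a) \<zeta>) \<xi>)"

text \<open>The integrand of the Duhamel term at time \<open>s\<close>, in Fourier variables.\<close>

definition duhamel :: "real \<Rightarrow> real \<Rightarrow> real \<Rightarrow> real
    \<Rightarrow> (real \<Rightarrow> 'n::finite functional) \<Rightarrow> (real \<Rightarrow> ('n functional)^'n)
    \<Rightarrow> real \<Rightarrow> real^'n \<Rightarrow> real \<Rightarrow> complex \<times> (complex^'n)" where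
  "duhamel \<mu> \<nu> \<kappa> \<alpha> a u t \<xi> s = W_symbol \<mu> \<nu> \<kappa> \<alpha> (t - s) \<xi>
     (f_hat (hatv (u s)) (hat (a s)) \<xi>, g_hat \<mu> \<nu> \<kappa> (hatv (u s)) (hat (a s)) \<xi>)"

text \<open>The Duhamel formula, as an identity of the Fourier transforms for almost every frequency.\<close>

definition mild_solution :: "real \<Rightarrow> real \<Rightarrow> real \<Rightarrow> real \<Rightarrow> real
    \<Rightarrow> 'n::finite functional \<Rightarrow> ('n functional)^'n
    \<Rightarrow> (real \<Rightarrow> 'n functional) \<Rightarrow> (real \<Rightarrow> ('n functional)^'n) \<Rightarrow> bool" where
  "mild_solution \<mu> \<nu> \<kappa> \<alpha> p a0 u0 a u \<longleftrightarrow> (a, u) \<in> X_space p \<and>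
     (\<forall>t>0. AE \<xi> in lborel.
        set_integrable lborel {0<..<t} (duhamel \<mu> \<nu> \<kappa> \<alpha> a u t \<xi>) \<and>
        (hat (a t) \<xi>, hatv (u t) \<xi>) =
          W_symbol \<mu> \<nu> \<kappa> \<alpha> t \<xi> (hat a0 \<xi>, hatv u0 \<xi>)
          + (LINT s:{0<..<t}|lborel. duhamel \<mu> \<nu> \<kappa> \<alpha> a u t \<xi> s))"

text \<open>\<open>(b, |\<xi>|b, w)\<close>\<close>

definition augment :: "real^'n::finite \<Rightarrow> complex \<times> (complex^'n)
    \<Rightarrow> complex \<times> complex \<times> (complex^'n)" where
  "augment \<xi> = (\<lambda>(b, w). (b, complex_of_real (norm \<xi>) * b, w))"

section \<open>Radius of analyticity\<close>

text \<open>\<open>e\<close> to the power \<open>\<sigma>|D|\<close> applied to \<open>v\<close> is the distribution whose Fourier transform is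
  \<open>exp (\<sigma>|\<xi>|)\<close> times that of \<open>v\<close>. In \<open>ennreal\<close> the supremum of the empty set is \<open>0\<close>.\<close>

definition rad :: "real \<Rightarrow> 'n::finite functional \<Rightarrow> ennreal" where
  "rad r v = Sup {ennreal \<sigma> | \<sigma>. \<sigma> > 0 \<and> (\<exists>w\<in>PM r.
     AE \<xi> in lborel. hat w \<xi> = complex_of_real (exp (\<sigma> * norm \<xi>)) * hat v \<xi>)}"

definition rad_pair :: "real \<Rightarrow> 'n::finite functional \<Rightarrow> ('n functional)^'n \<Rightarrow> ennreal" where
  "rad_pair r a u = Min (insert (rad r a) (range (\<lambda>j. rad r (u $ j))))"

end

theory Submission
  imports Defs "HOL-Probability.Characteristic_Functions"
begin

text \<open>In Fourier variables the Duhamel formula is a fixed point equation for functions \<open>v\<close> of time and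
  frequency. Measure the size of \<open>v = (a, u)\<close> by \<open>|(a, |\<xi>|a, u)|\<close> and bound it by a multiple of
  \<open>t\<close> to the power \<open>-1/p\<close> times \<open>|\<xi>|\<close> to the power \<open>-\<sigma>\<close> times \<open>exp (- \<tau> \<surd>t |\<xi>|)\<close>, where
  \<open>\<sigma> = d - 1 + 2/p\<close>. Convolutions of homogeneous powers and the parabolic decay of the semigroup give a
  contraction for every \<open>0 \<le> \<tau> \<le> c0\<close>. Picard iteration with \<open>\<tau> = c0\<close> yields a solution that is
  already analytic, and uniqueness with \<open>\<tau> = 0\<close> identifies it with any solution that is small in
  \<open>X\<close>. The exponential factor also makes the Duhamel integral Lipschitz or Hoelder in time without
  any interpolation, which is how the continuity required by \<open>K\<close> is obtained.

  To return to distributions one needs that the transform of a tempered distribution, when it is a function,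
  is unique almost everywhere and determines the distribution; both follow from Gaussian
  regularization and the inversion formula on the Schwartz space, in which the value of the
  constant is irrelevant.\<close>

section \<open>Convolution of powers\<close>

text \<open>The exponents are dictated by scaling. If a, |\<xi>| a and u have size t^(-1/p)
  |\<xi>|^(-\<sigma>), then grad a may be charged either |\<xi>|^(-\<sigma>) or
  |\<xi>|^(-(\<sigma>-1)), and each term of f, |\<xi>| f and g becomes a convolution of the powers
  \<sigma> and \<sigma>-1, or of \<sigma> and \<sigma> with one further factor |\<xi>|. All have
  size t^(-2/p) |\<xi>|^\<gamma>, \<gamma> = d + 1 - 2\<sigma>. These convolutions converge when
  \<sigma> < d and 2\<sigma> - 1 > d, which are the conditions p > 2 and d - 3 + 4/p > 0. Trading
  parabolic decay for (t-s)^(1/p-1) |\<xi>|^(-2+2/p) restores |\<xi>|^(-\<sigma>), and the remaining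
  integral in s is a Beta integral that converges since p > 2 and scales like t^(-1/p). The obstacle
  is uniqueness: a competing solution in X is known to have only polynomial bounds. This is why
  \<tau> is kept as a parameter and the bilinear constant is uniform in it: one smallness threshold
  then serves both for constructing the analytic solution and for comparing it with a rough
  one.\<close>

lemma power_tail_integrable:
  fixes a b :: real
  assumes b: "0 \<le> b" "b < real CARD('n::finite)" and ab: "a + b > real CARD('n)"
  shows "integrable lborel (\<lambda>y::real^'n. max 1 (norm y) powr (-a) * norm y powr (-b))"
proof -
  let ?f = "\<lambda>y::real^'n. max 1 (norm y) powr (-a) * norm y powr (-b)"
  define d where "d = CARD('n)"
  define V where "V = unit_ball_vol (real d)"
  have V: "V \<ge> 0" by (simp add: V_def)
  \<comment> \<open>A dyadic majorant: the first summand dominates the integrand on 2^-(k+1) \<le>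
    |y| < 2^-k, the second on 2^k \<le> |y| < 2^(k+1). Whole balls replace annuli because only their
    volume is needed.\<close>
  define g :: "nat \<Rightarrow> real^'n \<Rightarrow> ennreal" where
    "g k = (\<lambda>y. ennreal (2 powr (real (k+1) * b)) * indicator (ball 0 (2 powr - real k)) y
        + ennreal (2 powr (- real k * (a+b))) * indicator (ball 0 (2 powr (real k + 1))) y)" for k
  have [measurable]: "g k \<in> borel_measurable lborel" for k unfolding g_def
    by (intro borel_measurable_add borel_measurable_times_ennreal borel_measurable_const borel_measurable_indicator) auto
  have meas[measurable]: "?f \<in> borel_measurable lborel" by measurable
  have le: "ennreal (?f y) \<le> (\<Sum>k. g k y)" for y
  proof (cases "y = 0")
    case True then show ?thesis by simp
  next
    case False
    then have pos: "norm y > 0" by simp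
    have "\<exists>k. ennreal (?f y) \<le> g k y"
    proof (cases "norm y < 1")
      case True
      define k where "k = nat \<lfloor>- log 2 (norm y)\<rfloor>"
      have l0: "- log 2 (norm y) > 0" using True pos by (simp)
      have k1: "real k \<le> - log 2 (norm y)" "- log 2 (norm y) < real k + 1"
        using l0 unfolding k_def by linarith+
      show ?thesis
      proof (cases "norm y < 2 powr - real k")
        case True
        have "2 powr - (real k + 1) \<le> norm y" 
          using k1 pos le_log_iff[of 2 "norm y" "-(real k+1)"] by (simp add: algebra_simps)
        then have "norm y powr (-b) \<le> (2 powr - (real k + 1)) powr (-b)"
          using b by (intro powr_mono2') auto
        also have "\<dots> = 2 powr (real (k+1) * b)" by (simp add: powr_powr algebra_simps)
        finally have "?f y \<le> 2 powr (real (k+1) * b)" using \<open>norm y < 1\<close> by (simp add: max_def)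
        then have "ennreal (?f y) \<le> g k y" unfolding g_def using True
          by (auto intro!: add_increasing2 ennreal_leI simp: indicator_def)
        then show ?thesis ..
      next
        case False
        \<comment> \<open>On the sphere |y| = 2^-k the open ball of index k is missed; the next
          larger ball, of index k - 1, takes over, and k \<ge> 1 because |y| < 1.\<close>
        have "norm y \<le> 2 powr - real k" using k1 pos log_le_iff[of 2 "norm y" "- real k"] by simp
        then have eq: "norm y = 2 powr - real k" using False by simp
        have "k \<ge> 1" using \<open>norm y < 1\<close> eq by (cases k) auto
        then obtain j where j: "k = Suc j" by (cases k) auto
        have "norm y powr (-b) = 2 powr ((- real (Suc j)) * (-b))" unfolding eq j powr_powr ..
        then have "norm y powr (-b) = 2 powr (real (j+1) * b)" by (simp only: minus_mult_minus Suc_eq_plus1)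
        then have "?f y \<le> 2 powr (real (j+1) * b)" using \<open>norm y < 1\<close> by (simp add: max_def)
        moreover have "norm y < 2 powr - real j" by (simp add: eq j)
        ultimately have "ennreal (?f y) \<le> g j y" unfolding g_def 
          by (auto intro!: add_increasing2 ennreal_leI simp: indicator_def)
        then show ?thesis ..
      qed
    next
      case False
      define k where "k = nat \<lfloor>log 2 (norm y)\<rfloor>"
      have l0: "log 2 (norm y) \<ge> 0" using False pos by (simp)
      have k1: "real k \<le> log 2 (norm y)" "log 2 (norm y) < real k + 1"
        using l0 unfolding k_def by linarith+
      have n1: "2 powr (real k) \<le> norm y" using k1 pos by (simp add: le_log_iff)
      have n2: "norm y < 2 powr (real k + 1)" using k1 pos by (simp add: log_less_iff)
      have "norm y powr (-(a+b)) \<le> (2 powr (real k)) powr (-(a+b))"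
        using n1 b ab by (intro powr_mono2') auto
      also have "\<dots> = 2 powr (- real k * (a+b))" by (simp add: powr_powr algebra_simps)
      finally have "?f y \<le> 2 powr (- real k * (a+b))" using False by (simp add: max_def powr_add[symmetric])
      then have "ennreal (?f y) \<le> g k y" unfolding g_def using n2
        by (auto intro!: add_increasing ennreal_leI simp: indicator_def)
      then show ?thesis ..
    qed
    then obtain k where "ennreal (?f y) \<le> g k y" ..
    also have "\<dots> \<le> (\<Sum>k. g k y)"
      using sum_le_suminf[of "\<lambda>k. g k y" "{k}"] by simp
    finally show ?thesis .
  qed
  \<comment> \<open>Ratios of the geometric series of masses: b < d makes the shells at the origin
    summable, a + b > d those at infinity.\<close>
  define r1 r2 where "r1 = 2 powr (b - real d)" and "r2 = 2 powr (real d - (a+b))"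
  have r: "0 < r1" "r1 < 1" "0 < r2" "r2 < 1" 
    unfolding r1_def r2_def using b ab by (auto simp: d_def intro: powr_less_one)
  define c where "c k = V * 2 powr b * r1 ^ k + V * 2 powr (real d) * r2 ^ k" for k :: nat
  have powr_power_2: "(2 powr x) ^ m = 2 powr (x * real m)" for x and m :: nat
    by (simp add: powr_realpow[symmetric] powr_powr)
  have gi: "(\<integral>\<^sup>+y. g k y \<partial>lborel) = ennreal (c k)" for k
  proof -
    have "(\<integral>\<^sup>+y. g k y \<partial>lborel) = ennreal (2 powr (real (k+1) * b)) * emeasure lborel (ball (0::real^'n) (2 powr - real k))
        + ennreal (2 powr (- real k * (a+b))) * emeasure lborel (ball (0::real^'n) (2 powr (real k + 1)))"
    proof -
      have m: "(\<lambda>y::real^'n. ennreal w * indicator (ball 0 r) y) \<in> borel_measurable lborel" for w r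
        by (intro borel_measurable_times_ennreal borel_measurable_const borel_measurable_indicator) auto
      have n: "(\<integral>\<^sup>+y. ennreal w * indicator (ball (0::real^'n) r) y \<partial>lborel) = ennreal w * emeasure lborel (ball (0::real^'n) r)" for w r
        by (rule nn_integral_cmult_indicator) simp
      show ?thesis unfolding g_def nn_integral_add[OF m m] n ..
    qed
    also have "\<dots> = ennreal (2 powr (real (k+1) * b) * (V * (2 powr - real k)^d)
         + 2 powr (- real k * (a+b)) * (V * (2 powr (real k + 1))^d))"
      using V by (simp add: emeasure_ball V_def d_def ennreal_mult[symmetric] del: ennreal_plus)
        (subst ennreal_plus, auto intro!: mult_nonneg_nonneg)
    also have "2 powr (real (k+1) * b) * (V * (2 powr - real k)^d) = V * 2 powr b * r1 ^ k"
    proof -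
      have "2 powr (real (k+1) * b) * (2 powr - real k)^d = 2 powr (real (k+1) * b + (- real k) * real d)"
        by (simp only: powr_power_2 powr_add)
      also have "real (k+1) * b + (- real k) * real d = b + (b - real d) * real k" by (simp add: algebra_simps)
      also have "2 powr (b + (b - real d) * real k) = 2 powr b * r1 ^ k" by (simp only: r1_def powr_power_2 powr_add)
      finally show ?thesis by simp
    qed
    also have "2 powr (- real k * (a+b)) * (V * (2 powr (real k + 1))^d) = V * 2 powr (real d) * r2^k"
    proof -
      have "2 powr (- real k * (a+b)) * (2 powr (real k + 1))^d = 2 powr (- real k * (a+b) + (real k + 1) * real d)"
        by (simp only: powr_power_2 powr_add[of 2 "- real k * (a+b)"])
      also have "- real k * (a+b) + (real k + 1) * real d = real d + (real d - (a+b)) * real k" by (simp add: algebra_simps)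
      also have "2 powr (real d + (real d - (a+b)) * real k) = 2 powr (real d) * r2 ^ k" by (simp only: r2_def powr_power_2 powr_add)
      finally show ?thesis by simp
    qed
    finally show ?thesis by (simp add: c_def)
  qed
  have sc: "summable c" unfolding c_def using r by (intro summable_add summable_mult summable_geometric) auto
  have c0: "c k \<ge> 0" for k unfolding c_def using V r by simp
  have "(\<integral>\<^sup>+y. ennreal (?f y) \<partial>lborel) \<le> (\<integral>\<^sup>+y. (\<Sum>k. g k y) \<partial>lborel)"
    by (intro nn_integral_mono le)
  also have "\<dots> = (\<Sum>k. ennreal (c k))" by (simp add: nn_integral_suminf gi)
  also have "\<dots> = ennreal (suminf c)" by (intro suminf_ennreal2 c0 sc)
  finally have "(\<integral>\<^sup>+y. ennreal (?f y) \<partial>lborel) < \<infinity>" by (simp add: le_less_trans)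
  then show ?thesis by (intro integrableI_nonneg) auto
qed


section \<open>Affine changes of variable for Lebesgue measure\<close>

lemma lborel_integral_affine_vec:
  fixes f :: "'a::euclidean_space \<Rightarrow> 'b::{banach, second_countable_topology}"
  assumes [measurable]: "f \<in> borel_measurable borel" and c: "c \<noteq> 0"
  shows "(LINT x|lborel. f x) = \<bar>c\<bar> ^ DIM('a) *\<^sub>R (LINT x|lborel. f (t + c *\<^sub>R x))"
proof -
  have "(LINT x|lborel. f x) = (LINT x|density (distr lborel borel (\<lambda>x. t + c *\<^sub>R x)) (\<lambda>_. \<bar>c\<bar>^DIM('a)). f x)"
    using lborel_affine[OF c, of t] by simp
  also have "\<dots> = \<bar>c\<bar> ^ DIM('a) *\<^sub>R (LINT x|lborel. f (t + c *\<^sub>R x))"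
    by (subst integral_density) (auto simp: integral_distr)
  finally show ?thesis .
qed

lemma lborel_integrable_affine_vec:
  fixes f :: "'a::euclidean_space \<Rightarrow> 'b::{banach, second_countable_topology}"
  assumes [measurable]: "f \<in> borel_measurable borel" and c: "c \<noteq> 0"
  shows "integrable lborel f \<longleftrightarrow> integrable lborel (\<lambda>x. f (t + c *\<^sub>R x))"
proof -
  have "integrable lborel f = integrable (density (distr lborel borel (\<lambda>x. t + c *\<^sub>R x)) (\<lambda>_. \<bar>c\<bar>^DIM('a))) f"
    using lborel_affine[OF c, of t] by simp
  also have "\<dots> = integrable lborel (\<lambda>x. f (t + c *\<^sub>R x))"
    (is "_ = integrable lborel ?g")
  proof -
    have "integrable (density (distr lborel borel (\<lambda>x. t + c *\<^sub>R x)) (\<lambda>_. \<bar>c\<bar>^DIM('a))) f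
       \<longleftrightarrow> integrable lborel (\<lambda>x. \<bar>c\<bar>^DIM('a) *\<^sub>R ?g x)"
      by (subst integrable_density) (auto simp: integrable_distr_eq)
    also have "\<dots> \<longleftrightarrow> integrable lborel ?g"
    proof
      assume A: "integrable lborel (\<lambda>x. \<bar>c\<bar>^DIM('a) *\<^sub>R ?g x)"
      have "integrable lborel (\<lambda>x. (1 / \<bar>c\<bar>^DIM('a)) *\<^sub>R (\<bar>c\<bar>^DIM('a) *\<^sub>R ?g x))"
        by (rule integrable_scaleR_right) (rule A)
      then show "integrable lborel ?g" using c by (simp del: scaleR_conv_of_real)
    next
      assume A: "integrable lborel ?g"
      show "integrable lborel (\<lambda>x. \<bar>c\<bar>^DIM('a) *\<^sub>R ?g x)"
        by (rule integrable_scaleR_right) (rule A)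
    qed
    finally show ?thesis .
  qed
  finally show ?thesis .
qed

lemma lborel_AE_affine_vec:
  fixes P :: "'a::euclidean_space \<Rightarrow> bool"
  assumes "AE x in lborel. P x" and c: "c \<noteq> 0"
  shows "AE x in lborel. P (t + c *\<^sub>R x)"
proof -
  obtain N where N: "N \<in> null_sets lborel" "{x. \<not> P x} \<subseteq> N"
    using assms(1) by (auto simp: eventually_ae_filter)
  have Nb[measurable]: "N \<in> sets borel" using N(1) by auto
  have "0 = (\<integral>\<^sup>+x. indicator N x \<partial>lborel)" using N by (simp add: null_sets_def)
  also have "\<dots> = (\<integral>\<^sup>+x. indicator N x \<partial>density (distr lborel borel (\<lambda>x. t + c *\<^sub>R x)) (\<lambda>_. \<bar>c\<bar>^DIM('a)))"
    using lborel_affine[OF c, of t] by simp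
  also have "\<dots> = ennreal (\<bar>c\<bar>^DIM('a)) * (\<integral>\<^sup>+x. indicator N (t + c *\<^sub>R x) \<partial>lborel)"
    by (subst nn_integral_density) (auto simp: nn_integral_cmult nn_integral_distr simp del: nn_integral_indicator)
  finally have "(\<integral>\<^sup>+x. indicator N (t + c *\<^sub>R x) \<partial>lborel) = 0"
    using c by (simp add: ennreal_zero_less_mult_iff[symmetric] del: ennreal_zero_less_mult_iff)
  then have "AE x in lborel. indicator N (t + c *\<^sub>R x) = (0::ennreal)"
    by (subst (asm) nn_integral_0_iff_AE) auto
  then show ?thesis by eventually_elim (use N(2) in \<open>auto simp: indicator_def split: if_splits\<close>)
qed

text \<open>Homogeneity: the substitution y -> r y moves the cutoff radius r to 1, with d powers of
  r from the Jacobian and -a - b from the kernel.\<close>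

lemma power_kernel_scaling:
  fixes a b r :: real
  assumes b: "0 \<le> b" "b < real CARD('n::finite)" and ab: "a + b > real CARD('n)" and r: "r > 0"
  shows "integrable lborel (\<lambda>y::real^'n. max r (norm y) powr (-a) * norm y powr (-b))" (is ?A)
    and "(LINT y|lborel. max r (norm (y::real^'n)) powr (-a) * norm y powr (-b))
       = r powr (real CARD('n) - a - b) * (LINT y|lborel. max 1 (norm (y::real^'n)) powr (-a) * norm y powr (-b))" (is ?B)
proof -
  let ?f = "\<lambda>r. \<lambda>y::real^'n. max r (norm y) powr (-a) * norm y powr (-b)"
  have [measurable]: "?f r \<in> borel_measurable borel" for r by measurable
  have sc: "?f r (0 + r *\<^sub>R y) = r powr (- a - b) * ?f 1 y" for y
  proof -
    have "max r (norm (0 + r *\<^sub>R y)) = r * max 1 (norm y)" using r by (simp add: max_mult_distrib_left)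
    then show ?thesis using r by (simp add: powr_mult powr_add[symmetric] powr_diff powr_minus field_simps)
  qed
  show ?A
    using power_tail_integrable[OF b ab] 
    by (subst lborel_integrable_affine_vec[where t=0 and c=r]) (use r in \<open>auto simp only: sc integrable_mult_right\<close>, auto)
  have "(LINT y|lborel. ?f r y) = r ^ CARD('n) * (r powr (-a-b) * (LINT y|lborel. ?f 1 y))"
    by (subst lborel_integral_affine_vec[where t=0 and c=r]) (use r in \<open>auto simp only: sc integral_mult_right_zero\<close>, auto)
  also have "\<dots> = r powr (real CARD('n) + (-a-b)) * (LINT y|lborel. ?f 1 y)"
    using r by (simp add: powr_realpow[symmetric] powr_add)
  finally show ?B by (simp add: algebra_simps)
qed

text \<open>At every \<eta> the larger of |\<xi> - \<eta>| and |\<eta>| is at least |\<xi>|/2, so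
  its negative power is controlled by the kernel truncated at that radius. This leaves two kernels
  with one singularity each, centred at 0 and at \<xi>, and scaling gives the power of
  |\<xi>|.\<close>

lemma convolution_of_powers:
  fixes a b :: real
  assumes a: "0 \<le> a" "a < real CARD('n::finite)" and b: "0 \<le> b" "b < real CARD('n)"
    and ab: "a + b > real CARD('n)"
  shows "\<exists>C\<ge>0. \<forall>\<xi>::real^'n. \<xi> \<noteq> 0 \<longrightarrow>
      integrable lborel (\<lambda>\<eta>. norm (\<xi> - \<eta>) powr (-a) * norm \<eta> powr (-b)) \<and>
      (LINT \<eta>|lborel. norm (\<xi> - \<eta>) powr (-a) * norm \<eta> powr (-b)) \<le> C * norm \<xi> powr (real CARD('n) - a - b)"
proof -
  let ?f = "\<lambda>a b r. \<lambda>y::real^'n. max r (norm y) powr (-a) * norm y powr (-b)"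
  define e where "e = real CARD('n) - a - b"
  define C where "C = (1/2) powr e * ((LINT y|lborel. ?f a b 1 y) + (LINT y|lborel. ?f b a 1 y))"
  have "C \<ge> 0" unfolding C_def by (auto intro!: mult_nonneg_nonneg add_nonneg_nonneg Bochner_Integration.integral_nonneg)
  moreover have "integrable lborel (\<lambda>\<eta>. norm (\<xi> - \<eta>) powr (-a) * norm \<eta> powr (-b)) \<and>
      (LINT \<eta>|lborel. norm (\<xi> - \<eta>) powr (-a) * norm \<eta> powr (-b)) \<le> C * norm \<xi> powr e" if "\<xi> \<noteq> 0" for \<xi> :: "real^'n"
  proof -
    define r where "r = norm \<xi> / 2"
    have r: "r > 0" using that by (simp add: r_def)
    let ?g = "\<lambda>\<eta>. norm (\<xi> - \<eta>) powr (-a) * norm \<eta> powr (-b)"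
    let ?h = "\<lambda>\<eta>. ?f a b r \<eta> + ?f b a r (\<xi> + (-1) *\<^sub>R \<eta>)"
    have ba: "b + a > real CARD('n)" using ab by simp
    have ab': "(-b) + (-a) = (-a) + (-b)" by simp
    have [measurable]: "?f a b r \<in> borel_measurable borel" for a b by measurable
    have i1: "integrable lborel (?f a b r)" by (rule power_kernel_scaling[OF b ab r])
    have i0: "integrable lborel (?f b a r)" by (rule power_kernel_scaling[OF a ba r])
    then have i2: "integrable lborel (\<lambda>\<eta>. ?f b a r (\<xi> + (-1) *\<^sub>R \<eta>))"
      by (subst (asm) lborel_integrable_affine_vec[where t=\<xi> and c="-1"]) auto
    have e2: "(LINT \<eta>|lborel. ?f b a r (\<xi> + (-1) *\<^sub>R \<eta>)) = (LINT \<eta>|lborel. ?f b a r \<eta>)"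
      by (subst (2) lborel_integral_affine_vec[where t=\<xi> and c="-1"]) auto
    have ih: "integrable lborel ?h" using i1 i2 by (rule Bochner_Integration.integrable_add)
    have le: "?g \<eta> \<le> ?h \<eta>" for \<eta>
    proof -
      have tri: "norm \<xi> \<le> norm (\<xi> - \<eta>) + norm \<eta>" using norm_triangle_ineq[of "\<xi> - \<eta>" \<eta>] by simp
      show ?thesis
      proof (cases "norm \<eta> \<le> norm (\<xi> - \<eta>)")
        case True
        then have "max r (norm \<eta>) \<le> norm (\<xi> - \<eta>)" using tri by (auto simp: r_def)
        then have "norm (\<xi> - \<eta>) powr (-a) \<le> max r (norm \<eta>) powr (-a)"
          using a r by (intro powr_mono2') auto
        then have "?g \<eta> \<le> ?f a b r \<eta>" by (intro mult_right_mono) auto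
        moreover have "?f b a r (\<xi> + (-1) *\<^sub>R \<eta>) \<ge> 0" by simp
        ultimately show ?thesis by linarith
      next
        case False
        then have "max r (norm (\<xi> - \<eta>)) \<le> norm \<eta>" using tri by (auto simp: r_def)
        then have "norm \<eta> powr (-b) \<le> max r (norm (\<xi> - \<eta>)) powr (-b)"
          using b r by (intro powr_mono2') auto
        then have "?g \<eta> \<le> ?f b a r (\<xi> - \<eta>)" by (subst mult.commute, intro mult_right_mono) auto
        then show ?thesis by (simp add: add_increasing)
      qed
    qed
    have ig: "integrable lborel ?g"
      by (rule Bochner_Integration.integrable_bound[OF ih]) (use le in \<open>auto intro!: AE_I2\<close>)
    have "(LINT \<eta>|lborel. ?g \<eta>) \<le> (LINT \<eta>|lborel. ?h \<eta>)"
      by (intro Bochner_Integration.integral_mono ig ih le)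
    also have "\<dots> = (LINT \<eta>|lborel. ?f a b r \<eta>) + (LINT \<eta>|lborel. ?f b a r \<eta>)"
      using i1 i2 by (subst Bochner_Integration.integral_add) (auto simp only: e2)
    also have "\<dots> = r powr (real CARD('n) - a - b) * (LINT y|lborel. ?f a b 1 y)
        + r powr (real CARD('n) - b - a) * (LINT y|lborel. ?f b a 1 y)"
      using power_kernel_scaling(2)[OF b ab r] power_kernel_scaling(2)[OF a ba r] by simp
    also have "\<dots> = C * norm \<xi> powr e"
    proof -
      have "r powr e = (1/2) powr e * norm \<xi> powr e" unfolding r_def by (subst powr_mult[symmetric]) auto
      moreover have "real CARD('n) - a - b = e" "real CARD('n) - b - a = e" by (auto simp: e_def)
      ultimately show ?thesis by (simp add: C_def algebra_simps)
    qed
    finally show ?thesis using ig by simp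
  qed
  ultimately show ?thesis unfolding e_def by blast
qed

section \<open>Products as convolutions in frequency\<close>

text \<open>Because |\<xi>| \<le> |\<xi> - \<eta>| + |\<eta>|, the product of the two exponential
  weights is at most the weight at \<xi>. It leaves the integral, so the constant is the one of the
  plain powers and does not depend on \<tau>.\<close>

lemma hprod_bound:
  fixes a b :: real
  assumes a: "0 \<le> a" "a < real CARD('n::finite)" and b: "0 \<le> b" "b < real CARD('n)"
    and ab: "a + b > real CARD('n)"
  shows "\<exists>C\<ge>0. \<forall>(h::real^'n \<Rightarrow> complex) k A B \<tau>.
     h \<in> borel_measurable borel \<longrightarrow> k \<in> borel_measurable borel \<longrightarrow> 0 \<le> \<tau> \<longrightarrow>
     (AE \<xi> in lborel. norm (h \<xi>) \<le> A * (norm \<xi> powr (-a) * exp (- \<tau> * norm \<xi>))) \<longrightarrow>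
     (AE \<xi> in lborel. norm (k \<xi>) \<le> B * (norm \<xi> powr (-b) * exp (- \<tau> * norm \<xi>))) \<longrightarrow>
     (\<forall>\<xi>. \<xi> \<noteq> 0 \<longrightarrow> integrable lborel (\<lambda>\<eta>. h (\<xi> - \<eta>) * k \<eta>) \<and>
        norm (hprod h k \<xi>) \<le> C * (A * B) * (norm \<xi> powr (real CARD('n) - a - b) * exp (- \<tau> * norm \<xi>)))"
proof -
  obtain C where C: "C \<ge> 0" and CI: "\<And>\<xi>::real^'n. \<xi> \<noteq> 0 \<Longrightarrow>
      integrable lborel (\<lambda>\<eta>. norm (\<xi> - \<eta>) powr (-a) * norm \<eta> powr (-b)) \<and>
      (LINT \<eta>|lborel. norm (\<xi> - \<eta>) powr (-a) * norm \<eta> powr (-b)) \<le> C * norm \<xi> powr (real CARD('n) - a - b)"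
    using convolution_of_powers[OF a b ab] by blast
  define D where "D = C / (2*pi)^CARD('n)"
  have "integrable lborel (\<lambda>\<eta>. h (\<xi> - \<eta>) * k \<eta>) \<and>
        norm (hprod h k \<xi>) \<le> D * (A * B) * (norm \<xi> powr (real CARD('n) - a - b) * exp (- \<tau> * norm \<xi>))"
    if [measurable]: "h \<in> borel_measurable borel" "k \<in> borel_measurable borel" and "0 \<le> \<tau>"
     and hA: "AE \<xi> in lborel. norm (h \<xi>) \<le> A * (norm \<xi> powr (-a) * exp (- \<tau> * norm \<xi>))"
     and kB: "AE \<xi> in lborel. norm (k \<xi>) \<le> B * (norm \<xi> powr (-b) * exp (- \<tau> * norm \<xi>))"
     and x: "\<xi> \<noteq> 0" 
    for h k :: "real^'n \<Rightarrow> complex" and A B \<tau> \<xi>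
  proof -
    \<comment> \<open>No sign of A or B is assumed: a negative constant would bound a norm from
      above by a negative number almost everywhere.\<close>
    have nn: "A \<ge> 0" if "AE \<xi> in lborel. norm (h \<xi>) \<le> A * (norm \<xi> powr (-a) * exp (- \<tau> * norm \<xi>))"
      for h :: "real^'n \<Rightarrow> complex" and A a
    proof (rule ccontr)
      assume "\<not> A \<ge> 0"
      then have neg: "A * (norm \<xi> powr (-a) * exp (- \<tau> * norm \<xi>)) < 0" if "\<xi> \<noteq> 0" for \<xi> :: "real^'n"
        using that by (intro mult_neg_pos) auto
      have "AE \<xi> in lborel. \<xi> \<noteq> (0::real^'n)" by (rule AE_lborel_singleton)
      with that have "AE \<xi> in (lborel::(real^'n) measure). False"
        by eventually_elim (use neg in \<open>meson norm_ge_zero not_less order_trans\<close>)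
      then show False by (simp add: trivial_limit_def[symmetric] eventually_const Measure_Space.ae_filter_eq_bot_iff)
    qed
    have A: "A \<ge> 0" and B: "B \<ge> 0" using nn hA kB by blast+
    \<comment> \<open>Reflection about the fixed \<xi> preserves null sets, so an almost everywhere
      bound on h controls the integrand for every nonzero \<xi>.\<close>
    have hA': "AE \<eta> in lborel. norm (h (\<xi> + (-1) *\<^sub>R \<eta>)) \<le> A * (norm (\<xi> + (-1) *\<^sub>R \<eta>) powr (-a) * exp (- \<tau> * norm (\<xi> + (-1) *\<^sub>R \<eta>)))"
      by (rule lborel_AE_affine_vec[OF hA]) simp
    let ?g = "\<lambda>\<eta>. (A * B * exp (- \<tau> * norm \<xi>)) * (norm (\<xi> - \<eta>) powr (-a) * norm \<eta> powr (-b))"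
    have ae: "AE \<eta> in lborel. norm (h (\<xi> - \<eta>) * k \<eta>) \<le> ?g \<eta>"
      using hA' kB
    proof eventually_elim
      case (elim \<eta>)
      have "norm \<xi> \<le> norm (\<xi> - \<eta>) + norm \<eta>" using norm_triangle_ineq[of "\<xi> - \<eta>" \<eta>] by simp
      then have "\<tau> * norm \<xi> \<le> \<tau> * (norm (\<xi> - \<eta>) + norm \<eta>)" using \<open>0 \<le> \<tau>\<close> by (intro mult_left_mono)
      then have E: "exp (- \<tau> * norm (\<xi> - \<eta>)) * exp (- \<tau> * norm \<eta>) \<le> exp (- \<tau> * norm \<xi>)"
        by (simp add: exp_add[symmetric] algebra_simps)
      have "norm (h (\<xi> - \<eta>) * k \<eta>) \<le> (A * (norm (\<xi> - \<eta>) powr (-a) * exp (- \<tau> * norm (\<xi> - \<eta>))))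
          * (B * (norm \<eta> powr (-b) * exp (- \<tau> * norm \<eta>)))"
        unfolding norm_mult using elim A B by (intro mult_mono) auto
      also have "\<dots> = (A * B * (norm (\<xi> - \<eta>) powr (-a) * norm \<eta> powr (-b))) * (exp (- \<tau> * norm (\<xi> - \<eta>)) * exp (- \<tau> * norm \<eta>))"
        by (simp add: algebra_simps)
      also have "\<dots> \<le> (A * B * (norm (\<xi> - \<eta>) powr (-a) * norm \<eta> powr (-b))) * exp (- \<tau> * norm \<xi>)"
        using E A B by (intro mult_left_mono) auto
      finally show ?case by (simp add: algebra_simps)
    qed
    have ig: "integrable lborel ?g" using CI[OF x] by (intro integrable_mult_right) auto
    have ih: "integrable lborel (\<lambda>\<eta>. h (\<xi> - \<eta>) * k \<eta>)"
    proof (rule Bochner_Integration.integrable_bound[OF ig])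
      show "AE \<eta> in lborel. norm (h (\<xi> - \<eta>) * k \<eta>) \<le> norm (?g \<eta>)"
        using ae by eventually_elim (erule order_trans, simp only: real_norm_def abs_ge_self)
    qed measurable
    have "norm (hprod h k \<xi>) = norm (LINT \<eta>|lborel. h (\<xi> - \<eta>) * k \<eta>) / (2*pi)^CARD('n)"
      by (simp add: hprod_def norm_mult norm_divide norm_power)
    also have "norm (LINT \<eta>|lborel. h (\<xi> - \<eta>) * k \<eta>) \<le> (LINT \<eta>|lborel. ?g \<eta>)"
      by (rule order_trans[OF integral_norm_bound]) (intro integral_mono_AE ig ae integrable_norm ih)
    also have "\<dots> = (A * B * exp (- \<tau> * norm \<xi>)) * (LINT \<eta>|lborel. norm (\<xi> - \<eta>) powr (-a) * norm \<eta> powr (-b))"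
      by (rule integral_mult_right_zero)
    also have "\<dots> \<le> (A * B * exp (- \<tau> * norm \<xi>)) * (C * norm \<xi> powr (real CARD('n) - a - b))"
      using CI[OF x] A B by (intro mult_left_mono) auto
    finally have "norm (hprod h k \<xi>) \<le> D * (A * B) * (norm \<xi> powr (real CARD('n) - a - b) * exp (- \<tau> * norm \<xi>))"
      by (simp add: D_def divide_right_mono mult_ac)
    with ih show ?thesis by simp
  qed
  moreover have "D \<ge> 0" using C by (simp add: D_def)
  ultimately show ?thesis by blast
qed

text \<open>Each value of a convolution is an integral, and the reflection \<eta> -> \<xi> - \<eta>
  preserves null sets. Hence the quadratic terms do not depend, at any single frequency, on the
  representatives that \<open>hat\<close> selects.\<close>

lemma hprod_cong_AE:
  assumes "AE \<xi> in lborel. h \<xi> = h' \<xi>" "AE \<xi> in lborel. k \<xi> = k' \<xi>"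
    and [measurable]: "h \<in> borel_measurable borel" "k \<in> borel_measurable borel"
      "h' \<in> borel_measurable borel" "k' \<in> borel_measurable borel"
  shows "hprod h k \<xi> = hprod h' k' \<xi>"
proof -
  have "AE \<eta> in lborel. h (\<xi> + (-1) *\<^sub>R \<eta>) = h' (\<xi> + (-1) *\<^sub>R \<eta>)"
    by (rule lborel_AE_affine_vec[OF assms(1)]) simp
  then have "AE \<eta> in lborel. h (\<xi> - \<eta>) * k \<eta> = h' (\<xi> - \<eta>) * k' \<eta>"
    using assms(2) by eventually_elim simp
  then show ?thesis unfolding hprod_def by (intro arg_cong2[where f="(*)"] refl integral_cong_AE) auto
qed

section \<open>Schwartz functions\<close>

lemma partial_deriv_eqI: "(f has_derivative f') (at x) \<Longrightarrow> partial_deriv i f x = f' (axis i 1)"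
  unfolding partial_deriv_def by (simp add: frechet_derivative_at[symmetric])

text \<open>The Schwartz conditions speak of all iterated derivatives. A class of functions stable
  under \<open>partial_deriv\<close> whose members are differentiable and rapidly decreasing settles
  them at once, which avoids Leibniz formulas of higher order.\<close>

lemma schwartz_coinduct:
  assumes "f \<in> Q"
    and diff: "\<And>f x. f \<in> Q \<Longrightarrow> f differentiable (at x)"
    and bnd: "\<And>f k. f \<in> Q \<Longrightarrow> \<exists>B. \<forall>x. norm x ^ k * norm (f x) \<le> B"
    and step: "\<And>f i. f \<in> Q \<Longrightarrow> partial_deriv i f \<in> Q"
  shows "f \<in> schwartz_space"
proof -
  have "iter_deriv js f \<in> Q" for js
    by (induction js) (auto simp: iter_deriv_def assms)
  then show ?thesis unfolding schwartz_space_def bdd_above_def using diff bnd by (fastforce)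
qed

lemma schwartz_differentiable: "\<phi> \<in> schwartz_space \<Longrightarrow> \<phi> differentiable (at x)"
  unfolding schwartz_space_def by (auto simp: iter_deriv_def dest: spec[of _ "[]"])

lemma schwartz_bounded: "\<phi> \<in> schwartz_space \<Longrightarrow> \<exists>B. \<forall>x. norm x ^ k * norm (\<phi> x) \<le> B"
proof -
  assume "\<phi> \<in> schwartz_space"
  then have "bdd_above (range (\<lambda>x. norm x ^ k * norm (iter_deriv [] \<phi> x)))"
    unfolding schwartz_space_def mem_Collect_eq by (elim conjE allE)
  then show ?thesis by (auto simp: iter_deriv_def bdd_above_def)
qed

lemma weighted_norm_add_le:
  "norm x ^ k * norm (a + b) \<le> norm x ^ k * norm a + norm x ^ k * norm (b :: 'b::real_normed_vector)"
  using mult_left_mono[OF norm_triangle_ineq[of a b], of "norm x ^ k"] by (simp add: distrib_left)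

lemma iter_deriv_append: "iter_deriv js (iter_deriv ks \<phi>) = iter_deriv (js @ ks) \<phi>"
  by (simp add: iter_deriv_def)

lemma schwartz_iter_deriv: "\<phi> \<in> schwartz_space \<Longrightarrow> iter_deriv ks \<phi> \<in> schwartz_space"
  unfolding schwartz_space_def by (auto simp: iter_deriv_append)

lemma schwartz_partial_deriv: "\<phi> \<in> schwartz_space \<Longrightarrow> partial_deriv i \<phi> \<in> schwartz_space"
  using schwartz_iter_deriv[of \<phi> "[i]"] by (simp add: iter_deriv_def)

lemma schwartz_has_derivative:
  "\<phi> \<in> schwartz_space \<Longrightarrow> (\<phi> has_derivative (frechet_derivative \<phi> (at x))) (at x)"
  using schwartz_differentiable frechet_derivative_works by blast

lemma schwartz_continuous: "\<phi> \<in> schwartz_space \<Longrightarrow> continuous_on UNIV \<phi>"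
  using schwartz_differentiable by (metis continuous_at_imp_continuous_on differentiable_imp_continuous_within)

lemma schwartz_measurable: "\<phi> \<in> schwartz_space \<Longrightarrow> \<phi> \<in> borel_measurable borel"
  by (rule borel_measurable_continuous_onI[OF schwartz_continuous])

lemma schwartz_add:
  assumes "\<phi> \<in> schwartz_space" "\<psi> \<in> schwartz_space"
  shows "(\<lambda>x. \<phi> x + \<psi> x) \<in> schwartz_space"
proof (rule schwartz_coinduct[where Q="{(\<lambda>x. \<phi> x + \<psi> x) | \<phi> \<psi>. \<phi> \<in> schwartz_space \<and> \<psi> \<in> schwartz_space}"])
  fix f i k assume "f \<in> {(\<lambda>x. \<phi> x + \<psi> x) | \<phi> \<psi>. \<phi> \<in> schwartz_space \<and> \<psi> \<in> schwartz_space}"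
  then obtain \<phi> \<psi> where f: "f = (\<lambda>x. \<phi> x + \<psi> x)" and S: "\<phi> \<in> schwartz_space" "\<psi> \<in> schwartz_space" by blast
  have d: "(f has_derivative (\<lambda>h. frechet_derivative \<phi> (at x) h + frechet_derivative \<psi> (at x) h)) (at x)" for x
    unfolding f by (intro has_derivative_add schwartz_has_derivative S)
  show "f differentiable (at x)" for x using d differentiable_def by blast
  obtain B1 B2 where "\<And>x. norm x ^ k * norm (\<phi> x) \<le> B1" "\<And>x. norm x ^ k * norm (\<psi> x) \<le> B2"
    using schwartz_bounded[OF S(1), of k] schwartz_bounded[OF S(2), of k] by auto
  then have "norm x ^ k * norm (f x) \<le> B1 + B2" for x unfolding f
    by (rule order_trans[OF weighted_norm_add_le add_mono])
  then show "\<exists>B. \<forall>x. norm x ^ k * norm (f x) \<le> B" by blast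
  have "partial_deriv i f = (\<lambda>x. partial_deriv i \<phi> x + partial_deriv i \<psi> x)"
    using partial_deriv_eqI[OF d] by (auto simp: partial_deriv_def)
  then show "partial_deriv i f \<in> {(\<lambda>x. \<phi> x + \<psi> x) | \<phi> \<psi>. \<phi> \<in> schwartz_space \<and> \<psi> \<in> schwartz_space}"
    using schwartz_partial_deriv S by blast
qed (use assms in blast)

lemma schwartz_cmult:
  assumes "\<phi> \<in> schwartz_space"
  shows "(\<lambda>x. c * \<phi> x) \<in> schwartz_space"
proof (rule schwartz_coinduct[where Q="{(\<lambda>x. c * \<phi> x) | \<phi>. \<phi> \<in> schwartz_space}"])
  fix f i k assume "f \<in> {(\<lambda>x. c * \<phi> x) | \<phi>. \<phi> \<in> schwartz_space}"
  then obtain \<phi> where f: "f = (\<lambda>x. c * \<phi> x)" and S: "\<phi> \<in> schwartz_space" by blast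
  have d: "(f has_derivative (\<lambda>h. c * frechet_derivative \<phi> (at x) h)) (at x)" for x
    unfolding f by (intro has_derivative_mult_right schwartz_has_derivative S)
  show "f differentiable (at x)" for x using d differentiable_def by blast
  obtain B1 where "\<And>x. norm x ^ k * norm (\<phi> x) \<le> B1"
    using schwartz_bounded S by blast
  then have "norm c * (norm x ^ k * norm (\<phi> x)) \<le> norm c * B1" for x
    by (intro mult_left_mono) auto
  then have "norm x ^ k * norm (f x) \<le> norm c * B1" for x unfolding f
    by (simp add: norm_mult mult_ac)
  then show "\<exists>B. \<forall>x. norm x ^ k * norm (f x) \<le> B" by blast
  have "partial_deriv i f = (\<lambda>x. c * partial_deriv i \<phi> x)"
    using partial_deriv_eqI[OF d] by (auto simp: partial_deriv_def)
  then show "partial_deriv i f \<in> {(\<lambda>x. c * \<phi> x) | \<phi>. \<phi> \<in> schwartz_space}"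
    using schwartz_partial_deriv S by blast
qed (use assms in blast)

lemma schwartz_reflect:
  assumes "\<phi> \<in> schwartz_space"
  shows "(\<lambda>x. \<phi> (- x)) \<in> schwartz_space"
proof (rule schwartz_coinduct[where Q="{(\<lambda>x. \<phi> (- x)) | \<phi>. \<phi> \<in> schwartz_space}"])
  fix f i k assume "f \<in> {(\<lambda>x. \<phi> (- x)) | \<phi>. \<phi> \<in> schwartz_space}"
  then obtain \<phi> where f: "f = (\<lambda>x. \<phi> (- x))" and S: "\<phi> \<in> schwartz_space" by blast
  have d: "(f has_derivative (\<lambda>h. frechet_derivative \<phi> (at (- x)) (- h))) (at x)" for x
    unfolding f by (rule has_derivative_compose[where f=uminus and g=\<phi>, OF _ schwartz_has_derivative[OF S]])
      (auto intro!: derivative_eq_intros)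
  show "f differentiable (at x)" for x using d differentiable_def by blast
  obtain B1 where B1: "\<And>x. norm x ^ k * norm (\<phi> x) \<le> B1"
    using schwartz_bounded S by blast
  have "norm x ^ k * norm (f x) \<le> B1" for x unfolding f
    using B1[of "-x"] by simp
  then show "\<exists>B. \<forall>x. norm x ^ k * norm (f x) \<le> B" by blast
  have "partial_deriv i f = (\<lambda>x. (-1) * partial_deriv i \<phi> (- x))"
    using partial_deriv_eqI[OF d] linear_neg[OF has_derivative_linear[OF schwartz_has_derivative[OF S]]]
    by (auto simp: partial_deriv_def)
  moreover have "(\<lambda>x. (-1) * partial_deriv i \<phi> x) \<in> schwartz_space"
    by (intro schwartz_cmult schwartz_partial_deriv S)
  ultimately show "partial_deriv i f \<in> {(\<lambda>x. \<phi> (- x)) | \<phi>. \<phi> \<in> schwartz_space}"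
    by (intro CollectI exI[of _ "\<lambda>x. (-1) * partial_deriv i \<phi> x"]) simp
qed (use assms in blast)

text \<open>The product rule produces \<phi> itself besides a coordinate times a derivative. The
  class of all functions x_j \<phi> + \<psi> absorbs this term and is therefore stable.\<close>

lemma schwartz_mult_coord:
  assumes "\<phi> \<in> schwartz_space"
  shows "(\<lambda>x. complex_of_real (x $ j) * \<phi> x) \<in> schwartz_space"
proof (rule schwartz_coinduct[where Q="{(\<lambda>x. complex_of_real (x $ j) * \<phi> x + \<psi> x) | \<phi> \<psi>. \<phi> \<in> schwartz_space \<and> \<psi> \<in> schwartz_space}"])
  fix f i k assume "f \<in> {(\<lambda>x. complex_of_real (x $ j) * \<phi> x + \<psi> x) | \<phi> \<psi>. \<phi> \<in> schwartz_space \<and> \<psi> \<in> schwartz_space}"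
  then obtain \<phi> \<psi> where f: "f = (\<lambda>x. complex_of_real (x $ j) * \<phi> x + \<psi> x)" and S: "\<phi> \<in> schwartz_space" "\<psi> \<in> schwartz_space" by blast
  have c: "((\<lambda>x. complex_of_real (x $ j)) has_derivative (\<lambda>h. complex_of_real (h $ j))) (at x)" for x
    by (intro bounded_linear_imp_has_derivative bounded_linear_compose[OF bounded_linear_of_real bounded_linear_vec_nth])
  have d: "(f has_derivative (\<lambda>h. (complex_of_real (x $ j) * frechet_derivative \<phi> (at x) h + complex_of_real (h $ j) * \<phi> x) + frechet_derivative \<psi> (at x) h)) (at x)" for x
    unfolding f by (intro has_derivative_add has_derivative_mult c schwartz_has_derivative S)
  show "f differentiable (at x)" for x using d differentiable_def by blast
  obtain B1 B2 where B: "\<And>x. norm x ^ Suc k * norm (\<phi> x) \<le> B1" "\<And>x. norm x ^ k * norm (\<psi> x) \<le> B2"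
    using schwartz_bounded S by metis
  have "norm x ^ k * norm (f x) \<le> B1 + B2" for x
  proof -
    have "norm x ^ k * norm (f x) \<le> norm x ^ k * (norm x * norm (\<phi> x) + norm (\<psi> x))"
      unfolding f using component_le_norm_cart[of x j]
      by (intro mult_left_mono order_trans[OF norm_triangle_ineq] add_mono) (auto simp: norm_mult mult_right_mono)
    also have "\<dots> \<le> B1 + B2" using B[of x] by (simp add: algebra_simps)
    finally show ?thesis .
  qed
  then show "\<exists>B. \<forall>x. norm x ^ k * norm (f x) \<le> B" by blast
  have "partial_deriv i f = (\<lambda>x. complex_of_real (x $ j) * partial_deriv i \<phi> x + (of_bool (i = j) * \<phi> x + partial_deriv i \<psi> x))"
    using partial_deriv_eqI[OF d] by (auto simp: partial_deriv_def axis_def fun_eq_iff)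
  then show "partial_deriv i f \<in> {(\<lambda>x. complex_of_real (x $ j) * \<phi> x + \<psi> x) | \<phi> \<psi>. \<phi> \<in> schwartz_space \<and> \<psi> \<in> schwartz_space}"
    using schwartz_partial_deriv[OF S(1)] schwartz_add[OF schwartz_cmult[OF S(1)] schwartz_partial_deriv[OF S(2)]] 
    by (intro CollectI exI conjI) 
next
  have "(\<lambda>x::real^'a. 0::complex) \<in> schwartz_space" using schwartz_cmult[OF assms, of 0] by simp
  then show "(\<lambda>x. complex_of_real (x $ j) * \<phi> x) \<in> {(\<lambda>x. complex_of_real (x $ j) * \<phi> x + \<psi> x) | \<phi> \<psi>. \<phi> \<in> schwartz_space \<and> \<psi> \<in> schwartz_space}"
    using assms by force
qed

section \<open>Gaussians times polynomials\<close>

text \<open>Polynomials times one fixed Gaussian, generated by closure so that no representation of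
  polynomials is required. The linear exponent \<open>c\<close> makes room for Gaussians centred
  away from the origin.\<close>

inductive_set gaussian_polys :: "real \<Rightarrow> real^'n::finite \<Rightarrow> (real^'n \<Rightarrow> complex) set" for a c where
  base: "(\<lambda>x. complex_of_real (exp (- a * (x \<bullet> x) + c \<bullet> x))) \<in> gaussian_polys a c"
| add: "f \<in> gaussian_polys a c \<Longrightarrow> g \<in> gaussian_polys a c \<Longrightarrow> (\<lambda>x. f x + g x) \<in> gaussian_polys a c"
| cmult: "f \<in> gaussian_polys a c \<Longrightarrow> (\<lambda>x. z * f x) \<in> gaussian_polys a c"
| coord: "f \<in> gaussian_polys a c \<Longrightarrow> (\<lambda>x. complex_of_real (x $ j) * f x) \<in> gaussian_polys a c"

lemma gaussian_exp_decay:
  assumes "a > 0"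
  shows "\<exists>B. \<forall>x::real^'n::finite. norm x ^ k * exp (- a * (x \<bullet> x) + c \<bullet> x) \<le> B"
proof -
  define C where "C = norm c + 1"
  have "norm x ^ k * exp (- a * (x \<bullet> x) + c \<bullet> x) \<le> exp (C\<^sup>2 / (4 * a)) * fact k" for x :: "real^'n"
  proof -
    define r where "r = norm x"
    \<comment> \<open>Completing the square bounds -a r^2 + C r. Since C exceeds |c| by 1, a factor
      exp (-r) remains, and it beats r^k at the cost of k!.\<close>
    have "0 \<le> (2 * a * r - C)\<^sup>2 / (4 * a)" using assms by simp
    also have "\<dots> = a * r\<^sup>2 - C * r + C\<^sup>2 / (4 * a)" using assms by (simp add: field_simps power2_eq_square)
    finally have 1: "- a * r\<^sup>2 + C * r \<le> C\<^sup>2 / (4 * a)" by simp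
    have "c \<bullet> x \<le> norm c * r" unfolding r_def by (rule norm_cauchy_schwarz)
    then have "- a * (x \<bullet> x) + c \<bullet> x \<le> C\<^sup>2 / (4 * a) - r"
      using 1 by (simp add: r_def power2_norm_eq_inner C_def algebra_simps)
    then have "norm x ^ k * exp (- a * (x \<bullet> x) + c \<bullet> x) \<le> r ^ k * exp (C\<^sup>2 / (4 * a) - r)"
      by (simp add: r_def mult_left_mono)
    also have "\<dots> = exp (C\<^sup>2 / (4 * a)) * (r ^ k / exp r)" by (simp add: exp_diff)
    also have "r ^ k / exp r \<le> fact k"
    proof -
      have "(\<Sum>n\<in>{k}. r ^ n /\<^sub>R fact n) \<le> exp r" unfolding exp_def
        by (rule sum_le_suminf[OF summable_exp_generic]) (auto simp: r_def)
      then show ?thesis by (simp add: field_simps)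
    qed
    finally show ?thesis by (simp add: mult_left_mono)
  qed
  then show ?thesis by blast
qed

lemma gaussian_polys_schwartz:
  assumes a: "a > 0" and f: "f \<in> gaussian_polys a c"
  shows "f \<in> schwartz_space"
proof (rule schwartz_coinduct[OF f])
  \<comment> \<open>Membership does not expose a formula for f, so a derivative is produced along
    the generation, together with the fact that its partial derivatives stay in the class.\<close>
  have der: "\<exists>f'. (\<forall>x. (f has_derivative f' x) (at x)) \<and> (\<forall>i. (\<lambda>x. f' x (axis i 1)) \<in> gaussian_polys a c)"
    if "f \<in> gaussian_polys a c" for f
    using that
  proof induction
    case base
    let ?g = "\<lambda>x. complex_of_real (exp (- a * (x \<bullet> x) + c \<bullet> x))"
    let ?f' = "\<lambda>x h. complex_of_real (exp (- a * (x \<bullet> x) + c \<bullet> x) * (- a * (2 * (x \<bullet> h)) + c \<bullet> h))"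
    have "(?g has_derivative ?f' x) (at x)" for x
      by (rule has_derivative_of_real) (auto intro!: derivative_eq_intros simp: inner_commute algebra_simps)
    moreover have "(\<lambda>x. ?f' x (axis i 1)) \<in> gaussian_polys a c" for i
    proof -
      have "(\<lambda>x. ?f' x (axis i 1)) = (\<lambda>x. complex_of_real (- 2 * a) * (complex_of_real (x $ i) * ?g x) + complex_of_real (c $ i) * ?g x)"
        by (auto simp: inner_axis algebra_simps)
      then show ?thesis by (simp only:) (intro gaussian_polys.intros)
    qed
    ultimately show ?case by (intro exI[of _ ?f'] conjI allI)
  next
    case (add f g)
    then obtain f' g' where "\<forall>x. (f has_derivative f' x) (at x)" "\<forall>i. (\<lambda>x. f' x (axis i 1)) \<in> gaussian_polys a c"
      "\<forall>x. (g has_derivative g' x) (at x)" "\<forall>i. (\<lambda>x. g' x (axis i 1)) \<in> gaussian_polys a c" by blast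
    then show ?case 
      by (intro exI[of _ "\<lambda>x h. f' x h + g' x h"] conjI allI has_derivative_add gaussian_polys.intros) auto
  next
    case (cmult f z)
    then obtain f' where "\<forall>x. (f has_derivative f' x) (at x)" "\<forall>i. (\<lambda>x. f' x (axis i 1)) \<in> gaussian_polys a c" by blast
    then show ?case 
      by (intro exI[of _ "\<lambda>x h. z * f' x h"] conjI allI has_derivative_mult_right gaussian_polys.intros) auto
  next
    case (coord f j)
    then obtain f' where f': "\<forall>x. (f has_derivative f' x) (at x)" "\<forall>i. (\<lambda>x. f' x (axis i 1)) \<in> gaussian_polys a c" by blast
    have c: "((\<lambda>x. complex_of_real (x $ j)) has_derivative (\<lambda>h. complex_of_real (h $ j))) (at x)" for x :: "real^'a"
      by (intro bounded_linear_imp_has_derivative bounded_linear_compose[OF bounded_linear_of_real bounded_linear_vec_nth])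
    have "(\<lambda>x. complex_of_real (x $ j) * f' x (axis i 1) + complex_of_real (axis i 1 $ j) * f x) \<in> gaussian_polys a c" for i
      using f' coord by (intro gaussian_polys.intros) auto
    then show ?case using f'
      by (intro exI[of _ "\<lambda>x h. complex_of_real (x $ j) * f' x h + complex_of_real (h $ j) * f x"] conjI allI has_derivative_mult c) auto
  qed
  fix f i k assume "f \<in> gaussian_polys a c"
  then obtain f' where f': "\<And>x. (f has_derivative f' x) (at x)" "\<And>i. (\<lambda>x. f' x (axis i 1)) \<in> gaussian_polys a c"
    using der by blast
  show "f differentiable (at x)" for x using f' differentiable_def by blast
  have "partial_deriv i f = (\<lambda>x. f' x (axis i 1))" using partial_deriv_eqI[OF f'(1)] by auto
  then show "partial_deriv i f \<in> gaussian_polys a c" using f' by simp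
  show "\<exists>B. \<forall>x. norm x ^ k * norm (f x) \<le> B" using \<open>f \<in> gaussian_polys a c\<close>
  proof (induction arbitrary: k)
    case base
    then show ?case using gaussian_exp_decay[OF a, of k c] by (simp add: norm_mult)
  next
    case (add f g)
    obtain B1 B2 where "\<And>x. norm x ^ k * norm (f x) \<le> B1" "\<And>x. norm x ^ k * norm (g x) \<le> B2"
      using add by metis
    then have "norm x ^ k * norm (f x + g x) \<le> B1 + B2" for x
      by (rule order_trans[OF weighted_norm_add_le add_mono])
    then show ?case by blast
  next
    case (cmult f z)
    obtain B1 where "\<And>x. norm x ^ k * norm (f x) \<le> B1" using cmult by metis
    then have "norm z * (norm x ^ k * norm (f x)) \<le> norm z * B1" for x
      by (intro mult_left_mono) auto
    then have "norm x ^ k * norm (z * f x) \<le> norm z * B1" for x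
      by (simp add: norm_mult mult_ac)
    then show ?case by blast
  next
    case (coord f j)
    obtain B1 where B: "\<And>x. norm x ^ Suc k * norm (f x) \<le> B1" using coord by metis
    have "norm x ^ k * norm (complex_of_real (x $ j) * f x) \<le> B1" for x
    proof -
      have "norm x ^ k * norm (complex_of_real (x $ j) * f x) \<le> norm x ^ k * (norm x * norm (f x))"
        using component_le_norm_cart[of x j] by (intro mult_left_mono) (auto simp: norm_mult mult_right_mono)
      also have "\<dots> \<le> B1" using B[of x] by (simp add: algebra_simps)
      finally show ?thesis .
    qed
    then show ?case by blast
  qed
qed

definition gauss :: "real^'n::finite \<Rightarrow> complex" where
  "gauss x = complex_of_real (exp (- (x \<bullet> x) / 2))"

lemma gauss_schwartz: "gauss \<in> schwartz_space"
  using gaussian_polys_schwartz[OF _ gaussian_polys.base[of "1/2" 0]] by (simp add: gauss_def[abs_def])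

text \<open>A product of two Gaussians is a constant times a Gaussian with a linear exponent. These
  are the test functions against which a merely locally integrable function can be examined after
  multiplication by \<open>gauss\<close>.\<close>

lemma gauss_shift_mult_schwartz:
  assumes "e > 0"
  shows "(\<lambda>x. gauss x * gauss ((1/e) *\<^sub>R (x - y))) \<in> schwartz_space"
proof -
  have "gauss x * gauss ((1/e) *\<^sub>R (x - y)) = complex_of_real (exp (- (y \<bullet> y) / (2 * e\<^sup>2))) *
      complex_of_real (exp (- (1/2 + 1/(2 * e\<^sup>2)) * (x \<bullet> x) + ((1/e\<^sup>2) *\<^sub>R y) \<bullet> x))" for x
  proof -
    have "- (x \<bullet> x) / 2 + - (((1/e) *\<^sub>R (x - y)) \<bullet> ((1/e) *\<^sub>R (x - y))) / 2
       = - (y \<bullet> y) / (2 * e\<^sup>2) + (- (1/2 + 1/(2 * e\<^sup>2)) * (x \<bullet> x) + ((1/e\<^sup>2) *\<^sub>R y) \<bullet> x)"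
      using assms by (simp add: inner_simps inner_commute field_simps power2_eq_square)
    then show ?thesis unfolding gauss_def of_real_mult[symmetric] exp_add[symmetric] by simp
  qed
  moreover have "(\<lambda>x. complex_of_real (exp (- (1/2 + 1/(2 * e\<^sup>2)) * (x \<bullet> x) + ((1/e\<^sup>2) *\<^sub>R y) \<bullet> x))) \<in> schwartz_space"
    by (rule gaussian_polys_schwartz[OF _ gaussian_polys.base]) (use assms in \<open>auto intro!: add_pos_pos\<close>)
  ultimately show ?thesis using schwartz_cmult by auto
qed

section \<open>Polynomial weights and absolute integrability\<close>

abbreviation weight :: "real^'n::finite \<Rightarrow> real" where
  "weight x \<equiv> max 1 (norm x)"

lemma weight_shift: "norm y \<le> 1 \<Longrightarrow> weight x \<le> 2 * weight (x + y)"
  using norm_triangle_ineq4[of "x + y" y] by auto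

lemma weight_integrable:
  fixes b :: real
  assumes "0 \<le> b" "b < real CARD('n::finite)"
  shows "integrable lborel (\<lambda>x::real^'n. norm x powr (-b) / weight x ^ (CARD('n) + 1))"
proof -
  have "integrable lborel (\<lambda>y::real^'n. weight y powr - (real CARD('n) + 1) * norm y powr (-b))"
    using assms by (intro power_tail_integrable) auto
  moreover have "weight y powr - (real CARD('n) + 1) * norm y powr (-b) = norm y powr (-b) / weight y ^ (CARD('n) + 1)" for y :: "real^'n"
  proof -
    have "weight y powr - (real CARD('n) + 1) = weight y powr - real (CARD('n) + 1)" by (simp add: algebra_simps)
    also have "\<dots> = inverse (weight y ^ (CARD('n) + 1))"
      by (subst powr_minus, subst powr_realpow) auto
    finally show ?thesis by (simp add: divide_inverse)
  qed
  ultimately show ?thesis by simp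
qed

lemma weight_integrable_0: "integrable lborel (\<lambda>x::real^'n::finite. 1 / weight x ^ (CARD('n) + 1))"
proof -
  have i: "integrable lborel (\<lambda>x::real^'n. norm x powr (-0) / weight x ^ (CARD('n) + 1))"
    by (rule weight_integrable) auto
  \<comment> \<open>With b = 0 the power is 1 except at the origin, where \<open>0 powr 0\<close> is
    0; the two integrands agree only almost everywhere.\<close>
  have "AE x in lborel. x \<noteq> (0::real^'n)" by (rule AE_lborel_singleton)
  then have "AE x::real^'n in lborel. norm x powr (-0) / weight x ^ (CARD('n) + 1) = 1 / weight x ^ (CARD('n) + 1)"
    by eventually_elim simp
  moreover have "(\<lambda>x::real^'n. norm x powr (-0) / weight x ^ (CARD('n) + 1)) \<in> borel_measurable lborel" using i by auto
  moreover have "(\<lambda>x::real^'n. 1 / weight x ^ (CARD('n) + 1)) \<in> borel_measurable lborel" by measurable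
  ultimately show ?thesis using integrable_cong_AE[THEN iffD1, OF _ _ _ i] by blast
qed

lemma weight_power_le: "weight x ^ k \<le> 1 + norm x ^ k"
  by (cases "norm x \<le> 1") (auto simp: max_def)

lemma schwartz_weight_decay:
  assumes "\<phi> \<in> schwartz_space"
  shows "\<exists>B. \<forall>x. norm (\<phi> x) \<le> B / weight x ^ k"
proof -
  obtain B1 where B1: "\<And>x. norm x ^ 0 * norm (\<phi> x) \<le> B1" using schwartz_bounded[OF assms, of 0] by blast
  obtain B2 where B2: "\<And>x. norm x ^ k * norm (\<phi> x) \<le> B2" using schwartz_bounded[OF assms, of k] by blast
  have "weight x ^ k * norm (\<phi> x) \<le> B1 + B2" for x
    using mult_right_mono[OF weight_power_le[of x k] norm_ge_zero[of "\<phi> x"]] B1[of x] B2[of x]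
    by (simp add: algebra_simps)
  moreover have "weight x ^ k > 0" for x :: "real^'a" by simp
  ultimately have "norm (\<phi> x) \<le> (B1 + B2) / weight x ^ k" for x
    by (simp add: pos_le_divide_eq mult.commute)
  then show ?thesis by blast
qed

lemma schwartz_decay_nonneg:
  assumes "\<phi> \<in> schwartz_space"
  shows "\<exists>B\<ge>0. \<forall>x. norm (\<phi> x) \<le> B / weight x ^ k"
proof -
  obtain B where B: "\<And>x. norm (\<phi> x) \<le> B / weight x ^ k" using schwartz_weight_decay[OF assms] by blast
  have "0 \<le> B / weight (0::real^'a) ^ k" using B[of 0] order_trans norm_ge_zero by blast
  then have "B \<ge> 0" by simp
  with B show ?thesis by blast
qed

lemma integrable_weight_bound:
  fixes f :: "real^'n::finite \<Rightarrow> complex"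
  assumes "f \<in> borel_measurable borel" "\<And>x. norm (f x) \<le> B / weight x ^ (CARD('n) + 1)"
  shows "integrable lborel f"
proof (rule Bochner_Integration.integrable_bound[OF integrable_mult_right[OF weight_integrable_0, of B]])
  show "AE x in lborel. norm (f x) \<le> norm (B * (1 / weight x ^ (CARD('n) + 1)))"
    using assms(2) by (intro AE_I2) (simp only: real_norm_def mult_1_right times_divide_eq_right, rule order_trans[OF _ abs_ge_self])
qed (use assms in auto)

lemma schwartz_integrable:
  assumes "\<phi> \<in> schwartz_space"
  shows "integrable lborel \<phi>"
  using schwartz_weight_decay[OF assms] integrable_weight_bound[OF schwartz_measurable[OF assms]] by blast

lemma schwartz_seminorm_upper:
  assumes "\<phi> \<in> schwartz_space"
  shows "norm x ^ k * norm (iter_deriv js \<phi> x) \<le> schwartz_seminorm k js \<phi>"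
  unfolding schwartz_seminorm_def
proof (rule cSUP_upper)
  show "bdd_above (range (\<lambda>x. norm x ^ k * norm (iter_deriv js \<phi> x)))"
    using assms unfolding schwartz_space_def mem_Collect_eq by (elim conjE allE)
qed simp

lemma schwartz_seminorm_nonneg: "\<phi> \<in> schwartz_space \<Longrightarrow> 0 \<le> schwartz_seminorm k js \<phi>"
  using schwartz_seminorm_upper[of \<phi> 0 k js] by (meson mult_nonneg_nonneg norm_ge_zero order_trans zero_le_power)

text \<open>An L1 norm costs d + 1 powers of decay, which the two seminorms of order 0 and d + 1
  supply together. The estimate is quantitative because it enters the continuity bound of a tempered
  distribution.\<close>

lemma schwartz_L1_bound:
  "\<exists>K\<ge>0. \<forall>\<phi>\<in>schwartz_space. \<forall>js. (LINT x|lborel. norm (iter_deriv js \<phi> (x::real^'n::finite)))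
      \<le> K * (schwartz_seminorm 0 js \<phi> + schwartz_seminorm (CARD('n)+1) js \<phi>)"
proof (intro exI conjI ballI allI)
  let ?K = "LINT x|lborel. 1 / weight (x::real^'n) ^ (CARD('n) + 1)"
  show "0 \<le> ?K" by (intro Bochner_Integration.integral_nonneg) auto
  fix \<phi> :: "real^'n \<Rightarrow> complex" and js assume S: "\<phi> \<in> schwartz_space"
  let ?s = "schwartz_seminorm 0 js \<phi> + schwartz_seminorm (CARD('n)+1) js \<phi>"
  have "norm (iter_deriv js \<phi> x) \<le> ?s * (1 / weight x ^ (CARD('n) + 1))" for x
  proof -
    have "weight x ^ (CARD('n)+1) * norm (iter_deriv js \<phi> x) \<le> ?s"
      using mult_right_mono[OF weight_power_le[of x "CARD('n)+1"] norm_ge_zero[of "iter_deriv js \<phi> x"]]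
        schwartz_seminorm_upper[OF S, of x 0 js] schwartz_seminorm_upper[OF S, of x "CARD('n)+1" js]
      by (simp add: algebra_simps)
    moreover have "weight x ^ (CARD('n)+1) > 0" by simp
    ultimately show ?thesis by (simp add: pos_le_divide_eq mult.commute del: power_Suc)
  qed
  then have "(LINT x|lborel. norm (iter_deriv js \<phi> x)) \<le> (LINT x|lborel. ?s * (1 / weight (x::real^'n) ^ (CARD('n) + 1)))"
    by (intro Bochner_Integration.integral_mono integrable_norm schwartz_integrable schwartz_iter_deriv S integrable_mult_right weight_integrable_0)
  then show "(LINT x|lborel. norm (iter_deriv js \<phi> x)) \<le> ?K * ?s"
    by (simp only: integral_mult_right_zero mult.commute[of _ ?s])
qed

section \<open>The Fourier transform and derivatives\<close>

lemma norm_exp_imag: "norm (exp (- \<i> * complex_of_real r)) = 1"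
  by (simp add: norm_exp_eq_Re)

lemma fourier_integrand_measurable:
  "\<phi> \<in> borel_measurable borel \<Longrightarrow> (\<lambda>x. exp (- \<i> * complex_of_real (x \<bullet> \<xi>)) * \<phi> x) \<in> borel_measurable borel"
  by (rule borel_measurable_times, rule borel_measurable_continuous_onI) (auto intro!: continuous_intros)

lemma fourier_integrable:
  assumes "\<phi> \<in> schwartz_space"
  shows "integrable lborel (\<lambda>x. exp (- \<i> * complex_of_real (x \<bullet> \<xi>)) * \<phi> x)"
  by (rule Bochner_Integration.integrable_bound[OF schwartz_integrable[OF assms]])
    (use fourier_integrand_measurable[OF schwartz_measurable[OF assms]] in \<open>auto simp: norm_mult norm_exp_eq_Re\<close>)

lemma norm_fourier_le: "\<phi> \<in> schwartz_space \<Longrightarrow> norm (fourier \<phi> \<xi>) \<le> (LINT x|lborel. norm (\<phi> x))"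
  unfolding fourier_def by (rule order_trans[OF integral_norm_bound]) (simp add: norm_mult norm_exp_eq_Re)

lemma exp_imag_taylor: "norm (exp (- \<i> * complex_of_real r) - 1 + \<i> * complex_of_real r) \<le> r\<^sup>2"
proof -
  have "norm (iexp (-r) - (\<Sum>k\<le>1. (\<i> * complex_of_real (-r))^k / fact k)) \<le> \<bar>-r\<bar>^(Suc 1) / fact (Suc 1)"
    by (rule iexp_approx1)
  also have "\<dots> \<le> r\<^sup>2" by (simp add: power2_eq_square fact_numeral)
  finally show ?thesis by (simp add: algebra_simps)
qed

text \<open>Expanding the phase to first order leaves a remainder of at most (x . h)^2 |\<phi>(x)|
  in the integrand, so differentiability comes with an explicit O(|h|^2) error and without a limit
  theorem under the integral.\<close>

lemma fourier_has_derivative: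
  fixes \<phi> :: "real^'n::finite \<Rightarrow> complex"
  assumes S: "\<phi> \<in> schwartz_space"
  shows "(fourier \<phi> has_derivative (\<lambda>h. \<Sum>j\<in>UNIV. complex_of_real (h $ j) * fourier (\<lambda>x. - \<i> * (complex_of_real (x $ j) * \<phi> x)) \<xi>)) (at \<xi>)"
    (is "(_ has_derivative ?L) _")
proof -
  let ?e = "\<lambda>x. exp (- \<i> * complex_of_real (x \<bullet> \<xi>))"
  have Sj: "(\<lambda>x. - \<i> * (complex_of_real (x $ j) * \<phi> x)) \<in> schwartz_space" for j
    by (intro schwartz_cmult schwartz_mult_coord S)
  \<comment> \<open>Two of the d + 3 powers pay for (x . h)^2, the others give
    integrability.\<close>
  obtain B where B: "B \<ge> 0" "\<And>x. norm (\<phi> x) \<le> B / weight x ^ (CARD('n) + 3)"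
    using schwartz_decay_nonneg[OF S] by blast
  define M where "M = (LINT x|lborel. B / weight (x::real^'n) ^ (CARD('n) + 1))"
  have iM: "integrable lborel (\<lambda>x::real^'n. B / weight x ^ (CARD('n) + 1))"
    using integrable_mult_right[OF weight_integrable_0, of B] by simp
  have main: "norm (fourier \<phi> (\<xi> + h) - fourier \<phi> \<xi> - ?L h) \<le> M * (norm h)\<^sup>2" for h
  proof -
    have L: "?L h = (LINT x|lborel. ?e x * (- \<i> * complex_of_real (x \<bullet> h)) * \<phi> x)"
    proof -
      have "?L h = (\<Sum>j\<in>UNIV. (LINT x|lborel. complex_of_real (h $ j) * (?e x * (- \<i> * (complex_of_real (x $ j) * \<phi> x)))))"
        unfolding fourier_def by simp
      also have "\<dots> = (LINT x|lborel. (\<Sum>j\<in>UNIV. complex_of_real (h $ j) * (?e x * (- \<i> * (complex_of_real (x $ j) * \<phi> x)))))"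
        by (rule Bochner_Integration.integral_sum[symmetric]) (intro integrable_mult_right fourier_integrable Sj)
      also have "\<dots> = (LINT x|lborel. ?e x * (- \<i> * complex_of_real (x \<bullet> h)) * \<phi> x)"
        by (intro Bochner_Integration.integral_cong refl)
          (simp add: inner_vec_def sum_distrib_left sum_distrib_right mult_ac)
      finally show ?thesis .
    qed
    have iL: "integrable lborel (\<lambda>x. ?e x * (- \<i> * complex_of_real (x \<bullet> h)) * \<phi> x)"
    proof -
      have "integrable lborel (\<lambda>x. (\<Sum>j\<in>UNIV. complex_of_real (h $ j) * (?e x * (- \<i> * (complex_of_real (x $ j) * \<phi> x)))))"
        by (intro Bochner_Integration.integrable_sum integrable_mult_right fourier_integrable Sj)
      then show ?thesis
        by (rule Bochner_Integration.integrable_cong[THEN iffD1, rotated 2])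
          (auto simp add: inner_vec_def sum_distrib_left sum_distrib_right mult_ac)
    qed
    have "fourier \<phi> (\<xi> + h) - fourier \<phi> \<xi> - ?L h =
      (LINT x|lborel. exp (- \<i> * complex_of_real (x \<bullet> (\<xi> + h))) * \<phi> x - ?e x * \<phi> x - ?e x * (- \<i> * complex_of_real (x \<bullet> h)) * \<phi> x)"
      unfolding L unfolding fourier_def
      by (simp only: Bochner_Integration.integral_diff Bochner_Integration.integrable_diff fourier_integrable[OF S] iL)
    also have "norm \<dots> \<le> (LINT x|lborel. (norm h)\<^sup>2 * (B / weight (x::real^'n) ^ (CARD('n) + 1)))"
    proof -
      have i1: "integrable lborel (\<lambda>x. norm (exp (- \<i> * complex_of_real (x \<bullet> (\<xi> + h))) * \<phi> x - ?e x * \<phi> x - ?e x * (- \<i> * complex_of_real (x \<bullet> h)) * \<phi> x))"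
        by (intro integrable_norm Bochner_Integration.integrable_diff fourier_integrable S iL)
      have i2: "integrable lborel (\<lambda>x::real^'n. (norm h)\<^sup>2 * (B / weight x ^ (CARD('n) + 1)))"
        by (intro integrable_mult_right iM)
      have "norm (exp (- \<i> * complex_of_real (x \<bullet> (\<xi> + h))) * \<phi> x - ?e x * \<phi> x - ?e x * (- \<i> * complex_of_real (x \<bullet> h)) * \<phi> x)
         \<le> (norm h)\<^sup>2 * (B / weight x ^ (CARD('n) + 1))" for x
      proof -
      have "exp (- \<i> * complex_of_real (x \<bullet> (\<xi> + h))) * \<phi> x - ?e x * \<phi> x - ?e x * (- \<i> * complex_of_real (x \<bullet> h)) * \<phi> x
         = ?e x * (exp (- \<i> * complex_of_real (x \<bullet> h)) - 1 + \<i> * complex_of_real (x \<bullet> h)) * \<phi> x"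
        by (simp add: inner_add_right ring_distribs exp_add[symmetric] exp_diff algebra_simps)
      also have "norm \<dots> \<le> (x \<bullet> h)\<^sup>2 * norm (\<phi> x)"
        unfolding norm_mult norm_exp_imag using exp_imag_taylor[of "x \<bullet> h"] by (simp add: mult_right_mono)
      also have "\<dots> \<le> (norm h * weight x)\<^sup>2 * (B / weight x ^ (CARD('n) + 3))"
      proof (intro mult_mono B)
        have "\<bar>x \<bullet> h\<bar> \<le> norm h * weight x"
          using Cauchy_Schwarz_ineq2[of x h] mult_right_mono[of "norm x" "weight x" "norm h"] by (simp add: mult.commute)
        then show "(x \<bullet> h)\<^sup>2 \<le> (norm h * weight x)\<^sup>2" by (rule abs_le_square_iff[THEN iffD1, of "x \<bullet> h", simplified abs_of_nonneg[of "norm h * weight x"], OF order_trans]) simp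
      qed auto
      also have "\<dots> = (norm h)\<^sup>2 * (B / weight x ^ (CARD('n) + 1))"
      proof -
        have w: "weight x \<noteq> 0" using max.cobounded1[of 1 "norm x"] by linarith
        have "weight x ^ (CARD('n) + 3) = weight x ^ (CARD('n) + 1) * (weight x)\<^sup>2"
          by (simp add: power_add power2_eq_square power3_eq_cube)
        then show ?thesis using w by (simp only: power_mult_distrib) (simp del: power_Suc)
      qed
      finally show ?thesis .
      qed
      then show ?thesis
        by (intro order_trans[OF integral_norm_bound Bochner_Integration.integral_mono[OF i1 i2]])
    qed
    also have "\<dots> = M * (norm h)\<^sup>2" unfolding M_def by (subst integral_mult_right_zero) (rule mult.commute)
    finally show ?thesis .
  qed
  have bl: "bounded_linear ?L"
    by (intro bounded_linear_sum bounded_linear_mult_left[THEN bounded_linear_compose]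
       bounded_linear_compose[OF bounded_linear_of_real bounded_linear_vec_nth])
  have "((\<lambda>h. norm (fourier \<phi> (\<xi> + h) - fourier \<phi> \<xi> - ?L h) / norm h) \<longlongrightarrow> 0) (at 0)"
  proof (rule tendsto_sandwich[of "\<lambda>_. 0" _ _ "\<lambda>h. M * norm h"])
    show "\<forall>\<^sub>F h in at 0. norm (fourier \<phi> (\<xi> + h) - fourier \<phi> \<xi> - ?L h) / norm h \<le> M * norm h"
      unfolding eventually_at_filter
    proof (intro always_eventually allI impI)
      fix h :: "real^'n" assume "h \<noteq> 0"
      then show "norm (fourier \<phi> (\<xi> + h) - fourier \<phi> \<xi> - ?L h) / norm h \<le> M * norm h"
        using main[of h] by (simp add: pos_divide_le_eq power2_eq_square mult.assoc)
    qed
    show "((\<lambda>h. M * norm h) \<longlongrightarrow> 0) (at (0::real^'n))" by (intro tendsto_eq_intros) auto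
  qed auto
  with bl show ?thesis unfolding has_derivative_at by blast
qed

lemma partial_deriv_fourier:
  assumes S: "\<phi> \<in> schwartz_space"
  shows "partial_deriv j (fourier \<phi>) = fourier (\<lambda>x. - \<i> * (complex_of_real (x $ j) * \<phi> x))"
proof
  fix \<xi>
  have "complex_of_real (axis j 1 $ k) * z = (if k = j then z else 0)" for k z by (simp add: axis_def)
  then show "partial_deriv j (fourier \<phi>) \<xi> = fourier (\<lambda>x. - \<i> * (complex_of_real (x $ j) * \<phi> x)) \<xi>"
    by (simp only: partial_deriv_eqI[OF fourier_has_derivative[OF S]]) simp
qed

section \<open>The Fourier transform on the Schwartz space\<close>

lemma fourier_translate:
  assumes S: "\<phi> \<in> schwartz_space"
  shows "(LINT x|lborel. exp (- \<i> * complex_of_real (x \<bullet> \<xi>)) * \<phi> (x + v)) = exp (\<i> * complex_of_real (v \<bullet> \<xi>)) * fourier \<phi> \<xi>"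
proof -
  have e: "exp (- \<i> * complex_of_real ((v + 1 *\<^sub>R x) \<bullet> \<xi>)) = exp (- \<i> * complex_of_real (v \<bullet> \<xi>)) * exp (- \<i> * complex_of_real (x \<bullet> \<xi>))" for x
    by (simp add: inner_add_left exp_add[symmetric] algebra_simps)
  have "fourier \<phi> \<xi> = (LINT x|lborel. exp (- \<i> * complex_of_real ((v + 1 *\<^sub>R x) \<bullet> \<xi>)) * \<phi> (v + 1 *\<^sub>R x))"
    unfolding fourier_def
    using lborel_integral_affine_vec[OF fourier_integrand_measurable[OF schwartz_measurable[OF S]], of 1 \<xi> v] by simp
  also have "\<dots> = (LINT x|lborel. exp (- \<i> * complex_of_real (v \<bullet> \<xi>)) * (exp (- \<i> * complex_of_real (x \<bullet> \<xi>)) * \<phi> (x + v)))"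
    by (intro Bochner_Integration.integral_cong refl) (simp only: e mult.assoc, simp add: add.commute)
  also have "\<dots> = exp (- \<i> * complex_of_real (v \<bullet> \<xi>)) * (LINT x|lborel. exp (- \<i> * complex_of_real (x \<bullet> \<xi>)) * \<phi> (x + v))"
    by (rule integral_mult_right_zero)
  finally show ?thesis by (simp add: mult.assoc[symmetric] exp_add[symmetric])
qed

lemma schwartz_line_derivative:
  assumes S: "\<phi> \<in> schwartz_space"
  shows "((\<lambda>t. \<phi> (x + t *\<^sub>R axis j 1)) has_vector_derivative partial_deriv j \<phi> (x + t *\<^sub>R axis j 1)) (at t)"
proof -
  let ?v = "axis j (1::real)"
  have "((\<lambda>t. \<phi> (x + t *\<^sub>R ?v)) has_derivative (\<lambda>h. frechet_derivative \<phi> (at (x + t *\<^sub>R ?v)) (h *\<^sub>R ?v))) (at t)"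
    by (rule has_derivative_compose[OF _ schwartz_has_derivative[OF S]]) (auto intro!: derivative_eq_intros)
  moreover have "frechet_derivative \<phi> (at (x + t *\<^sub>R ?v)) (h *\<^sub>R ?v) = h *\<^sub>R partial_deriv j \<phi> (x + t *\<^sub>R ?v)" for h
    unfolding partial_deriv_def
    using linear_scale[OF has_derivative_linear[OF schwartz_has_derivative[OF S]]] by blast
  ultimately show ?thesis unfolding has_vector_derivative_def by simp
qed

text \<open>Integration by parts is replaced by difference quotients. Translation invariance turns
  the transform of a quotient into (exp (\<i> t \<xi>_j) - 1) / t times the transform of \<phi>, and
  dominated convergence identifies the limit.\<close>

lemma fourier_partial_deriv:
  fixes \<phi> :: "real^'n::finite \<Rightarrow> complex"
  assumes S: "\<phi> \<in> schwartz_space"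
  shows "fourier (partial_deriv j \<phi>) \<xi> = \<i> * complex_of_real (\<xi> $ j) * fourier \<phi> \<xi>"
proof -
  let ?v = "axis j (1::real) :: real^'n" and ?e = "\<lambda>x. exp (- \<i> * complex_of_real (x \<bullet> \<xi>))"
  define t where "t k = inverse (real (Suc k))" for k
  have t: "0 < t k" "t k \<le> 1" for k unfolding t_def by (auto simp: field_simps)
  have t0: "t \<longlonglongrightarrow> 0" unfolding t_def by (rule LIMSEQ_inverse_real_of_nat)
  have t0': "filterlim t (at 0) sequentially"
    using t0 t by (auto simp: filterlim_at intro!: eventuallyI less_imp_neq[THEN not_sym])
  have Sd: "partial_deriv j \<phi> \<in> schwartz_space" by (rule schwartz_partial_deriv[OF S])
  note [measurable] = schwartz_measurable[OF S] schwartz_measurable[OF Sd]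
  obtain B where B: "B \<ge> 0" "\<And>x. norm (partial_deriv j \<phi> x) \<le> B / weight x ^ (CARD('n) + 1)"
    using schwartz_decay_nonneg[OF Sd] by blast
  \<comment> \<open>Along a shift of length at most 1 the weight drops by at most the factor 2, so
    one multiple of B bounds the derivative on the whole segment.\<close>
  define B' where "B' = B * 2 ^ (CARD('n) + 1)"
  let ?s = "\<lambda>k x. ?e x * ((\<phi> (x + t k *\<^sub>R ?v) - \<phi> x) /\<^sub>R t k)"
  have em: "(\<lambda>x. ?e x) \<in> borel_measurable borel"
    by (rule borel_measurable_continuous_onI) (auto intro!: continuous_intros)
  have sm: "?s k \<in> borel_measurable lborel" for k
    using em by measurable
  have bound: "norm (?s k x) \<le> B' / weight x ^ (CARD('n) + 1)" for k x
  proof -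
    have "norm (\<phi> (x + t k *\<^sub>R ?v) - \<phi> (x + 0 *\<^sub>R ?v)) \<le> (B' / weight x ^ (CARD('n) + 1)) * norm (t k - 0)"
    proof (rule differentiable_bound[of "{0..t k}" "\<lambda>s. \<phi> (x + s *\<^sub>R ?v)" "\<lambda>s h. h *\<^sub>R partial_deriv j \<phi> (x + s *\<^sub>R ?v)"])
      fix s assume s: "s \<in> {0..t k}"
      show "((\<lambda>s. \<phi> (x + s *\<^sub>R ?v)) has_derivative (\<lambda>h. h *\<^sub>R partial_deriv j \<phi> (x + s *\<^sub>R ?v))) (at s within {0..t k})"
        using schwartz_line_derivative[OF S, of x j s] unfolding has_vector_derivative_def
        by (rule has_derivative_at_withinI)
      have "norm (s *\<^sub>R ?v) \<le> 1" using s t(2)[of k] by (simp add: norm_axis_1)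
      then have w: "weight x \<le> 2 * weight (x + s *\<^sub>R ?v)" by (rule weight_shift)
      have "weight x ^ (CARD('n) + 1) \<le> (2 * weight (x + s *\<^sub>R ?v)) ^ (CARD('n) + 1)"
        by (rule power_mono[OF w]) simp
      then have "B * weight x ^ (CARD('n) + 1) \<le> B' * weight (x + s *\<^sub>R ?v) ^ (CARD('n) + 1)"
        using B(1) by (simp add: B'_def power_mult_distrib mult_left_mono mult.assoc del: power_Suc)
      then have "B / weight (x + s *\<^sub>R ?v) ^ (CARD('n) + 1) \<le> B' / weight x ^ (CARD('n) + 1)"
        by (subst frac_le_eq) (auto simp: divide_nonpos_pos mult.commute)
      then have "norm (partial_deriv j \<phi> (x + s *\<^sub>R ?v)) \<le> B' / weight x ^ (CARD('n) + 1)"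
        using B(2) order_trans by blast
      then show "onorm (\<lambda>h. h *\<^sub>R partial_deriv j \<phi> (x + s *\<^sub>R ?v)) \<le> B' / weight x ^ (CARD('n) + 1)"
        by (intro onorm_le) (simp only: norm_scaleR mult.commute[of "norm _" "norm (partial_deriv _ _ _)"] real_norm_def[symmetric], rule mult_right_mono, auto)
    qed (use t[of k] in auto)
    then have "norm (\<phi> (x + t k *\<^sub>R ?v) - \<phi> x) / t k \<le> B' / weight x ^ (CARD('n) + 1)"
      using t(1)[of k] by (simp add: pos_divide_le_eq)
    then show ?thesis using t(1)[of k] by (simp add: norm_mult norm_exp_eq_Re divide_inverse mult.commute)
  qed
  have lim: "(\<lambda>k. ?s k x) \<longlonglongrightarrow> ?e x * partial_deriv j \<phi> x" for x
  proof (rule tendsto_mult_left)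
    let ?p = "partial_deriv j \<phi> x"
    have "((\<lambda>h. norm (\<phi> (x + h *\<^sub>R ?v) - \<phi> x - h *\<^sub>R ?p) / norm h) \<longlongrightarrow> 0) (at 0)"
      using schwartz_line_derivative[OF S, of x j 0] by (simp add: has_vector_derivative_def has_derivative_at)
    moreover have "\<forall>\<^sub>F h in at 0. norm (\<phi> (x + h *\<^sub>R ?v) - \<phi> x - h *\<^sub>R ?p) / norm h = norm ((\<phi> (x + h *\<^sub>R ?v) - \<phi> x) /\<^sub>R h - ?p)"
      unfolding eventually_at_filter
    proof (intro always_eventually allI impI)
      fix h :: real assume "h \<noteq> 0"
      then have "(\<phi> (x + h *\<^sub>R ?v) - \<phi> x) /\<^sub>R h - ?p = inverse h *\<^sub>R (\<phi> (x + h *\<^sub>R ?v) - \<phi> x - h *\<^sub>R ?p)"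
        by (simp add: scaleR_diff_right)
      then show "norm (\<phi> (x + h *\<^sub>R ?v) - \<phi> x - h *\<^sub>R ?p) / norm h = norm ((\<phi> (x + h *\<^sub>R ?v) - \<phi> x) /\<^sub>R h - ?p)"
        by (simp only: norm_scaleR) (simp add: divide_inverse mult.commute)
    qed
    ultimately have "((\<lambda>h. norm ((\<phi> (x + h *\<^sub>R ?v) - \<phi> x) /\<^sub>R h - ?p)) \<longlongrightarrow> 0) (at 0)"
      by (rule Lim_transform_eventually)
    then have "((\<lambda>h. (\<phi> (x + h *\<^sub>R ?v) - \<phi> x) /\<^sub>R h) \<longlongrightarrow> ?p) (at 0)"
      using tendsto_norm_zero_iff LIM_zero_iff by blast
    from filterlim_compose[OF this t0'] show "(\<lambda>k. (\<phi> (x + t k *\<^sub>R ?v) - \<phi> x) /\<^sub>R t k) \<longlonglongrightarrow> partial_deriv j \<phi> x" .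
  qed
  have 1: "(\<lambda>k. LINT x|lborel. ?s k x) \<longlonglongrightarrow> (LINT x|lborel. ?e x * partial_deriv j \<phi> x)"
  proof (rule integral_dominated_convergence[where w="\<lambda>x. B' / weight x ^ (CARD('n) + 1)"])
    show "integrable lborel (\<lambda>x::real^'n. B' / weight x ^ (CARD('n) + 1))"
      using integrable_mult_right[OF weight_integrable_0, of B'] by simp
    show "AE x in lborel. (\<lambda>k. ?s k x) \<longlonglongrightarrow> ?e x * partial_deriv j \<phi> x" by (intro AE_I2 lim)
    show "AE x in lborel. norm (?s k x) \<le> B' / weight x ^ (CARD('n) + 1)" for k by (intro AE_I2 bound)
    show "(\<lambda>x. ?e x * partial_deriv j \<phi> x) \<in> borel_measurable lborel" using em by measurable
  qed (rule sm)
  have it: "integrable lborel (\<lambda>x. ?e x * \<phi> (x + v))" for v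
  proof -
    have "integrable lborel (\<lambda>x. \<phi> (v + 1 *\<^sub>R x))"
      using lborel_integrable_affine_vec[OF schwartz_measurable[OF S], of 1 v] schwartz_integrable[OF S] by simp
    then show ?thesis
      by (rule Bochner_Integration.integrable_bound) (use em in \<open>auto simp: norm_mult norm_exp_eq_Re add.commute\<close>)
  qed
  have 2: "(LINT x|lborel. ?s k x) = ((exp (\<i> * complex_of_real (t k * \<xi> $ j)) - 1) /\<^sub>R t k) * fourier \<phi> \<xi>" for k
  proof -
    have "(LINT x|lborel. ?s k x) = (LINT x|lborel. (1 / t k) *\<^sub>R (?e x * \<phi> (x + t k *\<^sub>R ?v) - ?e x * \<phi> (x + 0)))"
      by (intro Bochner_Integration.integral_cong refl) (simp add: algebra_simps scaleR_conv_of_real divide_inverse)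
    also have "\<dots> = (1 / t k) *\<^sub>R ((LINT x|lborel. ?e x * \<phi> (x + t k *\<^sub>R ?v)) - (LINT x|lborel. ?e x * \<phi> (x + 0)))"
      by (simp only: integral_scaleR_right Bochner_Integration.integral_diff it)
    also have "\<dots> = (1 / t k) *\<^sub>R (exp (\<i> * complex_of_real (t k * \<xi> $ j)) * fourier \<phi> \<xi> - fourier \<phi> \<xi>)"
      by (simp only: fourier_translate[OF S]) (simp add: inner_commute inner_axis)
    finally show ?thesis by (simp add: algebra_simps divide_inverse)
  qed
  have 3: "(\<lambda>k. (exp (\<i> * complex_of_real (t k * \<xi> $ j)) - 1) /\<^sub>R t k) \<longlonglongrightarrow> \<i> * complex_of_real (\<xi> $ j)"
  proof -
    let ?a = "\<i> * complex_of_real (\<xi> $ j)"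
    have "((\<lambda>z. exp (?a * z)) has_field_derivative ?a) (at 0)"
      by (auto intro!: derivative_eq_intros)
    then have "((\<lambda>z. (exp (?a * z) - 1) / z) \<longlongrightarrow> ?a) (at 0)"
      by (simp add: has_field_derivative_iff)
    moreover have "filterlim (\<lambda>k. complex_of_real (t k)) (at 0) sequentially"
      using t t0 tendsto_of_real[OF t0] by (auto simp: filterlim_at intro!: eventuallyI less_imp_neq[THEN not_sym])
    ultimately have "(\<lambda>k. (exp (?a * complex_of_real (t k)) - 1) / complex_of_real (t k)) \<longlonglongrightarrow> ?a"
      by (rule filterlim_compose)
    then show ?thesis by (simp add: scaleR_conv_of_real divide_inverse mult_ac)
  qed
  have "(\<lambda>k. LINT x|lborel. ?s k x) \<longlonglongrightarrow> \<i> * complex_of_real (\<xi> $ j) * fourier \<phi> \<xi>"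
    unfolding 2 by (intro tendsto_mult_right 3)
  with 1 show ?thesis unfolding fourier_def using LIMSEQ_unique by blast
qed

lemma fourier_iter_partial_deriv:
  assumes S: "\<phi> \<in> schwartz_space"
  shows "fourier (iter_deriv (replicate k j) \<phi>) \<xi> = (\<i> * complex_of_real (\<xi> $ j)) ^ k * fourier \<phi> \<xi>"
proof (induction k)
  case (Suc k)
  have "iter_deriv (replicate (Suc k) j) \<phi> = partial_deriv j (iter_deriv (replicate k j) \<phi>)" by (simp add: iter_deriv_def)
  then show ?case using fourier_partial_deriv[OF schwartz_iter_deriv[OF S]] Suc by (simp add: mult.assoc)
qed (simp add: iter_deriv_def)

lemma norm_power_le_sum_coords:
  fixes \<xi> :: "real^'n::finite"
  shows "norm \<xi> ^ k \<le> real CARD('n) ^ k * (\<Sum>j\<in>UNIV. \<bar>\<xi> $ j\<bar> ^ k)"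
proof -
  define m where "m = Max (range (\<lambda>j. \<bar>\<xi> $ j\<bar>))"
  have "m \<in> range (\<lambda>j. \<bar>\<xi> $ j\<bar>)" unfolding m_def by (rule Max_in) auto
  then obtain j0 where j0: "\<bar>\<xi> $ j0\<bar> = m" by auto
  have "norm \<xi> \<le> (\<Sum>j\<in>UNIV. \<bar>\<xi> $ j\<bar>)" by (rule norm_le_l1_cart)
  also have "\<dots> \<le> (\<Sum>j\<in>(UNIV::'n set). m)" unfolding m_def by (intro sum_mono Max_ge) auto
  also have "\<dots> = real CARD('n) * m" by simp
  finally have "norm \<xi> ^ k \<le> (real CARD('n) * m) ^ k" by (intro power_mono) auto
  also have "\<dots> = real CARD('n) ^ k * \<bar>\<xi> $ j0\<bar> ^ k" by (simp add: power_mult_distrib j0)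
  also have "\<dots> \<le> real CARD('n) ^ k * (\<Sum>j\<in>UNIV. \<bar>\<xi> $ j\<bar> ^ k)"
    by (intro mult_left_mono member_le_sum) auto
  finally show ?thesis .
qed

text \<open>Only pure derivatives in one coordinate enter, since |\<xi>|^k is controlled by the k-th
  powers of the coordinates.\<close>

lemma fourier_decay:
  fixes \<phi> :: "real^'n::finite \<Rightarrow> complex"
  assumes S: "\<phi> \<in> schwartz_space"
  shows "norm \<xi> ^ k * norm (fourier \<phi> \<xi>) \<le> real CARD('n) ^ k * (\<Sum>j\<in>UNIV. LINT x|lborel. norm (iter_deriv (replicate k j) \<phi> x))"
proof -
  have "norm \<xi> ^ k * norm (fourier \<phi> \<xi>) \<le> real CARD('n) ^ k * (\<Sum>j\<in>UNIV. \<bar>\<xi> $ j\<bar> ^ k) * norm (fourier \<phi> \<xi>)"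
    by (intro mult_right_mono norm_power_le_sum_coords) auto
  also have "\<dots> = real CARD('n) ^ k * (\<Sum>j\<in>UNIV. norm (fourier (iter_deriv (replicate k j) \<phi>) \<xi>))"
    by (simp add: fourier_iter_partial_deriv[OF S] norm_mult norm_power sum_distrib_right mult.assoc)
  also have "\<dots> \<le> real CARD('n) ^ k * (\<Sum>j\<in>UNIV. LINT x|lborel. norm (iter_deriv (replicate k j) \<phi> x))"
    by (intro mult_left_mono sum_mono norm_fourier_le schwartz_iter_deriv S) auto
  finally show ?thesis .
qed

text \<open>A derivative of a transform is the transform of a coordinate multiple, so the image of
  the Schwartz space is itself a class to which \<open>schwartz_coinduct\<close> applies.\<close>

lemma fourier_schwartz:
  assumes "\<phi> \<in> schwartz_space"
  shows "fourier \<phi> \<in> schwartz_space"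
proof (rule schwartz_coinduct[where Q="fourier ` schwartz_space"])
  fix f :: "real^'a \<Rightarrow> complex" and i k assume "f \<in> fourier ` schwartz_space"
  then obtain \<phi> where f: "f = fourier \<phi>" and S: "\<phi> \<in> schwartz_space" by blast
  show "f differentiable (at x)" for x unfolding f using fourier_has_derivative[OF S] differentiable_def by blast
  show "\<exists>B. \<forall>x. norm x ^ k * norm (f x) \<le> B" unfolding f using fourier_decay[OF S] by blast
  show "partial_deriv i f \<in> fourier ` schwartz_space"
    unfolding f partial_deriv_fourier[OF S] by (intro imageI schwartz_cmult schwartz_mult_coord S)
qed (use assms in auto)

lemma fourier_cmult: "fourier (\<lambda>x. c * \<phi> x) \<xi> = c * fourier \<phi> \<xi>"
  unfolding fourier_def by (simp only: mult.left_commute[of _ c] integral_mult_right_zero)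

section \<open>The Gaussian and Fourier inversion\<close>

lemma gauss_has_derivative: "(gauss has_derivative (\<lambda>h. - complex_of_real (x \<bullet> h) * gauss x)) (at x)"
proof -
  have "((\<lambda>x. complex_of_real (exp (- (x \<bullet> x) / 2))) has_derivative (\<lambda>h. complex_of_real (exp (- (x \<bullet> x) / 2) * (- (x \<bullet> h))))) (at x)"
    by (rule has_derivative_of_real) (auto intro!: derivative_eq_intros simp: inner_commute)
  then show ?thesis by (simp add: gauss_def[abs_def] mult.commute)
qed

lemma partial_deriv_gauss: "partial_deriv j gauss = (\<lambda>x. - complex_of_real (x $ j) * gauss x)"
  using partial_deriv_eqI[OF gauss_has_derivative] by (auto simp: inner_axis)

text \<open>The transform F of the Gaussian has gradient -\<xi> F(\<xi>), as the Gaussian itself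
  does, so F(\<xi>) exp (|\<xi>|^2 / 2) has zero derivative and is constant. The constant is left as
  the Gaussian integral.\<close>

lemma fourier_gauss: "fourier gauss \<xi> = fourier gauss (0::real^'n) * gauss (\<xi>::real^'n::finite)"
proof -
  let ?G = "\<lambda>\<xi>::real^'n. fourier gauss \<xi> * complex_of_real (exp ((\<xi> \<bullet> \<xi>) / 2))"
  have 1: "fourier (\<lambda>x. - \<i> * (complex_of_real (x $ j) * gauss x)) \<xi> = - complex_of_real (\<xi> $ j) * fourier gauss \<xi>" for \<xi> :: "real^'n" and j
  proof -
    have "(\<lambda>x::real^'n. - \<i> * (complex_of_real (x $ j) * gauss x)) = (\<lambda>x. \<i> * partial_deriv j gauss x)"
      by (simp add: partial_deriv_gauss)
    then show ?thesis by (simp only: fourier_cmult fourier_partial_deriv[OF gauss_schwartz]) (simp add: mult.assoc)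
  qed
  have d1: "(fourier gauss has_derivative (\<lambda>h. - complex_of_real (\<xi> \<bullet> h) * fourier gauss \<xi>)) (at \<xi>)" for \<xi> :: "real^'n"
    by (rule has_derivative_eq_rhs[OF fourier_has_derivative[OF gauss_schwartz]])
      (simp only: 1, simp add: inner_vec_def sum_distrib_left sum_negf mult_ac)
  have d2: "((\<lambda>\<xi>. complex_of_real (exp ((\<xi> \<bullet> \<xi>) / 2))) has_derivative (\<lambda>h. complex_of_real (exp ((\<xi> \<bullet> \<xi>) / 2) * (\<xi> \<bullet> h)))) (at \<xi>)" for \<xi> :: "real^'n"
    by (rule has_derivative_of_real) (auto intro!: derivative_eq_intros simp: inner_commute)
  have "(?G has_derivative (\<lambda>h. 0)) (at \<xi> within UNIV)" for \<xi>
    by (rule has_derivative_eq_rhs[OF has_derivative_mult[OF d1 d2]]) (simp add: algebra_simps)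
  then have "?G \<xi> = ?G 0"
    by (intro has_derivative_zero_unique[of UNIV ?G]) auto
  then have "fourier gauss \<xi> * (complex_of_real (exp ((\<xi> \<bullet> \<xi>) / 2)) * gauss \<xi>) = fourier gauss (0::real^'n) * gauss \<xi>"
    by (simp add: mult.assoc[symmetric])
  also have "complex_of_real (exp ((\<xi> \<bullet> \<xi>) / 2)) * gauss \<xi> = 1"
    unfolding gauss_def of_real_mult[symmetric] exp_add[symmetric] by simp
  finally show ?thesis by simp
qed

lemma fourier_gauss_0: "fourier (gauss :: real^'n::finite \<Rightarrow> complex) 0 = (LINT x|lborel. gauss (x::real^'n))"
  by (simp add: fourier_def)

lemma gauss_integral_nonzero: "(LINT x|lborel. gauss (x::real^'n::finite)) \<noteq> 0"
proof
  assume 0: "(LINT x|lborel. gauss (x::real^'n)) = 0"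
  have i: "integrable lborel (\<lambda>x::real^'n. exp (- (x \<bullet> x) / 2))"
    using integrable_norm[OF schwartz_integrable[OF gauss_schwartz]] by (simp add: gauss_def)
  have "(LINT x|lborel. exp (- ((x::real^'n) \<bullet> x) / 2)) = 0"
    using 0 by (simp add: gauss_def)
  then have "AE x in lborel. exp (- ((x::real^'n) \<bullet> x) / 2) = 0"
    using integral_nonneg_eq_0_iff_AE[OF i] by simp
  then show False by (simp add: trivial_limit_def[symmetric] eventually_const Measure_Space.ae_filter_eq_bot_iff)
qed

lemma norm_gauss_le_1: "norm (gauss x) \<le> 1"
  by (simp add: gauss_def)

lemma gauss_even: "gauss (- x) = gauss x"
  by (simp add: gauss_def)

lemma gauss_measurable[measurable]: "gauss \<in> borel_measurable borel"
  by (rule schwartz_measurable[OF gauss_schwartz])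

lemma gauss_isCont: "isCont gauss x"
  by (rule has_derivative_continuous[OF gauss_has_derivative])

lemma gauss_average_tendsto:
  fixes \<psi> :: "real^'n::finite \<Rightarrow> complex"
  assumes c: "continuous_on UNIV \<psi>" and B: "\<And>x. norm (\<psi> x) \<le> B" and t: "t \<longlonglongrightarrow> 0"
  shows "(\<lambda>k::nat. LINT z|lborel. \<psi> (x + t k *\<^sub>R z) * gauss z) \<longlonglongrightarrow> \<psi> x * (LINT z|lborel. gauss (z::real^'n))"
proof -
  have [measurable]: "\<psi> \<in> borel_measurable borel" by (rule borel_measurable_continuous_onI[OF c])
  have "(\<lambda>k. LINT z|lborel. \<psi> (x + t k *\<^sub>R z) * gauss z) \<longlonglongrightarrow> (LINT z|lborel. \<psi> x * gauss (z::real^'n))"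
  proof (rule integral_dominated_convergence[where w="\<lambda>z. B * norm (gauss z)"])
    show "integrable lborel (\<lambda>z::real^'n. B * norm (gauss z))"
      by (intro integrable_mult_right integrable_norm schwartz_integrable gauss_schwartz)
    have "(\<lambda>k. \<psi> (x + t k *\<^sub>R z) * gauss z) \<longlonglongrightarrow> \<psi> x * gauss z" for z
    proof (rule tendsto_mult_right)
      have "(\<lambda>k. x + t k *\<^sub>R z) \<longlonglongrightarrow> x + 0 *\<^sub>R z" by (intro tendsto_intros t)
      then have "(\<lambda>k. x + t k *\<^sub>R z) \<longlonglongrightarrow> x" by simp
      moreover have "isCont \<psi> x" using c by (simp add: continuous_on_eq_continuous_at)
      ultimately show "(\<lambda>k. \<psi> (x + t k *\<^sub>R z)) \<longlonglongrightarrow> \<psi> x" using isCont_tendsto_compose by blast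
    qed
    then show "AE z in lborel. (\<lambda>k. \<psi> (x + t k *\<^sub>R z) * gauss z) \<longlonglongrightarrow> \<psi> x * gauss z" by simp
    show "AE z in lborel. norm (\<psi> (x + t k *\<^sub>R z) * gauss z) \<le> B * norm (gauss z)" for k
      by (intro AE_I2) (simp add: norm_mult mult_right_mono B)
  qed measurable
  then show ?thesis by simp
qed

lemma schwartz_bounded_0: "\<phi> \<in> schwartz_space \<Longrightarrow> \<exists>B. \<forall>x. norm (\<phi> x) \<le> B"
  using schwartz_bounded[of \<phi> 0] by simp

lemma fourier_scaled_gauss:
  fixes y :: "real^'n::finite"
  assumes "e > 0"
  shows "(LINT \<xi>|lborel. exp (- \<i> * complex_of_real (\<xi> \<bullet> y)) * gauss (e *\<^sub>R \<xi>)) 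
      = (1/e)^CARD('n) *\<^sub>R ((LINT x|lborel. gauss (x::real^'n)) * gauss ((1/e) *\<^sub>R y))"
proof -
  have "(\<lambda>\<xi>. exp (- \<i> * complex_of_real (\<xi> \<bullet> y)) * gauss (e *\<^sub>R \<xi>)) \<in> borel_measurable borel"
    by (intro fourier_integrand_measurable) measurable
  from lborel_integral_affine_vec[OF this, of "1/e" 0]
  have "(LINT \<xi>|lborel. exp (- \<i> * complex_of_real (\<xi> \<bullet> y)) * gauss (e *\<^sub>R \<xi>)) 
    = (1/e)^CARD('n) *\<^sub>R (LINT \<xi>|lborel. exp (- \<i> * complex_of_real (\<xi> \<bullet> ((1/e) *\<^sub>R y))) * gauss \<xi>)"
    using assms by (simp add: abs_of_pos)
  also have "(LINT \<xi>|lborel. exp (- \<i> * complex_of_real (\<xi> \<bullet> ((1/e) *\<^sub>R y))) * gauss \<xi>) = fourier gauss ((1/e) *\<^sub>R y)"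
    unfolding fourier_def ..
  finally show ?thesis using fourier_gauss[of "(1/e) *\<^sub>R y"] by (simp add: fourier_gauss_0)
qed

text \<open>The double integral behind a twofold transform does not converge absolutely. The factor
  \<open>gauss (e *\<^sub>R \<xi>)\<close> makes it so; after Fubini the inner integral is a narrow
  Gaussian around -x.\<close>

lemma fourier_fourier_mollified:
  fixes \<phi> :: "real^'n::finite \<Rightarrow> complex"
  assumes S: "\<phi> \<in> schwartz_space" and e: "e > 0"
  shows "(LINT \<xi>|lborel. exp (- \<i> * complex_of_real (\<xi> \<bullet> x)) * gauss (e *\<^sub>R \<xi>) * fourier \<phi> \<xi>)
     = (LINT z|lborel. gauss (z::real^'n)) * (LINT z|lborel. \<phi> (- x + e *\<^sub>R z) * gauss z)"
proof -
  let ?E = "\<lambda>\<xi> x::real^'n. exp (- \<i> * complex_of_real (\<xi> \<bullet> x))" and ?\<Gamma> = "LINT z|lborel. gauss (z::real^'n)"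
  have Em[measurable]: "(\<lambda>p. ?E (fst p) (snd p)) \<in> borel_measurable (borel \<Otimes>\<^sub>M borel)"
    unfolding borel_prod by (rule borel_measurable_continuous_onI) (auto intro!: continuous_intros)
  note [measurable] = schwartz_measurable[OF S]
  let ?F = "\<lambda>\<xi> y. ?E \<xi> (x + y) * gauss (e *\<^sub>R \<xi>) * \<phi> y"
  have nF: "norm (?F \<xi> y) = norm (gauss (e *\<^sub>R \<xi>)) * norm (\<phi> y)" for \<xi> y
    by (simp add: norm_mult norm_exp_eq_Re)
  have ig: "integrable lborel (\<lambda>\<xi>::real^'n. gauss (e *\<^sub>R \<xi>))"
  proof -
    have "integrable lborel (\<lambda>\<xi>::real^'n. gauss (0 + e *\<^sub>R \<xi>))"
      by (subst lborel_integrable_affine_vec[symmetric]) (use e in \<open>auto intro: schwartz_integrable gauss_schwartz\<close>)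
    then show ?thesis by simp
  qed
  have E2: "(\<lambda>p. ?E (fst p) (x + snd p)) \<in> borel_measurable (borel \<Otimes>\<^sub>M borel)"
    unfolding borel_prod by (rule borel_measurable_continuous_onI) (auto intro!: continuous_intros)
  have Fm: "case_prod ?F \<in> borel_measurable (lborel \<Otimes>\<^sub>M lborel)"
    unfolding split_beta' using E2 by measurable
  have iF: "integrable (lborel \<Otimes>\<^sub>M lborel) (case_prod ?F)"
  proof (rule lborel_pair.Fubini_integrable[OF Fm])
    show "integrable lborel (\<lambda>\<xi>. LINT y|lborel. norm (case (\<xi>, y) of (\<xi>, y) \<Rightarrow> ?F \<xi> y))"
      by (simp only: prod.case nF integral_mult_right_zero)
        (intro integrable_mult_left integrable_norm ig)
    show "AE \<xi> in lborel. integrable lborel (\<lambda>y. case (\<xi>, y) of (\<xi>, y) \<Rightarrow> ?F \<xi> y)"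
    proof (intro AE_I2)
      fix \<xi> :: "real^'n"
      have "integrable lborel (\<lambda>y. (?E \<xi> x * gauss (e *\<^sub>R \<xi>)) * (?E y \<xi> * \<phi> y))"
        by (intro integrable_mult_right fourier_integrable S)
      then show "integrable lborel (\<lambda>y. case (\<xi>, y) of (\<xi>, y) \<Rightarrow> ?F \<xi> y)"
        by (simp add: inner_add_right distrib_left exp_diff exp_minus divide_inverse inner_commute mult_ac)
    qed
  qed
  have "(LINT \<xi>|lborel. ?E \<xi> x * gauss (e *\<^sub>R \<xi>) * fourier \<phi> \<xi>) = (LINT \<xi>|lborel. LINT y|lborel. ?F \<xi> y)"
  proof (rule Bochner_Integration.integral_cong[OF refl])
    fix \<xi> :: "real^'n"
    have "?E \<xi> x * gauss (e *\<^sub>R \<xi>) * fourier \<phi> \<xi> = (LINT y|lborel. (?E \<xi> x * gauss (e *\<^sub>R \<xi>)) * (?E y \<xi> * \<phi> y))"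
      unfolding fourier_def by (rule integral_mult_right_zero[symmetric])
    also have "\<dots> = (LINT y|lborel. ?F \<xi> y)"
      by (intro Bochner_Integration.integral_cong refl)
        (simp add: inner_add_right distrib_left exp_diff exp_minus divide_inverse inner_commute mult_ac)
    finally show "?E \<xi> x * gauss (e *\<^sub>R \<xi>) * fourier \<phi> \<xi> = (LINT y|lborel. ?F \<xi> y)" .
  qed
  also have "\<dots> = (LINT y|lborel. LINT \<xi>|lborel. ?F \<xi> y)"
    using lborel_pair.Fubini_integral[OF iF] by simp
  also have "\<dots> = (LINT y|lborel. (1/e)^CARD('n) *\<^sub>R (?\<Gamma> * gauss ((1/e) *\<^sub>R (x + y))) * \<phi> y)"
    by (simp only: integral_mult_left_zero fourier_scaled_gauss[OF e])
  also have "\<dots> = e^CARD('n) *\<^sub>R (LINT z|lborel. (1/e)^CARD('n) *\<^sub>R (?\<Gamma> * gauss ((1/e) *\<^sub>R (x + (- x + e *\<^sub>R z)))) * \<phi> (- x + e *\<^sub>R z))"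
    using lborel_integral_affine_vec[of "\<lambda>y. (1/e)^CARD('n) *\<^sub>R (?\<Gamma> * gauss ((1/e) *\<^sub>R (x + y))) * \<phi> y" e "- x"] e by simp
  also have "\<dots> = e^CARD('n) *\<^sub>R (LINT z|lborel. ((1/e)^CARD('n) *\<^sub>R ?\<Gamma>) * (\<phi> (- x + e *\<^sub>R z) * gauss z))"
    using e by (simp add: mult_ac)
  also have "\<dots> = ?\<Gamma> * (LINT z|lborel. \<phi> (- x + e *\<^sub>R z) * gauss z)"
    using e by (simp add: integral_mult_right_zero power_divide)
  finally show ?thesis .
qed

text \<open>The mollified identity is passed to the limit e -> 0: on the left dominated by the norm
  of \<open>fourier \<phi>\<close>, on the right as an average of a bounded continuous function. One
  factor of the square normalizes the transform of the Gaussian, the other is the mass of the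
  average.\<close>

lemma fourier_fourier:
  fixes \<phi> :: "real^'n::finite \<Rightarrow> complex"
  assumes S: "\<phi> \<in> schwartz_space"
  shows "fourier (fourier \<phi>) x = (LINT z|lborel. gauss (z::real^'n))\<^sup>2 * \<phi> (- x)"
proof -
  let ?E = "\<lambda>\<xi> x::real^'n. exp (- \<i> * complex_of_real (\<xi> \<bullet> x))" and ?\<Gamma> = "LINT z|lborel. gauss (z::real^'n)"
  define t where "t k = inverse (real (Suc k))" for k
  have t: "0 < t k" for k unfolding t_def by auto
  have t0: "t \<longlonglongrightarrow> 0" unfolding t_def by (rule LIMSEQ_inverse_real_of_nat)
  note FS = fourier_schwartz[OF S]
  note [measurable] = schwartz_measurable[OF S] schwartz_measurable[OF FS]
  have Em[measurable]: "(\<lambda>\<xi>. ?E \<xi> x) \<in> borel_measurable borel"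
    by (rule borel_measurable_continuous_onI) (auto intro!: continuous_intros)
  have 1: "(\<lambda>k. LINT \<xi>|lborel. ?E \<xi> x * gauss (t k *\<^sub>R \<xi>) * fourier \<phi> \<xi>) \<longlonglongrightarrow> (LINT \<xi>|lborel. ?E \<xi> x * fourier \<phi> \<xi>)"
  proof (rule integral_dominated_convergence[where w="\<lambda>\<xi>. norm (fourier \<phi> \<xi>)"])
    show "integrable lborel (\<lambda>\<xi>. norm (fourier \<phi> \<xi>))" by (intro integrable_norm schwartz_integrable FS)
    have "(\<lambda>k. ?E \<xi> x * gauss (t k *\<^sub>R \<xi>) * fourier \<phi> \<xi>) \<longlonglongrightarrow> ?E \<xi> x * 1 * fourier \<phi> \<xi>" for \<xi>
    proof (intro tendsto_mult tendsto_const)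
      have "(\<lambda>k. t k *\<^sub>R \<xi>) \<longlonglongrightarrow> 0 *\<^sub>R \<xi>" by (intro tendsto_intros t0)
      moreover have "isCont gauss (0::real^'n)" by (rule gauss_isCont)
      ultimately have "(\<lambda>k. gauss (t k *\<^sub>R \<xi>)) \<longlonglongrightarrow> gauss (0::real^'n)"
        using isCont_tendsto_compose[of "0::real^'n" gauss] by simp
      then show "(\<lambda>k. gauss (t k *\<^sub>R \<xi>)) \<longlonglongrightarrow> 1" by (simp add: gauss_def)
    qed
    then show "AE \<xi> in lborel. (\<lambda>k. ?E \<xi> x * gauss (t k *\<^sub>R \<xi>) * fourier \<phi> \<xi>) \<longlonglongrightarrow> ?E \<xi> x * fourier \<phi> \<xi>" by simp
    show "AE \<xi> in lborel. norm (?E \<xi> x * gauss (t k *\<^sub>R \<xi>) * fourier \<phi> \<xi>) \<le> norm (fourier \<phi> \<xi>)" for k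
      by (intro AE_I2) (auto simp: norm_mult norm_exp_eq_Re intro!: mult_left_le_one_le norm_gauss_le_1)
  qed measurable
  obtain B where B: "\<And>x. norm (\<phi> x) \<le> B" using schwartz_bounded_0[OF S] by blast
  have 2: "(\<lambda>k. ?\<Gamma> * (LINT z|lborel. \<phi> (- x + t k *\<^sub>R z) * gauss z)) \<longlonglongrightarrow> ?\<Gamma> * (\<phi> (- x) * ?\<Gamma>)"
    by (intro tendsto_mult_left gauss_average_tendsto[OF schwartz_continuous[OF S] B t0])
  have "(LINT \<xi>|lborel. ?E \<xi> x * fourier \<phi> \<xi>) = ?\<Gamma> * (\<phi> (- x) * ?\<Gamma>)"
    by (rule LIMSEQ_unique[OF 1]) (simp only: fourier_fourier_mollified[OF S t] 2)
  then show ?thesis unfolding fourier_def[of "fourier \<phi>"] by (simp add: power2_eq_square mult_ac)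
qed

definition inverse_fourier :: "(real^'n::finite \<Rightarrow> complex) \<Rightarrow> real^'n \<Rightarrow> complex" where
  "inverse_fourier \<phi> x = fourier \<phi> (- x) / (LINT z|lborel. gauss (z::real^'n))\<^sup>2"

lemma inverse_fourier_schwartz: "\<phi> \<in> schwartz_space \<Longrightarrow> inverse_fourier \<phi> \<in> schwartz_space"
  using schwartz_cmult[OF schwartz_reflect[OF fourier_schwartz], of \<phi> "1 / (LINT z|lborel. gauss (z::real^'a))\<^sup>2"]
  by (simp add: inverse_fourier_def[abs_def])

lemma inverse_fourier_fourier: "\<phi> \<in> schwartz_space \<Longrightarrow> inverse_fourier (fourier \<phi>) = \<phi>"
  by (auto simp: inverse_fourier_def fourier_fourier gauss_integral_nonzero)

lemma fourier_reflect: 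
  assumes S: "\<phi> \<in> schwartz_space" 
  shows "fourier (\<lambda>x. \<phi> (- x)) \<xi> = fourier \<phi> (- \<xi>)"
  using lborel_integral_affine_vec[OF fourier_integrand_measurable[OF schwartz_measurable[OF schwartz_reflect[OF S]]], of "-1" \<xi> 0]
  unfolding fourier_def by simp

lemma fourier_inverse_fourier:
  assumes S: "\<phi> \<in> schwartz_space"
  shows "fourier (inverse_fourier \<phi>) = \<phi>"
proof
  fix x :: "real^'a"
  let ?c = "1 / (LINT z|lborel. gauss (z::real^'a))\<^sup>2"
  have "inverse_fourier \<phi> = (\<lambda>x. ?c * fourier \<phi> (- x))" by (auto simp: inverse_fourier_def)
  then have "fourier (inverse_fourier \<phi>) x = ?c * fourier (fourier \<phi>) (- x)"
    by (simp only: fourier_cmult fourier_reflect[OF fourier_schwartz[OF S]])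
  then show "fourier (inverse_fourier \<phi>) x = \<phi> x" by (simp add: fourier_fourier[OF S] gauss_integral_nonzero)
qed

section \<open>Determination of a distribution by its Fourier transform\<close>

text \<open>Convolving \<psi> with narrow Gaussians writes it as a superposition over centres y of
  exactly those functions against which g integrates to 0. Fubini gives the vanishing for the
  smoothed \<psi>, and the smoothing converges boundedly to a nonzero multiple of \<psi>.\<close>

lemma gauss_averages_zero_continuous:
  fixes g :: "real^'n::finite \<Rightarrow> complex"
  assumes ig: "integrable lborel g"
    and z: "\<And>y e. e > 0 \<Longrightarrow> (LINT \<xi>|lborel. g \<xi> * gauss ((1/e) *\<^sub>R (\<xi> - y))) = 0"
    and c: "continuous_on UNIV \<psi>" and B: "\<And>x. norm (\<psi> x) \<le> B"
  shows "(LINT \<xi>|lborel. g \<xi> * \<psi> \<xi>) = 0"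
proof -
  let ?\<Gamma> = "LINT z|lborel. gauss (z::real^'n)"
  have gm[measurable]: "g \<in> borel_measurable borel" using ig by auto
  have pm[measurable]: "\<psi> \<in> borel_measurable borel" by (rule borel_measurable_continuous_onI[OF c])
  have iG: "integrable lborel (gauss :: real^'n \<Rightarrow> complex)" by (rule schwartz_integrable[OF gauss_schwartz])
  have B0: "B \<ge> 0" using B[of 0] norm_ge_zero order_trans by blast
  define t where "t k = inverse (real (Suc k))" for k
  have t: "0 < t k" for k unfolding t_def by auto
  have t0: "t \<longlonglongrightarrow> 0" unfolding t_def by (rule LIMSEQ_inverse_real_of_nat)
  define \<Psi> where "\<Psi> k \<xi> = (LINT z|lborel. \<psi> (\<xi> + t k *\<^sub>R z) * gauss z)" for k \<xi>
  have \<Psi>m[measurable]: "(\<lambda>\<xi>. \<Psi> k \<xi>) \<in> borel_measurable borel" for k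
  proof -
    have "(\<lambda>\<xi>. LINT z|lborel. \<psi> (\<xi> + t k *\<^sub>R z) * gauss z) \<in> borel_measurable lborel"
      by (rule lborel.borel_measurable_lebesgue_integral) measurable
    then show ?thesis by (simp add: \<Psi>_def)
  qed
  have \<Psi>b: "norm (\<Psi> k \<xi>) \<le> B * (LINT z|lborel. norm (gauss (z::real^'n)))" for k \<xi>
  proof -
    have "norm (\<Psi> k \<xi>) \<le> (LINT z|lborel. norm (\<psi> (\<xi> + t k *\<^sub>R z) * gauss z))"
      unfolding \<Psi>_def by (rule integral_norm_bound)
    also have "\<dots> \<le> (LINT z|lborel. B * norm (gauss (z::real^'n)))"
    proof (rule Bochner_Integration.integral_mono)
      show i: "integrable lborel (\<lambda>z::real^'n. B * norm (gauss z))" by (intro integrable_mult_right integrable_norm iG)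
      show "norm (\<psi> (\<xi> + t k *\<^sub>R z) * gauss z) \<le> B * norm (gauss z)" for z
        by (simp add: norm_mult mult_right_mono B)
      then show "integrable lborel (\<lambda>z. norm (\<psi> (\<xi> + t k *\<^sub>R z) * gauss z))"
        by (intro Bochner_Integration.integrable_bound[OF i]) (auto simp: B0)
    qed
    finally show ?thesis by simp
  qed
  have 0: "(LINT \<xi>|lborel. g \<xi> * \<Psi> k \<xi>) = 0" for k
  proof -
    define e where "e = t k"
    have e: "e > 0" using t by (simp add: e_def)
    let ?F = "\<lambda>\<xi> z. g \<xi> * (\<psi> (\<xi> + e *\<^sub>R z) * gauss z)"
    have Fm: "case_prod ?F \<in> borel_measurable (lborel \<Otimes>\<^sub>M lborel)" unfolding split_beta' by measurable
    have iin: "integrable lborel (\<lambda>z. \<psi> (\<xi> + e *\<^sub>R z) * gauss z)" for \<xi>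
      by (rule Bochner_Integration.integrable_bound[OF integrable_mult_right[OF integrable_norm[OF iG], of B]])
        (auto simp: B0 norm_mult intro!: mult_right_mono B)
    have iF: "integrable (lborel \<Otimes>\<^sub>M lborel) (case_prod ?F)"
    proof (rule lborel_pair.Fubini_integrable[OF Fm])
      have nm: "(\<lambda>\<xi>. LINT z|lborel. norm (?F \<xi> z)) \<in> borel_measurable lborel"
        by (rule lborel.borel_measurable_lebesgue_integral) measurable
      have le: "(LINT z|lborel. norm (?F \<xi> z)) \<le> norm (g \<xi>) * (B * (LINT z|lborel. norm (gauss (z::real^'n))))" for \<xi>
      proof -
        have "(LINT z|lborel. norm (?F \<xi> z)) \<le> (LINT z|lborel. norm (g \<xi>) * (B * norm (gauss (z::real^'n))))"
        proof (rule Bochner_Integration.integral_mono)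
          show "integrable lborel (\<lambda>z. norm (?F \<xi> z))" by (intro integrable_norm integrable_mult_right iin)
          show "integrable lborel (\<lambda>z::real^'n. norm (g \<xi>) * (B * norm (gauss z)))" by (intro integrable_mult_right integrable_norm iG)
          show "norm (?F \<xi> z) \<le> norm (g \<xi>) * (B * norm (gauss z))" for z
            unfolding norm_mult by (intro mult_left_mono mult_right_mono B) auto
        qed
        then show ?thesis by simp
      qed
      show "integrable lborel (\<lambda>\<xi>. LINT z|lborel. norm (case (\<xi>, z) of (\<xi>, z) \<Rightarrow> ?F \<xi> z))"
        unfolding prod.case
      proof (rule Bochner_Integration.integrable_bound[OF integrable_mult_left[OF integrable_norm[OF ig], of "B * (LINT z|lborel. norm (gauss (z::real^'n)))"] nm], intro AE_I2)
        fix \<xi>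
        have "0 \<le> (LINT z|lborel. norm (?F \<xi> z))" by (rule Bochner_Integration.integral_nonneg) auto
        then show "norm (LINT z|lborel. norm (?F \<xi> z)) \<le> norm (norm (g \<xi>) * (B * (LINT z|lborel. norm (gauss (z::real^'n)))))"
          using le[of \<xi>] by simp
      qed
      show "AE \<xi> in lborel. integrable lborel (\<lambda>z. case (\<xi>, z) of (\<xi>, z) \<Rightarrow> ?F \<xi> z)"
        unfolding prod.case by (intro AE_I2 integrable_mult_right iin)
    qed
    have inner0: "(LINT \<xi>|lborel. ?F \<xi> z) = gauss z * (LINT \<xi>|lborel. g \<xi> * \<psi> (\<xi> + e *\<^sub>R z))" for z
      by (subst integral_mult_right_zero[symmetric]) (simp add: mult_ac)
    \<comment> \<open>Instead of substituting in the inner integral, compare with the integral over \<open>y = \<xi> + e z\<close>.\<close>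
    have "(LINT \<xi>|lborel. g \<xi> * \<Psi> k \<xi>) = (LINT \<xi>|lborel. LINT z|lborel. ?F \<xi> z)"
      unfolding \<Psi>_def e_def by (intro Bochner_Integration.integral_cong refl) (rule integral_mult_right_zero[symmetric])
    also have "\<dots> = (LINT \<xi>|lborel. (1/e)^CARD('n) *\<^sub>R (LINT y|lborel. g \<xi> * (\<psi> y * gauss ((1/e) *\<^sub>R (\<xi> - y)))))"
    proof (rule Bochner_Integration.integral_cong[OF refl])
      fix \<xi> :: "real^'n"
      have *: "(LINT y|lborel. g \<xi> * (\<psi> y * gauss ((1/e) *\<^sub>R (\<xi> - y)))) = e ^ CARD('n) *\<^sub>R (LINT z|lborel. ?F \<xi> z)"
        using lborel_integral_affine_vec[of "\<lambda>y. g \<xi> * (\<psi> y * gauss ((1/e) *\<^sub>R (\<xi> - y)))" e \<xi>] e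
        by (simp add: gauss_even)
      show "(LINT z|lborel. ?F \<xi> z) = (1/e)^CARD('n) *\<^sub>R (LINT y|lborel. g \<xi> * (\<psi> y * gauss ((1/e) *\<^sub>R (\<xi> - y))))"
        unfolding * using e by (simp add: power_divide)
    qed
    also have "\<dots> = (1/e)^CARD('n) *\<^sub>R (LINT \<xi>|lborel. LINT y|lborel. g \<xi> * (\<psi> y * gauss ((1/e) *\<^sub>R (\<xi> - y))))"
      by (rule integral_scaleR_right)
    also have "(LINT \<xi>|lborel. LINT y|lborel. g \<xi> * (\<psi> y * gauss ((1/e) *\<^sub>R (\<xi> - y))))
        = (LINT y|lborel. LINT \<xi>|lborel. g \<xi> * (\<psi> y * gauss ((1/e) *\<^sub>R (\<xi> - y))))"
    proof -
      let ?H = "\<lambda>\<xi> y. g \<xi> * (\<psi> y * gauss ((1/e) *\<^sub>R (\<xi> - y)))"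
      have Hm: "case_prod ?H \<in> borel_measurable (lborel \<Otimes>\<^sub>M lborel)" unfolding split_beta' by measurable
      have Hz: "?H \<xi> (\<xi> + e *\<^sub>R z) = ?F \<xi> z" for \<xi> z using e by (simp add: gauss_even)
      have iHy: "integrable lborel (\<lambda>y. ?H \<xi> y)" for \<xi>
        by (subst lborel_integrable_affine_vec[where t=\<xi> and c=e]) (use e in \<open>auto simp only: Hz intro!: integrable_mult_right iin\<close>, measurable)
      have nH: "(LINT y|lborel. norm (?H \<xi> y)) = e^CARD('n) * (LINT z|lborel. norm (?F \<xi> z))" for \<xi>
        by (subst lborel_integral_affine_vec[where t=\<xi> and c=e]) (use e in \<open>auto simp only: Hz\<close>, auto)
      have "integrable (lborel \<Otimes>\<^sub>M lborel) (case_prod ?H)"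
      proof (rule lborel_pair.Fubini_integrable[OF Hm])
        have "integrable lborel (\<lambda>\<xi>. LINT z|lborel. norm (?F \<xi> z))"
        proof -
          have "integrable (lborel \<Otimes>\<^sub>M lborel) (\<lambda>(\<xi>, z). norm (?F \<xi> z))"
            using integrable_norm[OF iF] by (simp add: split_beta')
          from lborel_pair.integrable_fst[OF this] show ?thesis .
        qed
        then show "integrable lborel (\<lambda>\<xi>. LINT y|lborel. norm (case (\<xi>, y) of (\<xi>, y) \<Rightarrow> ?H \<xi> y))"
          unfolding prod.case nH by (rule integrable_mult_right)
        show "AE \<xi> in lborel. integrable lborel (\<lambda>y. case (\<xi>, y) of (\<xi>, y) \<Rightarrow> ?H \<xi> y)"
          unfolding prod.case by (intro AE_I2 iHy)
      qed
      from lborel_pair.Fubini_integral[OF this] show ?thesis by simp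
    qed
    also have "\<dots> = (LINT y|lborel. \<psi> y * (LINT \<xi>|lborel. g \<xi> * gauss ((1/e) *\<^sub>R (\<xi> - y))))"
      by (simp only: mult.left_commute[of "g _"] integral_mult_right_zero)
    also have "\<dots> = 0" by (simp only: z[OF e]) simp
    finally show ?thesis by simp
  qed
  have "(\<lambda>k. LINT \<xi>|lborel. g \<xi> * \<Psi> k \<xi>) \<longlonglongrightarrow> (LINT \<xi>|lborel. g \<xi> * (\<psi> \<xi> * ?\<Gamma>))"
  proof (rule integral_dominated_convergence[where w="\<lambda>\<xi>. norm (g \<xi>) * (B * (LINT z|lborel. norm (gauss (z::real^'n))))"])
    show "integrable lborel (\<lambda>\<xi>. norm (g \<xi>) * (B * (LINT z|lborel. norm (gauss (z::real^'n)))))"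
      by (intro integrable_mult_left integrable_norm ig)
    show "AE \<xi> in lborel. (\<lambda>k. g \<xi> * \<Psi> k \<xi>) \<longlonglongrightarrow> g \<xi> * (\<psi> \<xi> * ?\<Gamma>)"
      unfolding \<Psi>_def by (intro AE_I2 tendsto_mult_left gauss_average_tendsto[OF c B t0])
    show "AE \<xi> in lborel. norm (g \<xi> * \<Psi> k \<xi>) \<le> norm (g \<xi>) * (B * (LINT z|lborel. norm (gauss (z::real^'n))))" for k
      unfolding norm_mult by (intro AE_I2 mult_left_mono \<Psi>b) auto
  qed measurable
  then have "(LINT \<xi>|lborel. g \<xi> * (\<psi> \<xi> * ?\<Gamma>)) = 0" by (simp only: 0 LIMSEQ_const_iff)
  then have "?\<Gamma> * (LINT \<xi>|lborel. g \<xi> * \<psi> \<xi>) = 0"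
    by (subst integral_mult_right_zero[symmetric]) (simp add: mult_ac)
  then show ?thesis using gauss_integral_nonzero[where 'n='n] by simp
qed

text \<open>The Borel sets over which g integrates to 0 form a Dynkin system, and the closed sets
  are an intersection-stable generator.\<close>

lemma AE_zero_from_closed_sets:
  fixes g :: "'a::euclidean_space \<Rightarrow> complex"
  assumes ig: "integrable lborel g"
    and cl: "\<And>C. closed C \<Longrightarrow> (LINT x:C|lborel. g x) = 0"
  shows "AE x in lborel. g x = 0"
proof (rule sigma_finite_measure.density_zero[OF sigma_finite_lborel ig])
  fix A :: "'a set" assume "A \<in> sets lborel"
  then have A: "A \<in> sigma_sets UNIV (Collect closed)" by (simp add: borel_eq_closed)
  have si: "set_integrable lborel A g" if "A \<in> sets borel" for A
    unfolding set_integrable_def using that ig by (intro integrable_mult_indicator) auto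
  have sb: "B \<in> sets borel" if "B \<in> sigma_sets UNIV (Collect closed)" for B :: "'a set"
    using that by (simp add: borel_eq_closed)
  have sp: "Collect closed \<subseteq> Pow (UNIV :: 'a set)" by simp
  have stable: "Int_stable (Collect closed :: 'a set set)" by (auto simp: Int_stable_def)
  show "(LINT x:A|lborel. g x) = 0"
    using stable sp A
  proof (induction rule: sigma_sets_induct_disjoint)
    case (basic A) then show ?case using cl by simp
  next
    case empty then show ?case by (simp add: set_lebesgue_integral_def)
  next
    case (compl A)
    have "A \<in> sets borel" using compl sb by blast
    then have "(LINT x:(A \<union> (UNIV - A))|lborel. g x) = (LINT x:A|lborel. g x) + (LINT x:(UNIV - A)|lborel. g x)"
      by (intro set_integral_Un si) auto
    then show ?case using compl cl[of UNIV] by simp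
  next
    case (union F)
    have Fb: "F i \<in> sets borel" for i using union sb by blast
    have "(LINT x:(\<Union>i. F i)|lborel. g x) = (\<Sum>i. (LINT x:(F i)|lborel. g x))"
      using union(1) Fb by (intro lebesgue_integral_countable_add si) (auto simp: disjoint_family_on_def)
    then show ?case using union by simp
  qed
qed

text \<open>The indicator of a closed set C is the bounded limit of the continuous functions max 0
  (1 - k dist(x, C)), which brings the claim back to continuous test functions.\<close>

lemma AE_zero_from_gauss_averages:
  fixes g :: "real^'n::finite \<Rightarrow> complex"
  assumes ig: "integrable lborel g"
    and z: "\<And>y e. e > 0 \<Longrightarrow> (LINT \<xi>|lborel. g \<xi> * gauss ((1/e) *\<^sub>R (\<xi> - y))) = 0"
  shows "AE x in lborel. g x = 0"
proof (rule AE_zero_from_closed_sets[OF ig])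
  fix C :: "(real^'n) set" assume C: "closed C"
  have [measurable]: "g \<in> borel_measurable borel" using ig by auto
  show "(LINT x:C|lborel. g x) = 0"
  \<comment> \<open>For the empty set \<open>infdist\<close> is 0 by convention, so the
    approximating functions would be 1 instead of tending to 0.\<close>
  proof (cases "C = {}")
    case True then show ?thesis by (simp add: set_lebesgue_integral_def)
  next
    case False
    have Cb[measurable]: "C \<in> sets borel" using C by auto
    let ?\<psi> = "\<lambda>k x. complex_of_real (max 0 (1 - real k * infdist x C))"
    have c: "continuous_on UNIV (?\<psi> k)" for k by (intro continuous_intros)
    have B: "norm (?\<psi> k x) \<le> 1" for k x using infdist_nonneg[of x C] by simp
    have 0: "(LINT x|lborel. g x * ?\<psi> k x) = 0" for k
      by (rule gauss_averages_zero_continuous[OF ig z c B])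
    have "(\<lambda>k. LINT x|lborel. g x * ?\<psi> k x) \<longlonglongrightarrow> (LINT x|lborel. g x * indicator C x)"
    proof (rule integral_dominated_convergence[where w="\<lambda>x. norm (g x)"])
      show "AE x in lborel. (\<lambda>k. g x * ?\<psi> k x) \<longlonglongrightarrow> g x * indicator C x"
      proof (intro AE_I2 tendsto_mult_left)
        fix x
        show "(\<lambda>k. ?\<psi> k x) \<longlonglongrightarrow> indicator C x"
        proof (cases "x \<in> C")
          case True then show ?thesis by simp
        next
          case x: False
          then have "infdist x C > 0" using C False infdist_pos_not_in_closed by blast
          then obtain m where m: "real m * infdist x C > 1" using reals_Archimedean3 by blast
          have "?\<psi> k x = 0" if "k \<ge> m" for k
            using m mult_right_mono[of "real m" "real k" "infdist x C"] that infdist_nonneg[of x C] by simp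
          then have "\<forall>\<^sub>F k in sequentially. ?\<psi> k x = 0" using eventually_sequentially by blast
          then show ?thesis using x by (simp add: tendsto_eventually)
        qed
      qed
      show "AE x in lborel. norm (g x * ?\<psi> k x) \<le> norm (g x)" for k
        unfolding norm_mult by (intro AE_I2 mult_right_le_one_le B) auto
      show "(\<lambda>x. g x * ?\<psi> k x) \<in> borel_measurable lborel" for k
        using borel_measurable_continuous_onI[OF c] by measurable
    qed (use ig in auto)
    then have "(LINT x|lborel. g x * indicator C x) = 0" by (simp only: 0 LIMSEQ_const_iff)
    then show ?thesis unfolding set_lebesgue_integral_def by (simp add: scaleR_conv_of_real mult.commute of_real_indicator)
  qed
qed

text \<open>Neither function need be integrable, so their difference is first multiplied by
  \<open>gauss\<close>. Testing this product with a Gaussian centred at y amounts to testing the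
  difference with a Schwartz function.\<close>

lemma represents_unique:
  fixes h k :: "real^'n::finite \<Rightarrow> complex"
  assumes h: "represents h T" and k: "represents k T"
  shows "AE \<xi> in lborel. h \<xi> = k \<xi>"
proof -
  define g where "g \<xi> = (h \<xi> - k \<xi>) * gauss \<xi>" for \<xi>
  have ih: "integrable lborel (\<lambda>\<xi>. h \<xi> * \<phi> \<xi>)" "integrable lborel (\<lambda>\<xi>. k \<xi> * \<phi> \<xi>)" 
    and eq: "(LINT \<xi>|lborel. h \<xi> * \<phi> \<xi>) = (LINT \<xi>|lborel. k \<xi> * \<phi> \<xi>)" if "\<phi> \<in> schwartz_space" for \<phi>
    using h k that unfolding represents_def by auto
  have i2: "integrable lborel (\<lambda>\<xi>. (h \<xi> - k \<xi>) * \<phi> \<xi>)" "(LINT \<xi>|lborel. (h \<xi> - k \<xi>) * \<phi> \<xi>) = 0" if "\<phi> \<in> schwartz_space" for \<phi>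
    using ih[OF that] eq[OF that] unfolding left_diff_distrib by auto
  have "AE \<xi> in lborel. g \<xi> = 0"
  proof (rule AE_zero_from_gauss_averages)
    show "integrable lborel g" unfolding g_def by (rule i2(1)[OF gauss_schwartz])
    fix y :: "real^'n" and e :: real assume "e > 0"
    from i2(2)[OF gauss_shift_mult_schwartz[OF this]] 
    show "(LINT \<xi>|lborel. g \<xi> * gauss ((1/e) *\<^sub>R (\<xi> - y))) = 0" unfolding g_def by (simp add: mult.assoc)
  qed
  then show ?thesis by eventually_elim (simp add: g_def gauss_def)
qed

section \<open>The transform as a function and what it determines\<close>

text \<open>Measurability is not spelled out in \<open>locally_integrable\<close>; it is recovered
  as a pointwise limit of truncations to balls of growing radius.\<close>

lemma locally_integrable_measurable:
  fixes h :: "real^'n::finite \<Rightarrow> complex"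
  assumes "locally_integrable h"
  shows "h \<in> borel_measurable borel"
proof (rule borel_measurable_LIMSEQ_metric[where f="\<lambda>k x. indicator (cball 0 (real k)) x *\<^sub>R h x"])
  fix k
  have "set_integrable lborel (cball 0 (real k)) h" using assms unfolding locally_integrable_def by simp
  then show "(\<lambda>x. indicator (cball 0 (real k)) x *\<^sub>R h x) \<in> borel_measurable borel"
    unfolding set_integrable_def by auto
next
  fix x :: "real^'n"
  obtain m where m: "norm x \<le> real m" using real_arch_simple by blast
  have "indicator (cball 0 (real k)) x *\<^sub>R h x = h x" if "k \<ge> m" for k
    using m that by (simp add: indicator_def)
  then have "\<forall>\<^sub>F k in sequentially. indicator (cball 0 (real k)) x *\<^sub>R h x = h x"
    using eventually_sequentially by blast
  then show "(\<lambda>k. indicator (cball 0 (real k)) x *\<^sub>R h x) \<longlonglongrightarrow> h x" by (rule tendsto_eventually)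
qed

lemma has_fourier_function_unique:
  "has_fourier_function T h \<Longrightarrow> has_fourier_function T k \<Longrightarrow> AE \<xi> in lborel. h \<xi> = k \<xi>"
  unfolding has_fourier_function_def using represents_unique by blast

lemma has_fourier_function_hat: "\<exists>h. has_fourier_function T h \<Longrightarrow> has_fourier_function T (hat T)"
  using someI_ex[of "has_fourier_function T"] by (simp add: hat_def)

lemma hat_unique: "has_fourier_function T h \<Longrightarrow> AE \<xi> in lborel. hat T \<xi> = h \<xi>"
  using has_fourier_function_unique has_fourier_function_hat by blast

lemma hat_measurable: "\<exists>h. has_fourier_function T h \<Longrightarrow> hat T \<in> borel_measurable borel"
  using has_fourier_function_hat locally_integrable_measurable has_fourier_function_def by blast

lemma has_fourier_function_diff:
  assumes T: "has_fourier_function T h" and S: "has_fourier_function S k"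
  shows "has_fourier_function (T - S) (\<lambda>\<xi>. h \<xi> - k \<xi>)"
  using assms unfolding has_fourier_function_def locally_integrable_def represents_def fourier_functional_def
  by (auto simp: left_diff_distrib set_integral_diff intro!: set_integral_diff)

text \<open>The Fourier side only gives the values of T on transforms; surjectivity of the transform
  on the Schwartz space turns these into all values. Outside that space both functionals are 0 by
  the encoding.\<close>

lemma tempered_eqI:
  assumes T: "T \<in> tempered" "has_fourier_function T h" and S: "S \<in> tempered" "has_fourier_function S k"
    and eq: "AE \<xi> in lborel. h \<xi> = k \<xi>"
  shows "T = S"
proof
  fix \<phi>
  show "T \<phi> = S \<phi>"
  proof (cases "\<phi> \<in> schwartz_space")
    case False then show ?thesis using T(1) S(1) unfolding tempered_def by auto
  next
    case True
    define \<psi> where "\<psi> = inverse_fourier \<phi>"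
    have \<psi>: "\<psi> \<in> schwartz_space" "fourier \<psi> = \<phi>"
      using inverse_fourier_schwartz[OF True] fourier_inverse_fourier[OF True] by (auto simp: \<psi>_def)
    have "T \<phi> = (LINT \<xi>|lborel. h \<xi> * \<psi> \<xi>)" and mh: "(\<lambda>\<xi>. h \<xi> * \<psi> \<xi>) \<in> borel_measurable lborel"
      using T(2) \<psi> unfolding has_fourier_function_def represents_def fourier_functional_def by auto
    moreover have "S \<phi> = (LINT \<xi>|lborel. k \<xi> * \<psi> \<xi>)" and mk: "(\<lambda>\<xi>. k \<xi> * \<psi> \<xi>) \<in> borel_measurable lborel"
      using S(2) \<psi> unfolding has_fourier_function_def represents_def fourier_functional_def by auto
    moreover have "(LINT \<xi>|lborel. h \<xi> * \<psi> \<xi>) = (LINT \<xi>|lborel. k \<xi> * \<psi> \<xi>)"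
      by (rule integral_cong_AE[OF mh mk]) (use eq in \<open>eventually_elim, simp\<close>)
    ultimately show ?thesis by simp
  qed
qed

section \<open>Distributions with a prescribed Fourier transform\<close>

text \<open>The power |\<xi>|^(-s) with s < d is harmless at the origin, and d + 1 powers of decay
  of \<psi> take care of infinity. Linearity of the bound in B is what continuity of a distribution
  demands.\<close>

lemma integrable_power_schwartz:
  fixes h :: "real^'n::finite \<Rightarrow> complex"
  assumes [measurable]: "h \<in> borel_measurable borel"
    and s: "0 \<le> s" "s < real CARD('n)"
    and b: "AE \<xi> in lborel. norm (h \<xi>) \<le> M * norm \<xi> powr (-s)"
    and [measurable]: "\<psi> \<in> borel_measurable borel"
    and B: "\<And>x. weight x ^ (CARD('n) + 1) * norm (\<psi> x) \<le> B"
  shows "integrable lborel (\<lambda>\<xi>. h \<xi> * \<psi> \<xi>)" (is ?A)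
    and "norm (LINT \<xi>|lborel. h \<xi> * \<psi> \<xi>) \<le> (\<bar>M\<bar> * (LINT x|lborel. norm (x::real^'n) powr (-s) / weight x ^ (CARD('n) + 1))) * B" (is ?B)
proof -
  let ?w = "\<lambda>x::real^'n. norm x powr (-s) / weight x ^ (CARD('n) + 1)"
  have B0: "B \<ge> 0" using B[of 0] by (meson mult_nonneg_nonneg norm_ge_zero order_trans max.coboundedI1 zero_le_one zero_le_power)
  have iw: "integrable lborel (\<lambda>x. \<bar>M\<bar> * B * ?w x)"
    by (intro integrable_mult_right weight_integrable s)
  have le: "AE x in lborel. norm (h x * \<psi> x) \<le> \<bar>M\<bar> * B * ?w x"
    using b
  proof eventually_elim
    case (elim x)
    have W: "weight x ^ (CARD('n) + 1) > 0" by simp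
    have "norm (\<psi> x) \<le> B / weight x ^ (CARD('n) + 1)"
      using B[of x] W by (simp add: pos_le_divide_eq mult.commute del: power_Suc)
    moreover have "norm (h x) \<le> \<bar>M\<bar> * norm x powr (-s)"
      using elim by (rule order_trans) (intro mult_right_mono, auto)
    ultimately have "norm (h x) * norm (\<psi> x) \<le> (\<bar>M\<bar> * norm x powr (-s)) * (B / weight x ^ (CARD('n) + 1))"
      by (intro mult_mono) auto
    then show ?case by (simp add: norm_mult mult_ac)
  qed
  show ?A
  proof (rule Bochner_Integration.integrable_bound[OF iw])
    show "AE x in lborel. norm (h x * \<psi> x) \<le> norm (\<bar>M\<bar> * B * ?w x)"
      using le by eventually_elim (erule order_trans, simp only: real_norm_def abs_ge_self)
  qed measurable
  have "norm (LINT \<xi>|lborel. h \<xi> * \<psi> \<xi>) \<le> (LINT x|lborel. \<bar>M\<bar> * B * ?w x)"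
    by (rule order_trans[OF integral_norm_bound]) (intro integral_mono_AE integrable_norm \<open>?A\<close> iw le)
  also have "\<dots> = (\<bar>M\<bar> * (LINT x|lborel. ?w x)) * B" by (simp only: integral_mult_right_zero mult_ac)
  finally show ?B .
qed

text \<open>Decay of order d + 1 on the Fourier side costs d + 1 derivatives, and their L1 norms
  cost d + 1 weights; hence N = d + 1 serves as both limits in the sum of seminorms.\<close>

lemma inverse_fourier_seminorm_bound:
  "\<exists>K\<ge>0. \<forall>\<phi>\<in>schwartz_space. \<forall>x::real^'n::finite. weight x ^ (CARD('n)+1) * norm (inverse_fourier \<phi> x)
     \<le> K * (\<Sum>k\<le>CARD('n)+1. \<Sum>js | length js \<le> CARD('n)+1. schwartz_seminorm k js \<phi>)"
proof -
  let ?N = "CARD('n) + 1"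
  obtain K where K: "K \<ge> 0" "\<And>\<phi> js. \<phi> \<in> schwartz_space \<Longrightarrow> (LINT x|lborel. norm (iter_deriv js \<phi> (x::real^'n)))
      \<le> K * (schwartz_seminorm 0 js \<phi> + schwartz_seminorm ?N js \<phi>)"
    using schwartz_L1_bound by blast
  define g where "g = norm ((LINT z|lborel. gauss (z::real^'n))\<^sup>2)"
  have g: "g > 0" unfolding g_def using gauss_integral_nonzero by simp
  define K' where "K' = (2 * K + real CARD('n) ^ ?N * (real CARD('n) * (2 * K))) / g"
  \<comment> \<open>A sum over an infinite set would be 0 by convention; finiteness lets a single
    seminorm be dominated by the whole sum.\<close>
  have fin: "finite {js::'n list. length js \<le> ?N}"
    using finite_lists_length_le[of "UNIV::'n set" ?N] by simp
  show ?thesis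
  proof (intro exI[of _ K'] conjI ballI allI)
    show "0 \<le> K'" unfolding K'_def using K g by simp
    fix \<phi> :: "real^'n \<Rightarrow> complex" and x :: "real^'n" assume S: "\<phi> \<in> schwartz_space"
    let ?S = "\<Sum>k\<le>?N. \<Sum>js | length js \<le> ?N. schwartz_seminorm k js \<phi>"
    have le: "schwartz_seminorm k js \<phi> \<le> ?S" if "k \<le> ?N" "length js \<le> ?N" for k js
    proof -
      have "schwartz_seminorm k js \<phi> \<le> (\<Sum>js | length js \<le> ?N. schwartz_seminorm k js \<phi>)"
        by (rule member_le_sum) (use that fin in \<open>auto simp: schwartz_seminorm_nonneg[OF S]\<close>)
      also have "\<dots> \<le> ?S"
        by (rule member_le_sum) (use that in \<open>auto simp: schwartz_seminorm_nonneg[OF S] intro!: sum_nonneg\<close>)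
      finally show ?thesis .
    qed
    have L1: "(LINT x|lborel. norm (iter_deriv js \<phi> x)) \<le> 2 * K * ?S" if "length js \<le> ?N" for js
    proof -
      have "schwartz_seminorm 0 js \<phi> + schwartz_seminorm ?N js \<phi> \<le> 2 * ?S"
        using le[of 0 js] le[of ?N js] that by simp
      from order_trans[OF K(2)[OF S, of js] mult_left_mono[OF this K(1)]] show ?thesis
        by (simp only: mult.assoc mult.left_commute[of 2])
    qed
    have f0: "norm (fourier \<phi> (- x)) \<le> 2 * K * ?S"
      using norm_fourier_le[OF S, of "- x"] L1[of "[]"] by (simp add: iter_deriv_def)
    have fN: "norm x ^ ?N * norm (fourier \<phi> (- x)) \<le> real CARD('n) ^ ?N * (real CARD('n) * (2 * K)) * ?S"
    proof -
      have "norm x ^ ?N * norm (fourier \<phi> (- x)) \<le> real CARD('n) ^ ?N * (\<Sum>j\<in>UNIV. LINT x|lborel. norm (iter_deriv (replicate ?N j) \<phi> x))"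
        using fourier_decay[OF S, of "- x" ?N] by (simp only: norm_minus_cancel)
      also have "\<dots> \<le> real CARD('n) ^ ?N * (\<Sum>j\<in>(UNIV::'n set). 2 * K * ?S)"
        by (intro mult_left_mono sum_mono L1) auto
      finally show ?thesis by (simp only: sum_constant mult.assoc)
    qed
    have "weight x ^ ?N * norm (fourier \<phi> (- x)) \<le> (1 + norm x ^ ?N) * norm (fourier \<phi> (- x))"
      by (intro mult_right_mono weight_power_le) auto
    also have "\<dots> = norm (fourier \<phi> (- x)) + norm x ^ ?N * norm (fourier \<phi> (- x))" by (simp only: distrib_right mult_1)
    also have "\<dots> \<le> 2 * K * ?S + real CARD('n) ^ ?N * (real CARD('n) * (2 * K)) * ?S" by (rule add_mono[OF f0 fN])
    also have "\<dots> = (2 * K + real CARD('n) ^ ?N * (real CARD('n) * (2 * K))) * ?S" by (simp only: distrib_right)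
    also have "2 * K + real CARD('n) ^ ?N * (real CARD('n) * (2 * K)) = g * K'" using g by (simp add: K'_def del: power_Suc)
    finally have "weight x ^ ?N * norm (fourier \<phi> (- x)) / g \<le> K' * ?S" using g by (simp add: pos_divide_le_eq mult_ac)
    then show "weight x ^ ?N * norm (inverse_fourier \<phi> x) \<le> K' * ?S"
      by (simp add: inverse_fourier_def norm_divide g_def)
  qed
qed

lemma inverse_fourier_add:
  assumes "\<phi> \<in> schwartz_space" "\<psi> \<in> schwartz_space"
  shows "inverse_fourier (\<lambda>x. \<phi> x + \<psi> x) \<xi> = inverse_fourier \<phi> \<xi> + inverse_fourier \<psi> \<xi>"
  using fourier_integrable[OF assms(1), of "- \<xi>"] fourier_integrable[OF assms(2), of "- \<xi>"]
  by (simp add: inverse_fourier_def fourier_def distrib_left add_divide_distrib)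

text \<open>The distribution is defined by duality, as the pairing of h with the inverse transform
  of the test function, so that testing it with the transform of \<psi> returns the pairing of h
  with \<psi>. This is the passage back from frequency functions to elements of
  \<open>PM\<close>.\<close>

lemma tempered_exists:
  fixes h :: "real^'n::finite \<Rightarrow> complex"
  assumes hm[measurable]: "h \<in> borel_measurable borel"
    and s: "0 \<le> s" "s < real CARD('n)"
    and b: "AE \<xi> in lborel. norm (h \<xi>) \<le> M * norm \<xi> powr (-s)"
  shows "\<exists>T\<in>tempered. has_fourier_function T h"
proof -
  let ?N = "CARD('n) + 1"
  define T where "T \<phi> = (if \<phi> \<in> schwartz_space then (LINT \<xi>|lborel. h \<xi> * inverse_fourier \<phi> \<xi>) else 0)" for \<phi>
  have dec: "\<exists>B. \<forall>x. weight x ^ ?N * norm (\<phi> x) \<le> B" if S: "\<phi> \<in> schwartz_space" for \<phi> :: "real^'n \<Rightarrow> complex"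
  proof -
    obtain B where B: "\<And>x. norm (\<phi> x) \<le> B / weight x ^ ?N" using schwartz_weight_decay[OF S] by blast
    have "weight x ^ ?N > 0" for x :: "real^'n" by simp
    then have "weight x ^ ?N * norm (\<phi> x) \<le> B" for x using B[of x] by (simp add: pos_le_divide_eq mult.commute del: power_Suc)
    then show ?thesis by blast
  qed
  have int: "integrable lborel (\<lambda>\<xi>. h \<xi> * \<phi> \<xi>)" if S: "\<phi> \<in> schwartz_space" for \<phi>
    using dec[OF S] integrable_power_schwartz(1)[OF hm s b schwartz_measurable[OF S]] by blast
  have inti: "integrable lborel (\<lambda>\<xi>. h \<xi> * inverse_fourier \<phi> \<xi>)" if S: "\<phi> \<in> schwartz_space" for \<phi>
    by (rule int[OF inverse_fourier_schwartz[OF S]])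
  obtain K where K: "K \<ge> 0" "\<And>\<phi> x. \<phi> \<in> schwartz_space \<Longrightarrow> weight x ^ ?N * norm (inverse_fourier \<phi> (x::real^'n))
     \<le> K * (\<Sum>k\<le>?N. \<Sum>js | length js \<le> ?N. schwartz_seminorm k js \<phi>)"
    using inverse_fourier_seminorm_bound by blast
  define J where "J = \<bar>M\<bar> * (LINT x|lborel. norm (x::real^'n) powr (-s) / weight x ^ ?N)"
  have bT: "norm (T \<phi>) \<le> (J * K) * (\<Sum>k\<le>?N. \<Sum>js | length js \<le> ?N. schwartz_seminorm k js \<phi>)" if S: "\<phi> \<in> schwartz_space" for \<phi>
    using integrable_power_schwartz(2)[OF hm s b schwartz_measurable[OF inverse_fourier_schwartz[OF S]] K(2)[OF S]] S
    unfolding T_def J_def by (simp only: if_True mult.assoc)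
  have cm: "inverse_fourier (\<lambda>x. c * \<phi> x) \<xi> = c * inverse_fourier \<phi> \<xi>" for c \<phi> and \<xi> :: "real^'n"
    by (simp add: inverse_fourier_def fourier_cmult)
  have "T \<in> tempered"
    unfolding tempered_def
  proof (intro CollectI conjI allI impI ballI)
    show "T \<phi> = 0" if "\<phi> \<notin> schwartz_space" for \<phi> using that by (simp add: T_def)
    show "T (\<lambda>x. \<phi> x + \<psi> x) = T \<phi> + T \<psi>" if "\<phi> \<in> schwartz_space" "\<psi> \<in> schwartz_space" for \<phi> \<psi>
      using that inti[OF that(1)] inti[OF that(2)] by (simp add: T_def schwartz_add inverse_fourier_add[OF that] distrib_left)
    show "T (\<lambda>x. c * \<phi> x) = c * T \<phi>" if "\<phi> \<in> schwartz_space" for c \<phi>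
      using that by (simp add: T_def schwartz_cmult cm mult.left_commute[of _ c])
    show "\<exists>C N. \<forall>\<phi>\<in>schwartz_space. norm (T \<phi>) \<le> C * (\<Sum>k\<le>N. \<Sum>js | length js \<le> N. schwartz_seminorm k js \<phi>)"
      using bT by blast
  qed
  moreover have "has_fourier_function T h"
    unfolding has_fourier_function_def
  proof
    show "represents h (fourier_functional T)"
      unfolding represents_def fourier_functional_def
      by (auto simp: int T_def fourier_schwartz inverse_fourier_fourier)
    show "locally_integrable h"
      unfolding locally_integrable_def
    proof (intro allI impI)
      fix C :: "(real^'n) set" assume C: "compact C"
      then obtain r where r: "\<And>x. x \<in> C \<Longrightarrow> norm x \<le> r"
        using compact_imp_bounded[OF C] unfolding bounded_iff by blast
      have [measurable]: "C \<in> sets borel" by (intro borel_closed compact_imp_closed C)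
      \<comment> \<open>Local integrability is the preceding estimate with the indicator of a
        compact set in the role of \<psi>; its weighted size is bounded because the set is.\<close>
      have "weight x ^ ?N * norm (indicator C x :: complex) \<le> (max 1 r) ^ ?N" for x
      proof (cases "x \<in> C")
        case True
        then have "weight x \<le> max 1 r" using r[of x] by (simp add: max.coboundedI2)
        then have "weight x ^ ?N \<le> (max 1 r) ^ ?N" by (rule power_mono) simp
        then show ?thesis using True by (simp del: power_Suc)
      next
        case False
        have "0 \<le> (max 1 r) ^ ?N" by (rule zero_le_power) simp
        then show ?thesis using False by (simp del: power_Suc)
      qed
      then have "integrable lborel (\<lambda>\<xi>. h \<xi> * indicator C \<xi>)"
        by (intro integrable_power_schwartz(1)[OF hm s b]) auto
      then show "set_integrable lborel C h"
        unfolding set_integrable_def by (simp add: scaleR_conv_of_real of_real_indicator mult.commute)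
    qed
  qed
  ultimately show ?thesis by blast
qed

section \<open>The linear semigroup\<close>

lemma cdot_add: "cdot \<xi> (v + w) = cdot \<xi> v + cdot \<xi> w"
  by (simp add: cdot_def distrib_left sum.distrib)

lemma cdot_scaleR: "cdot \<xi> (c *\<^sub>R w) = c *\<^sub>R cdot \<xi> w"
  by (simp add: cdot_def scaleR_sum_right)

lemma norm_cdot_le:
  fixes \<xi> :: "real^'n::finite"
  shows "norm (cdot \<xi> w) \<le> real CARD('n) * (norm \<xi> * norm w)"
proof -
  have "norm (cdot \<xi> w) \<le> (\<Sum>j\<in>(UNIV::'n set). norm \<xi> * norm w)"
    unfolding cdot_def
    by (intro sum_norm_le) (auto simp: norm_mult intro!: mult_mono component_le_norm_cart Finite_Cartesian_Product.norm_nth_le)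
  then show ?thesis by simp
qed

lemma A_symbol_linear: "linear (A_symbol \<mu> \<nu> \<kappa> \<alpha> \<xi>)"
  by (rule linearI)
    (auto simp: A_symbol_def split_beta vec_eq_iff cdot_add cdot_scaleR distrib_left distrib_right scaleR_right_distrib mult_scaleR_left)

lemma A_symbol_bounded_linear: "bounded_linear (A_symbol \<mu> \<nu> \<kappa> \<alpha> (\<xi>::real^'n::finite))"
  using A_symbol_linear linear_conv_bounded_linear by blast

lemma augment_bounded_linear: "bounded_linear (augment (\<xi>::real^'n::finite))"
proof -
  have "linear (augment \<xi>)"
    by (rule linearI) (auto simp: augment_def split_beta distrib_left)
  then show ?thesis using linear_conv_bounded_linear by blast
qed

abbreviation aug_norm :: "real^'n::finite \<Rightarrow> complex \<times> (complex^'n) \<Rightarrow> real" where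
  "aug_norm \<xi> v \<equiv> norm (augment \<xi> v)"

lemma aug_norm_triangle: "aug_norm \<xi> (v + w) \<le> aug_norm \<xi> v + aug_norm \<xi> w"
  using norm_triangle_ineq by (simp add: linear_add[OF bounded_linear.linear[OF augment_bounded_linear]])

lemma aug_norm_diff: "aug_norm \<xi> (v - w) \<le> aug_norm \<xi> v + aug_norm \<xi> w"
  using norm_triangle_ineq4 by (simp add: linear_diff[OF bounded_linear.linear[OF augment_bounded_linear]])

lemma aug_norm_minus_commute: "aug_norm \<xi> (v - w) = aug_norm \<xi> (w - v)"
  by (simp add: linear_diff[OF bounded_linear.linear[OF augment_bounded_linear]] norm_minus_commute)

lemma aug_norm_zero [simp]: "aug_norm \<xi> 0 = 0"
  by (simp add: linear_0[OF bounded_linear.linear[OF augment_bounded_linear]])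

lemma aug_norm_ge:
  shows "norm (fst v) \<le> aug_norm \<xi> v" "norm \<xi> * norm (fst v) \<le> aug_norm \<xi> v" "norm (snd v) \<le> aug_norm \<xi> v"
proof -
  have e: "augment \<xi> v = (fst v, complex_of_real (norm \<xi>) * fst v, snd v)" by (simp add: augment_def split_beta)
  show "norm (fst v) \<le> aug_norm \<xi> v" unfolding e by (rule norm_fst_le)
  have 2: "norm (complex_of_real (norm \<xi>) * fst v, snd v) \<le> aug_norm \<xi> v" unfolding e using norm_snd_le by blast
  show "norm \<xi> * norm (fst v) \<le> aug_norm \<xi> v"
    using order_trans[OF norm_fst_le 2] by (simp add: norm_mult)
  show "norm (snd v) \<le> aug_norm \<xi> v" using order_trans[OF norm_snd_le 2] .
qed

lemma aug_norm_le: "aug_norm \<xi> v \<le> norm (fst v) + norm \<xi> * norm (fst v) + norm (snd v)"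
proof -
  have "aug_norm \<xi> v = norm (fst v, complex_of_real (norm \<xi>) * fst v, snd v)" by (simp add: augment_def split_beta)
  also have "\<dots> \<le> norm (fst v) + norm (complex_of_real (norm \<xi>) * fst v, snd v)" by (rule norm_Pair_le)
  also have "\<dots> \<le> norm (fst v) + (norm (complex_of_real (norm \<xi>) * fst v) + norm (snd v))"
    by (intro add_left_mono norm_Pair_le)
  finally show ?thesis by (simp add: norm_mult)
qed

lemma norm_le_aug_norm: "norm v \<le> 2 * aug_norm \<xi> v"
  using norm_Pair_le[of "fst v" "snd v"] aug_norm_ge[where v=v and \<xi>=\<xi>] by simp

lemma norm_le_sum_coords:
  fixes w :: "complex^'n::finite"
  assumes "\<And>j. norm (w $ j) \<le> c"
  shows "norm w \<le> real CARD('n) * c"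
proof -
  have "norm w \<le> (\<Sum>j\<in>UNIV. norm (w $ j))" by (simp add: norm_vec_def L2_set_le_sum)
  also have "\<dots> \<le> (\<Sum>j\<in>(UNIV::'n set). c)" by (intro sum_mono assms)
  finally show ?thesis by simp
qed

text \<open>In this norm the generator costs only |\<xi>| + |\<xi>|^2: the capillary term \<kappa>
  |\<xi>|^2 b \<xi> is cubic against b but quadratic against |\<xi>| b, and the first component, of
  size |\<xi>| |w|, bears the extra weight |\<xi>| within the same order.\<close>

lemma aug_norm_A_symbol:
  "\<exists>K\<ge>0. \<forall>(\<xi>::real^'n::finite) v. aug_norm \<xi> (A_symbol \<mu> \<nu> \<kappa> \<alpha> \<xi> v) \<le> K * (norm \<xi> + (norm \<xi>)\<^sup>2) * aug_norm \<xi> v"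
proof -
  define d where "d = real CARD('n)"
  have d: "d \<ge> 0" by (simp add: d_def)
  define K where "K = d + (d * (\<bar>\<alpha>\<bar> + \<bar>\<kappa>\<bar> + \<bar>\<mu>\<bar> + \<bar>\<mu> + \<nu>\<bar> * d))"
  have "aug_norm \<xi> (A_symbol \<mu> \<nu> \<kappa> \<alpha> \<xi> v) \<le> K * (norm \<xi> + (norm \<xi>)\<^sup>2) * aug_norm \<xi> v" for \<xi> :: "real^'n" and v
  proof -
    define N r where "N = aug_norm \<xi> v" and "r = norm \<xi>"
    have r: "r \<ge> 0" and N: "N \<ge> 0" by (auto simp: r_def N_def)
    obtain b w where v: "v = (b, w)" by (cases v)
    have nb: "norm b \<le> N" "r * norm b \<le> N" and nw: "norm w \<le> N"
      using aug_norm_ge[where v=v and \<xi>=\<xi>] by (auto simp: v N_def r_def)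
    have cd: "norm (cdot \<xi> w) \<le> d * (r * N)"
      by (rule order_trans[OF norm_cdot_le]) (use nw r in \<open>auto simp: d_def r_def intro!: mult_left_mono\<close>)
    have "norm (snd (A_symbol \<mu> \<nu> \<kappa> \<alpha> \<xi> v)) \<le> d * ((\<bar>\<alpha>\<bar> + \<bar>\<kappa>\<bar> + \<bar>\<mu>\<bar> + \<bar>\<mu> + \<nu>\<bar> * d) * ((r + r\<^sup>2) * N))"
      unfolding d_def
    proof (rule norm_le_sum_coords, fold d_def)
      fix j
      have xj: "\<bar>\<xi> $ j\<bar> \<le> r" unfolding r_def by (rule component_le_norm_cart)
      have "norm (\<i> * complex_of_real (\<alpha> + \<kappa> * r\<^sup>2) * b * complex_of_real (\<xi> $ j))
         = \<bar>\<alpha> + \<kappa> * r\<^sup>2\<bar> * norm b * \<bar>\<xi> $ j\<bar>" by (simp add: norm_mult del: of_real_add)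
      also have "\<dots> \<le> (\<bar>\<alpha>\<bar> + \<bar>\<kappa>\<bar> * r\<^sup>2) * norm b * r"
        by (intro mult_mono xj) (auto simp: abs_mult intro!: order_trans[OF abs_triangle_ineq])
      also have "\<dots> = \<bar>\<alpha>\<bar> * (r * norm b) + \<bar>\<kappa>\<bar> * (r\<^sup>2 * (r * norm b))" by (simp add: algebra_simps)
      also have "\<dots> \<le> \<bar>\<alpha>\<bar> * (r * N) + \<bar>\<kappa>\<bar> * (r\<^sup>2 * N)"
        by (intro add_mono mult_left_mono nb r) auto
      finally have 1: "norm (\<i> * complex_of_real (\<alpha> + \<kappa> * r\<^sup>2) * b * complex_of_real (\<xi> $ j)) \<le> \<bar>\<alpha>\<bar> * (r * N) + \<bar>\<kappa>\<bar> * (r\<^sup>2 * N)" .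
      have "norm (w $ j) \<le> N" using nw Finite_Cartesian_Product.norm_nth_le[of w j] by linarith
      then have 2: "norm (complex_of_real (\<mu> * r\<^sup>2) * w $ j) \<le> \<bar>\<mu>\<bar> * (r\<^sup>2 * N)"
        by (simp add: norm_mult abs_mult mult_left_mono mult.assoc del: of_real_mult)
      have "norm (complex_of_real (\<mu> + \<nu>) * cdot \<xi> w * complex_of_real (\<xi> $ j)) = \<bar>\<mu> + \<nu>\<bar> * (norm (cdot \<xi> w) * \<bar>\<xi> $ j\<bar>)"
        by (simp add: norm_mult del: of_real_add)
      also have "\<dots> \<le> \<bar>\<mu> + \<nu>\<bar> * ((d * (r * N)) * r)"
        using cd xj d r N by (intro mult_left_mono mult_mono) auto
      finally have 3: "norm (complex_of_real (\<mu> + \<nu>) * cdot \<xi> w * complex_of_real (\<xi> $ j)) \<le> \<bar>\<mu> + \<nu>\<bar> * d * (r\<^sup>2 * N)"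
        by (simp add: power2_eq_square algebra_simps)
      have "norm (snd (A_symbol \<mu> \<nu> \<kappa> \<alpha> \<xi> v) $ j) \<le> (\<bar>\<alpha>\<bar> * (r * N) + \<bar>\<kappa>\<bar> * (r\<^sup>2 * N)) + \<bar>\<mu>\<bar> * (r\<^sup>2 * N) + \<bar>\<mu> + \<nu>\<bar> * d * (r\<^sup>2 * N)"
        unfolding A_symbol_def v prod.case snd_conv vec_lambda_beta r_def[symmetric]
        by (intro order_trans[OF norm_triangle_ineq] add_mono 1 2 3)
      also have "\<dots> \<le> (\<bar>\<alpha>\<bar> + \<bar>\<kappa>\<bar> + \<bar>\<mu>\<bar> + \<bar>\<mu> + \<nu>\<bar> * d) * ((r + r\<^sup>2) * N)"
        using r N d by (simp add: algebra_simps)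
      finally show "norm (snd (A_symbol \<mu> \<nu> \<kappa> \<alpha> \<xi> v) $ j) \<le> (\<bar>\<alpha>\<bar> + \<bar>\<kappa>\<bar> + \<bar>\<mu>\<bar> + \<bar>\<mu> + \<nu>\<bar> * d) * ((r + r\<^sup>2) * N)" .
    qed
    moreover have f: "norm (fst (A_symbol \<mu> \<nu> \<kappa> \<alpha> \<xi> v)) \<le> d * (r * N)"
      using cd by (simp add: A_symbol_def v norm_mult)
    moreover have "r * norm (fst (A_symbol \<mu> \<nu> \<kappa> \<alpha> \<xi> v)) \<le> d * (r\<^sup>2 * N)"
      using mult_left_mono[OF f r] by (simp add: power2_eq_square algebra_simps)
    ultimately have "aug_norm \<xi> (A_symbol \<mu> \<nu> \<kappa> \<alpha> \<xi> v) \<le> d * (r * N) + d * (r\<^sup>2 * N) +  d * ((\<bar>\<alpha>\<bar> + \<bar>\<kappa>\<bar> + \<bar>\<mu>\<bar> + \<bar>\<mu> + \<nu>\<bar> * d) * ((r + r\<^sup>2) * N))"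
      using aug_norm_le[of \<xi> "A_symbol \<mu> \<nu> \<kappa> \<alpha> \<xi> v"] unfolding r_def by linarith
    also have "\<dots> = K * (r + r\<^sup>2) * N" by (simp add: K_def algebra_simps)
    finally show ?thesis by (simp add: r_def N_def)
  qed
  moreover have "K \<ge> 0" using d by (simp add: K_def)
  ultimately show ?thesis by blast
qed

section \<open>Exponential of a linear map by its series\<close>

context
  fixes L :: "'a::euclidean_space \<Rightarrow> 'a"
  assumes L: "bounded_linear L"
begin

lemma funpow_bounded_linear: "bounded_linear (L ^^ k)"
proof (induction k)
  case (Suc k) then show ?case using bounded_linear_compose[OF L] by (simp add: o_def)
qed (simp add: id_def bounded_linear_ident)

lemma norm_funpow_le: "norm ((L ^^ k) v) \<le> onorm L ^ k * norm v"
proof (induction k)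
  case (Suc k)
  have "norm ((L ^^ Suc k) v) \<le> onorm L * norm ((L ^^ k) v)" using onorm[OF L] by simp
  also have "\<dots> \<le> onorm L * (onorm L ^ k * norm v)" by (intro mult_left_mono Suc onorm_pos_le L)
  finally show ?case by (simp add: mult.assoc)
qed simp

lemma exp_series_summable_norm: "summable (\<lambda>k. norm (((- t) ^ k / fact k) *\<^sub>R ((L ^^ k) v)))"
proof (rule summable_comparison_test')
  show "summable (\<lambda>k. (\<bar>t\<bar> * onorm L) ^ k /\<^sub>R fact k * norm v)"
    by (intro summable_mult2 summable_exp_generic)
  show "norm (norm (((- t) ^ k / fact k) *\<^sub>R ((L ^^ k) v))) \<le> (\<bar>t\<bar> * onorm L) ^ k /\<^sub>R fact k * norm v" if "k \<ge> 0" for k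
  proof -
    have "norm (((- t) ^ k / fact k) *\<^sub>R ((L ^^ k) v)) = \<bar>t\<bar> ^ k / fact k * norm ((L ^^ k) v)"
      by (simp add: power_abs)
    also have "\<dots> \<le> \<bar>t\<bar> ^ k / fact k * (onorm L ^ k * norm v)"
      by (intro mult_left_mono norm_funpow_le) auto
    finally show ?thesis by (simp add: power_mult_distrib divide_inverse mult_ac)
  qed
qed

lemmas exp_series_summable = summable_norm_cancel[OF exp_series_summable_norm]

lemma exp_series_linear: "linear (\<lambda>v. \<Sum>k. ((- t) ^ k / fact k) *\<^sub>R ((L ^^ k) v))"
proof (rule linearI)
  have lin: "linear (L ^^ k)" for k using funpow_bounded_linear bounded_linear.linear by blast
  show "(\<Sum>k. ((- t) ^ k / fact k) *\<^sub>R ((L ^^ k) (v + w))) = (\<Sum>k. ((- t) ^ k / fact k) *\<^sub>R ((L ^^ k) v)) + (\<Sum>k. ((- t) ^ k / fact k) *\<^sub>R ((L ^^ k) w))" for v w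
    by (simp add: linear_add[OF lin] scaleR_right_distrib suminf_add[OF exp_series_summable exp_series_summable])
  show "(\<Sum>k. ((- t) ^ k / fact k) *\<^sub>R ((L ^^ k) (c *\<^sub>R v))) = c *\<^sub>R (\<Sum>k. ((- t) ^ k / fact k) *\<^sub>R ((L ^^ k) v))" for c v
    by (simp add: linear_scale[OF lin] suminf_scaleR_right[OF exp_series_summable] scaleR_left_commute[of _ c] del: scaleR_scaleR)
qed

text \<open>Tested against a basis vector the series becomes a scalar power series that converges
  everywhere, so it may be differentiated termwise; shifting the index moves one L onto v.\<close>

lemma exp_series_has_vector_derivative:
  "((\<lambda>t. \<Sum>k. ((- t) ^ k / fact k) *\<^sub>R ((L ^^ k) v)) has_vector_derivative
     - (\<Sum>k. ((- t) ^ k / fact k) *\<^sub>R ((L ^^ k) (L v)))) (at t)"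
  unfolding has_vector_derivative_def
proof (rule has_derivative_componentwise_within[THEN iffD2], rule ballI)
  fix i :: 'a assume "i \<in> Basis"
  define c where "c k = (-1) ^ k / fact k * (((L ^^ k) v) \<bullet> i)" for k
  have comp: "(\<Sum>k. ((- t) ^ k / fact k) *\<^sub>R ((L ^^ k) v)) \<bullet> i = (\<Sum>k. ((- t) ^ k / fact k) * (((L ^^ k) v) \<bullet> i))" for t v
    using bounded_linear.suminf[OF bounded_linear_inner_left[of i] exp_series_summable[of t v]] by simp
  have sc: "summable (\<lambda>k. c k * t ^ k)" for t
    using bounded_linear.summable[OF bounded_linear_inner_left[of i] exp_series_summable[of t v]]
    by (simp add: c_def power_minus[of t] mult_ac)
  have f: "(\<Sum>k. ((- t) ^ k / fact k) *\<^sub>R ((L ^^ k) v)) \<bullet> i = (\<Sum>k. c k * t ^ k)" for t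
    unfolding comp c_def by (simp add: power_minus[of t] mult_ac)
  have "diffs c k * t ^ k = - (((- t) ^ k / fact k) * (((L ^^ k) (L v)) \<bullet> i))" for k
    unfolding diffs_def c_def by (simp add: power_minus[of t] funpow_swap1 field_simps del: of_nat_Suc)
  then have "(\<Sum>k. diffs c k * t ^ k) = - ((\<Sum>k. ((- t) ^ k / fact k) *\<^sub>R ((L ^^ k) (L v))) \<bullet> i)"
    unfolding comp
    using suminf_minus[OF bounded_linear.summable[OF bounded_linear_inner_left[of i] exp_series_summable[of t "L v"]]] by simp
  then have "((\<lambda>t. \<Sum>k. c k * t ^ k) has_field_derivative (- (\<Sum>k. ((- t) ^ k / fact k) *\<^sub>R ((L ^^ k) (L v)))) \<bullet> i) (at t)"
    using termdiffs_strong_converges_everywhere[OF sc, of t] by simp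
  moreover have "(\<lambda>x. x *\<^sub>R (- (\<Sum>k. ((- t) ^ k / fact k) *\<^sub>R ((L ^^ k) (L v)))) \<bullet> i)
      = (*) ((- (\<Sum>k. ((- t) ^ k / fact k) *\<^sub>R ((L ^^ k) (L v)))) \<bullet> i)"
    by (rule ext) (simp only: inner_scaleR_left mult.commute)
  ultimately show "((\<lambda>x. (\<Sum>k. ((- x) ^ k / fact k) *\<^sub>R ((L ^^ k) v)) \<bullet> i) has_derivative
         (\<lambda>x. x *\<^sub>R (- (\<Sum>k. ((- t) ^ k / fact k) *\<^sub>R ((L ^^ k) (L v)))) \<bullet> i)) (at t)"
    unfolding f has_field_derivative_def by (simp only:)
qed

end

lemma W_symbol_linear: "linear (W_symbol \<mu> \<nu> \<kappa> \<alpha> t \<xi>)"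
  using exp_series_linear[OF A_symbol_bounded_linear] by (simp add: W_symbol_def[abs_def])

lemma W_symbol_has_vector_derivative:
  "((\<lambda>t. W_symbol \<mu> \<nu> \<kappa> \<alpha> t \<xi> v) has_vector_derivative - W_symbol \<mu> \<nu> \<kappa> \<alpha> t \<xi> (A_symbol \<mu> \<nu> \<kappa> \<alpha> \<xi> v)) (at t)"
  using exp_series_has_vector_derivative[OF A_symbol_bounded_linear] by (simp add: W_symbol_def)

lemma A_symbol_continuous:
  "continuous_on UNIV (\<lambda>q::(real^'n::finite) \<times> (complex \<times> (complex^'n)). A_symbol \<mu> \<nu> \<kappa> \<alpha> (fst q) (snd q))"
  unfolding A_symbol_def split_beta cdot_def
  by (intro continuous_intros continuous_on_vec_lambda continuous_on_component)

text \<open>Joint measurability in time, frequency and vector is what the Duhamel integral requires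
  as a function of \<xi>. Every term of the exponential series is jointly continuous.\<close>

lemma W_symbol_measurable:
  "(\<lambda>q::real \<times> (real^'n::finite) \<times> (complex \<times> (complex^'n)). W_symbol \<mu> \<nu> \<kappa> \<alpha> (fst q) (fst (snd q)) (snd (snd q))) \<in> borel_measurable borel"
  unfolding W_symbol_def
proof (rule borel_measurable_suminf)
  fix k
  have "continuous_on UNIV (\<lambda>q::(real^'n) \<times> (complex \<times> (complex^'n)). (A_symbol \<mu> \<nu> \<kappa> \<alpha> (fst q) ^^ k) (snd q))"
  proof (induction k)
    case (Suc k)
    have "continuous_on UNIV (\<lambda>q::(real^'n) \<times> (complex \<times> (complex^'n)). (fst q, (A_symbol \<mu> \<nu> \<kappa> \<alpha> (fst q) ^^ k) (snd q)))"
      by (intro continuous_intros Suc)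
    from continuous_on_compose2[OF A_symbol_continuous this] show ?case by simp
  qed (simp add: continuous_intros)
  from continuous_on_compose2[OF this, of UNIV snd]
  have "continuous_on UNIV (\<lambda>q::real \<times> (real^'n) \<times> (complex \<times> (complex^'n)). (A_symbol \<mu> \<nu> \<kappa> \<alpha> (fst (snd q)) ^^ k) (snd (snd q)))"
    by (simp add: continuous_intros)
  then have "continuous_on UNIV (\<lambda>q::real \<times> (real^'n) \<times> (complex \<times> (complex^'n)). ((- fst q) ^ k / fact k) *\<^sub>R (A_symbol \<mu> \<nu> \<kappa> \<alpha> (fst (snd q)) ^^ k) (snd (snd q)))"
    by (intro continuous_intros) auto
  then show "(\<lambda>q::real \<times> (real^'n) \<times> (complex \<times> (complex^'n)). ((- fst q) ^ k / fact k) *\<^sub>R (A_symbol \<mu> \<nu> \<kappa> \<alpha> (fst (snd q)) ^^ k) (snd (snd q))) \<in> borel_measurable borel"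
    by (rule borel_measurable_continuous_onI)
qed

section \<open>The nonlinear terms\<close>

text \<open>The bilinear form whose diagonal is the pair \<open>(f, g)\<close> of nonlinear terms.\<close>

definition nonlin :: "real \<Rightarrow> real \<Rightarrow> real \<Rightarrow> (real^'n::finite \<Rightarrow> complex \<times> (complex^'n))
    \<Rightarrow> (real^'n \<Rightarrow> complex \<times> (complex^'n)) \<Rightarrow> real^'n \<Rightarrow> complex \<times> (complex^'n)" where
  "nonlin \<mu> \<nu> \<kappa> v w \<xi> = (f_hat (\<lambda>\<zeta>. snd (v \<zeta>)) (\<lambda>\<zeta>. fst (w \<zeta>)) \<xi>, \<chi> j.
     - (\<Sum>i\<in>UNIV. hprod (\<lambda>\<zeta>. snd (v \<zeta>) $ i) (dsym i (\<lambda>\<zeta>. snd (w \<zeta>) $ j)) \<xi>)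
     + complex_of_real \<mu> * (\<Sum>i\<in>UNIV. hprod (dsym i (\<lambda>\<zeta>. fst (v \<zeta>))) (dsym i (\<lambda>\<zeta>. snd (w \<zeta>) $ j)) \<xi>)
     + complex_of_real (\<mu> + \<nu>) * (\<Sum>i\<in>UNIV. hprod (dsym i (\<lambda>\<zeta>. fst (v \<zeta>))) (dsym j (\<lambda>\<zeta>. snd (w \<zeta>) $ i)) \<xi>)
     + complex_of_real (\<kappa> / 2) * dsym j (\<lambda>\<zeta>. \<Sum>i\<in>UNIV. hprod (dsym i (\<lambda>\<zeta>. fst (v \<zeta>))) (dsym i (\<lambda>\<zeta>. fst (w \<zeta>))) \<zeta>) \<xi>)"

lemma nonlin_diagonal:
  "nonlin \<mu> \<nu> \<kappa> v v \<xi> = (f_hat (\<lambda>\<zeta>. snd (v \<zeta>)) (\<lambda>\<zeta>. fst (v \<zeta>)) \<xi>, g_hat \<mu> \<nu> \<kappa> (\<lambda>\<zeta>. snd (v \<zeta>)) (\<lambda>\<zeta>. fst (v \<zeta>)) \<xi>)"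
  by (simp add: nonlin_def g_hat_def)

text \<open>The profile of a function of frequency at one instant; \<tau> here stands for the whole
  analyticity rate, which at time t will be \<open>\<tau> * sqrt t\<close>. Measurability and the
  sign of M are included so that bounds can be chained without side conditions.\<close>

definition freq_bound :: "real \<Rightarrow> real \<Rightarrow> real \<Rightarrow> (real^'n::finite \<Rightarrow> complex \<times> (complex^'n)) \<Rightarrow> bool" where
  "freq_bound \<tau> s M v \<longleftrightarrow> 0 \<le> M \<and> v \<in> borel_measurable borel \<and>
     (AE \<xi> in lborel. aug_norm \<xi> (v \<xi>) \<le> M * (norm \<xi> powr (-s) * exp (- \<tau> * norm \<xi>)))"

lemma AE_lborel_nonzero: "AE \<xi> in lborel. \<xi> \<noteq> (0::'a::euclidean_space)"
  by (rule AE_lborel_singleton)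

lemma borel_measurable_vec_lambda:
  fixes f :: "'n::finite \<Rightarrow> 'a \<Rightarrow> complex"
  assumes "\<And>j. f j \<in> borel_measurable M"
  shows "(\<lambda>x. \<chi> j. f j x) \<in> borel_measurable M"
proof (rule borel_measurable_euclidean_space[THEN iffD2], rule ballI)
  fix b :: "complex^'n" assume "b \<in> Basis"
  then obtain i c where b: "b = axis i c" by (auto simp: Basis_vec_def)
  have "(\<lambda>x. f i x \<bullet> c) \<in> borel_measurable M" using assms[of i] by measurable
  then show "(\<lambda>x. (\<chi> j. f j x) \<bullet> b) \<in> borel_measurable M" by (simp add: b inner_axis)
qed

lemma vec_nth_measurable:
  fixes f :: "'a \<Rightarrow> complex^'n::finite"
  assumes "f \<in> borel_measurable M"
  shows "(\<lambda>x. f x $ i) \<in> borel_measurable M"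
  by (rule borel_measurable_continuous_on[OF _ assms]) (intro continuous_intros continuous_on_component)

lemma dsym_measurable:
  fixes h :: "real^'n::finite \<Rightarrow> complex"
  assumes "h \<in> borel_measurable borel"
  shows "dsym i h \<in> borel_measurable borel"
proof -
  have "(\<lambda>\<xi>::real^'n. \<i> * complex_of_real (\<xi> $ i)) \<in> borel_measurable borel"
    by (rule borel_measurable_continuous_onI) (intro continuous_intros continuous_on_component)
  then show ?thesis unfolding dsym_def by (rule borel_measurable_times) (rule assms)
qed

lemma hprod_measurable:
  assumes [measurable]: "h \<in> borel_measurable borel" "k \<in> borel_measurable borel"
  shows "hprod h k \<in> borel_measurable borel"
proof -
  have "(\<lambda>\<xi>. LINT \<eta>|lborel. h (\<xi> - \<eta>) * k \<eta>) \<in> borel_measurable lborel"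
    by (rule lborel.borel_measurable_lebesgue_integral) measurable
  then show ?thesis unfolding hprod_def by simp
qed

lemma pair_components_measurable:
  assumes "v \<in> borel_measurable borel"
  shows "(\<lambda>\<zeta>. fst (v \<zeta>)) \<in> borel_measurable borel" "(\<lambda>\<zeta>. snd (v \<zeta>)) \<in> borel_measurable borel"
    "(\<lambda>\<zeta>. snd (v \<zeta> :: 'a::second_countable_topology \<times> (complex^'n::finite)) $ i) \<in> borel_measurable borel"
proof -
  show 1: "(\<lambda>\<zeta>. fst (v \<zeta>)) \<in> borel_measurable borel" "(\<lambda>\<zeta>. snd (v \<zeta>)) \<in> borel_measurable borel"
    by (rule borel_measurable_continuous_on[OF _ assms], intro continuous_intros)+
  show "(\<lambda>\<zeta>. snd (v \<zeta>) $ i) \<in> borel_measurable borel" by (rule vec_nth_measurable[OF 1(2)])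
qed

lemma nonlin_measurable:
  assumes v: "v \<in> borel_measurable borel" and w: "w \<in> borel_measurable borel"
  shows "nonlin \<mu> \<nu> \<kappa> v w \<in> borel_measurable borel"
  unfolding nonlin_def[abs_def] f_hat_def
  by (intro borel_measurable_Pair borel_measurable_vec_lambda borel_measurable_add borel_measurable_times
      borel_measurable_const borel_measurable_uminus borel_measurable_sum hprod_measurable
      dsym_measurable[unfolded eta_contract_eq] pair_components_measurable v w dsym_measurable)

text \<open>The gradient of the first component has two bounds: the power s comes from the entry
  |\<xi>| a of the augmented vector, the power s - 1 from a itself. Which one is used decides
  whether a product has room for one more derivative.\<close>

lemma freq_bound_components:
  assumes "freq_bound \<tau> s M v"
  shows "AE \<xi> in lborel. norm (snd (v \<xi>) $ i) \<le> M * (norm \<xi> powr (-s) * exp (- \<tau> * norm \<xi>))"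
    and "AE \<xi> in lborel. norm (dsym i (\<lambda>\<zeta>. fst (v \<zeta>)) \<xi>) \<le> M * (norm \<xi> powr (-s) * exp (- \<tau> * norm \<xi>))"
    and "AE \<xi> in lborel. norm (dsym i (\<lambda>\<zeta>. fst (v \<zeta>)) \<xi>) \<le> M * (norm \<xi> powr (-(s-1)) * exp (- \<tau> * norm \<xi>))"
    and "AE \<xi> in lborel. norm (dsym i (\<lambda>\<zeta>. snd (v \<zeta>) $ j) \<xi>) \<le> M * (norm \<xi> powr (-(s-1)) * exp (- \<tau> * norm \<xi>))"
proof -
  have b: "AE \<xi> in lborel. \<xi> \<noteq> 0 \<and> aug_norm \<xi> (v \<xi>) \<le> M * (norm \<xi> powr (-s) * exp (- \<tau> * norm \<xi>))"
    using assms AE_lborel_nonzero unfolding freq_bound_def by (auto elim: AE_mp intro!: AE_I2)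
  have p: "norm \<xi> powr (-(s-1)) = norm \<xi> * norm \<xi> powr (-s)" if "\<xi> \<noteq> 0" for \<xi> :: "real^'n"
    using that powr_add[of "norm \<xi>" 1 "-s"] by (simp add: powr_one)
  have ds: "norm (dsym i h \<xi>) \<le> norm \<xi> * norm (h \<xi>)" for h i and \<xi> :: "real^'n"
    using component_le_norm_cart[of \<xi> i] by (simp add: dsym_def norm_mult mult_right_mono)
  have sn: "norm (snd (v \<xi>) $ i) \<le> aug_norm \<xi> (v \<xi>)" for \<xi> i
    using Finite_Cartesian_Product.norm_nth_le[of "snd (v \<xi>)" i] aug_norm_ge(3)[where v="v \<xi>" and \<xi>=\<xi>] by linarith
  show "AE \<xi> in lborel. norm (snd (v \<xi>) $ i) \<le> M * (norm \<xi> powr (-s) * exp (- \<tau> * norm \<xi>))"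
    using b by eventually_elim (use sn order_trans in blast)
  show "AE \<xi> in lborel. norm (dsym i (\<lambda>\<zeta>. fst (v \<zeta>)) \<xi>) \<le> M * (norm \<xi> powr (-s) * exp (- \<tau> * norm \<xi>))"
    using b
  proof eventually_elim
    case (elim \<xi>)
    then show ?case using ds[of i "\<lambda>\<zeta>. fst (v \<zeta>)" \<xi>] aug_norm_ge(2)[where v="v \<xi>" and \<xi>=\<xi>] by linarith
  qed
  have *: "norm (dsym i h \<xi>) \<le> M * (norm \<xi> powr (-(s-1)) * exp (- \<tau> * norm \<xi>))"
    if "\<xi> \<noteq> 0" "norm (h \<xi>) \<le> aug_norm \<xi> (v \<xi>)" "aug_norm \<xi> (v \<xi>) \<le> M * (norm \<xi> powr (-s) * exp (- \<tau> * norm \<xi>))"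
    for h \<xi>
  proof -
    have "norm (dsym i h \<xi>) \<le> norm \<xi> * norm (h \<xi>)" by (rule ds)
    also have "\<dots> \<le> norm \<xi> * (M * (norm \<xi> powr (-s) * exp (- \<tau> * norm \<xi>)))"
      using that by (intro mult_left_mono) auto
    also have "\<dots> = M * (norm \<xi> powr (-(s-1)) * exp (- \<tau> * norm \<xi>))" unfolding p[OF that(1)] by (simp add: mult_ac)
    finally show ?thesis .
  qed
  show "AE \<xi> in lborel. norm (dsym i (\<lambda>\<zeta>. fst (v \<zeta>)) \<xi>) \<le> M * (norm \<xi> powr (-(s-1)) * exp (- \<tau> * norm \<xi>))"
    using b by eventually_elim (rule *, blast, rule aug_norm_ge(1), blast)
  show "AE \<xi> in lborel. norm (dsym i (\<lambda>\<zeta>. snd (v \<zeta>) $ j) \<xi>) \<le> M * (norm \<xi> powr (-(s-1)) * exp (- \<tau> * norm \<xi>))"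
    using b by eventually_elim (rule *, blast, rule sn, blast)
qed

lemma freq_bound_measurable: "freq_bound \<tau> s M v \<Longrightarrow> v \<in> borel_measurable borel"
  by (simp add: freq_bound_def)

lemma freq_bound_component_measurable:
  assumes "freq_bound \<tau> s M v"
  shows "(\<lambda>\<zeta>. snd (v \<zeta>) $ i) \<in> borel_measurable borel" "dsym i (\<lambda>\<zeta>. fst (v \<zeta>)) \<in> borel_measurable borel"
    "dsym i (\<lambda>\<zeta>. snd (v \<zeta>) $ j) \<in> borel_measurable borel"
  using freq_bound_measurable[OF assms] by (auto intro!: dsym_measurable pair_components_measurable)

text \<open>Pairing a factor of power s with one of power s - 1 suffices for f and for the three
  products in g that contain u. For |\<xi>| f and the gradient of grad a . grad a both factors are
  taken with power s, and the outer factor |\<xi>| raises the exponent to the same value.\<close>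

lemma nonlin_bound:
  fixes s :: real
  assumes s: "1 \<le> s" "s < real CARD('n::finite)" "2 * s - 1 > real CARD('n)"
  shows "\<exists>C\<ge>0. \<forall>(v::real^'n \<Rightarrow> complex \<times> (complex^'n)) w M1 M2 \<tau>. 0 \<le> \<tau> \<longrightarrow> freq_bound \<tau> s M1 v \<longrightarrow> freq_bound \<tau> s M2 w \<longrightarrow>
     (\<forall>\<xi>. \<xi> \<noteq> 0 \<longrightarrow> aug_norm \<xi> (nonlin \<mu> \<nu> \<kappa> v w \<xi>) \<le> C * (M1 * M2) * (norm \<xi> powr (real CARD('n) + 1 - 2 * s) * exp (- \<tau> * norm \<xi>)))"
proof -
  define d where "d = real CARD('n)"
  have d: "d \<ge> 0" by (simp add: d_def)
  have s0: "0 \<le> s" "0 \<le> s - 1" "s - 1 < real CARD('n)" "s + s > real CARD('n)" "s + (s - 1) > real CARD('n)" using s by auto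
  obtain C1 where C1: "C1 \<ge> 0" and H1: "\<And>(h::real^'n \<Rightarrow> complex) k A B \<tau> \<xi>.
     h \<in> borel_measurable borel \<Longrightarrow> k \<in> borel_measurable borel \<Longrightarrow> 0 \<le> \<tau> \<Longrightarrow>
     (AE \<xi> in lborel. norm (h \<xi>) \<le> A * (norm \<xi> powr (-s) * exp (- \<tau> * norm \<xi>))) \<Longrightarrow>
     (AE \<xi> in lborel. norm (k \<xi>) \<le> B * (norm \<xi> powr (-(s-1)) * exp (- \<tau> * norm \<xi>))) \<Longrightarrow> \<xi> \<noteq> 0 \<Longrightarrow>
     norm (hprod h k \<xi>) \<le> C1 * (A * B) * (norm \<xi> powr (real CARD('n) - s - (s-1)) * exp (- \<tau> * norm \<xi>))"
    using hprod_bound[OF s0(1) s(2) s0(2,3,5)] by blast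
  obtain C2 where C2: "C2 \<ge> 0" and H2: "\<And>(h::real^'n \<Rightarrow> complex) k A B \<tau> \<xi>.
     h \<in> borel_measurable borel \<Longrightarrow> k \<in> borel_measurable borel \<Longrightarrow> 0 \<le> \<tau> \<Longrightarrow>
     (AE \<xi> in lborel. norm (h \<xi>) \<le> A * (norm \<xi> powr (-s) * exp (- \<tau> * norm \<xi>))) \<Longrightarrow>
     (AE \<xi> in lborel. norm (k \<xi>) \<le> B * (norm \<xi> powr (-s) * exp (- \<tau> * norm \<xi>))) \<Longrightarrow> \<xi> \<noteq> 0 \<Longrightarrow>
     norm (hprod h k \<xi>) \<le> C2 * (A * B) * (norm \<xi> powr (real CARD('n) - s - s) * exp (- \<tau> * norm \<xi>))"
    using hprod_bound[OF s0(1) s(2) s0(1) s(2) s0(4)] by blast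
  define K where "K = d * C1 + d * C2 + d * (d * C1 + \<bar>\<mu>\<bar> * (d * C1) + \<bar>\<mu> + \<nu>\<bar> * (d * C1) + \<bar>\<kappa> / 2\<bar> * (d * C2))"
  have "aug_norm \<xi> (nonlin \<mu> \<nu> \<kappa> v w \<xi>) \<le> K * (M1 * M2) * (norm \<xi> powr (real CARD('n) + 1 - 2 * s) * exp (- \<tau> * norm \<xi>))"
    if \<tau>: "0 \<le> \<tau>" and v: "freq_bound \<tau> s M1 v" and w: "freq_bound \<tau> s M2 w" and x: "\<xi> \<noteq> 0"
    for v w :: "real^'n \<Rightarrow> complex \<times> (complex^'n)" and M1 M2 \<tau> and \<xi> :: "real^'n"
  proof -
    note vm = freq_bound_component_measurable[OF v] and wm = freq_bound_component_measurable[OF w]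
    note vb = freq_bound_components[OF v] and wb = freq_bound_components[OF w]
    define X where "X = M1 * M2 * (norm \<xi> powr (real CARD('n) + 1 - 2 * s) * exp (- \<tau> * norm \<xi>))"
    have X: "X \<ge> 0" using v w by (auto simp: X_def freq_bound_def)
    have e1: "real CARD('n) - s - (s-1) = real CARD('n) + 1 - 2 * s" by simp
    have h1: "norm (hprod h k \<xi>) \<le> C1 * X"
      if "h \<in> borel_measurable borel" "k \<in> borel_measurable borel" 
        "AE \<xi> in lborel. norm (h \<xi>) \<le> M1 * (norm \<xi> powr (-s) * exp (- \<tau> * norm \<xi>))"
        "AE \<xi> in lborel. norm (k \<xi>) \<le> M2 * (norm \<xi> powr (-(s-1)) * exp (- \<tau> * norm \<xi>))" for h k :: "real^'n \<Rightarrow> complex"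
      using H1[OF that(1,2) \<tau> that(3,4) x] unfolding X_def e1 by (simp add: mult_ac)
    have h2: "norm \<xi> * norm (hprod h k \<xi>) \<le> C2 * X"
      if "h \<in> borel_measurable borel" "k \<in> borel_measurable borel" 
        "AE \<xi> in lborel. norm (h \<xi>) \<le> M1 * (norm \<xi> powr (-s) * exp (- \<tau> * norm \<xi>))"
        "AE \<xi> in lborel. norm (k \<xi>) \<le> M2 * (norm \<xi> powr (-s) * exp (- \<tau> * norm \<xi>))" for h k :: "real^'n \<Rightarrow> complex"
    proof -
      have "norm \<xi> * norm \<xi> powr (real CARD('n) - s - s) = norm \<xi> powr (1 + (real CARD('n) - s - s))"
        using x by (subst powr_add) (simp add: powr_one)
      also have "1 + (real CARD('n) - s - s) = real CARD('n) + 1 - 2 * s" by simp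
      finally have e2: "norm \<xi> * norm \<xi> powr (real CARD('n) - s - s) = norm \<xi> powr (real CARD('n) + 1 - 2 * s)" .
      have "norm \<xi> * norm (hprod h k \<xi>) \<le> norm \<xi> * (C2 * (M1 * M2) * (norm \<xi> powr (real CARD('n) - s - s) * exp (- \<tau> * norm \<xi>)))"
        by (rule mult_left_mono[OF H2[OF that(1,2) \<tau> that(3,4) x]]) simp
      also have "\<dots> = C2 * (M1 * M2) * ((norm \<xi> * norm \<xi> powr (real CARD('n) - s - s)) * exp (- \<tau> * norm \<xi>))" by (simp add: mult_ac)
      finally show ?thesis unfolding e2 by (simp add: X_def mult_ac)
    qed
    have sumb: "norm (\<Sum>i\<in>UNIV. t i) \<le> d * c" if "\<And>i. norm (t i) \<le> c" for t :: "'n \<Rightarrow> complex" and c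
      using order_trans[OF norm_sum sum_mono[of UNIV "\<lambda>i. norm (t i)" "\<lambda>_. c"]] that by (simp add: d_def)
    have f1: "norm (fst (nonlin \<mu> \<nu> \<kappa> v w \<xi>)) \<le> d * C1 * X"
      unfolding nonlin_def f_hat_def fst_conv norm_minus_cancel mult.assoc
      by (intro sumb h1 vm wm vb wb)
    have f2: "norm \<xi> * norm (fst (nonlin \<mu> \<nu> \<kappa> v w \<xi>)) \<le> d * C2 * X"
    proof -
      have "norm (\<Sum>i\<in>UNIV. complex_of_real (norm \<xi>) * hprod (\<lambda>\<zeta>. snd (v \<zeta>) $ i) (dsym i (\<lambda>\<zeta>. fst (w \<zeta>))) \<xi>) \<le> d * (C2 * X)"
        by (rule sumb) (simp only: norm_mult norm_of_real abs_norm_cancel, intro h2 vm wm vb wb)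
      then show ?thesis
        unfolding nonlin_def f_hat_def fst_conv norm_minus_cancel sum_distrib_left[symmetric] norm_mult by simp
    qed
    have g: "norm (snd (nonlin \<mu> \<nu> \<kappa> v w \<xi>)) \<le> d * ((d * C1 + \<bar>\<mu>\<bar> * (d * C1) + \<bar>\<mu> + \<nu>\<bar> * (d * C1) + \<bar>\<kappa> / 2\<bar> * (d * C2)) * X)"
      unfolding d_def
    proof (rule norm_le_sum_coords, fold d_def)
      fix j
      let ?t1 = "\<Sum>i\<in>UNIV. hprod (\<lambda>\<zeta>. snd (v \<zeta>) $ i) (dsym i (\<lambda>\<zeta>. snd (w \<zeta>) $ j)) \<xi>"
      let ?t2 = "\<Sum>i\<in>UNIV. hprod (dsym i (\<lambda>\<zeta>. fst (v \<zeta>))) (dsym i (\<lambda>\<zeta>. snd (w \<zeta>) $ j)) \<xi>"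
      let ?t3 = "\<Sum>i\<in>UNIV. hprod (dsym i (\<lambda>\<zeta>. fst (v \<zeta>))) (dsym j (\<lambda>\<zeta>. snd (w \<zeta>) $ i)) \<xi>"
      let ?t4 = "dsym j (\<lambda>\<zeta>. \<Sum>i\<in>UNIV. hprod (dsym i (\<lambda>\<zeta>. fst (v \<zeta>))) (dsym i (\<lambda>\<zeta>. fst (w \<zeta>))) \<zeta>) \<xi>"
      have t1: "norm ?t1 \<le> d * (C1 * X)" by (intro sumb h1 vm wm vb wb)
      have t2: "norm ?t2 \<le> d * (C1 * X)" by (intro sumb h1 vm wm vb wb)
      have t3: "norm ?t3 \<le> d * (C1 * X)" by (intro sumb h1 vm wm vb wb)
      have "norm ?t4 \<le> norm \<xi> * norm (\<Sum>i\<in>UNIV. hprod (dsym i (\<lambda>\<zeta>. fst (v \<zeta>))) (dsym i (\<lambda>\<zeta>. fst (w \<zeta>))) \<xi>)"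
        using component_le_norm_cart[of \<xi> j] by (simp add: dsym_def norm_mult mult_right_mono)
      also have "\<dots> = norm (\<Sum>i\<in>UNIV. complex_of_real (norm \<xi>) * hprod (dsym i (\<lambda>\<zeta>. fst (v \<zeta>))) (dsym i (\<lambda>\<zeta>. fst (w \<zeta>))) \<xi>)"
        unfolding sum_distrib_left[symmetric] norm_mult by simp
      also have "\<dots> \<le> d * (C2 * X)"
        by (rule sumb) (simp only: norm_mult norm_of_real abs_norm_cancel, intro h2 vm wm vb wb)
      finally have t4: "norm ?t4 \<le> d * (C2 * X)" .
      have m: "norm (complex_of_real c * t) \<le> \<bar>c\<bar> * b" if "norm t \<le> b" for c t b
        using that by (simp add: norm_mult mult_left_mono)
      have "norm (snd (nonlin \<mu> \<nu> \<kappa> v w \<xi>) $ j) \<le> d * (C1 * X) + \<bar>\<mu>\<bar> * (d * (C1 * X)) + \<bar>\<mu> + \<nu>\<bar> * (d * (C1 * X)) + \<bar>\<kappa> / 2\<bar> * (d * (C2 * X))"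
        unfolding nonlin_def snd_conv vec_lambda_beta
        by (intro order_trans[OF norm_triangle_ineq] add_mono m t2 t3 t4) (use t1 in simp)
      then show "norm (snd (nonlin \<mu> \<nu> \<kappa> v w \<xi>) $ j) \<le> (d * C1 + \<bar>\<mu>\<bar> * (d * C1) + \<bar>\<mu> + \<nu>\<bar> * (d * C1) + \<bar>\<kappa> / 2\<bar> * (d * C2)) * X"
        by (simp add: algebra_simps)
    qed
    have "aug_norm \<xi> (nonlin \<mu> \<nu> \<kappa> v w \<xi>) \<le> d * C1 * X + d * C2 * X + d * ((d * C1 + \<bar>\<mu>\<bar> * (d * C1) + \<bar>\<mu> + \<nu>\<bar> * (d * C1) + \<bar>\<kappa> / 2\<bar> * (d * C2)) * X)"
      using aug_norm_le[of \<xi> "nonlin \<mu> \<nu> \<kappa> v w \<xi>"] f1 f2 g by linarith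
    also have "\<dots> = K * X" by (simp add: K_def algebra_simps)
    finally show ?thesis by (simp add: X_def mult_ac)
  qed
  moreover have "K \<ge> 0" using d C1 C2 by (simp add: K_def)
  ultimately show ?thesis by blast
qed

lemma dsym_diff: "dsym i (\<lambda>\<zeta>. h \<zeta> - k \<zeta>) = (\<lambda>\<zeta>. dsym i h \<zeta> - dsym i k \<zeta>)"
  by (simp add: dsym_def right_diff_distrib)

lemma dsym_sum: "dsym j (\<lambda>\<zeta>. \<Sum>i\<in>I. H i \<zeta>) \<xi> = \<i> * complex_of_real (\<xi> $ j) * (\<Sum>i\<in>I. H i \<xi>)"
  by (simp add: dsym_def)

lemma hprod_diff_left:
  assumes "integrable lborel (\<lambda>\<eta>. h (\<xi> - \<eta>) * k \<eta>)" "integrable lborel (\<lambda>\<eta>. h' (\<xi> - \<eta>) * k \<eta>)"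
  shows "hprod (\<lambda>\<zeta>. h \<zeta> - h' \<zeta>) k \<xi> = hprod h k \<xi> - hprod h' k \<xi>"
  unfolding hprod_def using assms by (simp add: left_diff_distrib right_diff_distrib diff_divide_distrib)

lemma hprod_diff_right:
  assumes "integrable lborel (\<lambda>\<eta>. h (\<xi> - \<eta>) * k \<eta>)" "integrable lborel (\<lambda>\<eta>. h (\<xi> - \<eta>) * k' \<eta>)"
  shows "hprod h (\<lambda>\<zeta>. k \<zeta> - k' \<zeta>) \<xi> = hprod h k \<xi> - hprod h k' \<xi>"
  unfolding hprod_def using assms by (simp add: left_diff_distrib right_diff_distrib diff_divide_distrib)

text \<open>Bilinearity is not automatic, as a non-integrable integrand has Bochner integral 0 by
  convention. The frequency bounds make every convolution absolutely convergent at nonzero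
  \<xi>.\<close>

lemma nonlin_diff:
  fixes s :: real and v w :: "real^'n::finite \<Rightarrow> complex \<times> (complex^'n)"
  assumes s: "1 \<le> s" "s < real CARD('n)" "2 * s - 1 > real CARD('n)"
    and \<tau>: "0 \<le> \<tau>" and v: "freq_bound \<tau> s M1 v" and v': "freq_bound \<tau> s M2 v'" and w: "freq_bound \<tau> s M3 w" and x: "\<xi> \<noteq> 0"
  shows "nonlin \<mu> \<nu> \<kappa> (\<lambda>\<zeta>. v \<zeta> - v' \<zeta>) w \<xi> = nonlin \<mu> \<nu> \<kappa> v w \<xi> - nonlin \<mu> \<nu> \<kappa> v' w \<xi>"
    and "nonlin \<mu> \<nu> \<kappa> w (\<lambda>\<zeta>. v \<zeta> - v' \<zeta>) \<xi> = nonlin \<mu> \<nu> \<kappa> w v \<xi> - nonlin \<mu> \<nu> \<kappa> w v' \<xi>"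
proof -
  have s0: "0 \<le> s" "0 \<le> s - 1" "s - 1 < real CARD('n)" "s + (s - 1) > real CARD('n)" using s by auto
  have I: "integrable lborel (\<lambda>\<eta>. h (\<xi> - \<eta>) * k \<eta>)"
    if "h \<in> borel_measurable borel" "k \<in> borel_measurable borel" 
      "AE \<xi> in lborel. norm (h \<xi>) \<le> A * (norm \<xi> powr (-s) * exp (- \<tau> * norm \<xi>))"
      "AE \<xi> in lborel. norm (k \<xi>) \<le> B * (norm \<xi> powr (-(s-1)) * exp (- \<tau> * norm \<xi>))" for h k :: "real^'n \<Rightarrow> complex" and A B
    using hprod_bound[OF s0(1) s(2) s0(2,3,4)] that \<tau> x by blast
  note vm = freq_bound_component_measurable[OF v] and vb = freq_bound_components[OF v]
  note vm' = freq_bound_component_measurable[OF v'] and vb' = freq_bound_components[OF v']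
  note wm = freq_bound_component_measurable[OF w] and wb = freq_bound_components[OF w]
  have L1: "hprod (\<lambda>\<zeta>. snd (v \<zeta>) $ i - snd (v' \<zeta>) $ i) (dsym j (\<lambda>\<zeta>. fst (w \<zeta>))) \<xi> = hprod (\<lambda>\<zeta>. snd (v \<zeta>) $ i) (dsym j (\<lambda>\<zeta>. fst (w \<zeta>))) \<xi> - hprod (\<lambda>\<zeta>. snd (v' \<zeta>) $ i) (dsym j (\<lambda>\<zeta>. fst (w \<zeta>))) \<xi>" for i j
    by (rule hprod_diff_left; rule I; rule vm vm' wm vb vb' wb)
  have L2: "hprod (\<lambda>\<zeta>. snd (v \<zeta>) $ i - snd (v' \<zeta>) $ i) (dsym j (\<lambda>\<zeta>. snd (w \<zeta>) $ k)) \<xi> = hprod (\<lambda>\<zeta>. snd (v \<zeta>) $ i) (dsym j (\<lambda>\<zeta>. snd (w \<zeta>) $ k)) \<xi> - hprod (\<lambda>\<zeta>. snd (v' \<zeta>) $ i) (dsym j (\<lambda>\<zeta>. snd (w \<zeta>) $ k)) \<xi>" for i j k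
    by (rule hprod_diff_left; rule I; rule vm vm' wm vb vb' wb)
  have L3: "hprod (\<lambda>\<zeta>. dsym i (\<lambda>\<zeta>. fst (v \<zeta>)) \<zeta> - dsym i (\<lambda>\<zeta>. fst (v' \<zeta>)) \<zeta>) (dsym j (\<lambda>\<zeta>. fst (w \<zeta>))) \<xi> = hprod (dsym i (\<lambda>\<zeta>. fst (v \<zeta>))) (dsym j (\<lambda>\<zeta>. fst (w \<zeta>))) \<xi> - hprod (dsym i (\<lambda>\<zeta>. fst (v' \<zeta>))) (dsym j (\<lambda>\<zeta>. fst (w \<zeta>))) \<xi>" for i j
    by (rule hprod_diff_left; rule I; rule vm vm' wm vb vb' wb)
  have L4: "hprod (\<lambda>\<zeta>. dsym i (\<lambda>\<zeta>. fst (v \<zeta>)) \<zeta> - dsym i (\<lambda>\<zeta>. fst (v' \<zeta>)) \<zeta>) (dsym j (\<lambda>\<zeta>. snd (w \<zeta>) $ k)) \<xi> = hprod (dsym i (\<lambda>\<zeta>. fst (v \<zeta>))) (dsym j (\<lambda>\<zeta>. snd (w \<zeta>) $ k)) \<xi> - hprod (dsym i (\<lambda>\<zeta>. fst (v' \<zeta>))) (dsym j (\<lambda>\<zeta>. snd (w \<zeta>) $ k)) \<xi>" for i j k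
    by (rule hprod_diff_left; rule I; rule vm vm' wm vb vb' wb)
  show "nonlin \<mu> \<nu> \<kappa> (\<lambda>\<zeta>. v \<zeta> - v' \<zeta>) w \<xi> = nonlin \<mu> \<nu> \<kappa> v w \<xi> - nonlin \<mu> \<nu> \<kappa> v' w \<xi>"
    unfolding nonlin_def f_hat_def fst_diff snd_diff vector_minus_component dsym_diff
    by (simp only: L1 L2 L3 L4 dsym_sum) (simp add: vec_eq_iff sum_subtractf algebra_simps)
  have R1: "hprod (\<lambda>\<zeta>. snd (w \<zeta>) $ i) (\<lambda>\<zeta>. dsym j (\<lambda>\<zeta>. fst (v \<zeta>)) \<zeta> - dsym j (\<lambda>\<zeta>. fst (v' \<zeta>)) \<zeta>) \<xi> = hprod (\<lambda>\<zeta>. snd (w \<zeta>) $ i) (dsym j (\<lambda>\<zeta>. fst (v \<zeta>))) \<xi> - hprod (\<lambda>\<zeta>. snd (w \<zeta>) $ i) (dsym j (\<lambda>\<zeta>. fst (v' \<zeta>))) \<xi>" for i j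
    by (rule hprod_diff_right; rule I; rule vm vm' wm vb vb' wb)
  have R2: "hprod (\<lambda>\<zeta>. snd (w \<zeta>) $ i) (\<lambda>\<zeta>. dsym j (\<lambda>\<zeta>. snd (v \<zeta>) $ k) \<zeta> - dsym j (\<lambda>\<zeta>. snd (v' \<zeta>) $ k) \<zeta>) \<xi> = hprod (\<lambda>\<zeta>. snd (w \<zeta>) $ i) (dsym j (\<lambda>\<zeta>. snd (v \<zeta>) $ k)) \<xi> - hprod (\<lambda>\<zeta>. snd (w \<zeta>) $ i) (dsym j (\<lambda>\<zeta>. snd (v' \<zeta>) $ k)) \<xi>" for i j k
    by (rule hprod_diff_right; rule I; rule vm vm' wm vb vb' wb)
  have R3: "hprod (dsym i (\<lambda>\<zeta>. fst (w \<zeta>))) (\<lambda>\<zeta>. dsym j (\<lambda>\<zeta>. fst (v \<zeta>)) \<zeta> - dsym j (\<lambda>\<zeta>. fst (v' \<zeta>)) \<zeta>) \<xi> = hprod (dsym i (\<lambda>\<zeta>. fst (w \<zeta>))) (dsym j (\<lambda>\<zeta>. fst (v \<zeta>))) \<xi> - hprod (dsym i (\<lambda>\<zeta>. fst (w \<zeta>))) (dsym j (\<lambda>\<zeta>. fst (v' \<zeta>))) \<xi>" for i j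
    by (rule hprod_diff_right; rule I; rule vm vm' wm vb vb' wb)
  have R4: "hprod (dsym i (\<lambda>\<zeta>. fst (w \<zeta>))) (\<lambda>\<zeta>. dsym j (\<lambda>\<zeta>. snd (v \<zeta>) $ k) \<zeta> - dsym j (\<lambda>\<zeta>. snd (v' \<zeta>) $ k) \<zeta>) \<xi> = hprod (dsym i (\<lambda>\<zeta>. fst (w \<zeta>))) (dsym j (\<lambda>\<zeta>. snd (v \<zeta>) $ k)) \<xi> - hprod (dsym i (\<lambda>\<zeta>. fst (w \<zeta>))) (dsym j (\<lambda>\<zeta>. snd (v' \<zeta>) $ k)) \<xi>" for i j k
    by (rule hprod_diff_right; rule I; rule vm vm' wm vb vb' wb)
  show "nonlin \<mu> \<nu> \<kappa> w (\<lambda>\<zeta>. v \<zeta> - v' \<zeta>) \<xi> = nonlin \<mu> \<nu> \<kappa> w v \<xi> - nonlin \<mu> \<nu> \<kappa> w v' \<xi>"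
    unfolding nonlin_def f_hat_def fst_diff snd_diff vector_minus_component dsym_diff
    by (simp only: R1 R2 R3 R4 dsym_sum) (simp add: vec_eq_iff sum_subtractf algebra_simps)
qed

lemma nonlin_cong_AE:
  assumes "AE \<xi> in lborel. v \<xi> = v' \<xi>" and m: "v \<in> borel_measurable borel" "v' \<in> borel_measurable borel"
  shows "nonlin \<mu> \<nu> \<kappa> v v \<xi> = nonlin \<mu> \<nu> \<kappa> v' v' \<xi>"
proof -
  have e: "AE \<xi> in lborel. snd (v \<xi>) $ i = snd (v' \<xi>) $ i" "AE \<xi> in lborel. dsym i (\<lambda>\<zeta>. fst (v \<zeta>)) \<xi> = dsym i (\<lambda>\<zeta>. fst (v' \<zeta>)) \<xi>"
     "AE \<xi> in lborel. dsym i (\<lambda>\<zeta>. snd (v \<zeta>) $ j) \<xi> = dsym i (\<lambda>\<zeta>. snd (v' \<zeta>) $ j) \<xi>" for i j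
    using assms(1) by (eventually_elim, simp add: dsym_def)+
  have mm: "(\<lambda>\<zeta>. snd (v \<zeta>) $ i) \<in> borel_measurable borel" "dsym i (\<lambda>\<zeta>. fst (v \<zeta>)) \<in> borel_measurable borel"
    "dsym i (\<lambda>\<zeta>. snd (v \<zeta>) $ j) \<in> borel_measurable borel" 
    "(\<lambda>\<zeta>. snd (v' \<zeta>) $ i) \<in> borel_measurable borel" "dsym i (\<lambda>\<zeta>. fst (v' \<zeta>)) \<in> borel_measurable borel"
    "dsym i (\<lambda>\<zeta>. snd (v' \<zeta>) $ j) \<in> borel_measurable borel" for i j
    using m by (auto intro!: dsym_measurable pair_components_measurable)
  have "hprod (\<lambda>\<zeta>. snd (v \<zeta>) $ i) (dsym j (\<lambda>\<zeta>. fst (v \<zeta>))) = hprod (\<lambda>\<zeta>. snd (v' \<zeta>) $ i) (dsym j (\<lambda>\<zeta>. fst (v' \<zeta>)))" for i j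
    by (rule ext, rule hprod_cong_AE; rule e mm)
  moreover have "hprod (\<lambda>\<zeta>. snd (v \<zeta>) $ i) (dsym j (\<lambda>\<zeta>. snd (v \<zeta>) $ k)) = hprod (\<lambda>\<zeta>. snd (v' \<zeta>) $ i) (dsym j (\<lambda>\<zeta>. snd (v' \<zeta>) $ k))" for i j k
    by (rule ext, rule hprod_cong_AE; rule e mm)
  moreover have "hprod (dsym i (\<lambda>\<zeta>. fst (v \<zeta>))) (dsym j (\<lambda>\<zeta>. snd (v \<zeta>) $ k)) = hprod (dsym i (\<lambda>\<zeta>. fst (v' \<zeta>))) (dsym j (\<lambda>\<zeta>. snd (v' \<zeta>) $ k))" for i j k
    by (rule ext, rule hprod_cong_AE; rule e mm)
  moreover have "hprod (dsym i (\<lambda>\<zeta>. fst (v \<zeta>))) (dsym j (\<lambda>\<zeta>. fst (v \<zeta>))) = hprod (dsym i (\<lambda>\<zeta>. fst (v' \<zeta>))) (dsym j (\<lambda>\<zeta>. fst (v' \<zeta>)))" for i j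
    by (rule ext, rule hprod_cong_AE; rule e mm)
  ultimately show ?thesis unfolding nonlin_def f_hat_def by simp
qed

section \<open>Duhamel integrals\<close>

text \<open>Substituting s = t u reduces to the Beta integral on the unit interval; the exponent of
  t counts a - 1 and b - 1 from the powers and 1 from the measure.\<close>

lemma beta_kernel:
  fixes a b t :: real
  assumes a: "a > 0" and b: "b > 0" and t: "t > 0"
  shows "set_integrable lborel {0<..<t} (\<lambda>s. (t - s) powr (a - 1) * s powr (b - 1))" (is ?A)
    and "(LINT s:{0<..<t}|lborel. (t - s) powr (a - 1) * s powr (b - 1))
      = t powr (a + b - 1) * (LINT s:{0<..<1}|lborel. (1 - s) powr (a - 1) * s powr (b - 1))" (is ?B)
proof -
  let ?f = "\<lambda>t s::real. indicator {0<..<t} s *\<^sub>R ((t - s) powr (a - 1) * s powr (b - 1))"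
  have [measurable]: "?f t \<in> borel_measurable borel" for t by measurable
  have 1: "set_integrable lborel {0<..<1} (\<lambda>s. (1 - s) powr (a - 1) * s powr (b - 1))"
    using set_integrable_subset[OF integrable_Beta[OF b a], of "{0<..<1}"]
    by (auto simp: mult.commute greaterThanLessThan_subseteq_atLeastAtMost_iff)
  have sc: "?f t (0 + t *\<^sub>R u) = t powr (a + b - 2) * ?f 1 u" for u
  proof (cases "0 < u \<and> u < 1")
    case True
    then have "(t - t * u) powr (a - 1) * (t * u) powr (b - 1) = (t * (1 - u)) powr (a - 1) * (t * u) powr (b - 1)"
      by (simp add: algebra_simps)
    also have "\<dots> = (t powr (a - 1) * t powr (b - 1)) * ((1 - u) powr (a - 1) * u powr (b - 1))"
      using True t by (simp add: powr_mult)
    also have "t powr (a - 1) * t powr (b - 1) = t powr (a + b - 2)" by (simp add: powr_add[symmetric])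
    finally show ?thesis using True t by (simp add: indicator_def)
  next
    case False
    then have "\<not> (0 < t * u \<and> t * u < t)" using t by (auto simp: zero_less_mult_iff)
    then show ?thesis using False by (auto simp: indicator_def)
  qed
  have "integrable lborel (\<lambda>u. ?f t (0 + t *\<^sub>R u))"
    using 1 unfolding sc set_integrable_def by (rule integrable_mult_right)
  then show ?A unfolding set_integrable_def
    by (subst lborel_integrable_affine_vec[where t=0 and c=t]) (use t in auto)
  have "(LINT s|lborel. ?f t s) = t * (LINT u|lborel. ?f t (0 + t *\<^sub>R u))"
    by (subst lborel_integral_affine_vec[where t=0 and c=t]) (use t in auto)
  also have "\<dots> = t * (t powr (a + b - 2) * (LINT u|lborel. ?f 1 u))"
    unfolding sc by simp
  also have "\<dots> = t powr (a + b - 1) * (LINT u|lborel. ?f 1 u)"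
  proof -
    have "t * t powr (a + b - 2) = t powr (1 + (a + b - 2))" using t by (subst powr_add) (simp add: powr_one)
    then show ?thesis by (simp add: algebra_simps)
  qed
  finally show ?B unfolding set_lebesgue_integral_def .
qed

text \<open>The chain x^\<theta> \<le> 1 + x \<le> (1 / min 1 c) exp (c x) has a constant that does
  not depend on \<theta>. One constant therefore serves both for the free evolution (\<theta> = 1/p)
  and for the Duhamel term (\<theta> = 1 - 1/p).\<close>

lemma exp_minus_le_powr:
  fixes x c \<theta> :: real
  assumes x: "x > 0" and c: "c > 0" and \<theta>: "0 \<le> \<theta>" "\<theta> \<le> 1"
  shows "exp (- c * x) \<le> (1 / min 1 c) * x powr (-\<theta>)"
proof -
  have "x powr \<theta> \<le> 1 + x"
  proof (cases "x \<le> 1")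
    case True
    then have "x powr \<theta> \<le> 1" using x \<theta> powr_le1[of \<theta> x] by simp
    then show ?thesis using x by simp
  next
    case False
    then have "x powr \<theta> \<le> x powr 1" using \<theta> by (intro powr_mono) auto
    then show ?thesis using x by (simp add: powr_one)
  qed
  also have "\<dots> \<le> (1 / min 1 c) * (1 + c * x)"
  proof -
    have "min 1 c * (1 + x) \<le> 1 + c * x" using x c by (auto simp: min_def algebra_simps mult_right_mono)
    then show ?thesis using c by (simp add: pos_le_divide_eq mult.commute)
  qed
  also have "\<dots> \<le> (1 / min 1 c) * exp (c * x)"
    using c by (intro mult_left_mono exp_ge_add_one_self) auto
  finally have "x powr \<theta> * (exp (- c * x) * x powr (-\<theta>)) \<le> (1 / min 1 c) * exp (c * x) * (exp (- c * x) * x powr (-\<theta>))"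
    by (intro mult_right_mono) auto
  moreover have "x powr \<theta> * x powr (-\<theta>) = 1" using x by (simp add: powr_add[symmetric])
  moreover have "exp (c * x) * exp (- c * x) = 1" by (simp add: exp_add[symmetric])
  ultimately show ?thesis
    by (simp only: mult.assoc mult.left_commute[of "x powr \<theta>" "exp _"] mult.left_commute[of "exp (c * x)"])
      (simp add: mult.assoc[symmetric] exp_add[symmetric])
qed

text \<open>\<open>augment \<xi>\<close> is linear and commutes with the integral, so the bound
  passes through with constant 1; only integrability is checked in the product norm, where a factor
  2 appears.\<close>

lemma aug_norm_set_integral:
  fixes f :: "real \<Rightarrow> complex \<times> (complex^'n::finite)"
  assumes f: "set_borel_measurable lborel S f" and k: "set_integrable lborel S k"
    and le: "\<And>s. s \<in> S \<Longrightarrow> aug_norm \<xi> (f s) \<le> k s"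
  shows "set_integrable lborel S f" (is ?A)
    and "aug_norm \<xi> (LINT s:S|lborel. f s) \<le> (LINT s:S|lborel. k s)" (is ?B)
proof -
  have le': "aug_norm \<xi> (indicator S s *\<^sub>R f s) \<le> indicator S s *\<^sub>R k s" for s
    using le[of s] by (cases "s \<in> S") auto
  have ik: "integrable lborel (\<lambda>s. indicator S s *\<^sub>R k s)" using k by (simp add: set_integrable_def)
  have "integrable lborel (\<lambda>s. indicator S s *\<^sub>R f s)"
  proof (rule Bochner_Integration.integrable_bound[OF integrable_mult_right[OF ik, of 2]])
    show "(\<lambda>s. indicator S s *\<^sub>R f s) \<in> borel_measurable lborel" using f by (simp add: set_borel_measurable_def)
    show "AE s in lborel. norm (indicator S s *\<^sub>R f s) \<le> norm (2 * (indicator S s *\<^sub>R k s))"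
    proof (rule AE_I2)
      fix s
      have "norm (indicator S s *\<^sub>R f s) \<le> 2 * (indicator S s *\<^sub>R k s)"
        using norm_le_aug_norm[of "indicator S s *\<^sub>R f s" \<xi>] le'[of s] by linarith
      then show "norm (indicator S s *\<^sub>R f s) \<le> norm (2 * (indicator S s *\<^sub>R k s))"
        unfolding real_norm_def by (rule order_trans[OF _ abs_ge_self])
    qed
  qed
  then show ?A by (simp add: set_integrable_def)
  then have i: "integrable lborel (\<lambda>s. indicator S s *\<^sub>R f s)" by (simp add: set_integrable_def)
  have "aug_norm \<xi> (LINT s:S|lborel. f s) = norm (LINT s|lborel. augment \<xi> (indicator S s *\<^sub>R f s))"
    unfolding set_lebesgue_integral_def using integral_bounded_linear[OF augment_bounded_linear i] by metis
  also have "\<dots> \<le> (LINT s|lborel. aug_norm \<xi> (indicator S s *\<^sub>R f s))" by (rule integral_norm_bound)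
  also have "\<dots> \<le> (LINT s|lborel. indicator S s *\<^sub>R k s)"
    by (intro Bochner_Integration.integral_mono ik le' integrable_norm integrable_bounded_linear[OF augment_bounded_linear i])
  finally show ?B by (simp add: set_lebesgue_integral_def)
qed

text \<open>Measurability in \<xi> at each time and continuity in time at each \<xi> give joint
  measurability: time is replaced by the next point of a grid of step 1 / (n + 1), and the resulting
  functions, piecewise constant in time, converge.\<close>

lemma caratheodory_measurable:
  fixes G :: "real \<Rightarrow> 'a::euclidean_space \<Rightarrow> 'b::euclidean_space"
  assumes m: "\<And>s. s > 0 \<Longrightarrow> G s \<in> borel_measurable borel"
    and c: "\<And>\<xi>. \<xi> \<noteq> 0 \<Longrightarrow> continuous_on {0<..} (\<lambda>s. G s \<xi>)"
  shows "(\<lambda>q. if fst q > 0 \<and> snd q \<noteq> 0 then G (fst q) (snd q) else 0) \<in> borel_measurable (borel \<Otimes>\<^sub>M borel)"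
\<comment> \<open>Adding 1 to the floor keeps the sampled time positive, where G is
  controlled.\<close>
proof (rule borel_measurable_LIMSEQ_metric[where f="\<lambda>n q. if fst q > 0 \<and> snd q \<noteq> 0 then G ((real_of_int \<lfloor>real (Suc n) * fst q\<rfloor> + 1) / real (Suc n)) (snd q) else 0"])
  let ?k = "\<lambda>n s. \<lfloor>real (Suc n) * s\<rfloor>"
  let ?g = "\<lambda>n q. if fst q > 0 \<and> snd q \<noteq> 0 then G ((real_of_int (?k n (fst q)) + 1) / real (Suc n)) (snd q) else 0"
  fix n
  \<comment> \<open>The clause \<open>0 \<le> i\<close> extends the family to all integers, as
    composition with a countably valued map asks for measurability at each index.\<close>
  let ?h = "\<lambda>(i::int) (q::real \<times> 'a). if 0 \<le> i \<and> fst q > 0 \<and> snd q \<noteq> 0 then G ((real_of_int i + 1) / real (Suc n)) (snd q) else 0"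
  have "(\<lambda>q. ?h (?k n (fst q)) q) \<in> borel_measurable (borel \<Otimes>\<^sub>M borel)"
  proof (rule measurable_compose_countable[where f="?h" and g="\<lambda>q. ?k n (fst q)"])
    show "?h i \<in> borel_measurable (borel \<Otimes>\<^sub>M borel)" for i
    proof (cases "0 \<le> i")
      case True
      then have "(real_of_int i + 1) / real (Suc n) > 0" by (intro divide_pos_pos) auto
      note [measurable] = m[OF this]
      show ?thesis by measurable
    qed simp
    show "(\<lambda>q. ?k n (fst q)) \<in> measurable (borel \<Otimes>\<^sub>M borel) (count_space UNIV)"
      by measurable
  qed
  moreover have "(\<lambda>q. ?h (?k n (fst q)) q) = ?g n"
  proof
    fix q :: "real \<times> 'a"
    have "0 \<le> ?k n (fst q)" if "fst q > 0" using that by simp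
    then show "?h (?k n (fst q)) q = ?g n q" by (cases "fst q > 0") auto
  qed
  ultimately show "?g n \<in> borel_measurable (borel \<Otimes>\<^sub>M borel)" by (simp only:)
next
  let ?k = "\<lambda>n s. \<lfloor>real (Suc n) * s\<rfloor>"
  let ?g = "\<lambda>n q. if fst q > 0 \<and> snd q \<noteq> 0 then G ((real_of_int (?k n (fst q)) + 1) / real (Suc n)) (snd q) else 0"
  fix q :: "real \<times> 'a"
  show "(\<lambda>n. ?g n q) \<longlonglongrightarrow> (if fst q > 0 \<and> snd q \<noteq> 0 then G (fst q) (snd q) else 0)"
  proof (cases "fst q > 0 \<and> snd q \<noteq> 0")
    case True
    define s where "s = fst q"
    have s: "s > 0" using True by (simp add: s_def)
    have b: "s < (real_of_int (?k n s) + 1) / real (Suc n)" "(real_of_int (?k n s) + 1) / real (Suc n) \<le> s + inverse (real (Suc n))" for n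
    proof -
      have N: "real (Suc n) > 0" by simp
      have k: "real (Suc n) * s < real_of_int (?k n s) + 1" "real_of_int (?k n s) \<le> real (Suc n) * s" by linarith+
      show "s < (real_of_int (?k n s) + 1) / real (Suc n)"
        using k(1) N by (simp only: pos_less_divide_eq mult.commute)
      have "real_of_int (?k n s) / real (Suc n) \<le> s"
        using k(2) N by (simp only: pos_divide_le_eq mult.commute)
      then show "(real_of_int (?k n s) + 1) / real (Suc n) \<le> s + inverse (real (Suc n))"
        by (simp only: add_divide_distrib inverse_eq_divide)
    qed
    have "(\<lambda>n. (real_of_int (?k n s) + 1) / real (Suc n)) \<longlonglongrightarrow> s"
    proof (rule tendsto_sandwich[of "\<lambda>_. s" _ _ "\<lambda>n. s + inverse (real (Suc n))"])
      show "(\<lambda>n. s + inverse (real (Suc n))) \<longlonglongrightarrow> s"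
        using tendsto_add[OF tendsto_const LIMSEQ_inverse_real_of_nat, of s] by simp
    qed (use b less_imp_le in \<open>auto intro!: always_eventually\<close>)
    moreover have "isCont (\<lambda>s. G s (snd q)) s"
      using c[of "snd q"] True s by (simp add: continuous_on_eq_continuous_at)
    ultimately have "(\<lambda>n. G ((real_of_int (?k n s) + 1) / real (Suc n)) (snd q)) \<longlonglongrightarrow> G s (snd q)"
      using isCont_tendsto_compose[of s "\<lambda>s. G s (snd q)"] by blast
    then show ?thesis using True by (simp add: s_def)
  next
    case False
    show ?thesis by (simp only: False if_False tendsto_const)
  qed
qed

section \<open>Frequency profiles and the semigroup in weighted norms\<close>

lemma freq_bound_mono:
  assumes v: "freq_bound \<tau> s M v" and "\<tau>' \<le> \<tau>" "M \<le> M'"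
  shows "freq_bound \<tau>' s M' v"
proof -
  have M: "0 \<le> M" using v by (simp add: freq_bound_def)
  have "AE \<xi> in lborel. aug_norm \<xi> (v \<xi>) \<le> M * (norm \<xi> powr (-s) * exp (- \<tau> * norm \<xi>))"
    using v by (simp add: freq_bound_def)
  then have "AE \<xi> in lborel. aug_norm \<xi> (v \<xi>) \<le> M' * (norm \<xi> powr (-s) * exp (- \<tau>' * norm \<xi>))"
  proof eventually_elim
    case (elim \<xi>)
    have "- \<tau> * norm \<xi> \<le> - \<tau>' * norm \<xi>" using assms(2) by (intro mult_right_mono) auto
    then have "M * (norm \<xi> powr (-s) * exp (- \<tau> * norm \<xi>)) \<le> M' * (norm \<xi> powr (-s) * exp (- \<tau>' * norm \<xi>))"
      using M assms(3) by (intro mult_mono mult_left_mono) auto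
    with elim show ?case by linarith
  qed
  with v M assms(3) show ?thesis by (simp add: freq_bound_def)
qed

lemma freq_bound_add:
  assumes v: "freq_bound \<tau> s M v" and w: "freq_bound \<tau> s M' w"
  shows "freq_bound \<tau> s (M + M') (\<lambda>\<xi>. v \<xi> + w \<xi>)"
proof -
  have "AE \<xi> in lborel. aug_norm \<xi> (v \<xi>) \<le> M * (norm \<xi> powr (-s) * exp (- \<tau> * norm \<xi>))"
    "AE \<xi> in lborel. aug_norm \<xi> (w \<xi>) \<le> M' * (norm \<xi> powr (-s) * exp (- \<tau> * norm \<xi>))"
    using v w by (auto simp: freq_bound_def)
  then have "AE \<xi> in lborel. aug_norm \<xi> (v \<xi> + w \<xi>) \<le> (M + M') * (norm \<xi> powr (-s) * exp (- \<tau> * norm \<xi>))"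
  proof eventually_elim
    case (elim \<xi>) then show ?case using aug_norm_triangle[of \<xi> "v \<xi>" "w \<xi>"] by (simp only: distrib_right)
  qed
  with v w show ?thesis by (auto simp: freq_bound_def)
qed

lemma freq_bound_diff:
  assumes v: "freq_bound \<tau> s M v" and w: "freq_bound \<tau> s M' w"
  shows "freq_bound \<tau> s (M + M') (\<lambda>\<xi>. v \<xi> - w \<xi>)"
proof -
  have "AE \<xi> in lborel. aug_norm \<xi> (v \<xi>) \<le> M * (norm \<xi> powr (-s) * exp (- \<tau> * norm \<xi>))"
    "AE \<xi> in lborel. aug_norm \<xi> (w \<xi>) \<le> M' * (norm \<xi> powr (-s) * exp (- \<tau> * norm \<xi>))"
    using v w by (auto simp: freq_bound_def)
  then have "AE \<xi> in lborel. aug_norm \<xi> (v \<xi> - w \<xi>) \<le> (M + M') * (norm \<xi> powr (-s) * exp (- \<tau> * norm \<xi>))"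
  proof eventually_elim
    case (elim \<xi>) then show ?case using aug_norm_diff[of \<xi> "v \<xi>" "w \<xi>"] by (simp only: distrib_right)
  qed
  with v w show ?thesis by (auto simp: freq_bound_def)
qed

locale nsk_semigroup =
  fixes p \<mu> \<nu> \<kappa> \<alpha> c0 C0 :: real
    and W :: "real \<Rightarrow> real^'n::finite \<Rightarrow> complex \<times> (complex^'n) \<Rightarrow> complex \<times> (complex^'n)"
  assumes d_ge_2: "CARD('n) \<ge> 2"
    and p_gt_2: "p > 2"
    and p_range: "real CARD('n) - 3 + 4 / p > 0"
    and c0_pos: "c0 > 0" and C0_pos: "C0 > 0"
    and W_eq: "W = W_symbol \<mu> \<nu> \<kappa> \<alpha>"
    and W_decay: "0 \<le> t \<Longrightarrow> aug_norm \<xi> (W t \<xi> v) \<le> C0 * exp (- c0 * t * (norm \<xi>)\<^sup>2) * aug_norm \<xi> v"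
begin

definition \<sigma> :: real where "\<sigma> = real CARD('n) - 1 + 2 / p"
text \<open>Homogeneity of a quadratic term: d - 2 \<sigma> from the convolution and 1 from the
  derivative.\<close>

definition \<gamma> :: real where "\<gamma> = real CARD('n) + 1 - 2 * \<sigma>"

lemma \<sigma>_bounds: "1 \<le> \<sigma>" "\<sigma> < real CARD('n)" "2 * \<sigma> - 1 > real CARD('n)"
proof -
  have "2 / p > 0" "2 / p < 1" using p_gt_2 by (auto simp: field_simps)
  then show "1 \<le> \<sigma>" "\<sigma> < real CARD('n)" "2 * \<sigma> - 1 > real CARD('n)"
    using d_ge_2 p_range unfolding \<sigma>_def by auto
qed

lemma \<gamma>_eq: "\<gamma> = 2 - 2 / p - \<sigma>"
  by (simp add: \<gamma>_def \<sigma>_def)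

lemma p_bounds: "0 < 1 / p" "1 / p < 1" "0 < 1 - 2 / p"
  using p_gt_2 by (auto simp: field_simps)

lemma W_linear: "linear (W t \<xi>)"
  unfolding W_eq by (rule W_symbol_linear)

text \<open>The factor exp (c0 / 2) is the price of completing the square against the growth of the
  radius; the other factor converts the remaining half of the parabolic decay into a power.\<close>

definition heat_const :: real where "heat_const = exp (c0 / 2) * (1 / min 1 (c0 / 2))"

lemma heat_const_pos: "heat_const > 0"
  using c0_pos by (simp add: heat_const_def)

text \<open>Since \<open>\<surd>t - \<surd>s \<le> \<surd>(t - s)\<close> and \<open>y - y\<^sup>2 \<le> 1/2 - y\<^sup>2/2\<close>, half of the parabolic decay pays for the
  growth of the analyticity radius from time \<open>s\<close> to time \<open>t\<close>.\<close>

lemma heat_gevrey_bound: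
  assumes s: "0 \<le> s" "s < t" and r: "0 < r" and \<tau>: "0 \<le> \<tau>" "\<tau> \<le> c0" and \<theta>: "0 \<le> \<theta>" "\<theta> \<le> 1"
  shows "exp (- c0 * (t - s) * r\<^sup>2) * exp (- (\<tau> * sqrt s) * r)
     \<le> heat_const * ((t - s) powr (-\<theta>) * r powr (- 2 * \<theta>) * exp (- (\<tau> * sqrt t) * r))"
proof -
  define y where "y = sqrt (t - s) * r"
  have y: "y > 0" using s r by (simp add: y_def)
  have y2: "y\<^sup>2 = (t - s) * r\<^sup>2" using s by (simp add: y_def power_mult_distrib)
  have "sqrt t \<le> sqrt s + sqrt (t - s)" using sqrt_add_le_add_sqrt[of s "t - s"] s by simp
  then have "(sqrt t - sqrt s) * r \<le> y" unfolding y_def using r by (intro mult_right_mono) auto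
  then have "\<tau> * ((sqrt t - sqrt s) * r) \<le> c0 * y"
    using \<tau> y s r by (intro mult_mono) auto
  also have "c0 * y \<le> c0 * (1/2 + y\<^sup>2 / 2)"
    using c0_pos sum_squares_bound[of 1 y] by (intro mult_left_mono) auto
  finally have "- c0 * y\<^sup>2 - \<tau> * sqrt s * r \<le> c0 / 2 - (c0 / 2) * y\<^sup>2 - \<tau> * sqrt t * r"
    by (simp add: algebra_simps)
  then have "exp (- c0 * y\<^sup>2 - \<tau> * sqrt s * r) \<le> exp (c0 / 2 + - (c0 / 2) * y\<^sup>2 + - (\<tau> * sqrt t) * r)"
    by (simp add: algebra_simps)
  also have "\<dots> = exp (c0 / 2) * exp (- (c0 / 2) * y\<^sup>2) * exp (- (\<tau> * sqrt t) * r)"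
    by (simp only: exp_add)
  also have "\<dots> \<le> exp (c0 / 2) * ((1 / min 1 (c0 / 2)) * (y\<^sup>2) powr (-\<theta>)) * exp (- (\<tau> * sqrt t) * r)"
    using exp_minus_le_powr[of "y\<^sup>2" "c0 / 2" \<theta>] y c0_pos \<theta> by (intro mult_left_mono mult_right_mono) auto
  also have "(y\<^sup>2) powr (-\<theta>) = (t - s) powr (-\<theta>) * r powr (- 2 * \<theta>)"
  proof -
    have "(r\<^sup>2) powr (-\<theta>) = r powr (- 2 * \<theta>)" using r powr_powr[of r 2 "-\<theta>"] by simp
    then show ?thesis unfolding y2 using s by (simp add: powr_mult)
  qed
  moreover have "exp (- c0 * (t - s) * r\<^sup>2) * exp (- (\<tau> * sqrt s) * r) = exp (- c0 * y\<^sup>2 - \<tau> * sqrt s * r)"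
    unfolding exp_add[symmetric] y2 by (simp add: mult.assoc)
  ultimately show ?thesis unfolding heat_const_def
    by (simp only: mult_ac)
qed

definition curve_weight :: "real \<Rightarrow> real \<Rightarrow> real^'n \<Rightarrow> real" where
  "curve_weight \<tau> t \<xi> = t powr (- (1 / p)) * (norm \<xi> powr (-\<sigma>) * exp (- (\<tau> * sqrt t) * norm \<xi>))"

text \<open>The bound is asked at every nonzero frequency, not almost everywhere, which is possible
  because convolutions are evaluated pointwise. At a fixed \<xi> the integral over s then meets no
  exceptional sets depending on s. Continuity in s supplies joint measurability.\<close>

definition force :: "real \<Rightarrow> real \<Rightarrow> (real \<Rightarrow> real^'n \<Rightarrow> complex \<times> (complex^'n)) \<Rightarrow> bool" where
  "force \<tau> K G \<longleftrightarrow> 0 \<le> K \<and> (\<forall>s>0. G s \<in> borel_measurable borel) \<and>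
    (\<forall>s>0. \<forall>\<xi>. \<xi> \<noteq> 0 \<longrightarrow> aug_norm \<xi> (G s \<xi>) \<le> K * (s powr (- (2 / p)) * (norm \<xi> powr \<gamma> * exp (- (\<tau> * sqrt s) * norm \<xi>)))) \<and>
    (\<forall>\<xi>. \<xi> \<noteq> 0 \<longrightarrow> continuous_on {0<..} (\<lambda>s. G s \<xi>))"

definition duh :: "(real \<Rightarrow> real^'n \<Rightarrow> complex \<times> (complex^'n)) \<Rightarrow> real \<Rightarrow> real^'n \<Rightarrow> complex \<times> (complex^'n)" where
  "duh G t \<xi> = (LINT s:{0<..<t}|lborel. W (t - s) \<xi> (G s \<xi>))"

text \<open>Euler's Beta function at (1/p, 1 - 2/p).\<close>

definition kernel_const :: real where
  "kernel_const = (LINT s:{0<..<1}|lborel. (1 - s) powr (1 / p - 1) * s powr (- (2 / p)))"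

lemma kernel_const_nonneg: "kernel_const \<ge> 0"
  unfolding kernel_const_def set_lebesgue_integral_def by (rule Bochner_Integration.integral_nonneg) auto

lemma kernel:
  assumes t: "t > 0"
  shows "set_integrable lborel {0<..<t} (\<lambda>s. (t - s) powr (1 / p - 1) * s powr (- (2 / p)))"
    and "(LINT s:{0<..<t}|lborel. (t - s) powr (1 / p - 1) * s powr (- (2 / p))) = kernel_const * t powr (- (1 / p))"
  using beta_kernel[OF p_bounds(1) p_bounds(3) t] by (simp_all add: kernel_const_def mult.commute)

lemma W_slice_measurable:
  assumes G: "continuous_on {0<..} (\<lambda>s. G s \<xi>)" and S: "S \<subseteq> {0<..}" "S \<in> sets borel"
  shows "set_borel_measurable lborel S (\<lambda>s. W (t - s) \<xi> (G s \<xi>))"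
proof -
  have "(\<lambda>s. indicator S s *\<^sub>R G s \<xi>) \<in> borel_measurable borel"
    by (rule borel_measurable_continuous_on_indicator[OF S(2) continuous_on_subset[OF G S(1)]])
  then have "(\<lambda>s. (t - s, \<xi>, indicator S s *\<^sub>R G s \<xi>)) \<in> borel_measurable borel" by measurable
  from measurable_compose[OF this W_symbol_measurable]
  have "(\<lambda>s. W (t - s) \<xi> (indicator S s *\<^sub>R G s \<xi>)) \<in> borel_measurable borel" by (simp add: W_eq)
  moreover have "W (t - s) \<xi> (indicator S s *\<^sub>R G s \<xi>) = indicator S s *\<^sub>R W (t - s) \<xi> (G s \<xi>)" for s
    by (rule linear_scale[OF W_linear])
  ultimately show ?thesis by (simp add: set_borel_measurable_def)
qed

text \<open>The choice \<theta> = 1 - 1/p in \<open>heat_gevrey_bound\<close> is forced: \<gamma> -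
  2 \<theta> = -\<sigma>, so the frequency weight of a curve is restored and only a kernel in time
  remains.\<close>

lemma W_force_bound:
  assumes G: "force \<tau> K G" and \<tau>: "0 \<le> \<tau>" "\<tau> \<le> c0" and s: "0 < s" "s < t" and x: "\<xi> \<noteq> 0"
  shows "exp (- c0 * (t - s) * (norm \<xi>)\<^sup>2) * aug_norm \<xi> (G s \<xi>) \<le>
     (K * heat_const * (norm \<xi> powr (-\<sigma>) * exp (- (\<tau> * sqrt t) * norm \<xi>))) * ((t - s) powr (1 / p - 1) * s powr (- (2 / p)))"
proof -
  have r: "norm \<xi> > 0" using x by simp
  have K: "K \<ge> 0" using G by (simp add: force_def)
  have "exp (- c0 * (t - s) * (norm \<xi>)\<^sup>2) * aug_norm \<xi> (G s \<xi>)
      \<le> exp (- c0 * (t - s) * (norm \<xi>)\<^sup>2) * (K * (s powr (- (2 / p)) * (norm \<xi> powr \<gamma> * exp (- (\<tau> * sqrt s) * norm \<xi>))))"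
    using G s x by (intro mult_left_mono) (auto simp: force_def)
  also have "\<dots> = (K * s powr (- (2 / p)) * norm \<xi> powr \<gamma>) * (exp (- c0 * (t - s) * (norm \<xi>)\<^sup>2) * exp (- (\<tau> * sqrt s) * norm \<xi>))"
    by (simp only: mult_ac)
  also have "\<dots> \<le> (K * s powr (- (2 / p)) * norm \<xi> powr \<gamma>) *
     (heat_const * ((t - s) powr (- (1 - 1 / p)) * norm \<xi> powr (- 2 * (1 - 1 / p)) * exp (- (\<tau> * sqrt t) * norm \<xi>)))"
    using K s p_bounds by (intro mult_left_mono heat_gevrey_bound r \<tau>) auto
  also have "\<dots> = (K * heat_const * ((norm \<xi> powr \<gamma> * norm \<xi> powr (- 2 * (1 - 1 / p))) * exp (- (\<tau> * sqrt t) * norm \<xi>))) * ((t - s) powr (- (1 - 1 / p)) * s powr (- (2 / p)))"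
    by (simp only: mult_ac)
  also have "norm \<xi> powr \<gamma> * norm \<xi> powr (- 2 * (1 - 1 / p)) = norm \<xi> powr (-\<sigma>)"
    by (simp add: powr_add[symmetric] \<gamma>_eq)
  finally show ?thesis by simp
qed

lemma duh_bound:
  assumes G: "force \<tau> K G" and \<tau>: "0 \<le> \<tau>" "\<tau> \<le> c0" and t: "t > 0" and x: "\<xi> \<noteq> 0"
  shows "set_integrable lborel {0<..<t} (\<lambda>s. W (t - s) \<xi> (G s \<xi>))" (is ?A)
    and "aug_norm \<xi> (duh G t \<xi>) \<le> C0 * heat_const * kernel_const * K * curve_weight \<tau> t \<xi>" (is ?B)
proof -
  let ?c = "C0 * (K * heat_const * (norm \<xi> powr (-\<sigma>) * exp (- (\<tau> * sqrt t) * norm \<xi>)))"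
  let ?k = "\<lambda>s. ?c * ((t - s) powr (1 / p - 1) * s powr (- (2 / p)))"
  have m: "set_borel_measurable lborel {0<..<t} (\<lambda>s. W (t - s) \<xi> (G s \<xi>))"
    using G x by (intro W_slice_measurable) (auto simp: force_def)
  have k: "set_integrable lborel {0<..<t} ?k"
    by (intro set_integrable_mult_right kernel(1)[OF t])
  have le: "aug_norm \<xi> (W (t - s) \<xi> (G s \<xi>)) \<le> ?k s" if "s \<in> {0<..<t}" for s
  proof -
    have "aug_norm \<xi> (W (t - s) \<xi> (G s \<xi>)) \<le> C0 * (exp (- c0 * (t - s) * (norm \<xi>)\<^sup>2) * aug_norm \<xi> (G s \<xi>))"
      using W_decay[of "t - s" \<xi> "G s \<xi>"] that by (simp add: mult.assoc)
    also have "\<dots> \<le> C0 * ((K * heat_const * (norm \<xi> powr (-\<sigma>) * exp (- (\<tau> * sqrt t) * norm \<xi>))) * ((t - s) powr (1 / p - 1) * s powr (- (2 / p))))"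
      using C0_pos that by (intro mult_left_mono W_force_bound[OF G \<tau> _ _ x]) auto
    finally show ?thesis by (simp only: mult.assoc)
  qed
  show ?A by (rule aug_norm_set_integral(1)[OF m k le])
  have "aug_norm \<xi> (duh G t \<xi>) \<le> (LINT s:{0<..<t}|lborel. ?k s)"
    unfolding duh_def by (rule aug_norm_set_integral(2)[OF m k le])
  also have "\<dots> = ?c * (kernel_const * t powr (- (1 / p)))"
    by (simp only: set_integral_mult_right kernel(2)[OF t])
  also have "\<dots> = C0 * heat_const * kernel_const * K * curve_weight \<tau> t \<xi>" by (simp add: curve_weight_def)
  finally show ?B .
qed

text \<open>Nothing is known about the size of a force at \<xi> = 0, so the integral is replaced by
  0 on that null set; elsewhere the integrand is jointly measurable by
  \<open>caratheodory_measurable\<close> and \<open>W_symbol_measurable\<close>.\<close>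

lemma duh_measurable:
  assumes G: "force \<tau> K G"
  shows "(\<lambda>\<xi>. if \<xi> = 0 then 0 else duh G t \<xi>) \<in> borel_measurable borel"
proof -
  let ?G = "\<lambda>q::real \<times> (real^'n). if fst q > 0 \<and> snd q \<noteq> 0 then G (fst q) (snd q) else 0"
  have [measurable]: "?G \<in> borel_measurable (borel \<Otimes>\<^sub>M borel)"
    by (rule caratheodory_measurable) (use G in \<open>auto simp: force_def\<close>)
  have [measurable]: "(\<lambda>q::(real^'n) \<times> real. ?G (snd q, fst q)) \<in> borel_measurable (borel \<Otimes>\<^sub>M borel)"
    by (rule measurable_compose[where g="?G", OF _ \<open>?G \<in> borel_measurable (borel \<Otimes>\<^sub>M borel)\<close>]) measurable
  have "(\<lambda>q::(real^'n) \<times> real. (t - snd q, fst q, ?G (snd q, fst q))) \<in> (borel \<Otimes>\<^sub>M borel) \<rightarrow>\<^sub>M borel"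
    by (intro borel_measurable_Pair) measurable
  from measurable_compose[OF this W_symbol_measurable]
  have Wm: "(\<lambda>q::(real^'n) \<times> real. W (t - snd q) (fst q) (?G (snd q, fst q))) \<in> borel_measurable (borel \<Otimes>\<^sub>M borel)"
    by (simp add: W_eq)
  have "(\<lambda>q::(real^'n) \<times> real. indicat_real {0<..<t} (snd q) *\<^sub>R W (t - snd q) (fst q) (?G (snd q, fst q))) \<in> borel_measurable (borel \<Otimes>\<^sub>M lborel)"
    using Wm by measurable
  then have "(\<lambda>\<xi>. LINT s|lborel. indicat_real {0<..<t} s *\<^sub>R W (t - s) \<xi> (?G (s, \<xi>))) \<in> borel_measurable borel"
    by (intro lborel.borel_measurable_lebesgue_integral) (simp add: split_beta')
  then have 1: "(\<lambda>\<xi>. if \<xi> = 0 then 0 else (LINT s|lborel. indicat_real {0<..<t} s *\<^sub>R W (t - s) \<xi> (?G (s, \<xi>)))) \<in> borel_measurable borel"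
    by measurable
  moreover have "(LINT s|lborel. indicat_real {0<..<t} s *\<^sub>R W (t - s) \<xi> (?G (s, \<xi>))) = duh G t \<xi>" if "\<xi> \<noteq> 0" for \<xi>
    unfolding duh_def set_lebesgue_integral_def
    by (rule Bochner_Integration.integral_cong) (use that in \<open>auto simp: indicator_def\<close>)
  ultimately show ?thesis by (simp cong: if_cong)
qed

text \<open>Continuity is measured without exponential weight. This is what convergence in
  \<open>PM_norm\<close> with exponents \<sigma> and \<sigma> + 1 for a, and in
  \<open>PMv_norm\<close> with exponent \<sigma> for u, amounts to.\<close>

definition time_cont :: "(real \<Rightarrow> real^'n \<Rightarrow> complex \<times> (complex^'n)) \<Rightarrow> bool" where
  "time_cont v \<longleftrightarrow> (\<forall>t>0. \<forall>e>0. \<forall>\<^sub>F s in at t. freq_bound 0 \<sigma> e (\<lambda>\<xi>. v s \<xi> - v t \<xi>))"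

definition curve :: "real \<Rightarrow> real \<Rightarrow> (real \<Rightarrow> real^'n \<Rightarrow> complex \<times> (complex^'n)) \<Rightarrow> bool" where
  "curve \<tau> M v \<longleftrightarrow> 0 \<le> M \<and> (\<forall>t>0. freq_bound (\<tau> * sqrt t) \<sigma> (M * t powr (- (1 / p))) (v t)) \<and> time_cont v"

lemma curveI:
  assumes "0 \<le> M" "\<And>t. t > 0 \<Longrightarrow> v t \<in> borel_measurable borel"
    and "\<And>t. t > 0 \<Longrightarrow> AE \<xi> in lborel. aug_norm \<xi> (v t \<xi>) \<le> M * curve_weight \<tau> t \<xi>" and "time_cont v"
  shows "curve \<tau> M v"
  using assms by (simp add: curve_def freq_bound_def curve_weight_def mult.assoc)

lemma eventually_at_pos:
  fixes t :: real
  assumes "t > 0"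
  shows "\<forall>\<^sub>F s in at t. t / 2 < s \<and> s < 2 * t"
  using assms by (intro eventually_conj order_tendstoD[OF tendsto_ident_at]) auto

lemma curve_diff:
  assumes v: "curve \<tau> M v" and w: "curve \<tau> M' w"
  shows "curve \<tau> (M + M') (\<lambda>t \<xi>. v t \<xi> - w t \<xi>)"
  unfolding curve_def
proof (intro conjI allI impI)
  show "0 \<le> M + M'" using v w by (simp add: curve_def)
  fix t :: real assume t: "t > 0"
  show "freq_bound (\<tau> * sqrt t) \<sigma> ((M + M') * t powr (- (1 / p))) (\<lambda>\<xi>. v t \<xi> - w t \<xi>)"
    unfolding distrib_right using v w t by (intro freq_bound_diff) (auto simp: curve_def)
next
  show "time_cont (\<lambda>t \<xi>. v t \<xi> - w t \<xi>)"
    unfolding time_cont_def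
  proof (intro allI impI)
    fix t e :: real assume t: "t > 0" and e: "e > 0"
    have "\<forall>\<^sub>F s in at t. freq_bound 0 \<sigma> (e/2) (\<lambda>\<xi>. v s \<xi> - v t \<xi>)" "\<forall>\<^sub>F s in at t. freq_bound 0 \<sigma> (e/2) (\<lambda>\<xi>. w s \<xi> - w t \<xi>)"
      using v w t e by (auto simp: curve_def time_cont_def)
    then show "\<forall>\<^sub>F s in at t. freq_bound 0 \<sigma> e (\<lambda>\<xi>. (v s \<xi> - w s \<xi>) - (v t \<xi> - w t \<xi>))"
    proof eventually_elim
      case (elim s)
      from freq_bound_diff[OF this] show ?case by (simp add: algebra_simps)
    qed
  qed
qed

lemma curve_add:
  assumes v: "curve \<tau> M v" and w: "curve \<tau> M' w"
  shows "curve \<tau> (M + M') (\<lambda>t \<xi>. v t \<xi> + w t \<xi>)"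
  unfolding curve_def
proof (intro conjI allI impI)
  show "0 \<le> M + M'" using v w by (simp add: curve_def)
  fix t :: real assume t: "t > 0"
  show "freq_bound (\<tau> * sqrt t) \<sigma> ((M + M') * t powr (- (1 / p))) (\<lambda>\<xi>. v t \<xi> + w t \<xi>)"
    unfolding distrib_right using v w t by (intro freq_bound_add) (auto simp: curve_def)
next
  show "time_cont (\<lambda>t \<xi>. v t \<xi> + w t \<xi>)"
    unfolding time_cont_def
  proof (intro allI impI)
    fix t e :: real assume t: "t > 0" and e: "e > 0"
    have "\<forall>\<^sub>F s in at t. freq_bound 0 \<sigma> (e/2) (\<lambda>\<xi>. v s \<xi> - v t \<xi>)" "\<forall>\<^sub>F s in at t. freq_bound 0 \<sigma> (e/2) (\<lambda>\<xi>. w s \<xi> - w t \<xi>)"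
      using v w t e by (auto simp: curve_def time_cont_def)
    then show "\<forall>\<^sub>F s in at t. freq_bound 0 \<sigma> e (\<lambda>\<xi>. (v s \<xi> + w s \<xi>) - (v t \<xi> + w t \<xi>))"
    proof eventually_elim
      case (elim s)
      from freq_bound_add[OF this] show ?case by (simp add: algebra_simps)
    qed
  qed
qed

lemma curve_freq_bound_0:
  assumes v: "curve \<tau> M v" and \<tau>: "0 \<le> \<tau>" and t: "t > 0"
  shows "freq_bound 0 \<sigma> (M * t powr (- (1 / p))) (v t)"
  using freq_bound_mono[of "\<tau> * sqrt t" \<sigma> "M * t powr (- (1 / p))" "v t" 0] v t \<tau> by (auto simp: curve_def)

text \<open>Sizes multiply, two factors t^(-1/p) giving t^(-2/p). Continuity in time at a fixed
  frequency comes from bilinearity and the same estimate with \<tau> = 0, applied to the increments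
  of v and of w.\<close>

lemma nonlin_force:
  "\<exists>C\<ge>0. \<forall>\<tau> M1 M2 v w. 0 \<le> \<tau> \<longrightarrow> curve \<tau> M1 v \<longrightarrow> curve \<tau> M2 w \<longrightarrow>
     force \<tau> (C * (M1 * M2)) (\<lambda>s. nonlin \<mu> \<nu> \<kappa> (v s) (w s))"
proof -
  obtain C where C: "C \<ge> 0" and CB: "\<And>(v::real^'n \<Rightarrow> complex \<times> (complex^'n)) w M1 M2 \<tau> \<xi>. 0 \<le> \<tau> \<Longrightarrow> freq_bound \<tau> \<sigma> M1 v \<Longrightarrow> freq_bound \<tau> \<sigma> M2 w \<Longrightarrow>
     \<xi> \<noteq> 0 \<Longrightarrow> aug_norm \<xi> (nonlin \<mu> \<nu> \<kappa> v w \<xi>) \<le> C * (M1 * M2) * (norm \<xi> powr \<gamma> * exp (- \<tau> * norm \<xi>))"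
    using nonlin_bound[OF \<sigma>_bounds, of \<mu> \<nu> \<kappa>] unfolding \<gamma>_def by blast
  have "force \<tau> (C * (M1 * M2)) (\<lambda>s. nonlin \<mu> \<nu> \<kappa> (v s) (w s))"
    if \<tau>: "0 \<le> \<tau>" and v: "curve \<tau> M1 v" and w: "curve \<tau> M2 w" for \<tau> M1 M2 v w
    unfolding force_def
  proof (intro conjI allI impI)
    have M: "0 \<le> M1" "0 \<le> M2" using v w by (auto simp: curve_def)
    show "0 \<le> C * (M1 * M2)" using C M by simp
    show "nonlin \<mu> \<nu> \<kappa> (v s) (w s) \<in> borel_measurable borel" if "s > 0" for s
      using v w that by (intro nonlin_measurable) (auto simp: curve_def freq_bound_def)
    show "aug_norm \<xi> (nonlin \<mu> \<nu> \<kappa> (v s) (w s) \<xi>) \<le> C * (M1 * M2) * (s powr (- (2 / p)) * (norm \<xi> powr \<gamma> * exp (- (\<tau> * sqrt s) * norm \<xi>)))"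
      if s: "s > 0" and x: "\<xi> \<noteq> 0" for s \<xi>
    proof -
      have "aug_norm \<xi> (nonlin \<mu> \<nu> \<kappa> (v s) (w s) \<xi>) \<le> C * (M1 * s powr (- (1 / p)) * (M2 * s powr (- (1 / p)))) * (norm \<xi> powr \<gamma> * exp (- (\<tau> * sqrt s) * norm \<xi>))"
        using v w s \<tau> by (intro CB x) (auto simp: curve_def)
      also have "C * (M1 * s powr (- (1 / p)) * (M2 * s powr (- (1 / p)))) = C * (M1 * M2) * (s powr (- (1 / p)) * s powr (- (1 / p)))" by (simp only: mult_ac)
      also have "s powr (- (1 / p)) * s powr (- (1 / p)) = s powr (- (2 / p))" by (simp add: powr_add[symmetric])
      finally show ?thesis by (simp only: mult.assoc)
    qed
    show "continuous_on {0<..} (\<lambda>s. nonlin \<mu> \<nu> \<kappa> (v s) (w s) \<xi>)" if x: "\<xi> \<noteq> 0" for \<xi>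
      unfolding continuous_on_eq_continuous_at[OF open_greaterThan]
    proof
      fix t :: real assume "t \<in> {0<..}"
      then have t: "t > 0" by simp
      let ?N = "\<lambda>s. nonlin \<mu> \<nu> \<kappa> (v s) (w s) \<xi>"
      \<comment> \<open>Times s are taken above t/2, where s^(-1/p) is at most (t/2)^(-1/p); the
        factor 2 is the comparison of the product norm with the augmented one.\<close>
      define B where "B = 2 * C * (M1 + M2) * (t / 2) powr (- (1 / p)) * norm \<xi> powr \<gamma>"
      have B: "B \<ge> 0" using C M by (simp add: B_def)
      have ev: "\<forall>\<^sub>F s in at t. norm (?N s - ?N t) \<le> B * e" if e: "e > 0" for e
      proof -
        have "\<forall>\<^sub>F s in at t. freq_bound 0 \<sigma> e (\<lambda>\<xi>. v s \<xi> - v t \<xi>)" "\<forall>\<^sub>F s in at t. freq_bound 0 \<sigma> e (\<lambda>\<xi>. w s \<xi> - w t \<xi>)"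
          using v w t e by (auto simp: curve_def time_cont_def)
        then show ?thesis using eventually_at_pos[OF t]
        proof eventually_elim
          case (elim s)
          have s: "s > 0" using elim t by simp
          note vs = curve_freq_bound_0[OF v \<tau> s] and vt = curve_freq_bound_0[OF v \<tau> t]
          note ws = curve_freq_bound_0[OF w \<tau> s] and wt = curve_freq_bound_0[OF w \<tau> t]
          have pw: "s powr (- (1 / p)) \<le> (t / 2) powr (- (1 / p))" "t powr (- (1 / p)) \<le> (t / 2) powr (- (1 / p))"
            using p_bounds t elim(3) by (auto intro!: powr_mono2')
          have 1: "aug_norm \<xi> (nonlin \<mu> \<nu> \<kappa> (\<lambda>\<xi>. v s \<xi> - v t \<xi>) (w s) \<xi>) \<le> C * (e * (M2 * (t / 2) powr (- (1 / p)))) * norm \<xi> powr \<gamma>"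
            using CB[OF _ elim(1) freq_bound_mono[OF ws order_refl mult_left_mono[OF pw(1) M(2)]] x] by simp
          have 2: "aug_norm \<xi> (nonlin \<mu> \<nu> \<kappa> (v t) (\<lambda>\<xi>. w s \<xi> - w t \<xi>) \<xi>) \<le> C * (M1 * (t / 2) powr (- (1 / p)) * e) * norm \<xi> powr \<gamma>"
            using CB[OF _ freq_bound_mono[OF vt order_refl mult_left_mono[OF pw(2) M(1)]] elim(2) x] by simp
          have "?N s - ?N t = nonlin \<mu> \<nu> \<kappa> (\<lambda>\<xi>. v s \<xi> - v t \<xi>) (w s) \<xi> + nonlin \<mu> \<nu> \<kappa> (v t) (\<lambda>\<xi>. w s \<xi> - w t \<xi>) \<xi>"
            using nonlin_diff(1)[OF \<sigma>_bounds order_refl vs vt ws x] nonlin_diff(2)[OF \<sigma>_bounds order_refl ws wt vt x] by simp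
          then have "norm (?N s - ?N t) \<le> 2 * (aug_norm \<xi> (nonlin \<mu> \<nu> \<kappa> (\<lambda>\<xi>. v s \<xi> - v t \<xi>) (w s) \<xi>) + aug_norm \<xi> (nonlin \<mu> \<nu> \<kappa> (v t) (\<lambda>\<xi>. w s \<xi> - w t \<xi>) \<xi>))"
            by (simp only:) (rule order_trans[OF norm_le_aug_norm[of _ \<xi>] mult_left_mono[OF aug_norm_triangle]], simp)
          also have "\<dots> \<le> 2 * (C * (e * (M2 * (t / 2) powr (- (1 / p)))) * norm \<xi> powr \<gamma> + C * (M1 * (t / 2) powr (- (1 / p)) * e) * norm \<xi> powr \<gamma>)"
            using 1 2 by (intro mult_left_mono add_mono) auto
          also have "\<dots> = B * e" by (simp add: B_def algebra_simps)
          finally show ?case .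
        qed
      qed
      show "isCont ?N t"
        unfolding isCont_def
      proof (rule tendstoI)
        fix e' :: real assume e': "e' > 0"
        have "\<forall>\<^sub>F s in at t. norm (?N s - ?N t) \<le> B * (e' / (B + 1))" using B e' by (intro ev) auto
        then show "\<forall>\<^sub>F s in at t. dist (?N s) (?N t) < e'"
        proof eventually_elim
          case (elim s)
          have "B * (e' / (B + 1)) < e'" using B e' by (simp add: field_simps)
          with elim show ?case by (simp add: dist_norm)
        qed
      qed
    qed
  qed
  with C show ?thesis by blast
qed

end

section \<open>Regularity in time\<close>

text \<open>The case b = 1 of \<open>beta_kernel\<close>, moved to start at t1. The factor
  \<open>s powr (1 - 1)\<close> equals 1 on the open interval and is kept so that the two forms
  match.\<close>

lemma shifted_power_kernel:
  fixes a t1 t2 :: real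
  assumes a: "a > 0" and t: "t1 < t2"
  shows "set_integrable lborel {t1<..<t2} (\<lambda>s. (t2 - s) powr (a - 1))" (is ?A)
    and "(LINT s:{t1<..<t2}|lborel. (t2 - s) powr (a - 1))
      = (t2 - t1) powr a * (LINT s:{0<..<1}|lborel. (1 - s) powr (a - 1) * s powr (1 - 1))" (is ?B)
proof -
  let ?h = "t2 - t1"
  let ?f = "\<lambda>s. indicator {t1<..<t2} s *\<^sub>R ((t2 - s) powr (a - 1))"
  let ?g = "\<lambda>s. indicator {0<..<?h} s *\<^sub>R ((?h - s) powr (a - 1) * s powr (1 - 1))"
  have [measurable]: "?f \<in> borel_measurable borel" by measurable
  have h: "?h > 0" using t by simp
  have sc: "?f (t1 + 1 *\<^sub>R s) = ?g s" for s by (auto simp: indicator_def diff_diff_eq)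
  note bk = beta_kernel[OF a zero_less_one h]
  have "integrable lborel ?g" using bk(1) by (simp only: set_integrable_def)
  then show ?A unfolding set_integrable_def
    by (subst lborel_integrable_affine_vec[where t=t1 and c=1]) (simp_all only: sc, measurable)
  have "(LINT s|lborel. ?f s) = (LINT s|lborel. ?f (t1 + 1 *\<^sub>R s))"
    by (subst lborel_integral_affine_vec[where t=t1 and c=1]) auto
  also have "\<dots> = (LINT s|lborel. ?g s)" by (simp only: sc)
  finally show ?B using bk(2) unfolding set_lebesgue_integral_def by simp
qed

text \<open>This absorbs the cost |\<xi>| + |\<xi>|^2 of the generator into an exponential weight;
  both summands follow from x \<le> exp x, the second after squaring.\<close>

lemma power_sum_exp_bound:
  fixes c r :: real
  assumes c: "c > 0" and r: "r > 0"
  shows "(r + r\<^sup>2) * exp (- c * r) \<le> 1 / c + 4 / c\<^sup>2"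
proof -
  have "c * r \<le> exp (c * r)" using exp_ge_add_one_self[of "c * r"] by linarith
  then have "r * c \<le> exp (c * r)" by (simp add: mult.commute)
  then have "r \<le> exp (c * r) / c" using c by (simp only: pos_le_divide_eq)
  then have 1: "r * exp (- c * r) \<le> 1 / c"
    using mult_right_mono[of r "exp (c * r) / c" "exp (- c * r)"] by (simp add: exp_add[symmetric])
  have "c * r / 2 \<le> exp (c * r / 2)" using exp_ge_add_one_self[of "c * r / 2"] by linarith
  then have "(c * r / 2)\<^sup>2 \<le> (exp (c * r / 2))\<^sup>2" using c r by (intro power_mono) auto
  also have "(exp (c * r / 2))\<^sup>2 = exp (c * r)" by (simp add: power2_eq_square exp_add[symmetric])
  finally have "r\<^sup>2 * c\<^sup>2 \<le> 4 * exp (c * r)" by (simp add: power_mult_distrib power_divide mult.commute)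
  then have "r\<^sup>2 \<le> 4 * exp (c * r) / c\<^sup>2" using c by (simp only: pos_le_divide_eq zero_less_power)
  then have 2: "r\<^sup>2 * exp (- c * r) \<le> 4 / c\<^sup>2"
    using mult_right_mono[of "r\<^sup>2" "4 * exp (c * r) / c\<^sup>2" "exp (- c * r)"] by (simp add: exp_add[symmetric] mult.assoc)
  show ?thesis using 1 2 by (simp add: distrib_right)
qed

context nsk_semigroup
begin

text \<open>Mean value inequality in time: the derivative is -W(t) A v, the decay is applied to A v,
  and on [t1, t2] it is weakest at t1. The generator contributes |\<xi>| + |\<xi>|^2 by
  \<open>aug_norm_A_symbol\<close>.\<close>

lemma W_lipschitz:
  "\<exists>L\<ge>0. \<forall>t1 t2 \<xi> v. 0 \<le> t1 \<longrightarrow> t1 \<le> t2 \<longrightarrow>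
     aug_norm \<xi> (W t2 \<xi> v - W t1 \<xi> v) \<le> L * (t2 - t1) * (norm \<xi> + (norm \<xi>)\<^sup>2) * (exp (- c0 * t1 * (norm \<xi>)\<^sup>2) * aug_norm \<xi> v)"
proof -
  obtain K where K: "K \<ge> 0" and KA: "\<And>(\<xi>::real^'n) v. aug_norm \<xi> (A_symbol \<mu> \<nu> \<kappa> \<alpha> \<xi> v) \<le> K * (norm \<xi> + (norm \<xi>)\<^sup>2) * aug_norm \<xi> v"
    using aug_norm_A_symbol by blast
  have "aug_norm \<xi> (W t2 \<xi> v - W t1 \<xi> v) \<le> (C0 * K) * (t2 - t1) * (norm \<xi> + (norm \<xi>)\<^sup>2) * (exp (- c0 * t1 * (norm \<xi>)\<^sup>2) * aug_norm \<xi> v)"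
    if t: "0 \<le> t1" "t1 \<le> t2" for t1 t2 \<xi> v
  proof -
    let ?B = "(C0 * K) * (norm \<xi> + (norm \<xi>)\<^sup>2) * (exp (- c0 * t1 * (norm \<xi>)\<^sup>2) * aug_norm \<xi> v)"
    let ?d = "\<lambda>t. augment \<xi> (- W t \<xi> (A_symbol \<mu> \<nu> \<kappa> \<alpha> \<xi> v))"
    have "norm (augment \<xi> (W t2 \<xi> v) - augment \<xi> (W t1 \<xi> v)) \<le> ?B * norm (t2 - t1)"
    proof (rule differentiable_bound[of "{t1..t2}" "\<lambda>t. augment \<xi> (W t \<xi> v)" "\<lambda>t h. h *\<^sub>R ?d t"])
      fix t assume tt: "t \<in> {t1..t2}"
      have "((\<lambda>t. augment \<xi> (W t \<xi> v)) has_vector_derivative ?d t) (at t within {t1..t2})"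
        unfolding W_eq
        by (rule bounded_linear.has_vector_derivative[OF augment_bounded_linear has_vector_derivative_at_within[OF W_symbol_has_vector_derivative]])
      then show "((\<lambda>t. augment \<xi> (W t \<xi> v)) has_derivative (\<lambda>h. h *\<^sub>R ?d t)) (at t within {t1..t2})"
        by (simp only: has_vector_derivative_def)
      have "norm (?d t) = aug_norm \<xi> (W t \<xi> (A_symbol \<mu> \<nu> \<kappa> \<alpha> \<xi> v))"
        by (simp add: linear_neg[OF bounded_linear.linear[OF augment_bounded_linear]])
      also have "\<dots> \<le> C0 * exp (- c0 * t * (norm \<xi>)\<^sup>2) * aug_norm \<xi> (A_symbol \<mu> \<nu> \<kappa> \<alpha> \<xi> v)"
        using tt t by (intro W_decay) auto
      also have "\<dots> \<le> C0 * exp (- c0 * t1 * (norm \<xi>)\<^sup>2) * (K * (norm \<xi> + (norm \<xi>)\<^sup>2) * aug_norm \<xi> v)"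
        using tt c0_pos C0_pos by (intro mult_mono mult_left_mono KA) (auto intro!: mult_right_mono)
      also have "\<dots> = ?B" by (simp add: mult_ac)
      finally have "norm (?d t) \<le> ?B" .
      then have "norm (h *\<^sub>R ?d t) \<le> ?B * norm h" for h
        unfolding norm_scaleR real_norm_def[symmetric] by (subst mult.commute) (rule mult_right_mono, auto)
      then show "onorm (\<lambda>h. h *\<^sub>R ?d t) \<le> ?B" by (rule onorm_le)
    qed (use t in auto)
    then show ?thesis using t
      by (simp add: linear_diff[OF bounded_linear.linear[OF augment_bounded_linear]] mult_ac)
  qed
  moreover have "C0 * K \<ge> 0" using C0_pos K by simp
  ultimately show ?thesis by blast
qed

text \<open>The constants may depend on m, since they can blow up as m tends to 0; near a given t
  the choice m = t/2 is enough. Ordered pairs suffice because the augmented norm of a difference is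
  symmetric.\<close>

lemma time_cont_from_holder:
  assumes m: "\<And>t. t > 0 \<Longrightarrow> v t \<in> borel_measurable borel"
    and h: "\<And>m. m > 0 \<Longrightarrow> \<exists>Q1 Q2. \<forall>t1 t2 \<xi>. m \<le> t1 \<longrightarrow> t1 < t2 \<longrightarrow> \<xi> \<noteq> 0 \<longrightarrow>
       aug_norm \<xi> (v t2 \<xi> - v t1 \<xi>) \<le> (Q1 * (t2 - t1) + Q2 * (t2 - t1) powr (1 / p)) * norm \<xi> powr (-\<sigma>)"
  shows "time_cont v"
  unfolding time_cont_def
proof (intro allI impI)
  fix t e :: real assume t: "t > 0" and e: "e > 0"
  obtain Q1 Q2 where Q: "\<And>t1 t2 \<xi>. t / 2 \<le> t1 \<Longrightarrow> t1 < t2 \<Longrightarrow> \<xi> \<noteq> 0 \<Longrightarrow>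
       aug_norm \<xi> (v t2 \<xi> - v t1 \<xi>) \<le> (Q1 * (t2 - t1) + Q2 * (t2 - t1) powr (1 / p)) * norm \<xi> powr (-\<sigma>)"
    using h[OF half_gt_zero[OF t]] by blast
  have a0: "((\<lambda>s. \<bar>s - t\<bar>) \<longlongrightarrow> 0) (at t)"
    by (rule tendsto_rabs_zero) (rule LIM_zero[OF tendsto_ident_at])
  have "((\<lambda>s. \<bar>s - t\<bar> powr (1 / p)) \<longlongrightarrow> 0) (at t)"
    by (rule tendsto_zero_powrI[OF a0 tendsto_const _ p_bounds(1)]) auto
  then have "((\<lambda>s. Q1 * \<bar>s - t\<bar> + Q2 * \<bar>s - t\<bar> powr (1 / p)) \<longlongrightarrow> Q1 * 0 + Q2 * 0) (at t)"
    by (intro tendsto_intros a0)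
  then have "\<forall>\<^sub>F s in at t. Q1 * \<bar>s - t\<bar> + Q2 * \<bar>s - t\<bar> powr (1 / p) < e"
    using e by (intro order_tendstoD) auto
  moreover have "\<forall>\<^sub>F s in at t. s \<noteq> t" by (rule eventually_neq_at_within)
  ultimately show "\<forall>\<^sub>F s in at t. freq_bound 0 \<sigma> e (\<lambda>\<xi>. v s \<xi> - v t \<xi>)"
    using eventually_at_pos[OF t]
  proof eventually_elim
    case (elim s)
    have s: "s > 0" using elim t by simp
    note [measurable] = m[OF s] m[OF t]
    have "aug_norm \<xi> (v s \<xi> - v t \<xi>) \<le> e * (norm \<xi> powr (-\<sigma>) * exp (- 0 * norm \<xi>))" if x: "\<xi> \<noteq> 0" for \<xi>
    proof -
      have "aug_norm \<xi> (v s \<xi> - v t \<xi>) \<le> (Q1 * \<bar>s - t\<bar> + Q2 * \<bar>s - t\<bar> powr (1 / p)) * norm \<xi> powr (-\<sigma>)"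
      proof (cases "s < t")
        case True
        then show ?thesis using Q[of s t \<xi>] elim x by (simp add: aug_norm_minus_commute[of _ "v s \<xi>"])
      next
        case False
        then show ?thesis using Q[of t s \<xi>] elim x t by simp
      qed
      also have "\<dots> \<le> e * norm \<xi> powr (-\<sigma>)" using elim by (intro mult_right_mono) auto
      finally show ?thesis by simp
    qed
    then have "AE \<xi> in lborel. aug_norm \<xi> (v s \<xi> - v t \<xi>) \<le> e * (norm \<xi> powr (-\<sigma>) * exp (- 0 * norm \<xi>))"
      using AE_lborel_nonzero by (auto elim!: eventually_mono)
    then show ?case using e unfolding freq_bound_def by auto
  qed
qed

text \<open>The integral is split at t1. On (0, t1) the increment of the semigroup is Lipschitz in
  time at the cost |\<xi>| + |\<xi>|^2, which the weight exp (-c0 sqrt t1 |\<xi>|) absorbs; the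
  short integral over (t1, t2) is bounded directly and yields the power (t2 - t1)^(1/p).\<close>

lemma duh_holder:
  assumes G: "force c0 K G" and m: "m > 0"
  shows "\<exists>Q1 Q2. \<forall>t1 t2 \<xi>. m \<le> t1 \<longrightarrow> t1 < t2 \<longrightarrow> \<xi> \<noteq> 0 \<longrightarrow>
       aug_norm \<xi> (duh G t2 \<xi> - duh G t1 \<xi>) \<le> (Q1 * (t2 - t1) + Q2 * (t2 - t1) powr (1 / p)) * norm \<xi> powr (-\<sigma>)"
proof -
  obtain L where L: "L \<ge> 0" and LW: "\<And>t1 t2 \<xi> v. 0 \<le> t1 \<Longrightarrow> t1 \<le> t2 \<Longrightarrow>
     aug_norm \<xi> (W t2 \<xi> v - W t1 \<xi> v) \<le> L * (t2 - t1) * (norm \<xi> + (norm \<xi>)\<^sup>2) * (exp (- c0 * t1 * (norm \<xi>)\<^sup>2) * aug_norm \<xi> v)"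
    using W_lipschitz by blast
  have K: "K \<ge> 0" using G by (simp add: force_def)
  have hc: "heat_const \<ge> 0" using heat_const_pos by simp
  \<comment> \<open>The smallest analyticity rate over the times t \<ge> m.\<close>
  define c where "c = c0 * sqrt m"
  have c: "c > 0" using c0_pos m by (simp add: c_def)
  define B where "B = (LINT s:{0<..<1}|lborel. (1 - s) powr (1 / p - 1) * s powr (1 - 1))"
  have B: "B \<ge> 0" unfolding B_def set_lebesgue_integral_def by (rule Bochner_Integration.integral_nonneg) auto
  define Q1 where "Q1 = L * (K * heat_const * (1 / c + 4 / c\<^sup>2)) * (kernel_const * m powr (- (1 / p)))"
  define Q2 where "Q2 = C0 * (K * heat_const * m powr (- (2 / p))) * B"
  have "aug_norm \<xi> (duh G t2 \<xi> - duh G t1 \<xi>) \<le> (Q1 * (t2 - t1) + Q2 * (t2 - t1) powr (1 / p)) * norm \<xi> powr (-\<sigma>)"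
    if t1: "m \<le> t1" and t12: "t1 < t2" and x: "\<xi> \<noteq> 0" for t1 t2 \<xi>
  proof -
    define r where "r = norm \<xi>"
    have r: "r > 0" using x by (simp add: r_def)
    have t1p: "t1 > 0" and t2p: "t2 > 0" using t1 t12 m by auto
    let ?S1 = "{0<..<t1}" and ?S2 = "{t1<..<t2}"
    let ?f = "\<lambda>t s. W (t - s) \<xi> (G s \<xi>)"
    have I2: "set_integrable lborel {0<..<t2} (?f t2)" and I1: "set_integrable lborel ?S1 (?f t1)"
      using duh_bound(1)[OF G _ _ _ x] c0_pos t1p t2p by auto
    have I21: "set_integrable lborel ?S1 (?f t2)" "set_integrable lborel ?S2 (?f t2)"
      by (rule set_integrable_subset[OF I2]; use t1p t12 in auto)+
    have "duh G t2 \<xi> = (LINT s:(?S1 \<union> ?S2)|lborel. ?f t2 s)"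
      unfolding duh_def set_lebesgue_integral_def
    proof (rule integral_cong_AE)
      show "(\<lambda>s. indicator {0<..<t2} s *\<^sub>R ?f t2 s) \<in> borel_measurable lborel"
        using I2 unfolding set_integrable_def by (rule borel_measurable_integrable)
      show "(\<lambda>s. indicator (?S1 \<union> ?S2) s *\<^sub>R ?f t2 s) \<in> borel_measurable lborel"
        using set_integrable_Un[OF I21] unfolding set_integrable_def by (intro borel_measurable_integrable) auto
      \<comment> \<open>The two open intervals together miss only the point t1.\<close>
      show "AE s in lborel. indicator {0<..<t2} s *\<^sub>R ?f t2 s = indicator (?S1 \<union> ?S2) s *\<^sub>R ?f t2 s"
        using AE_lborel_singleton[of t1] by eventually_elim (use t12 t1p in \<open>auto simp: indicator_def\<close>)
    qed
    also have "\<dots> = (LINT s:?S1|lborel. ?f t2 s) + (LINT s:?S2|lborel. ?f t2 s)"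
      by (rule set_integral_Un[OF _ I21]) auto
    finally have eq: "duh G t2 \<xi> - duh G t1 \<xi> = (LINT s:?S1|lborel. ?f t2 s - ?f t1 s) + (LINT s:?S2|lborel. ?f t2 s)"
      unfolding duh_def by (simp add: set_integral_diff(2)[OF I21(1) I1])
    have Gc: "continuous_on {0<..} (\<lambda>s. G s \<xi>)" using G x by (simp add: force_def)
    have fb: "exp (- c0 * (t - s) * r\<^sup>2) * aug_norm \<xi> (G s \<xi>) \<le>
        (K * heat_const * (r powr (-\<sigma>) * exp (- (c0 * sqrt t) * r))) * ((t - s) powr (1 / p - 1) * s powr (- (2 / p)))"
      if "0 < s" "s < t" for s t
      unfolding r_def using c0_pos by (intro W_force_bound[OF G _ _ that x]) auto
    let ?k1 = "\<lambda>s. (L * (t2 - t1) * (K * heat_const * (1 / c + 4 / c\<^sup>2) * r powr (-\<sigma>))) * ((t1 - s) powr (1 / p - 1) * s powr (- (2 / p)))"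
    have "aug_norm \<xi> (LINT s:?S1|lborel. ?f t2 s - ?f t1 s) \<le> (LINT s:?S1|lborel. ?k1 s)"
    proof (rule aug_norm_set_integral(2))
      show "set_borel_measurable lborel ?S1 (\<lambda>s. ?f t2 s - ?f t1 s)"
        using set_integral_diff(1)[OF I21(1) I1] unfolding set_integrable_def set_borel_measurable_def by (rule borel_measurable_integrable)
      show "set_integrable lborel ?S1 ?k1" by (intro set_integrable_mult_right kernel(1)[OF t1p])
      fix s assume s: "s \<in> ?S1"
      have "aug_norm \<xi> (?f t2 s - ?f t1 s) \<le> L * ((t2 - s) - (t1 - s)) * (r + r\<^sup>2) * (exp (- c0 * (t1 - s) * r\<^sup>2) * aug_norm \<xi> (G s \<xi>))"
        unfolding r_def using s t12 by (intro LW) auto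
      also have "\<dots> \<le> L * (t2 - t1) * (r + r\<^sup>2) * ((K * heat_const * (r powr (-\<sigma>) * exp (- (c0 * sqrt t1) * r))) * ((t1 - s) powr (1 / p - 1) * s powr (- (2 / p))))"
        using s t12 L r fb[of s t1] by (simp only: diff_diff_eq2 add_diff_cancel_right' diff_add_cancel, intro mult_left_mono) auto
      also have "\<dots> = (L * (t2 - t1) * (K * heat_const * ((r + r\<^sup>2) * exp (- (c0 * sqrt t1) * r)) * r powr (-\<sigma>))) * ((t1 - s) powr (1 / p - 1) * s powr (- (2 / p)))"
        by (simp only: mult_ac)
      also have "\<dots> \<le> ?k1 s"
      proof -
        have "c0 * sqrt m \<le> c0 * sqrt t1" using t1 c0_pos by (intro mult_left_mono) auto
        then have "exp (- (c0 * sqrt t1) * r) \<le> exp (- c * r)" unfolding c_def using r by (simp add: mult_right_mono)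
        then have "(r + r\<^sup>2) * exp (- (c0 * sqrt t1) * r) \<le> (r + r\<^sup>2) * exp (- c * r)" using r by (intro mult_left_mono) auto
        also have "\<dots> \<le> 1 / c + 4 / c\<^sup>2" by (rule power_sum_exp_bound[OF c r])
        finally show ?thesis using L t12 K hc by (intro mult_right_mono mult_left_mono) auto
      qed
      finally show "aug_norm \<xi> (?f t2 s - ?f t1 s) \<le> ?k1 s" .
    qed
    also have "\<dots> = (L * (t2 - t1) * (K * heat_const * (1 / c + 4 / c\<^sup>2) * r powr (-\<sigma>))) * (kernel_const * t1 powr (- (1 / p)))"
      by (simp only: set_integral_mult_right kernel(2)[OF t1p])
    also have "\<dots> \<le> (L * (t2 - t1) * (K * heat_const * (1 / c + 4 / c\<^sup>2) * r powr (-\<sigma>))) * (kernel_const * m powr (- (1 / p)))"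
      using L t12 K hc c m t1 kernel_const_nonneg p_bounds by (intro mult_left_mono powr_mono2') auto
    also have "\<dots> = Q1 * (t2 - t1) * r powr (-\<sigma>)" by (simp only: Q1_def mult_ac)
    finally have b1: "aug_norm \<xi> (LINT s:?S1|lborel. ?f t2 s - ?f t1 s) \<le> Q1 * (t2 - t1) * r powr (-\<sigma>)" .
    let ?k2 = "\<lambda>s. (C0 * (K * heat_const * m powr (- (2 / p)) * r powr (-\<sigma>))) * ((t2 - s) powr (1 / p - 1))"
    have "aug_norm \<xi> (LINT s:?S2|lborel. ?f t2 s) \<le> (LINT s:?S2|lborel. ?k2 s)"
    proof (rule aug_norm_set_integral(2))
      show "set_borel_measurable lborel ?S2 (?f t2)"
        using I21(2) unfolding set_integrable_def set_borel_measurable_def by (rule borel_measurable_integrable)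
      show "set_integrable lborel ?S2 ?k2" by (intro set_integrable_mult_right shifted_power_kernel(1) p_bounds t12)
      fix s assume s: "s \<in> ?S2"
      then have sp: "0 < s" "s < t2" "m \<le> s" using t1 m by auto
      have "aug_norm \<xi> (?f t2 s) \<le> C0 * (exp (- c0 * (t2 - s) * r\<^sup>2) * aug_norm \<xi> (G s \<xi>))"
        using W_decay[of "t2 - s" \<xi> "G s \<xi>"] sp by (simp add: r_def mult.assoc)
      also have "\<dots> \<le> C0 * ((K * heat_const * (r powr (-\<sigma>) * exp (- (c0 * sqrt t2) * r))) * ((t2 - s) powr (1 / p - 1) * s powr (- (2 / p))))"
        using C0_pos by (intro mult_left_mono fb sp) auto
      also have "\<dots> \<le> C0 * ((K * heat_const * (r powr (-\<sigma>) * 1)) * ((t2 - s) powr (1 / p - 1) * m powr (- (2 / p))))"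
        using C0_pos K hc c0_pos r t2p sp m p_gt_2 by (intro mult_left_mono mult_mono powr_mono2') auto
      finally show "aug_norm \<xi> (?f t2 s) \<le> ?k2 s" by (simp only: mult_ac mult_1_right mult_1_left)
    qed
    also have "\<dots> = (C0 * (K * heat_const * m powr (- (2 / p)) * r powr (-\<sigma>))) * ((t2 - t1) powr (1 / p) * B)"
      unfolding B_def by (simp only: set_integral_mult_right shifted_power_kernel(2)[OF p_bounds(1) t12])
    also have "\<dots> = Q2 * (t2 - t1) powr (1 / p) * r powr (-\<sigma>)" by (simp only: Q2_def mult_ac)
    finally have b2: "aug_norm \<xi> (LINT s:?S2|lborel. ?f t2 s) \<le> Q2 * (t2 - t1) powr (1 / p) * r powr (-\<sigma>)" .
    show ?thesis
      unfolding eq distrib_right r_def[symmetric]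
      by (rule order_trans[OF aug_norm_triangle add_mono[OF b1 b2]])
  qed
  then show ?thesis by blast
qed

section \<open>Linear and bilinear parts of the Duhamel map\<close>

text \<open>The bound holds at every nonzero frequency, so that the iterates built from the datum
  obey pointwise bounds as well.\<close>

definition datum :: "real \<Rightarrow> (real^'n \<Rightarrow> complex \<times> (complex^'n)) \<Rightarrow> bool" where
  "datum \<rho> v0 \<longleftrightarrow> 0 \<le> \<rho> \<and> v0 \<in> borel_measurable borel \<and> (\<forall>\<xi>. \<xi> \<noteq> 0 \<longrightarrow> aug_norm \<xi> (v0 \<xi>) \<le> \<rho> * norm \<xi> powr (- (real CARD('n) - 1)))"

definition lin :: "(real^'n \<Rightarrow> complex \<times> (complex^'n)) \<Rightarrow> real \<Rightarrow> real^'n \<Rightarrow> complex \<times> (complex^'n)" where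
  "lin v0 t \<xi> = (if \<xi> = 0 then 0 else W t \<xi> (v0 \<xi>))"

definition bilin :: "(real \<Rightarrow> real^'n \<Rightarrow> complex \<times> (complex^'n)) \<Rightarrow> (real \<Rightarrow> real^'n \<Rightarrow> complex \<times> (complex^'n))
    \<Rightarrow> real \<Rightarrow> real^'n \<Rightarrow> complex \<times> (complex^'n)" where
  "bilin v w t \<xi> = (if \<xi> = 0 then 0 else duh (\<lambda>s. nonlin \<mu> \<nu> \<kappa> (v s) (w s)) t \<xi>)"

text \<open>With \<theta> = 1/p the parabolic decay turns |\<xi>|^(-(d-1)) into t^(-1/p)
  |\<xi>|^(-\<sigma>), the size of a curve, and already with the full rate c0 sqrt t.\<close>

lemma datum_heat:
  assumes v0: "datum \<rho> v0" and t: "t > 0" and x: "\<xi> \<noteq> 0"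
  shows "exp (- c0 * t * (norm \<xi>)\<^sup>2) * aug_norm \<xi> (v0 \<xi>) \<le> heat_const * \<rho> * curve_weight c0 t \<xi>"
proof -
  have r: "norm \<xi> > 0" using x by simp
  have e: "exp (- c0 * t * (norm \<xi>)\<^sup>2) \<le> heat_const * (t powr (- (1 / p)) * norm \<xi> powr (- 2 * (1 / p)) * exp (- (c0 * sqrt t) * norm \<xi>))"
    using heat_gevrey_bound[of 0 t "norm \<xi>" c0 "1 / p"] t r c0_pos p_bounds by simp
  have "exp (- c0 * t * (norm \<xi>)\<^sup>2) * aug_norm \<xi> (v0 \<xi>) \<le>
     heat_const * (t powr (- (1 / p)) * norm \<xi> powr (- 2 * (1 / p)) * exp (- (c0 * sqrt t) * norm \<xi>)) * (\<rho> * norm \<xi> powr (- (real CARD('n) - 1)))"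
    using e v0 x heat_const_pos by (intro mult_mono) (auto simp: datum_def)
  also have "\<dots> = heat_const * \<rho> * (t powr (- (1 / p)) * ((norm \<xi> powr (- 2 * (1 / p)) * norm \<xi> powr (- (real CARD('n) - 1))) * exp (- (c0 * sqrt t) * norm \<xi>)))"
    by (simp only: mult_ac)
  also have "norm \<xi> powr (- 2 * (1 / p)) * norm \<xi> powr (- (real CARD('n) - 1)) = norm \<xi> powr (-\<sigma>)"
    by (simp add: powr_add[symmetric] \<sigma>_def algebra_simps)
  finally show ?thesis by (simp only: curve_weight_def)
qed

lemma lin_bound:
  assumes v0: "datum \<rho> v0" and t: "t > 0" and x: "\<xi> \<noteq> 0"
  shows "aug_norm \<xi> (lin v0 t \<xi>) \<le> C0 * heat_const * \<rho> * curve_weight c0 t \<xi>"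
proof -
  have "aug_norm \<xi> (lin v0 t \<xi>) \<le> C0 * (exp (- c0 * t * (norm \<xi>)\<^sup>2) * aug_norm \<xi> (v0 \<xi>))"
    using W_decay[of t \<xi> "v0 \<xi>"] t x by (simp add: lin_def mult.assoc)
  also have "\<dots> \<le> C0 * (heat_const * \<rho> * curve_weight c0 t \<xi>)"
    using C0_pos by (intro mult_left_mono datum_heat[OF v0 t x]) auto
  finally show ?thesis by (simp only: mult.assoc)
qed

lemma lin_curve:
  assumes v0: "datum \<rho> v0"
  shows "curve c0 (C0 * heat_const * \<rho>) (lin v0)"
proof (rule curveI)
  have \<rho>: "\<rho> \<ge> 0" using v0 by (simp add: datum_def)
  show "0 \<le> C0 * heat_const * \<rho>" using \<rho> C0_pos heat_const_pos by simp
  have [measurable]: "v0 \<in> borel_measurable borel" using v0 by (simp add: datum_def)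
  show m: "lin v0 t \<in> borel_measurable borel" for t
  proof -
    have "(\<lambda>\<xi>. (t, \<xi>, v0 \<xi>)) \<in> borel_measurable borel" by measurable
    from measurable_compose[OF this W_symbol_measurable]
    have "(\<lambda>\<xi>. W t \<xi> (v0 \<xi>)) \<in> borel_measurable borel" by (simp add: W_eq)
    then show ?thesis unfolding lin_def[abs_def] by measurable
  qed
  show "AE \<xi> in lborel. aug_norm \<xi> (lin v0 t \<xi>) \<le> C0 * heat_const * \<rho> * curve_weight c0 t \<xi>" if "t > 0" for t
    using AE_lborel_nonzero by eventually_elim (rule lin_bound[OF v0 that])
  obtain L where L: "L \<ge> 0" and LW: "\<And>t1 t2 \<xi> v. 0 \<le> t1 \<Longrightarrow> t1 \<le> t2 \<Longrightarrow>
     aug_norm \<xi> (W t2 \<xi> v - W t1 \<xi> v) \<le> L * (t2 - t1) * (norm \<xi> + (norm \<xi>)\<^sup>2) * (exp (- c0 * t1 * (norm \<xi>)\<^sup>2) * aug_norm \<xi> v)"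
    using W_lipschitz by blast
  show "time_cont (lin v0)"
  proof (rule time_cont_from_holder[OF m])
    fix m :: real assume m: "m > 0"
    define c where "c = c0 * sqrt m"
    have c: "c > 0" using c0_pos m by (simp add: c_def)
    define Q where "Q = L * (heat_const * \<rho> * m powr (- (1 / p))) * (1 / c + 4 / c\<^sup>2)"
    \<comment> \<open>No time integral is involved, so the free evolution is Lipschitz on t \<ge> m
      and the Hoelder coefficient is 0.\<close>
    have "aug_norm \<xi> (lin v0 t2 \<xi> - lin v0 t1 \<xi>) \<le> (Q * (t2 - t1) + 0 * (t2 - t1) powr (1 / p)) * norm \<xi> powr (-\<sigma>)"
      if t1: "m \<le> t1" and t12: "t1 < t2" and x: "\<xi> \<noteq> 0" for t1 t2 \<xi>
    proof -
      define r where "r = norm \<xi>"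
      have r: "r > 0" using x by (simp add: r_def)
      have t1p: "t1 > 0" using t1 m by simp
      have "aug_norm \<xi> (lin v0 t2 \<xi> - lin v0 t1 \<xi>) \<le> L * (t2 - t1) * (r + r\<^sup>2) * (exp (- c0 * t1 * (norm \<xi>)\<^sup>2) * aug_norm \<xi> (v0 \<xi>))"
        using LW[of t1 t2 \<xi> "v0 \<xi>"] t1p t12 x by (simp add: lin_def r_def)
      also have "\<dots> \<le> L * (t2 - t1) * (r + r\<^sup>2) * (heat_const * \<rho> * curve_weight c0 t1 \<xi>)"
        using L t12 r by (intro mult_left_mono datum_heat[OF v0 t1p x]) auto
      also have "\<dots> = L * (t2 - t1) * (heat_const * \<rho> * t1 powr (- (1 / p))) * ((r + r\<^sup>2) * exp (- (c0 * sqrt t1) * r)) * r powr (-\<sigma>)"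
        by (simp only: curve_weight_def r_def mult_ac)
      also have "\<dots> \<le> L * (t2 - t1) * (heat_const * \<rho> * m powr (- (1 / p))) * (1 / c + 4 / c\<^sup>2) * r powr (-\<sigma>)"
      proof (intro mult_right_mono mult_mono mult_left_mono)
        show "t1 powr (- (1 / p)) \<le> m powr (- (1 / p))" using t1 m p_bounds by (intro powr_mono2') auto
        have "c0 * sqrt m \<le> c0 * sqrt t1" using t1 c0_pos by (intro mult_left_mono) auto
        then have "exp (- (c0 * sqrt t1) * r) \<le> exp (- c * r)" unfolding c_def using r by (simp add: mult_right_mono)
        then have "(r + r\<^sup>2) * exp (- (c0 * sqrt t1) * r) \<le> (r + r\<^sup>2) * exp (- c * r)" using r by (intro mult_left_mono) auto
        also have "\<dots> \<le> 1 / c + 4 / c\<^sup>2" by (rule power_sum_exp_bound[OF c r])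
        finally show "(r + r\<^sup>2) * exp (- (c0 * sqrt t1) * r) \<le> 1 / c + 4 / c\<^sup>2" .
      qed (use L t12 heat_const_pos \<rho> r in auto)
      also have "\<dots> = (Q * (t2 - t1) + 0 * (t2 - t1) powr (1 / p)) * norm \<xi> powr (-\<sigma>)" by (simp add: Q_def r_def mult_ac)
      finally show ?thesis .
    qed
    then show "\<exists>Q1 Q2. \<forall>t1 t2 \<xi>. m \<le> t1 \<longrightarrow> t1 < t2 \<longrightarrow> \<xi> \<noteq> 0 \<longrightarrow>
       aug_norm \<xi> (lin v0 t2 \<xi> - lin v0 t1 \<xi>) \<le> (Q1 * (t2 - t1) + Q2 * (t2 - t1) powr (1 / p)) * norm \<xi> powr (-\<sigma>)" by blast
  qed
qed

text \<open>The constant is uniform in \<tau>. Being a curve again is claimed only for \<tau> = c0,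
  because the time regularity of a Duhamel integral is drawn from the exponential weight of its
  force.\<close>

lemma bilin_bound:
  "\<exists>C>0. \<forall>\<tau> M1 M2 v w. 0 \<le> \<tau> \<longrightarrow> \<tau> \<le> c0 \<longrightarrow> curve \<tau> M1 v \<longrightarrow> curve \<tau> M2 w \<longrightarrow>
     (\<forall>t>0. \<forall>\<xi>. \<xi> \<noteq> 0 \<longrightarrow> set_integrable lborel {0<..<t} (\<lambda>s. W (t - s) \<xi> (nonlin \<mu> \<nu> \<kappa> (v s) (w s) \<xi>)) \<and>
        aug_norm \<xi> (bilin v w t \<xi>) \<le> C * (M1 * M2) * curve_weight \<tau> t \<xi>) \<and>
     (\<tau> = c0 \<longrightarrow> curve c0 (C * (M1 * M2)) (bilin v w))"
proof -
  obtain C where C: "C \<ge> 0" and CF: "\<And>\<tau> M1 M2 v w. 0 \<le> \<tau> \<Longrightarrow> curve \<tau> M1 v \<Longrightarrow> curve \<tau> M2 w \<Longrightarrow>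
     force \<tau> (C * (M1 * M2)) (\<lambda>s. nonlin \<mu> \<nu> \<kappa> (v s) (w s))"
    using nonlin_force by blast
  \<comment> \<open>Adding 1 makes the constant strictly positive, so that it can later be divided
    by.\<close>
  define D where "D = C0 * heat_const * kernel_const * C + 1"
  have D: "D > 0" using C C0_pos heat_const_pos kernel_const_nonneg by (simp add: D_def add_nonneg_pos)
  have "(\<forall>t>0. \<forall>\<xi>. \<xi> \<noteq> 0 \<longrightarrow> set_integrable lborel {0<..<t} (\<lambda>s. W (t - s) \<xi> (nonlin \<mu> \<nu> \<kappa> (v s) (w s) \<xi>)) \<and>
        aug_norm \<xi> (bilin v w t \<xi>) \<le> D * (M1 * M2) * curve_weight \<tau> t \<xi>) \<and>
     (\<tau> = c0 \<longrightarrow> curve c0 (D * (M1 * M2)) (bilin v w))"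
    if \<tau>: "0 \<le> \<tau>" "\<tau> \<le> c0" and v: "curve \<tau> M1 v" and w: "curve \<tau> M2 w" for \<tau> M1 M2 v w
  proof (intro conjI allI impI)
    note F = CF[OF \<tau>(1) v w]
    have M: "0 \<le> M1" "0 \<le> M2" using v w by (auto simp: curve_def)
    show I: "set_integrable lborel {0<..<t} (\<lambda>s. W (t - s) \<xi> (nonlin \<mu> \<nu> \<kappa> (v s) (w s) \<xi>))" if "t > 0" "\<xi> \<noteq> 0" for t \<xi>
      using duh_bound(1)[OF F \<tau> that] .
    show bb: "aug_norm \<xi> (bilin v w t \<xi>) \<le> D * (M1 * M2) * curve_weight \<tau> t \<xi>" if t: "t > 0" and x: "\<xi> \<noteq> 0" for t \<xi>
    proof -
      have "aug_norm \<xi> (bilin v w t \<xi>) \<le> C0 * heat_const * kernel_const * (C * (M1 * M2)) * curve_weight \<tau> t \<xi>"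
        using duh_bound(2)[OF F \<tau> t x] x by (simp add: bilin_def)
      also have "\<dots> \<le> D * (M1 * M2) * curve_weight \<tau> t \<xi>"
        using M by (intro mult_right_mono) (auto simp: D_def curve_weight_def algebra_simps)
      finally show ?thesis .
    qed
    assume \<tau>c: "\<tau> = c0"
    show "curve c0 (D * (M1 * M2)) (bilin v w)"
    proof (rule curveI)
      show "0 \<le> D * (M1 * M2)" using D M by simp
      show m: "bilin v w t \<in> borel_measurable borel" for t
        using duh_measurable[OF F, of t] by (simp add: bilin_def[abs_def])
      show "AE \<xi> in lborel. aug_norm \<xi> (bilin v w t \<xi>) \<le> D * (M1 * M2) * curve_weight c0 t \<xi>" if "t > 0" for t
        using AE_lborel_nonzero by eventually_elim (use bb[OF that] \<tau>c in simp)
      show "time_cont (bilin v w)"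
      proof (rule time_cont_from_holder[OF m])
        fix m :: real assume "m > 0"
        from duh_holder[OF F[unfolded \<tau>c] this] obtain Q1 Q2 where Q: "\<forall>t1 t2 \<xi>. m \<le> t1 \<longrightarrow> t1 < t2 \<longrightarrow> \<xi> \<noteq> 0 \<longrightarrow>
          aug_norm \<xi> (duh (\<lambda>s. nonlin \<mu> \<nu> \<kappa> (v s) (w s)) t2 \<xi> - duh (\<lambda>s. nonlin \<mu> \<nu> \<kappa> (v s) (w s)) t1 \<xi>) \<le> (Q1 * (t2 - t1) + Q2 * (t2 - t1) powr (1 / p)) * norm \<xi> powr (-\<sigma>)"
          by blast
        show "\<exists>Q1 Q2. \<forall>t1 t2 \<xi>. m \<le> t1 \<longrightarrow> t1 < t2 \<longrightarrow> \<xi> \<noteq> 0 \<longrightarrow>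
          aug_norm \<xi> (bilin v w t2 \<xi> - bilin v w t1 \<xi>) \<le> (Q1 * (t2 - t1) + Q2 * (t2 - t1) powr (1 / p)) * norm \<xi> powr (-\<sigma>)"
          by (intro exI[of _ Q1] exI[of _ Q2]) (use Q in \<open>simp add: bilin_def\<close>)
      qed
    qed
  qed
  with D show ?thesis by blast
qed

text \<open>Bilinearity is used at each time s and transported through the linear map W. All four
  Duhamel integrals must converge before they can be combined, hence the curve hypotheses.\<close>

lemma bilin_diff:
  assumes \<tau>: "0 \<le> \<tau>" "\<tau> \<le> c0" and v: "curve \<tau> M1 v" and w: "curve \<tau> M2 w" and t: "t > 0"
  shows "bilin v v t \<xi> - bilin w w t \<xi> = bilin (\<lambda>t \<xi>. v t \<xi> - w t \<xi>) v t \<xi> + bilin w (\<lambda>t \<xi>. v t \<xi> - w t \<xi>) t \<xi>"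
proof (cases "\<xi> = 0")
  case True then show ?thesis by (simp add: bilin_def)
next
  case x: False
  note vw = curve_diff[OF v w]
  have I: "set_integrable lborel {0<..<t} (\<lambda>s. W (t - s) \<xi> (nonlin \<mu> \<nu> \<kappa> (u1 s) (u2 s) \<xi>))"
    if "curve \<tau> N1 u1" "curve \<tau> N2 u2" for u1 u2 N1 N2
    using bilin_bound \<tau> that t x by blast
  have e: "W (t - s) \<xi> (nonlin \<mu> \<nu> \<kappa> (v s) (v s) \<xi>) - W (t - s) \<xi> (nonlin \<mu> \<nu> \<kappa> (w s) (w s) \<xi>)
     = W (t - s) \<xi> (nonlin \<mu> \<nu> \<kappa> (\<lambda>\<xi>. v s \<xi> - w s \<xi>) (v s) \<xi>) + W (t - s) \<xi> (nonlin \<mu> \<nu> \<kappa> (w s) (\<lambda>\<xi>. v s \<xi> - w s \<xi>) \<xi>)"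
    if s: "s \<in> {0<..<t}" for s
  proof -
    have sp: "s > 0" using s by simp
    note vs = curve_freq_bound_0[OF v \<tau>(1) sp] and ws = curve_freq_bound_0[OF w \<tau>(1) sp]
    have "nonlin \<mu> \<nu> \<kappa> (v s) (v s) \<xi> - nonlin \<mu> \<nu> \<kappa> (w s) (w s) \<xi> = nonlin \<mu> \<nu> \<kappa> (\<lambda>\<xi>. v s \<xi> - w s \<xi>) (v s) \<xi> + nonlin \<mu> \<nu> \<kappa> (w s) (\<lambda>\<xi>. v s \<xi> - w s \<xi>) \<xi>"
      using nonlin_diff(1)[OF \<sigma>_bounds order_refl vs ws vs x] nonlin_diff(2)[OF \<sigma>_bounds order_refl vs ws ws x] by simp
    then show ?thesis
      by (simp only: linear_diff[OF W_linear, symmetric] linear_add[OF W_linear, symmetric])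
  qed
  have "bilin v v t \<xi> - bilin w w t \<xi> = (LINT s:{0<..<t}|lborel. W (t - s) \<xi> (nonlin \<mu> \<nu> \<kappa> (v s) (v s) \<xi>) - W (t - s) \<xi> (nonlin \<mu> \<nu> \<kappa> (w s) (w s) \<xi>))"
    using x by (simp add: bilin_def duh_def set_integral_diff(2)[OF I[OF v v] I[OF w w]])
  also have "\<dots> = (LINT s:{0<..<t}|lborel. W (t - s) \<xi> (nonlin \<mu> \<nu> \<kappa> (\<lambda>\<xi>. v s \<xi> - w s \<xi>) (v s) \<xi>) + W (t - s) \<xi> (nonlin \<mu> \<nu> \<kappa> (w s) (\<lambda>\<xi>. v s \<xi> - w s \<xi>) \<xi>))"
    by (rule set_lebesgue_integral_cong) (use e in auto)
  also have "\<dots> = bilin (\<lambda>t \<xi>. v t \<xi> - w t \<xi>) v t \<xi> + bilin w (\<lambda>t \<xi>. v t \<xi> - w t \<xi>) t \<xi>"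
    using x by (simp add: bilin_def duh_def set_integral_add(2)[OF I[OF vw v] I[OF w vw]])
  finally show ?thesis .
qed

end

section \<open>The fixed point\<close>

lemma le_zero_from_geometric:
  fixes x c :: real
  assumes "\<And>k::nat. x \<le> c / 2 ^ k"
  shows "x \<le> 0"
proof (rule LIMSEQ_le_const)
  show "(\<lambda>k. c / 2 ^ k) \<longlonglongrightarrow> 0"
    using tendsto_mult_right_zero[OF LIMSEQ_power_zero[of "1/2::real"], of c] by (simp add: power_divide)
qed (use assms in blast)

lemma aug_norm_eq_zero: "aug_norm \<xi> v \<le> 0 \<Longrightarrow> v = 0"
  using norm_le_aug_norm[of v \<xi>] by simp

context nsk_semigroup
begin

lemma curve_weight_nonneg: "curve_weight \<tau> t \<xi> \<ge> 0"
  by (simp add: curve_weight_def)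

lemma curve_bound:
  assumes "curve \<tau> M v" "t > 0"
  shows "AE \<xi> in lborel. aug_norm \<xi> (v t \<xi>) \<le> M * curve_weight \<tau> t \<xi>"
  using assms by (simp add: curve_def freq_bound_def curve_weight_def mult.assoc)

lemma curve_measurable: "curve \<tau> M v \<Longrightarrow> t > 0 \<Longrightarrow> v t \<in> borel_measurable borel"
  by (simp add: curve_def freq_bound_def)

text \<open>Time continuity does not involve the constant M, so only the size has to be proved
  anew.\<close>

lemma curve_improve:
  assumes "curve \<tau> M v" "0 \<le> M'" "\<And>t. t > 0 \<Longrightarrow> AE \<xi> in lborel. aug_norm \<xi> (v t \<xi>) \<le> M' * curve_weight \<tau> t \<xi>"
  shows "curve \<tau> M' v"
  using assms curve_measurable by (intro curveI) (auto simp: curve_def)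

lemma curve_improve_pointwise:
  assumes "curve \<tau> M v" "0 \<le> M'" "\<And>t \<xi>. t > 0 \<Longrightarrow> \<xi> \<noteq> 0 \<Longrightarrow> aug_norm \<xi> (v t \<xi>) \<le> M' * curve_weight \<tau> t \<xi>"
  shows "curve \<tau> M' v"
proof (rule curve_improve[OF assms(1,2)])
  show "AE \<xi> in lborel. aug_norm \<xi> (v t \<xi>) \<le> M' * curve_weight \<tau> t \<xi>" if "t > 0" for t
    using AE_lborel_nonzero by eventually_elim (rule assms(3)[OF that])
qed

lemma curve_unique:
  assumes C: "C > 0" and CB: "\<And>M1 M2 v w t \<xi>. curve 0 M1 v \<Longrightarrow> curve 0 M2 w \<Longrightarrow> t > 0 \<Longrightarrow> \<xi> \<noteq> 0 \<Longrightarrow>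
      aug_norm \<xi> (bilin v w t \<xi>) \<le> C * (M1 * M2) * curve_weight 0 t \<xi>"
    and v: "curve 0 M v" and w: "curve 0 M w" and CM: "4 * C * M \<le> 1"
    and eq: "\<And>t. t > 0 \<Longrightarrow> AE \<xi> in lborel. v t \<xi> - w t \<xi> = bilin v v t \<xi> - bilin w w t \<xi>"
    and t: "t > 0"
  shows "AE \<xi> in lborel. v t \<xi> = w t \<xi>"
proof -
  let ?d = "\<lambda>t \<xi>. v t \<xi> - w t \<xi>"
  have M: "M \<ge> 0" using v by (simp add: curve_def)
  have "curve 0 (2 * M / 2 ^ k) ?d" for k
  proof (induction k)
    case 0 show ?case using curve_diff[OF v w] by simp
  next
    case (Suc k)
    show ?case
    proof (rule curve_improve[OF Suc])
      show "0 \<le> 2 * M / 2 ^ Suc k" using M by simp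
      fix t :: real assume t: "t > 0"
      show "AE \<xi> in lborel. aug_norm \<xi> (v t \<xi> - w t \<xi>) \<le> 2 * M / 2 ^ Suc k * curve_weight 0 t \<xi>"
        using eq[OF t] AE_lborel_nonzero
      proof eventually_elim
        case (elim \<xi>)
        let ?X = "M / 2 ^ k * curve_weight 0 t \<xi>"
        have X: "?X \<ge> 0" using M curve_weight_nonneg by simp
        have "aug_norm \<xi> (v t \<xi> - w t \<xi>) = aug_norm \<xi> (bilin ?d v t \<xi> + bilin w ?d t \<xi>)"
          using elim(1) bilin_diff[OF order_refl _ v w t] c0_pos by simp
        also have "\<dots> \<le> C * (2 * M / 2 ^ k * M) * curve_weight 0 t \<xi> + C * (M * (2 * M / 2 ^ k)) * curve_weight 0 t \<xi>"
          by (rule order_trans[OF aug_norm_triangle add_mono[OF CB[OF Suc v t elim(2)] CB[OF w Suc t elim(2)]]])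
        also have "\<dots> = (4 * C * M) * ?X" by (simp add: field_simps)
        also have "\<dots> \<le> 1 * ?X" by (rule mult_right_mono[OF CM X])
        also have "\<dots> = 2 * M / 2 ^ Suc k * curve_weight 0 t \<xi>" by simp
        finally show ?case .
      qed
    qed
  qed
  then have "AE \<xi> in lborel. aug_norm \<xi> (?d t \<xi>) \<le> 2 * M / 2 ^ k * curve_weight 0 t \<xi>" for k
    using t by (rule curve_bound)
  \<comment> \<open>The exceptional sets for the countably many k are united before k tends to
    infinity.\<close>
  then have "AE \<xi> in lborel. \<forall>k::nat. aug_norm \<xi> (?d t \<xi>) \<le> 2 * M / 2 ^ k * curve_weight 0 t \<xi>"
    by (simp add: AE_all_countable)
  then show ?thesis
  proof eventually_elim
    case (elim \<xi>)
    have "aug_norm \<xi> (?d t \<xi>) \<le> 0"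
      by (rule le_zero_from_geometric[where c="2 * M * curve_weight 0 t \<xi>"]) (use elim in simp)
    from aug_norm_eq_zero[OF this] show ?case by simp
  qed
qed

section \<open>Picard iteration\<close>

primrec picard :: "(real^'n \<Rightarrow> complex \<times> (complex^'n)) \<Rightarrow> nat \<Rightarrow> real \<Rightarrow> real^'n \<Rightarrow> complex \<times> (complex^'n)" where
  "picard v0 0 = lin v0"
| "picard v0 (Suc k) = (\<lambda>t \<xi>. lin v0 t \<xi> + bilin (picard v0 k) (picard v0 k) t \<xi>)"

text \<open>All estimates hold at every nonzero frequency and positive time, so the iterates
  converge pointwise and completeness of the finite-dimensional target suffices. The free evolution
  takes M/2 and the bilinear term at most M/4 of the available size M.\<close>

lemma picard_converges:
  assumes C: "C > 0" and CB: "\<And>M1 M2 v w t \<xi>. curve c0 M1 v \<Longrightarrow> curve c0 M2 w \<Longrightarrow> t > 0 \<Longrightarrow> \<xi> \<noteq> 0 \<Longrightarrow>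
      aug_norm \<xi> (bilin v w t \<xi>) \<le> C * (M1 * M2) * curve_weight c0 t \<xi>"
    and CC: "\<And>M1 M2 v w. curve c0 M1 v \<Longrightarrow> curve c0 M2 w \<Longrightarrow> curve c0 (C * (M1 * M2)) (bilin v w)"
    and CM: "4 * C * M \<le> 1" and M: "0 \<le> M" and v0: "datum \<rho> v0" and \<rho>: "C0 * heat_const * \<rho> \<le> M / 2"
  shows "\<exists>v. curve c0 M v \<and> (\<forall>t>0. \<forall>\<xi>. \<xi> \<noteq> 0 \<longrightarrow> v t \<xi> = lin v0 t \<xi> + bilin v v t \<xi>)"
proof -
  let ?v = "picard v0"
  let ?\<omega> = "curve_weight c0"
  have CMM: "C * (M * M) \<le> M / 4" using mult_right_mono[OF CM M] by simp
  \<comment> \<open>A curve carries only almost everywhere bounds, so the pointwise bound is taken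
    through the induction beside it.\<close>
  have P: "curve c0 M (?v k) \<and> (\<forall>t>0. \<forall>\<xi>. \<xi> \<noteq> 0 \<longrightarrow> aug_norm \<xi> (?v k t \<xi>) \<le> M * ?\<omega> t \<xi>)" for k
  proof (induction k)
    case 0
    have b: "aug_norm \<xi> (lin v0 t \<xi>) \<le> M * ?\<omega> t \<xi>" if "t > 0" "\<xi> \<noteq> 0" for t \<xi>
      by (rule order_trans[OF lin_bound[OF v0 that] mult_right_mono[OF _ curve_weight_nonneg]]) (use \<rho> M in linarith)
    show ?case using curve_improve_pointwise[OF lin_curve[OF v0] M b] b by simp
  next
    case (Suc k)
    then have cv: "curve c0 M (?v k)" by simp
    have b: "aug_norm \<xi> (?v (Suc k) t \<xi>) \<le> M * ?\<omega> t \<xi>" if t: "t > 0" and x: "\<xi> \<noteq> 0" for t \<xi>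
    proof -
      have "aug_norm \<xi> (?v (Suc k) t \<xi>) \<le> C0 * heat_const * \<rho> * ?\<omega> t \<xi> + C * (M * M) * ?\<omega> t \<xi>"
        unfolding picard.simps by (rule order_trans[OF aug_norm_triangle add_mono[OF lin_bound[OF v0 t x] CB[OF cv cv t x]]])
      also have "\<dots> = (C0 * heat_const * \<rho> + C * (M * M)) * ?\<omega> t \<xi>" by (simp add: distrib_right)
      also have "\<dots> \<le> M * ?\<omega> t \<xi>" using \<rho> CMM M by (intro mult_right_mono curve_weight_nonneg) linarith
      finally show ?thesis .
    qed
    have "curve c0 (C0 * heat_const * \<rho> + C * (M * M)) (?v (Suc k))"
      unfolding picard.simps by (rule curve_add[OF lin_curve[OF v0] CC[OF cv cv]])
    from curve_improve_pointwise[OF this M b] b show ?case by blast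
  qed
  have cv: "curve c0 M (?v k)" for k using P by blast
  have pb: "aug_norm \<xi> (?v k t \<xi>) \<le> M * ?\<omega> t \<xi>" if "t > 0" "\<xi> \<noteq> 0" for k t \<xi> using P that by blast
  have D: "aug_norm \<xi> (?v (Suc k) t \<xi> - ?v k t \<xi>) \<le> M / 2 ^ k * ?\<omega> t \<xi>" if "t > 0" "\<xi> \<noteq> 0" for k t \<xi>
    using that
  proof (induction k arbitrary: t \<xi>)
    case 0
    have "aug_norm \<xi> (bilin (?v 0) (?v 0) t \<xi>) \<le> C * (M * M) * ?\<omega> t \<xi>" by (rule CB[OF cv cv 0])
    also have "\<dots> \<le> M * ?\<omega> t \<xi>" using CMM M by (intro mult_right_mono curve_weight_nonneg) linarith
    finally show ?case by simp
  next
    case (Suc k)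
    let ?d = "\<lambda>t \<xi>. ?v (Suc k) t \<xi> - ?v k t \<xi>"
    have M2: "0 \<le> M / 2 ^ k" using M by simp
    have cd: "curve c0 (M / 2 ^ k) ?d"
      using curve_improve_pointwise[OF curve_diff[OF cv cv] M2 Suc.IH] .
    have "?v (Suc (Suc k)) t \<xi> - ?v (Suc k) t \<xi> = bilin (?v (Suc k)) (?v (Suc k)) t \<xi> - bilin (?v k) (?v k) t \<xi>"
      by (simp only: picard.simps(2)) simp
    also have "\<dots> = bilin ?d (?v (Suc k)) t \<xi> + bilin (?v k) ?d t \<xi>"
      using c0_pos by (intro bilin_diff[OF _ order_refl cv cv Suc.prems(1)]) auto
    finally have "aug_norm \<xi> (?v (Suc (Suc k)) t \<xi> - ?v (Suc k) t \<xi>) \<le> C * (M / 2 ^ k * M) * ?\<omega> t \<xi> + C * (M * (M / 2 ^ k)) * ?\<omega> t \<xi>"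
      by (simp only:) (rule order_trans[OF aug_norm_triangle add_mono[OF CB[OF cd cv Suc.prems] CB[OF cv cd Suc.prems]]])
    also have "\<dots> = (4 * C * M) * (M / 2 ^ Suc k * ?\<omega> t \<xi>)" by (simp add: field_simps)
    also have "\<dots> \<le> 1 * (M / 2 ^ Suc k * ?\<omega> t \<xi>)" using M curve_weight_nonneg by (intro mult_right_mono CM) auto
    finally show ?case by simp
  qed
  \<comment> \<open>The factor 1 - 1/2^m is that of the geometric partial sum; it lets the induction
    on m close.\<close>
  have T: "aug_norm \<xi> (?v (k + m) t \<xi> - ?v k t \<xi>) \<le> (2 * M / 2 ^ k) * (1 - 1 / 2 ^ m) * ?\<omega> t \<xi>" if tx: "t > 0" "\<xi> \<noteq> 0" for k m t \<xi>
  proof (induction m)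
    case (Suc m)
    have "aug_norm \<xi> (?v (k + Suc m) t \<xi> - ?v k t \<xi>) \<le> aug_norm \<xi> (?v (Suc (k + m)) t \<xi> - ?v (k + m) t \<xi>) + aug_norm \<xi> (?v (k + m) t \<xi> - ?v k t \<xi>)"
      using aug_norm_triangle[of \<xi> "?v (Suc (k + m)) t \<xi> - ?v (k + m) t \<xi>" "?v (k + m) t \<xi> - ?v k t \<xi>"] by (simp del: picard.simps)
    also have "\<dots> \<le> M / 2 ^ (k + m) * ?\<omega> t \<xi> + (2 * M / 2 ^ k) * (1 - 1 / 2 ^ m) * ?\<omega> t \<xi>"
      by (rule add_mono[OF D[OF tx] Suc])
    also have "\<dots> = (2 * M / 2 ^ k) * (1 - 1 / 2 ^ Suc m) * ?\<omega> t \<xi>" by (simp add: power_add field_simps)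
    finally show ?case .
  qed simp
  have T2: "aug_norm \<xi> (?v (k + m) t \<xi> - ?v k t \<xi>) \<le> 2 * M / 2 ^ k * ?\<omega> t \<xi>" if tx: "t > 0" "\<xi> \<noteq> 0" for k m t \<xi>
  proof -
    have "(2 * M / 2 ^ k) * (1 - 1 / 2 ^ m) \<le> (2 * M / 2 ^ k) * 1"
      by (rule mult_left_mono) (use M in auto)
    then show ?thesis by (intro order_trans[OF T[OF tx]] mult_right_mono curve_weight_nonneg) simp
  qed
  have conv: "convergent (\<lambda>k. ?v k t \<xi>)" if tx: "t > 0" "\<xi> \<noteq> 0" for t \<xi>
  proof -
    have "summable (\<lambda>k. ?v (Suc k) t \<xi> - ?v k t \<xi>)"
    proof (rule summable_comparison_test'[where N=0])
      show "summable (\<lambda>k. 2 * (M * ?\<omega> t \<xi>) * (1/2) ^ k)" by (intro summable_mult summable_geometric) simp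
      show "norm (?v (Suc k) t \<xi> - ?v k t \<xi>) \<le> 2 * (M * ?\<omega> t \<xi>) * (1/2) ^ k" for k
        using norm_le_aug_norm[of "?v (Suc k) t \<xi> - ?v k t \<xi>" \<xi>] D[OF tx, of k] by (simp add: power_divide)
    qed
    from summable_LIMSEQ[OF this]
    have "(\<lambda>n. ?v n t \<xi> - ?v 0 t \<xi>) \<longlonglongrightarrow> (\<Sum>k. ?v (Suc k) t \<xi> - ?v k t \<xi>)"
      by (simp only: sum_lessThan_telescope[of "\<lambda>k. ?v k t \<xi>"])
    then have "(\<lambda>n. (?v n t \<xi> - ?v 0 t \<xi>) + ?v 0 t \<xi>) \<longlonglongrightarrow> (\<Sum>k. ?v (Suc k) t \<xi> - ?v k t \<xi>) + ?v 0 t \<xi>"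
      by (intro tendsto_add tendsto_const)
    then have "(\<lambda>n. ?v n t \<xi>) \<longlonglongrightarrow> (\<Sum>k. ?v (Suc k) t \<xi> - ?v k t \<xi>) + ?v 0 t \<xi>"
      by (simp only: diff_add_cancel)
    then show ?thesis unfolding convergent_def by blast
  qed
  define v where "v t \<xi> = (if 0 < t \<and> \<xi> \<noteq> 0 then lim (\<lambda>k. ?v k t \<xi>) else 0)" for t \<xi>
  have lim: "(\<lambda>k. ?v k t \<xi>) \<longlonglongrightarrow> v t \<xi>" if "t > 0" "\<xi> \<noteq> 0" for t \<xi>
    using conv[OF that] that by (simp add: v_def convergent_LIMSEQ_iff)
  have alim: "(\<lambda>k. aug_norm \<xi> (?v k t \<xi> - z)) \<longlonglongrightarrow> aug_norm \<xi> (v t \<xi> - z)" if "t > 0" "\<xi> \<noteq> 0" for t \<xi> z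
    by (intro tendsto_norm bounded_linear.tendsto[OF augment_bounded_linear] tendsto_diff lim that tendsto_const)
  have vb: "aug_norm \<xi> (v t \<xi>) \<le> M * ?\<omega> t \<xi>" if "t > 0" "\<xi> \<noteq> 0" for t \<xi>
    using LIMSEQ_le_const2[OF alim[OF that, of 0]] pb[OF that] by auto
  have vd: "aug_norm \<xi> (v t \<xi> - ?v k t \<xi>) \<le> 2 * M / 2 ^ k * ?\<omega> t \<xi>" if tx: "t > 0" "\<xi> \<noteq> 0" for k t \<xi>
  proof (rule LIMSEQ_le_const2)
    show "(\<lambda>m. aug_norm \<xi> (?v (m + k) t \<xi> - ?v k t \<xi>)) \<longlonglongrightarrow> aug_norm \<xi> (v t \<xi> - ?v k t \<xi>)"
      by (rule LIMSEQ_ignore_initial_segment[OF alim[OF tx]])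
    show "\<exists>N. \<forall>m\<ge>N. aug_norm \<xi> (?v (m + k) t \<xi> - ?v k t \<xi>) \<le> 2 * M / 2 ^ k * ?\<omega> t \<xi>"
      using T2[OF tx, of k] by (auto simp: add.commute)
  qed
  have vm: "v t \<in> borel_measurable borel" if t: "t > 0" for t
  proof (rule borel_measurable_LIMSEQ_metric)
    fix k
    have [measurable]: "?v k t \<in> borel_measurable borel" by (rule curve_measurable[OF cv t])
    show "(\<lambda>\<xi>. if \<xi> \<noteq> 0 then ?v k t \<xi> else 0) \<in> borel_measurable borel" by measurable
  next
    fix \<xi> show "(\<lambda>k. if \<xi> \<noteq> 0 then ?v k t \<xi> else 0) \<longlonglongrightarrow> v t \<xi>"
      using lim[OF t, of \<xi>] by (cases "\<xi> = 0") (auto simp: v_def)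
  qed
  have tc: "time_cont v"
    unfolding time_cont_def
  proof (intro allI impI)
    fix t e :: real assume t: "t > 0" and e: "e > 0"
    \<comment> \<open>Half of e goes to the continuity of one iterate, half to the two tails at s
      and t; each tail is at most B / 2^k / 2 times |\<xi>|^(-\<sigma>) as long as both times exceed
      t/2.\<close>
    define B where "B = 4 * M * (t / 2) powr (- (1 / p))"
    have "(\<lambda>k. B / 2 ^ k) \<longlonglongrightarrow> 0"
      using tendsto_mult_right_zero[OF LIMSEQ_power_zero[of "1/2::real"], of B] by (simp add: power_divide)
    then have "\<forall>\<^sub>F k in sequentially. B / 2 ^ k < e / 2" using e by (intro order_tendstoD) auto
    then obtain k where k: "B / 2 ^ k < e / 2" by (auto simp: eventually_sequentially)
    have "\<forall>\<^sub>F s in at t. freq_bound 0 \<sigma> (e/2) (\<lambda>\<xi>. ?v k s \<xi> - ?v k t \<xi>)"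
      using cv[of k] t e by (auto simp: curve_def time_cont_def)
    then show "\<forall>\<^sub>F s in at t. freq_bound 0 \<sigma> e (\<lambda>\<xi>. v s \<xi> - v t \<xi>)"
      using eventually_at_pos[OF t]
    proof eventually_elim
      case (elim s)
      have s: "s > 0" using elim t by simp
      note [measurable] = vm[OF s] vm[OF t]
      have w: "2 * M / 2 ^ k * ?\<omega> s' \<xi> \<le> B / 2 ^ k / 2 * norm \<xi> powr (-\<sigma>)" if "t / 2 < s'" for s' \<xi>
      proof -
        have "s' powr (- (1 / p)) \<le> (t / 2) powr (- (1 / p))" using that t p_bounds by (intro powr_mono2') auto
        moreover have "exp (- (c0 * sqrt s') * norm \<xi>) \<le> 1" using c0_pos that t by simp
        ultimately have "?\<omega> s' \<xi> \<le> (t / 2) powr (- (1 / p)) * (norm \<xi> powr (-\<sigma>) * 1)"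
          unfolding curve_weight_def by (intro mult_mono) auto
        then have "2 * M / 2 ^ k * ?\<omega> s' \<xi> \<le> 2 * M / 2 ^ k * ((t / 2) powr (- (1 / p)) * (norm \<xi> powr (-\<sigma>) * 1))"
          using M by (intro mult_left_mono) auto
        then show ?thesis by (simp add: B_def)
      qed
      have "AE \<xi> in lborel. aug_norm \<xi> (?v k s \<xi> - ?v k t \<xi>) \<le> e / 2 * (norm \<xi> powr (-\<sigma>) * exp (- 0 * norm \<xi>))"
        using elim(1) unfolding freq_bound_def by blast
      then have "AE \<xi> in lborel. aug_norm \<xi> (v s \<xi> - v t \<xi>) \<le> e * (norm \<xi> powr (-\<sigma>) * exp (- 0 * norm \<xi>))"
        using AE_lborel_nonzero
      proof eventually_elim
        case (elim \<xi>)
        have h: "t / 2 < s" "t / 2 < t" using \<open>t / 2 < s \<and> s < 2 * t\<close> t by auto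
        have "v s \<xi> - v t \<xi> = (v s \<xi> - ?v k s \<xi>) + ((?v k s \<xi> - ?v k t \<xi>) - (v t \<xi> - ?v k t \<xi>))" by simp
        then have "aug_norm \<xi> (v s \<xi> - v t \<xi>) \<le> aug_norm \<xi> (v s \<xi> - ?v k s \<xi>) + (aug_norm \<xi> (?v k s \<xi> - ?v k t \<xi>) + aug_norm \<xi> (v t \<xi> - ?v k t \<xi>))"
          by (simp only:) (intro order_trans[OF aug_norm_triangle] add_left_mono aug_norm_diff)
        also have "\<dots> \<le> B / 2 ^ k / 2 * norm \<xi> powr (-\<sigma>) + (e / 2 * norm \<xi> powr (-\<sigma>) + B / 2 ^ k / 2 * norm \<xi> powr (-\<sigma>))"
          using elim(1) by (intro add_mono order_trans[OF vd[OF s elim(2)] w[OF h(1)]] order_trans[OF vd[OF t elim(2)] w[OF h(2)]]) simp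
        also have "\<dots> = (B / 2 ^ k + e / 2) * norm \<xi> powr (-\<sigma>)" by (simp add: algebra_simps)
        also have "\<dots> \<le> e * norm \<xi> powr (-\<sigma>)"
        proof (rule mult_right_mono)
          show "B / 2 ^ k + e / 2 \<le> e" using k by linarith
        qed simp
        finally show ?case by simp
      qed
      then show ?case using e unfolding freq_bound_def by auto
    qed
  qed
  have cvv: "curve c0 M v"
  proof (rule curveI[OF M vm _ tc])
    show "AE \<xi> in lborel. aug_norm \<xi> (v t \<xi>) \<le> M * ?\<omega> t \<xi>" if "t > 0" for t
      using AE_lborel_nonzero by eventually_elim (rule vb[OF that])
  qed
  moreover have "v t \<xi> = lin v0 t \<xi> + bilin v v t \<xi>" if tx: "t > 0" "\<xi> \<noteq> 0" for t \<xi>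
  proof -
    \<comment> \<open>The defect of the limit is estimated through \<open>bilin_diff\<close>, so no
      limit is taken inside the Duhamel integral.\<close>
    have "aug_norm \<xi> (v t \<xi> - (lin v0 t \<xi> + bilin v v t \<xi>)) \<le> (3 * M * ?\<omega> t \<xi>) / 2 ^ k" for k
    proof -
      let ?d = "\<lambda>t \<xi>. ?v k t \<xi> - v t \<xi>"
      have M2: "0 \<le> 2 * M / 2 ^ k" using M by simp
      have cd: "curve c0 (2 * M / 2 ^ k) ?d"
        by (rule curve_improve_pointwise[OF curve_diff[OF cv cvv] M2]) (simp only: aug_norm_minus_commute[of _ "?v k _ _"], rule vd)
      have "?v (Suc k) t \<xi> - (lin v0 t \<xi> + bilin v v t \<xi>) = bilin (?v k) (?v k) t \<xi> - bilin v v t \<xi>"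
        by simp
      also have "\<dots> = bilin ?d (?v k) t \<xi> + bilin v ?d t \<xi>"
        using c0_pos by (intro bilin_diff[OF _ order_refl cv cvv tx(1)]) auto
      finally have e1: "?v (Suc k) t \<xi> - (lin v0 t \<xi> + bilin v v t \<xi>) = bilin ?d (?v k) t \<xi> + bilin v ?d t \<xi>" .
      have "aug_norm \<xi> (?v (Suc k) t \<xi> - (lin v0 t \<xi> + bilin v v t \<xi>)) \<le> C * (2 * M / 2 ^ k * M) * ?\<omega> t \<xi> + C * (M * (2 * M / 2 ^ k)) * ?\<omega> t \<xi>"
        unfolding e1 by (rule order_trans[OF aug_norm_triangle add_mono[OF CB[OF cd cv tx] CB[OF cvv cd tx]]])
      also have "\<dots> = (4 * C * M) * (M / 2 ^ k * ?\<omega> t \<xi>)" by (simp add: field_simps)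
      also have "\<dots> \<le> 1 * (M / 2 ^ k * ?\<omega> t \<xi>)" using M curve_weight_nonneg by (intro mult_right_mono CM) auto
      finally have b1: "aug_norm \<xi> (?v (Suc k) t \<xi> - (lin v0 t \<xi> + bilin v v t \<xi>)) \<le> M / 2 ^ k * ?\<omega> t \<xi>" by simp
      have "v t \<xi> - (lin v0 t \<xi> + bilin v v t \<xi>) = (v t \<xi> - ?v (Suc k) t \<xi>) + (?v (Suc k) t \<xi> - (lin v0 t \<xi> + bilin v v t \<xi>))"
        by (simp del: picard.simps)
      then have "aug_norm \<xi> (v t \<xi> - (lin v0 t \<xi> + bilin v v t \<xi>)) \<le> 2 * M / 2 ^ Suc k * ?\<omega> t \<xi> + M / 2 ^ k * ?\<omega> t \<xi>"
        by (simp only:) (rule order_trans[OF aug_norm_triangle add_mono[OF vd[OF tx] b1]])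
      also have "\<dots> \<le> (3 * M * ?\<omega> t \<xi>) / 2 ^ k"
        using M curve_weight_nonneg[of c0 t \<xi>] by (simp add: field_simps)
      finally show ?thesis .
    qed
    from aug_norm_eq_zero[OF le_zero_from_geometric[OF this]] show ?thesis by simp
  qed
  ultimately show ?thesis by blast
qed

end

section \<open>From frequency functions to distributions\<close>

lemma weighted_sup_le:
  fixes h :: "real^'n::finite \<Rightarrow> 'b::{real_normed_vector, second_countable_topology}"
  assumes [measurable]: "h \<in> borel_measurable borel"
    and "AE \<xi> in lborel. norm \<xi> powr r * norm (h \<xi>) \<le> B"
  shows "weighted_sup r h \<le> ennreal B"
  unfolding weighted_sup_def
proof (rule esssup_I)
  show "(\<lambda>\<xi>. ennreal (norm \<xi> powr r * norm (h \<xi>))) \<in> borel_measurable lborel" by measurable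
  show "AE \<xi> in lborel. ennreal (norm \<xi> powr r * norm (h \<xi>)) \<le> ennreal B"
    using assms(2) by eventually_elim (rule ennreal_leI)
qed

lemma weighted_sup_AE:
  assumes "weighted_sup r h \<le> ennreal B" "0 \<le> B"
  shows "AE \<xi> in lborel. norm \<xi> powr r * norm (h \<xi>) \<le> B"
proof -
  have "AE \<xi> in lborel. ennreal (norm \<xi> powr r * norm (h \<xi>)) \<le> weighted_sup r h"
    unfolding weighted_sup_def by (rule esssup_AE)
  then show ?thesis
  proof eventually_elim
    case (elim \<xi>)
    then have "ennreal (norm \<xi> powr r * norm (h \<xi>)) \<le> ennreal B" using assms(1) by (rule order_trans)
    then show ?case using assms(2) by (simp add: ennreal_le_iff)
  qed
qed

lemma powr_mult_le_iff:
  fixes x B r :: real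
  assumes "n > 0"
  shows "n powr r * x \<le> B \<longleftrightarrow> x \<le> B * n powr (-r)"
proof -
  have "n powr r > 0" using assms by simp
  then have "n powr r * x \<le> B \<longleftrightarrow> x \<le> B / n powr r" by (simp add: pos_le_divide_eq mult.commute)
  then show ?thesis by (simp add: powr_minus divide_inverse)
qed

text \<open>At the origin both powers are 0, so the two inequalities can disagree there; they are
  equivalent at every other point.\<close>

lemma weighted_AE_iff:
  "(AE \<xi> in lborel. norm \<xi> powr r * x \<xi> \<le> B) \<longleftrightarrow> (AE \<xi> in lborel. x \<xi> \<le> B * norm (\<xi>::'a::euclidean_space) powr (-r))"
proof -
  have "AE \<xi> in lborel. (norm \<xi> powr r * x \<xi> \<le> B) = (x \<xi> \<le> B * norm (\<xi>::'a) powr (-r))"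
    using AE_lborel_nonzero by eventually_elim (rule powr_mult_le_iff, simp)
  then show ?thesis by (rule eventually_subst)
qed

text \<open>\<open>hat\<close> chooses a representative for each distribution separately, so
  additivity is available only up to a null set.\<close>

lemma hat_diff:
  assumes "\<exists>h. has_fourier_function T h" "\<exists>h. has_fourier_function S h"
  shows "AE \<xi> in lborel. hat (T - S) \<xi> = hat T \<xi> - hat S \<xi>"
  by (rule hat_unique[OF has_fourier_function_diff[OF has_fourier_function_hat[OF assms(1)] has_fourier_function_hat[OF assms(2)]]])

lemma hatv_diff:
  assumes "\<And>j. \<exists>h. has_fourier_function (T $ j) h" "\<And>j. \<exists>h. has_fourier_function (S $ j) h"
  shows "AE \<xi> in lborel. hatv (T - S) \<xi> = hatv T \<xi> - hatv S \<xi>"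
proof -
  have "AE \<xi> in lborel. \<forall>j. hat (T $ j - S $ j) \<xi> = hat (T $ j) \<xi> - hat (S $ j) \<xi>"
    using hat_diff[OF assms] by (simp add: eventually_all_finite)
  then show ?thesis by eventually_elim (simp add: hatv_def vec_eq_iff)
qed

lemma hatv_measurable:
  assumes "\<And>j. \<exists>h. has_fourier_function (T $ j) h"
  shows "hatv T \<in> borel_measurable borel"
  unfolding hatv_def by (rule borel_measurable_vec_lambda) (rule hat_measurable[OF assms])

lemma tendsto_zero_ennrealI:
  fixes f :: "'a \<Rightarrow> ennreal"
  assumes "\<And>e::real. e > 0 \<Longrightarrow> \<forall>\<^sub>F x in F. f x \<le> ennreal e"
  shows "(f \<longlongrightarrow> 0) F"
proof (rule order_tendstoI)
  fix a :: ennreal assume "0 < a"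
  then obtain b where b: "0 < b" "b < a" using dense by blast
  have "b \<noteq> top" using b(2) top.extremum_strict[of a] by auto
  then obtain e where e: "b = ennreal e" "0 \<le> e" by (cases b) auto
  then have "e > 0" using b by (simp add: ennreal_zero_less_mult_iff[symmetric])
  from assms[OF this] show "\<forall>\<^sub>F x in F. f x < a" by eventually_elim (use e b in simp)
qed simp

lemma PM_member:
  assumes m: "h \<in> borel_measurable borel" and s: "0 \<le> s" "s < real CARD('n)" 
    and b: "AE \<xi> in lborel. norm (h \<xi>) \<le> B * norm (\<xi>::real^'n::finite) powr (-s)"
  shows "\<exists>T\<in>tempered. has_fourier_function T h \<and> T \<in> PM s"
proof -
  obtain T where T: "T \<in> tempered" "has_fourier_function T h" using tempered_exists[OF m s b] by blast
  have "AE \<xi> in lborel. norm (hat T \<xi>) \<le> B * norm \<xi> powr (-s)"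
    using hat_unique[OF T(2)] b by eventually_elim simp
  then have "PM_norm s T \<le> ennreal B" unfolding PM_norm_def
    using T(2) by (intro weighted_sup_le hat_measurable) (auto simp: weighted_AE_iff)
  then have "PM_norm s T < \<infinity>" by (simp add: le_less_trans)
  then show ?thesis using T by (auto simp: PM_def)
qed

context nsk_semigroup
begin

definition spectral :: "(real \<Rightarrow> 'n functional) \<Rightarrow> (real \<Rightarrow> ('n functional)^'n) \<Rightarrow> real \<Rightarrow> real^'n \<Rightarrow> complex \<times> (complex^'n)" where
  "spectral a u t \<xi> = (hat (a t) \<xi>, hatv (u t) \<xi>)"

lemma duhamel_spectral:
  "duhamel \<mu> \<nu> \<kappa> \<alpha> a u t \<xi> s = W (t - s) \<xi> (nonlin \<mu> \<nu> \<kappa> (spectral a u s) (spectral a u s) \<xi>)"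
  by (simp add: duhamel_def W_eq nonlin_diagonal spectral_def)

lemma K_exponents: "real CARD('n) - 1 + 2 / p = \<sigma>" "real CARD('n) + 2 / p = \<sigma> + 1"
  by (auto simp: \<sigma>_def)

lemma K_norm_bound:
  assumes "K_norm N p r x \<le> ennreal R" "0 \<le> R" "t > 0"
  shows "N (r + 2 / p) (x t) \<le> ennreal (R * t powr (- (1 / p)))"
proof -
  let ?q = "t powr (1 / p)"
  have q: "t powr (- (1 / p)) * ?q = 1" using assms(3) by (simp add: powr_add[symmetric])
  have "ennreal ?q * N (r + 2 / p) (x t) \<le> K_norm N p r x"
    unfolding K_norm_def by (rule SUP_upper) (use assms in auto)
  then have "ennreal ?q * N (r + 2 / p) (x t) \<le> ennreal R" using assms(1) by (rule order_trans)
  then have "ennreal (t powr (- (1 / p))) * (ennreal ?q * N (r + 2 / p) (x t)) \<le> ennreal (t powr (- (1 / p))) * ennreal R"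
    by (rule mult_left_mono) simp
  then show ?thesis
    by (simp add: mult.assoc[symmetric] ennreal_mult[symmetric] q assms(2) mult.commute[of R])
qed

text \<open>The three norms in X bound a, |\<xi>| a and u by R each, which explains the factor 3. No
  exponential weight is available for an arbitrary element of X, so the curve has \<tau> =
  0.\<close>

lemma X_space_curve:
  assumes X: "(a, u) \<in> X_space p" and XR: "X_norm p a u \<le> ennreal R" and R: "0 \<le> R"
  shows "curve 0 (3 * R) (spectral a u)"
proof -
  have aK: "a \<in> K_space PM PM_norm p (real CARD('n) - 1)" "a \<in> K_space PM PM_norm p (real CARD('n))"
    and uK: "u \<in> K_space PMv PMv_norm p (real CARD('n) - 1)" using X by (auto simp: X_space_def)
  have Na: "K_norm PM_norm p (real CARD('n) - 1) a \<le> ennreal R" "K_norm PM_norm p (real CARD('n)) a \<le> ennreal R"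
    and Nu: "K_norm PMv_norm p (real CARD('n) - 1) u \<le> ennreal R"
  proof -
    have "max (K_norm PM_norm p (real CARD('n) - 1) a) (K_norm PM_norm p (real CARD('n)) a) \<le> X_norm p a u"
      "K_norm PMv_norm p (real CARD('n) - 1) u \<le> X_norm p a u" by (auto simp: X_norm_def add_increasing add_increasing2)
    then show "K_norm PM_norm p (real CARD('n) - 1) a \<le> ennreal R" "K_norm PM_norm p (real CARD('n)) a \<le> ennreal R"
      "K_norm PMv_norm p (real CARD('n) - 1) u \<le> ennreal R" using XR by (auto simp del: max_less_iff_conj dest: order_trans)
  qed
  have aF: "\<exists>h. has_fourier_function (a t) h" if "t > 0" for t using aK(1) that by (auto simp: K_space_def PM_def)
  have uF: "\<exists>h. has_fourier_function (u t $ j) h" if "t > 0" for t j using uK that by (auto simp: K_space_def PMv_def)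
  have comb: "aug_norm \<xi> z \<le> 3 * b * norm \<xi> powr (-\<sigma>)"
    if "norm (fst z) \<le> b * norm \<xi> powr (-\<sigma>)" "norm (fst z) \<le> b * norm \<xi> powr (-(\<sigma>+1))" "norm (snd z) \<le> b * norm \<xi> powr (-\<sigma>)" "\<xi> \<noteq> 0"
    for z b and \<xi> :: "real^'n"
  proof -
    have "norm \<xi> * norm \<xi> powr (-(\<sigma>+1)) = norm \<xi> powr (1 + (-(\<sigma>+1)))" using that(4) by (subst powr_add) (simp add: powr_one)
    then have e: "norm \<xi> * norm \<xi> powr (-(\<sigma>+1)) = norm \<xi> powr (-\<sigma>)" by simp
    have "norm \<xi> * norm (fst z) \<le> norm \<xi> * (b * norm \<xi> powr (-(\<sigma>+1)))" using that(2) by (intro mult_left_mono) auto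
    also have "\<dots> = b * norm \<xi> powr (-\<sigma>)" unfolding e[symmetric] by (simp only: mult_ac)
    finally show ?thesis using aug_norm_le[of \<xi> z] that(1,3) by linarith
  qed
  have meas: "spectral a u t \<in> borel_measurable borel" if "t > 0" for t
    unfolding spectral_def[abs_def] using hat_measurable[OF aF[OF that]] hatv_measurable[OF uF[OF that]] by measurable
  show ?thesis
  proof (rule curveI)
    show "0 \<le> 3 * R" using R by simp
    show "spectral a u t \<in> borel_measurable borel" if "t > 0" for t by (rule meas[OF that])
    fix t :: real assume t: "t > 0"
    have RT: "0 \<le> R * t powr (- (1 / p))" using R by simp
    have "AE \<xi> in lborel. norm \<xi> powr \<sigma> * norm (hat (a t) \<xi>) \<le> R * t powr (- (1 / p))"
      using weighted_sup_AE[OF K_norm_bound[OF Na(1) R t, unfolded PM_norm_def] RT] by (simp only: K_exponents)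
    moreover have "AE \<xi> in lborel. norm \<xi> powr (\<sigma> + 1) * norm (hat (a t) \<xi>) \<le> R * t powr (- (1 / p))"
      using weighted_sup_AE[OF K_norm_bound[OF Na(2) R t, unfolded PM_norm_def] RT] by (simp only: K_exponents)
    moreover have "AE \<xi> in lborel. norm \<xi> powr \<sigma> * norm (hatv (u t) \<xi>) \<le> R * t powr (- (1 / p))"
      using weighted_sup_AE[OF K_norm_bound[OF Nu R t, unfolded PMv_norm_def] RT] by (simp only: K_exponents)
    ultimately have "AE \<xi> in lborel. norm (hat (a t) \<xi>) \<le> R * t powr (- (1 / p)) * norm \<xi> powr (-\<sigma>)"
      "AE \<xi> in lborel. norm (hat (a t) \<xi>) \<le> R * t powr (- (1 / p)) * norm \<xi> powr (-(\<sigma>+1))"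
      "AE \<xi> in lborel. norm (hatv (u t) \<xi>) \<le> R * t powr (- (1 / p)) * norm \<xi> powr (-\<sigma>)"
      by (simp_all only: weighted_AE_iff)
    then show "AE \<xi> in lborel. aug_norm \<xi> (spectral a u t \<xi>) \<le> 3 * R * curve_weight 0 t \<xi>"
      using AE_lborel_nonzero
    proof eventually_elim
      case (elim \<xi>)
      have "aug_norm \<xi> (spectral a u t \<xi>) \<le> 3 * (R * t powr (- (1 / p))) * norm \<xi> powr (-\<sigma>)"
        by (rule comb) (use elim in \<open>auto simp: spectral_def\<close>)
      then show ?case by (simp add: curve_weight_def mult.assoc)
    qed
  next
    show "time_cont (spectral a u)"
      unfolding time_cont_def
    proof (intro allI impI)
      fix t e :: real assume t: "t > 0" and e: "e > 0"
      have e3: "0 < ennreal (e/3)" "0 \<le> e / 3" using e by auto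
      have "((\<lambda>s. PM_norm \<sigma> (a s - a t)) \<longlongrightarrow> 0) (at t)" "((\<lambda>s. PM_norm (\<sigma>+1) (a s - a t)) \<longlongrightarrow> 0) (at t)"
        "((\<lambda>s. PMv_norm \<sigma> (u s - u t)) \<longlongrightarrow> 0) (at t)"
        using aK uK t unfolding K_space_def K_exponents by auto
      then have "\<forall>\<^sub>F s in at t. PM_norm \<sigma> (a s - a t) < ennreal (e/3)" "\<forall>\<^sub>F s in at t. PM_norm (\<sigma>+1) (a s - a t) < ennreal (e/3)"
        "\<forall>\<^sub>F s in at t. PMv_norm \<sigma> (u s - u t) < ennreal (e/3)"
        using e3(1) by (auto intro: order_tendstoD)
      then show "\<forall>\<^sub>F s in at t. freq_bound 0 \<sigma> e (\<lambda>\<xi>. spectral a u s \<xi> - spectral a u t \<xi>)"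
        using eventually_at_pos[OF t]
      proof eventually_elim
        case (elim s)
        have s: "s > 0" using elim t by simp
        have "AE \<xi> in lborel. norm \<xi> powr \<sigma> * norm (hat (a s - a t) \<xi>) \<le> e / 3"
          by (rule weighted_sup_AE[OF less_imp_le[OF elim(1)[unfolded PM_norm_def]] e3(2)])
        moreover have "AE \<xi> in lborel. norm \<xi> powr (\<sigma>+1) * norm (hat (a s - a t) \<xi>) \<le> e / 3"
          by (rule weighted_sup_AE[OF less_imp_le[OF elim(2)[unfolded PM_norm_def]] e3(2)])
        moreover have "AE \<xi> in lborel. norm \<xi> powr \<sigma> * norm (hatv (u s - u t) \<xi>) \<le> e / 3"
          by (rule weighted_sup_AE[OF less_imp_le[OF elim(3)[unfolded PMv_norm_def]] e3(2)])
        ultimately have "AE \<xi> in lborel. norm (hat (a s - a t) \<xi>) \<le> e / 3 * norm \<xi> powr (-\<sigma>)"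
          "AE \<xi> in lborel. norm (hat (a s - a t) \<xi>) \<le> e / 3 * norm \<xi> powr (-(\<sigma>+1))"
          "AE \<xi> in lborel. norm (hatv (u s - u t) \<xi>) \<le> e / 3 * norm \<xi> powr (-\<sigma>)"
          by (simp_all only: weighted_AE_iff)
        then have "AE \<xi> in lborel. aug_norm \<xi> (spectral a u s \<xi> - spectral a u t \<xi>) \<le> e * (norm \<xi> powr (-\<sigma>) * exp (- 0 * norm \<xi>))"
          using hat_diff[OF aF[OF s] aF[OF t]] hatv_diff[OF uF[OF s] uF[OF t]] AE_lborel_nonzero
        proof eventually_elim
          case (elim \<xi>)
          have "aug_norm \<xi> (spectral a u s \<xi> - spectral a u t \<xi>) \<le> 3 * (e / 3) * norm \<xi> powr (-\<sigma>)"
            by (rule comb) (use elim in \<open>auto simp: spectral_def\<close>)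
          then show ?case by simp
        qed
        moreover note [measurable] = meas[OF s] meas[OF t]
        ultimately show ?case using e unfolding freq_bound_def by auto
      qed
    qed
  qed
qed

text \<open>The norm of a is a maximum of two entries at most M; adding the norm of u gives 2 M.
  Since all norms see only the class of the transform, the distributions at the various times may be
  chosen independently, and continuity in time is inherited from v.\<close>

lemma curve_realization:
  assumes v: "curve c0 M v"
  shows "\<exists>a u. (a, u) \<in> X_space p \<and> X_norm p a u \<le> ennreal (2 * M) \<and> (\<forall>t>0. AE \<xi> in lborel. spectral a u t \<xi> = v t \<xi>)"
proof -
  have M: "0 \<le> M" using v by (simp add: curve_def)
  define B where "B t = M * t powr (- (1 / p))" for t
  have B: "0 \<le> B t" for t using M by (simp add: B_def)
  have fb: "freq_bound 0 \<sigma> (B t) (v t)" if "t > 0" for t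
    unfolding B_def using curve_freq_bound_0[OF v _ that] c0_pos by simp
  have vm: "v t \<in> borel_measurable borel" if "t > 0" for t by (rule curve_measurable[OF v that])
  note \<sigma>b = order_trans[OF zero_le_one \<sigma>_bounds(1)] \<sigma>_bounds(2)
  have split: "AE \<xi> in lborel. norm (fst (w \<xi>)) \<le> b * norm \<xi> powr (-\<sigma>)"
     "AE \<xi> in lborel. norm (fst (w \<xi>)) \<le> b * norm \<xi> powr (-(\<sigma>+1))"
     "AE \<xi> in lborel. norm (snd (w \<xi>)) \<le> b * norm \<xi> powr (-\<sigma>)"
     "AE \<xi> in lborel. norm (snd (w \<xi>) $ j) \<le> b * norm \<xi> powr (-\<sigma>)"
    if "freq_bound 0 \<sigma> b w" for b w j
  proof -
    have ae: "AE \<xi> in lborel. aug_norm \<xi> (w \<xi>) \<le> b * norm \<xi> powr (-\<sigma>)" using that by (simp add: freq_bound_def)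
    show "AE \<xi> in lborel. norm (fst (w \<xi>)) \<le> b * norm \<xi> powr (-\<sigma>)"
      using ae by eventually_elim (rule order_trans[OF aug_norm_ge(1)])
    show "AE \<xi> in lborel. norm (snd (w \<xi>)) \<le> b * norm \<xi> powr (-\<sigma>)"
      using ae by eventually_elim (rule order_trans[OF aug_norm_ge(3)])
    then show "AE \<xi> in lborel. norm (snd (w \<xi>) $ j) \<le> b * norm \<xi> powr (-\<sigma>)"
      by eventually_elim (rule order_trans[OF Finite_Cartesian_Product.norm_nth_le])
    show "AE \<xi> in lborel. norm (fst (w \<xi>)) \<le> b * norm \<xi> powr (-(\<sigma>+1))"
      using ae AE_lborel_nonzero
    proof eventually_elim
      case (elim \<xi>)
      have r: "norm \<xi> > 0" using elim by simp
      have "norm \<xi> powr 1 * norm (fst (w \<xi>)) \<le> b * norm \<xi> powr (-\<sigma>)"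
        using order_trans[OF aug_norm_ge(2) elim(1)] r by (simp add: powr_one)
      then have "norm (fst (w \<xi>)) \<le> b * norm \<xi> powr (-\<sigma>) * norm \<xi> powr (-1)" by (simp only: powr_mult_le_iff[OF r])
      then show ?case by (simp only: mult.assoc powr_add[symmetric]) simp
    qed
  qed
  \<comment> \<open>Existence is obtained with the exponent \<sigma> < d, which ensures local
    integrability; the exponent \<sigma> + 1 = d + 2/p exceeds d and enters only through the
    norm.\<close>
  define a where "a t = (SOME T. T \<in> tempered \<and> has_fourier_function T (\<lambda>\<xi>. fst (v t \<xi>)))" for t
  define u where "u t = (\<chi> j. SOME T. T \<in> tempered \<and> has_fourier_function T (\<lambda>\<xi>. snd (v t \<xi>) $ j))" for t
  have a: "a t \<in> tempered" "has_fourier_function (a t) (\<lambda>\<xi>. fst (v t \<xi>))" if t: "t > 0" for t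
  proof -
    have "\<exists>T. T \<in> tempered \<and> has_fourier_function T (\<lambda>\<xi>. fst (v t \<xi>))"
      using tempered_exists[OF pair_components_measurable(1)[OF vm[OF t]] \<sigma>b split(1)[OF fb[OF t]]] by blast
    from someI_ex[OF this] show "a t \<in> tempered" "has_fourier_function (a t) (\<lambda>\<xi>. fst (v t \<xi>))" by (auto simp: a_def)
  qed
  have u: "u t $ j \<in> tempered" "has_fourier_function (u t $ j) (\<lambda>\<xi>. snd (v t \<xi>) $ j)" if t: "t > 0" for t j
  proof -
    have "\<exists>T. T \<in> tempered \<and> has_fourier_function T (\<lambda>\<xi>. snd (v t \<xi>) $ j)"
      using tempered_exists[OF pair_components_measurable(3)[OF vm[OF t]] \<sigma>b split(4)[OF fb[OF t]]] by blast
    from someI_ex[OF this] show "u t $ j \<in> tempered" "has_fourier_function (u t $ j) (\<lambda>\<xi>. snd (v t \<xi>) $ j)" by (auto simp: u_def)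
  qed
  have ha: "AE \<xi> in lborel. hat (a t) \<xi> = fst (v t \<xi>)" if "t > 0" for t by (rule hat_unique[OF a(2)[OF that]])
  have hu: "AE \<xi> in lborel. hatv (u t) \<xi> = snd (v t \<xi>)" if "t > 0" for t
  proof -
    have "AE \<xi> in lborel. \<forall>j. hat (u t $ j) \<xi> = snd (v t \<xi>) $ j" using hat_unique[OF u(2)[OF that]] by (simp add: eventually_all_finite)
    then show ?thesis by eventually_elim (simp add: hatv_def vec_eq_iff)
  qed
  have aF: "\<exists>h. has_fourier_function (a t) h" and uF: "\<exists>h. has_fourier_function (u t $ j) h" if "t > 0" for t j
    using a(2)[OF that] u(2)[OF that] by auto
  have PMle: "PM_norm r T \<le> ennreal b" if "\<exists>h. has_fourier_function T h" "AE \<xi> in lborel. hat T \<xi> = h \<xi>"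
    "AE \<xi> in lborel. norm (h \<xi>) \<le> b * norm \<xi> powr (-r)" for r b h and T :: "'n functional"
    unfolding PM_norm_def
  proof (rule weighted_sup_le[OF hat_measurable[OF that(1)]])
    show "AE \<xi> in lborel. norm \<xi> powr r * norm (hat T \<xi>) \<le> b"
      unfolding weighted_AE_iff using that(2,3) by eventually_elim simp
  qed
  have PMvle: "PMv_norm r T \<le> ennreal b" if "\<And>j. \<exists>h. has_fourier_function (T $ j) h" "AE \<xi> in lborel. hatv T \<xi> = h \<xi>"
    "AE \<xi> in lborel. norm (h \<xi>) \<le> b * norm \<xi> powr (-r)" for r b h and T :: "('n functional)^'n"
    unfolding PMv_norm_def
  proof (rule weighted_sup_le[OF hatv_measurable[OF that(1)]])
    show "AE \<xi> in lborel. norm \<xi> powr r * norm (hatv T \<xi>) \<le> b"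
      unfolding weighted_AE_iff using that(2,3) by eventually_elim simp
  qed
  have Na: "PM_norm \<sigma> (a t) \<le> ennreal (B t)" "PM_norm (\<sigma> + 1) (a t) \<le> ennreal (B t)" if "t > 0" for t
    using PMle[OF aF[OF that] ha[OF that]] split(1,2)[OF fb[OF that]] by blast+
  have Nu: "PMv_norm \<sigma> (u t) \<le> ennreal (B t)" if "t > 0" for t
    using PMvle[OF uF[OF that] hu[OF that]] split(3)[OF fb[OF that]] by blast
  have aPM: "a t \<in> PM \<sigma>" "a t \<in> PM (\<sigma> + 1)" and uPM: "u t \<in> PMv \<sigma>" if "t > 0" for t
    using a[OF that] u[OF that] Na[OF that] Nu[OF that] by (auto simp: PM_def PMv_def intro: le_less_trans)
  have KM: "K_norm N p r x \<le> ennreal M" if "\<And>t. t > 0 \<Longrightarrow> N (r + 2 / p) (x t) \<le> ennreal (B t)" for N r and x :: "real \<Rightarrow> 'x"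
    unfolding K_norm_def
  proof (rule SUP_least)
    fix t :: real assume "t \<in> {0<..}"
    then have t: "t > 0" by simp
    have "ennreal (t powr (1 / p)) * N (r + 2 / p) (x t) \<le> ennreal (t powr (1 / p)) * ennreal (B t)"
      by (rule mult_left_mono[OF that[OF t]]) simp
    also have "\<dots> = ennreal (t powr (1 / p) * B t)" using B[of t] by (simp add: ennreal_mult)
    also have "t powr (1 / p) * B t = M * (t powr (1 / p) * t powr (- (1 / p)))" by (simp add: B_def)
    also have "\<dots> = M" using t by (simp add: powr_add[symmetric])
    finally show "ennreal (t powr (1 / p)) * N (r + 2 / p) (x t) \<le> ennreal M" .
  qed
  have Ka: "K_norm PM_norm p (real CARD('n) - 1) a \<le> ennreal M" "K_norm PM_norm p (real CARD('n)) a \<le> ennreal M"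
    by (rule KM; simp only: K_exponents Na)+
  have Ku: "K_norm PMv_norm p (real CARD('n) - 1) u \<le> ennreal M"
    by (rule KM) (simp only: K_exponents Nu)
  have cont: "((\<lambda>s. PM_norm \<sigma> (a s - a t)) \<longlongrightarrow> 0) (at t)" "((\<lambda>s. PM_norm (\<sigma>+1) (a s - a t)) \<longlongrightarrow> 0) (at t)"
     "((\<lambda>s. PMv_norm \<sigma> (u s - u t)) \<longlongrightarrow> 0) (at t)" if t: "t > 0" for t
  proof -
    have ev: "\<forall>\<^sub>F s in at t. PM_norm \<sigma> (a s - a t) \<le> ennreal e \<and> PM_norm (\<sigma>+1) (a s - a t) \<le> ennreal e \<and> PMv_norm \<sigma> (u s - u t) \<le> ennreal e"
      if e: "e > 0" for e
    proof -
      have "\<forall>\<^sub>F s in at t. freq_bound 0 \<sigma> e (\<lambda>\<xi>. v s \<xi> - v t \<xi>)" using v t e by (auto simp: curve_def time_cont_def)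
      then show ?thesis using eventually_at_pos[OF t]
      proof eventually_elim
        case (elim s)
        have s: "s > 0" using elim t by simp
        have da: "AE \<xi> in lborel. hat (a s - a t) \<xi> = fst (v s \<xi> - v t \<xi>)"
          using hat_diff[OF aF[OF s] aF[OF t]] ha[OF s] ha[OF t] by eventually_elim simp
        have du: "AE \<xi> in lborel. hatv (u s - u t) \<xi> = snd (v s \<xi> - v t \<xi>)"
          using hatv_diff[OF uF[OF s] uF[OF t]] hu[OF s] hu[OF t] by eventually_elim simp
        have Fa: "\<exists>h. has_fourier_function (a s - a t) h" using has_fourier_function_diff[OF a(2)[OF s] a(2)[OF t]] by blast
        have Fu: "\<exists>h. has_fourier_function ((u s - u t) $ j) h" for j using has_fourier_function_diff[OF u(2)[OF s, of j] u(2)[OF t, of j]] by auto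
        show ?case
          using PMle[OF Fa da] PMvle[OF Fu du] split[OF elim(1)] by blast
      qed
    qed
    show "((\<lambda>s. PM_norm \<sigma> (a s - a t)) \<longlongrightarrow> 0) (at t)" "((\<lambda>s. PM_norm (\<sigma>+1) (a s - a t)) \<longlongrightarrow> 0) (at t)"
     "((\<lambda>s. PMv_norm \<sigma> (u s - u t)) \<longlongrightarrow> 0) (at t)"
      by (rule tendsto_zero_ennrealI, rule eventually_mono[OF ev], assumption, blast)+
  qed
  have fin: "K_norm PM_norm p (real CARD('n) - 1) a < \<infinity>" "K_norm PM_norm p (real CARD('n)) a < \<infinity>" "K_norm PMv_norm p (real CARD('n) - 1) u < \<infinity>"
    using Ka Ku by (auto intro: le_less_trans)
  have "(a, u) \<in> X_space p"
    unfolding X_space_def K_space_def K_exponents using aPM uPM cont fin by auto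
  moreover have "X_norm p a u \<le> ennreal (2 * M)"
  proof -
    have "X_norm p a u \<le> ennreal M + ennreal M" unfolding X_norm_def using Ka Ku by (intro add_mono) auto
    also have "\<dots> = ennreal (2 * M)" using M by (simp add: ennreal_plus[symmetric] del: ennreal_plus)
    finally show ?thesis .
  qed
  moreover have "AE \<xi> in lborel. spectral a u t \<xi> = v t \<xi>" if "t > 0" for t
    using ha[OF that] hu[OF that] by eventually_elim (simp add: spectral_def)
  ultimately show ?thesis by blast
qed

end

section \<open>From the fixed point to the theorem\<close>

context nsk_semigroup
begin

text \<open>The norm bounds the data only almost everywhere. Setting them to 0 where the bound fails
  changes a null set and makes the bound valid everywhere, as \<open>datum\<close> demands.\<close>

lemma datum_from_norm:
  assumes a0: "a0 \<in> PM (real CARD('n) - 1)" and u0: "u0 \<in> PMv (real CARD('n) - 1)"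
    and dn: "data_norm (real CARD('n) - 1) a0 u0 \<le> ennreal \<rho>" and \<rho>: "0 \<le> \<rho>"
  shows "\<exists>v0. datum \<rho> v0 \<and> (AE \<xi> in lborel. v0 \<xi> = (hat a0 \<xi>, hatv u0 \<xi>))"
proof -
  let ?r = "real CARD('n) - 1"
  let ?h = "\<lambda>\<xi>. (hat a0 \<xi>, hatv u0 \<xi>)"
  have [measurable]: "hat a0 \<in> borel_measurable borel" using a0 by (auto simp: PM_def intro: hat_measurable)
  have [measurable]: "hatv u0 \<in> borel_measurable borel" using u0 by (auto simp: PMv_def intro: hatv_measurable)
  define v0 where "v0 \<xi> = (if aug_norm \<xi> (?h \<xi>) \<le> \<rho> * norm \<xi> powr (- ?r) then ?h \<xi> else 0)" for \<xi>
  have "(\<lambda>\<xi>. aug_norm \<xi> (?h \<xi>)) \<in> borel_measurable borel" unfolding augment_def prod.case by measurable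
  then have "v0 \<in> borel_measurable borel" unfolding v0_def[abs_def] by measurable
  moreover have "aug_norm \<xi> (v0 \<xi>) \<le> \<rho> * norm \<xi> powr (- ?r)" for \<xi> using \<rho> by (simp add: v0_def)
  ultimately have "datum \<rho> v0" using \<rho> by (simp add: datum_def)
  moreover have "AE \<xi> in lborel. norm \<xi> powr ?r * aug_norm \<xi> (?h \<xi>) \<le> \<rho>"
    using weighted_sup_AE[OF dn[unfolded data_norm_def] \<rho>] by (simp add: augment_def)
  then have "AE \<xi> in lborel. v0 \<xi> = ?h \<xi>"
    unfolding weighted_AE_iff by eventually_elim (simp add: v0_def)
  ultimately show ?thesis by blast
qed

lemma mild_solution_equation:
  assumes "mild_solution \<mu> \<nu> \<kappa> \<alpha> p a0 u0 a u" and t: "t > 0"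
  shows "AE \<xi> in lborel. spectral a u t \<xi> = W t \<xi> (hat a0 \<xi>, hatv u0 \<xi>) + bilin (spectral a u) (spectral a u) t \<xi>"
proof -
  have "AE \<xi> in lborel. (hat (a t) \<xi>, hatv (u t) \<xi>) = W_symbol \<mu> \<nu> \<kappa> \<alpha> t \<xi> (hat a0 \<xi>, hatv u0 \<xi>)
          + (LINT s:{0<..<t}|lborel. duhamel \<mu> \<nu> \<kappa> \<alpha> a u t \<xi> s)"
    using assms by (auto simp: mild_solution_def)
  then show ?thesis
    using AE_lborel_nonzero
  proof eventually_elim
    case (elim \<xi>)
    then show ?case by (simp add: spectral_def[of a u t] W_eq[symmetric] duhamel_spectral bilin_def duh_def)
  qed
qed

text \<open>By \<open>nonlin_cong_AE\<close> the nonlinear term at each time s has, at every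
  frequency, the same value for the distributions and for v, so the exceptional sets of different s
  never have to be united.\<close>

lemma mild_solutionI:
  assumes X: "(a, u) \<in> X_space p" and v: "curve c0 M v" 
    and sv: "\<And>t. t > 0 \<Longrightarrow> AE \<xi> in lborel. spectral a u t \<xi> = v t \<xi>"
    and sm: "\<And>t. t > 0 \<Longrightarrow> spectral a u t \<in> borel_measurable borel"
    and I: "\<And>t \<xi>. t > 0 \<Longrightarrow> \<xi> \<noteq> 0 \<Longrightarrow> set_integrable lborel {0<..<t} (\<lambda>s. W (t - s) \<xi> (nonlin \<mu> \<nu> \<kappa> (v s) (v s) \<xi>))"
    and eq: "\<And>t \<xi>. t > 0 \<Longrightarrow> \<xi> \<noteq> 0 \<Longrightarrow> v t \<xi> = lin v0 t \<xi> + bilin v v t \<xi>"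
    and v0: "AE \<xi> in lborel. v0 \<xi> = (hat a0 \<xi>, hatv u0 \<xi>)"
  shows "mild_solution \<mu> \<nu> \<kappa> \<alpha> p a0 u0 a u"
  unfolding mild_solution_def
proof (intro conjI X allI impI)
  fix t :: real assume t: "t > 0"
  have du: "duhamel \<mu> \<nu> \<kappa> \<alpha> a u t \<xi> s = W (t - s) \<xi> (nonlin \<mu> \<nu> \<kappa> (v s) (v s) \<xi>)" if "s \<in> {0<..<t}" for s \<xi>
  proof -
    have s: "s > 0" using that by simp
    show ?thesis unfolding duhamel_spectral nonlin_cong_AE[OF sv[OF s] sm[OF s] curve_measurable[OF v s]] ..
  qed
  show "AE \<xi> in lborel. set_integrable lborel {0<..<t} (duhamel \<mu> \<nu> \<kappa> \<alpha> a u t \<xi>) \<and>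
        (hat (a t) \<xi>, hatv (u t) \<xi>) = W_symbol \<mu> \<nu> \<kappa> \<alpha> t \<xi> (hat a0 \<xi>, hatv u0 \<xi>)
          + (LINT s:{0<..<t}|lborel. duhamel \<mu> \<nu> \<kappa> \<alpha> a u t \<xi> s)"
    using sv[OF t] v0 AE_lborel_nonzero
  proof eventually_elim
    case (elim \<xi>)
    have "set_integrable lborel {0<..<t} (duhamel \<mu> \<nu> \<kappa> \<alpha> a u t \<xi>)"
      using I[OF t elim(3)] by (rule set_integrable_cong[THEN iffD1, rotated 3]) (simp_all add: du)
    moreover have "(LINT s:{0<..<t}|lborel. duhamel \<mu> \<nu> \<kappa> \<alpha> a u t \<xi> s) = bilin v v t \<xi>"
      using elim(3) unfolding bilin_def duh_def by (simp, intro set_lebesgue_integral_cong) (auto simp: du)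
    moreover have "(hat (a t) \<xi>, hatv (u t) \<xi>) = lin v0 t \<xi> + bilin v v t \<xi>"
      using elim(1) eq[OF t elim(3)] by (simp add: spectral_def)
    moreover have "lin v0 t \<xi> = W t \<xi> (hat a0 \<xi>, hatv u0 \<xi>)" using elim(2,3) by (simp add: lin_def)
    ultimately show ?case unfolding W_eq[symmetric] by simp
  qed
qed

lemma spectral_determines:
  assumes X: "(a, u) \<in> X_space p" "(a', u') \<in> X_space p" and t: "t > 0"
    and eq: "AE \<xi> in lborel. spectral a u t \<xi> = spectral a' u' t \<xi>"
  shows "a t = a' t" "u t = u' t"
proof -
  have A: "b t \<in> tempered \<and> has_fourier_function (b t) (hat (b t))" "w t $ j \<in> tempered \<and> has_fourier_function (w t $ j) (hat (w t $ j))"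
    if "(b, w) \<in> X_space p" for b w j
  proof -
    have "b t \<in> tempered" "\<exists>h. has_fourier_function (b t) h" "w t $ j \<in> tempered" "\<exists>h. has_fourier_function (w t $ j) h"
      using that t by (auto simp: X_space_def K_space_def PM_def PMv_def)
    then show "b t \<in> tempered \<and> has_fourier_function (b t) (hat (b t))" "w t $ j \<in> tempered \<and> has_fourier_function (w t $ j) (hat (w t $ j))"
      using has_fourier_function_hat by blast+
  qed
  have "AE \<xi> in lborel. hat (a t) \<xi> = hat (a' t) \<xi>" using eq by eventually_elim (simp add: spectral_def)
  then show "a t = a' t" using A(1)[OF X(1)] A(1)[OF X(2)] tempered_eqI by blast
  have "u t $ j = u' t $ j" for j
  proof -
    have "AE \<xi> in lborel. hat (u t $ j) \<xi> = hat (u' t $ j) \<xi>"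
      using eq by eventually_elim (simp add: spectral_def hatv_def vec_eq_iff)
    then show ?thesis using A(2)[OF X(1)] A(2)[OF X(2)] tempered_eqI by blast
  qed
  then show "u t = u' t" by (simp add: vec_eq_iff)
qed

text \<open>Multiplying by exp (s |\<xi>|) exactly cancels the decay and leaves a function of size
  |\<xi>|^(-\<sigma>), which is the transform of an element of \<open>PM \<sigma>\<close>; hence s
  itself is admissible in the supremum.\<close>

lemma radius_lower_bound:
  assumes T: "\<exists>h. has_fourier_function T h" and s: "s > 0"
    and b: "AE \<xi> in lborel. norm (hat T \<xi>) \<le> B * (norm \<xi> powr (-\<sigma>) * exp (- s * norm \<xi>))"
  shows "ennreal s \<le> rad \<sigma> (T :: 'n functional)"
proof -
  have [measurable]: "hat T \<in> borel_measurable borel" by (rule hat_measurable[OF T])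
  let ?h = "\<lambda>\<xi>. complex_of_real (exp (s * norm \<xi>)) * hat T \<xi>"
  have "?h \<in> borel_measurable borel" by measurable
  moreover have "AE \<xi> in lborel. norm (?h \<xi>) \<le> B * norm \<xi> powr (-\<sigma>)"
    using b
  proof eventually_elim
    case (elim \<xi>)
    have "norm (?h \<xi>) \<le> exp (s * norm \<xi>) * (B * (norm \<xi> powr (-\<sigma>) * exp (- s * norm \<xi>)))"
      using elim by (simp add: norm_mult mult_left_mono)
    also have "\<dots> = B * norm \<xi> powr (-\<sigma>) * (exp (s * norm \<xi>) * exp (- s * norm \<xi>))" by (simp only: mult_ac)
    finally show ?case by (simp add: exp_add[symmetric])
  qed
  ultimately obtain w where w: "has_fourier_function w ?h" "w \<in> PM \<sigma>"
    using PM_member[OF _ order_trans[OF zero_le_one \<sigma>_bounds(1)] \<sigma>_bounds(2)] by blast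
  show ?thesis unfolding rad_def
    by (rule Sup_upper) (use s w hat_unique[OF w(1)] in blast)
qed

text \<open>Existence, uniqueness and radius are stated for one solution, so that every small
  solution coincides with the constructed one and inherits its radius of analyticity.\<close>

theorem well_posedness_and_analyticity:
  "\<exists>\<rho>>0. \<exists>R>0.
    (\<forall>(a0 :: 'n functional) u0.
       a0 \<in> PM (real CARD('n) - 1) \<inter> PM (real CARD('n)) \<and> u0 \<in> PMv (real CARD('n) - 1) \<and>
       data_norm (real CARD('n) - 1) a0 u0 \<le> ennreal \<rho> \<longrightarrow>
       (\<exists>a u. mild_solution \<mu> \<nu> \<kappa> \<alpha> p a0 u0 a u \<and> X_norm p a u \<le> ennreal R \<and>
          (\<forall>a' u'. mild_solution \<mu> \<nu> \<kappa> \<alpha> p a0 u0 a' u' \<and> X_norm p a' u' \<le> ennreal R \<longrightarrow>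
             (\<forall>t>0. a' t = a t \<and> u' t = u t)) \<and>
          (\<forall>t>0. rad_pair \<sigma> (a t) (u t) \<ge> ennreal (c0 * sqrt t))))"
proof -
  obtain C where C: "C > 0" and BB: "\<And>\<tau> M1 M2 v w. 0 \<le> \<tau> \<Longrightarrow> \<tau> \<le> c0 \<Longrightarrow> curve \<tau> M1 v \<Longrightarrow> curve \<tau> M2 w \<Longrightarrow>
     (\<forall>t>0. \<forall>\<xi>. \<xi> \<noteq> 0 \<longrightarrow> set_integrable lborel {0<..<t} (\<lambda>s. W (t - s) \<xi> (nonlin \<mu> \<nu> \<kappa> (v s) (w s) \<xi>)) \<and>
        aug_norm \<xi> (bilin v w t \<xi>) \<le> C * (M1 * M2) * curve_weight \<tau> t \<xi>) \<and>
     (\<tau> = c0 \<longrightarrow> curve c0 (C * (M1 * M2)) (bilin v w))"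
    using bilin_bound by blast
  note BBc = BB[OF less_imp_le[OF c0_pos] order_refl]
  have CBc: "aug_norm \<xi> (bilin v w t \<xi>) \<le> C * (M1 * M2) * curve_weight c0 t \<xi>"
    if "curve c0 M1 v" "curve c0 M2 w" "t > 0" "\<xi> \<noteq> 0" for M1 M2 v w t \<xi>
    using BBc[OF that(1,2)] that(3,4) by simp
  have CC: "curve c0 (C * (M1 * M2)) (bilin v w)" if "curve c0 M1 v" "curve c0 M2 w" for M1 M2 v w
    using BBc[OF that] by simp
  \<comment> \<open>A solution of norm at most R gives a curve of size 3 R, and uniqueness needs 4 C
    (3 R) \<le> 1. The iteration runs with M = R/2 because realization doubles M, and \<rho> makes
    the free evolution at most M/2.\<close>
  define R where "R = 1 / (12 * C)"
  define M where "M = R / 2"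
  define \<rho> where "\<rho> = M / (2 * (C0 * heat_const))"
  have R: "R > 0" and M: "M > 0" using C by (auto simp: R_def M_def)
  have cpos: "C0 * heat_const > 0" using C0_pos heat_const_pos by simp
  have \<rho>: "\<rho> > 0" using M cpos by (simp add: \<rho>_def)
  have CM: "4 * C * M \<le> 1" "4 * C * (3 * R) \<le> 1" using C by (auto simp: M_def R_def)
  have \<rho>M: "C0 * heat_const * \<rho> \<le> M / 2" using C0_pos heat_const_pos by (simp add: \<rho>_def)
  show ?thesis
  proof (rule exI[of _ \<rho>], rule conjI[OF \<rho>], rule exI[of _ R], rule conjI[OF R], intro allI impI)
    fix a0 :: "'n functional" and u0 :: "('n functional)^'n"
    assume "a0 \<in> PM (real CARD('n) - 1) \<inter> PM (real CARD('n)) \<and> u0 \<in> PMv (real CARD('n) - 1) \<and>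
       data_norm (real CARD('n) - 1) a0 u0 \<le> ennreal \<rho>"
    then obtain v0 where v0: "datum \<rho> v0" "AE \<xi> in lborel. v0 \<xi> = (hat a0 \<xi>, hatv u0 \<xi>)"
      using datum_from_norm[of a0 u0 \<rho>] \<rho> by auto
    obtain v where v: "curve c0 M v" and veq: "\<And>t \<xi>. t > 0 \<Longrightarrow> \<xi> \<noteq> 0 \<Longrightarrow> v t \<xi> = lin v0 t \<xi> + bilin v v t \<xi>"
      using picard_converges[OF C CBc CC CM(1) less_imp_le[OF M] v0(1) \<rho>M] by blast
    obtain a u where X: "(a, u) \<in> X_space p" and XM: "X_norm p a u \<le> ennreal (2 * M)"
      and sv: "\<And>t. t > 0 \<Longrightarrow> AE \<xi> in lborel. spectral a u t \<xi> = v t \<xi>"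
      using curve_realization[OF v] by blast
    have XR: "X_norm p a u \<le> ennreal R" using XM by (simp add: M_def)
    note sc = X_space_curve[OF X XR less_imp_le[OF R]]
    have Iv: "set_integrable lborel {0<..<t} (\<lambda>s. W (t - s) \<xi> (nonlin \<mu> \<nu> \<kappa> (v s) (v s) \<xi>))" if "t > 0" "\<xi> \<noteq> 0" for t \<xi>
      using BBc[OF v v] that by simp
    have ms: "mild_solution \<mu> \<nu> \<kappa> \<alpha> p a0 u0 a u"
      by (rule mild_solutionI[OF X v sv curve_measurable[OF sc] Iv veq v0(2)])
    have uniq: "a' t = a t \<and> u' t = u t"
      if ms': "mild_solution \<mu> \<nu> \<kappa> \<alpha> p a0 u0 a' u'" and XR': "X_norm p a' u' \<le> ennreal R" and t: "t > 0" for a' u' t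
    proof -
      have X': "(a', u') \<in> X_space p" using ms' by (simp add: mild_solution_def)
      note sc' = X_space_curve[OF X' XR' less_imp_le[OF R]]
      \<comment> \<open>The comparison takes place at \<tau> = 0, the only weight under which the
        competing solution is known to be a curve.\<close>
      have "AE \<xi> in lborel. spectral a' u' t \<xi> = spectral a u t \<xi>"
      proof (rule curve_unique[OF C _ sc' sc CM(2) _ t])
        show "aug_norm \<xi> (bilin v w t \<xi>) \<le> C * (M1 * M2) * curve_weight 0 t \<xi>"
          if "curve 0 M1 v" "curve 0 M2 w" "t > 0" "\<xi> \<noteq> 0" for M1 M2 v w t \<xi>
          using BB[OF order_refl less_imp_le[OF c0_pos] that(1,2)] that(3,4) by simp
        show "AE \<xi> in lborel. spectral a' u' t \<xi> - spectral a u t \<xi> = bilin (spectral a' u') (spectral a' u') t \<xi> - bilin (spectral a u) (spectral a u) t \<xi>"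
          if "t > 0" for t
          using mild_solution_equation[OF ms' that] mild_solution_equation[OF ms that] by eventually_elim simp
      qed
      from spectral_determines[OF X' X t this] show ?thesis by simp
    qed
    have rad: "rad_pair \<sigma> (a t) (u t) \<ge> ennreal (c0 * sqrt t)" if t: "t > 0" for t
    proof -
      have s: "c0 * sqrt t > 0" using c0_pos t by simp
      have F: "\<exists>h. has_fourier_function (a t) h" "\<exists>h. has_fourier_function (u t $ j) h" for j
        using X t by (auto simp: X_space_def K_space_def PM_def PMv_def)
      let ?B = "M * t powr (- (1 / p))"
      have b: "AE \<xi> in lborel. aug_norm \<xi> (spectral a u t \<xi>) \<le> ?B * (norm \<xi> powr (-\<sigma>) * exp (- (c0 * sqrt t) * norm \<xi>))"
        using sv[OF t] curve_bound[OF v t] by eventually_elim (simp add: curve_weight_def mult.assoc)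
      have "AE \<xi> in lborel. norm (hat (a t) \<xi>) \<le> ?B * (norm \<xi> powr (-\<sigma>) * exp (- (c0 * sqrt t) * norm \<xi>))"
        using b
      proof eventually_elim
        case (elim \<xi>)
        then show ?case using aug_norm_ge(1)[where v="spectral a u t \<xi>" and \<xi>=\<xi>] by (simp add: spectral_def)
      qed
      then have 1: "ennreal (c0 * sqrt t) \<le> rad \<sigma> (a t)" by (rule radius_lower_bound[OF F(1) s])
      have 2: "ennreal (c0 * sqrt t) \<le> rad \<sigma> (u t $ j)" for j
      proof (rule radius_lower_bound[OF F(2) s])
        show "AE \<xi> in lborel. norm (hat (u t $ j) \<xi>) \<le> ?B * (norm \<xi> powr (-\<sigma>) * exp (- (c0 * sqrt t) * norm \<xi>))"
          using b
        proof eventually_elim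
          case (elim \<xi>)
          have "norm (hat (u t $ j) \<xi>) = norm (snd (spectral a u t \<xi>) $ j)" by (simp add: spectral_def hatv_def)
          also have "\<dots> \<le> norm (snd (spectral a u t \<xi>))" by (rule Finite_Cartesian_Product.norm_nth_le)
          also have "\<dots> \<le> aug_norm \<xi> (spectral a u t \<xi>)" by (rule aug_norm_ge(3))
          finally show ?case using elim by linarith
        qed
      qed
      show ?thesis unfolding rad_pair_def using 1 2 by (intro Min.boundedI) auto
    qed
    show "\<exists>a u. mild_solution \<mu> \<nu> \<kappa> \<alpha> p a0 u0 a u \<and> X_norm p a u \<le> ennreal R \<and>
          (\<forall>a' u'. mild_solution \<mu> \<nu> \<kappa> \<alpha> p a0 u0 a' u' \<and> X_norm p a' u' \<le> ennreal R \<longrightarrow>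
             (\<forall>t>0. a' t = a t \<and> u' t = u t)) \<and>
          (\<forall>t>0. rad_pair \<sigma> (a t) (u t) \<ge> ennreal (c0 * sqrt t))"
      using ms XR uniq rad by blast
  qed
qed

end

text \<open>Part (ii) speaks of every solution of norm at most R rather than of a chosen one; by
  part (i) they agree at all positive times. The initial condition is contained in the mild
  formulation.\<close>

theorem theorem4p0p1:
  fixes p \<mu> \<nu> \<kappa> \<alpha> c0 :: real
  assumes d_ge_2: "CARD('n::finite) \<ge> 2"
    and p_gt_2: "p > 2"
    and p_range: "real CARD('n) - 3 + 4 / p > 0"
    and params: "\<mu> > 0" "\<mu> + \<nu> > 0" "\<kappa> > 0" "\<alpha> > 0"
    and c0_pos: "c0 > 0"
    and c0_decay: "\<exists>C>0. \<forall>t\<ge>0. \<forall>(\<xi>::real^'n) b0 w0.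
        norm (augment \<xi> (W_symbol \<mu> \<nu> \<kappa> \<alpha> t \<xi> (b0, w0)))
          \<le> C * exp (- c0 * t * (norm \<xi>)\<^sup>2) * norm (augment \<xi> (b0, w0))"
  shows "\<exists>\<rho>>0. \<exists>R>0.
    (\<forall>(a0 :: 'n functional) u0.
       a0 \<in> PM (real CARD('n) - 1) \<inter> PM (real CARD('n)) \<and> u0 \<in> PMv (real CARD('n) - 1) \<and>
       data_norm (real CARD('n) - 1) a0 u0 \<le> ennreal \<rho> \<longrightarrow>
       (\<exists>a u. mild_solution \<mu> \<nu> \<kappa> \<alpha> p a0 u0 a u \<and> X_norm p a u \<le> ennreal R \<and>
          (\<forall>a' u'. mild_solution \<mu> \<nu> \<kappa> \<alpha> p a0 u0 a' u' \<and> X_norm p a' u' \<le> ennreal R \<longrightarrow>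
             (\<forall>t>0. a' t = a t \<and> u' t = u t)))) \<and>
    (\<forall>(a0 :: 'n functional) u0.
       a0 \<in> PM (real CARD('n) - 1) \<inter> PM (real CARD('n)) \<and> u0 \<in> PMv (real CARD('n) - 1) \<and>
       data_norm (real CARD('n) - 1) a0 u0 \<le> ennreal (\<rho> / (2 * exp (2 * c0))) \<longrightarrow>
       (\<forall>a u. mild_solution \<mu> \<nu> \<kappa> \<alpha> p a0 u0 a u \<and> X_norm p a u \<le> ennreal R \<longrightarrow>
          (\<forall>t>0. rad_pair (real CARD('n) - 1 + 2 / p) (a t) (u t) \<ge> ennreal (c0 * sqrt t))))"
proof -
  obtain C where C: "C > 0" and decay: "\<And>t (\<xi>::real^'n) b0 w0. t \<ge> 0 \<Longrightarrow>
        norm (augment \<xi> (W_symbol \<mu> \<nu> \<kappa> \<alpha> t \<xi> (b0, w0)))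
          \<le> C * exp (- c0 * t * (norm \<xi>)\<^sup>2) * norm (augment \<xi> (b0, w0))"
    using c0_decay by blast
  interpret nsk_semigroup p \<mu> \<nu> \<kappa> \<alpha> c0 C "W_symbol \<mu> \<nu> \<kappa> \<alpha> :: real \<Rightarrow> real^'n \<Rightarrow> complex \<times> (complex^'n) \<Rightarrow> complex \<times> (complex^'n)"
  proof
    show "norm (augment \<xi> (W_symbol \<mu> \<nu> \<kappa> \<alpha> t \<xi> v)) \<le> C * exp (- c0 * t * (norm \<xi>)\<^sup>2) * norm (augment \<xi> v)"
      if "0 \<le> t" for t \<xi> and v :: "complex \<times> (complex^'n)"
      using decay[OF that, of \<xi> "fst v" "snd v"] by simp
  qed (use assms C in auto)
  obtain \<rho> R where \<rho>: "\<rho> > 0" and R: "R > 0" and main: "\<And>(a0 :: 'n functional) u0.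
       a0 \<in> PM (real CARD('n) - 1) \<inter> PM (real CARD('n)) \<and> u0 \<in> PMv (real CARD('n) - 1) \<and>
       data_norm (real CARD('n) - 1) a0 u0 \<le> ennreal \<rho> \<Longrightarrow>
       (\<exists>a u. mild_solution \<mu> \<nu> \<kappa> \<alpha> p a0 u0 a u \<and> X_norm p a u \<le> ennreal R \<and>
          (\<forall>a' u'. mild_solution \<mu> \<nu> \<kappa> \<alpha> p a0 u0 a' u' \<and> X_norm p a' u' \<le> ennreal R \<longrightarrow>
             (\<forall>t>0. a' t = a t \<and> u' t = u t)) \<and>
          (\<forall>t>0. rad_pair \<sigma> (a t) (u t) \<ge> ennreal (c0 * sqrt t)))"
    using well_posedness_and_analyticity by blast
  \<comment> \<open>Data below the threshold of (ii) lie below that of (i), so the analytic solution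
    built there is available for them.\<close>
  have "\<rho> / (2 * exp (2 * c0)) \<le> \<rho>"
  proof -
    have "exp (2 * c0) \<ge> 1" using c0_pos by simp
    then have "1 \<le> 2 * exp (2 * c0)" by linarith
    then have "\<rho> * 1 \<le> \<rho> * (2 * exp (2 * c0))" using \<rho> by (intro mult_left_mono) auto
    then show ?thesis by (simp add: pos_divide_le_eq)
  qed
  then have le: "ennreal (\<rho> / (2 * exp (2 * c0))) \<le> ennreal \<rho>" by (rule ennreal_leI)
  show ?thesis
  proof (rule exI[of _ \<rho>], rule conjI[OF \<rho>], rule exI[of _ R], rule conjI[OF R], rule conjI; intro allI impI)
    fix a0 :: "'n functional" and u0
    assume "a0 \<in> PM (real CARD('n) - 1) \<inter> PM (real CARD('n)) \<and> u0 \<in> PMv (real CARD('n) - 1) \<and>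
       data_norm (real CARD('n) - 1) a0 u0 \<le> ennreal \<rho>"
    from main[OF this] show "\<exists>a u. mild_solution \<mu> \<nu> \<kappa> \<alpha> p a0 u0 a u \<and> X_norm p a u \<le> ennreal R \<and>
          (\<forall>a' u'. mild_solution \<mu> \<nu> \<kappa> \<alpha> p a0 u0 a' u' \<and> X_norm p a' u' \<le> ennreal R \<longrightarrow>
             (\<forall>t>0. a' t = a t \<and> u' t = u t))" by blast
  next
    fix a0 :: "'n functional" and u0 a u and t :: real
    assume A: "a0 \<in> PM (real CARD('n) - 1) \<inter> PM (real CARD('n)) \<and> u0 \<in> PMv (real CARD('n) - 1) \<and>
       data_norm (real CARD('n) - 1) a0 u0 \<le> ennreal (\<rho> / (2 * exp (2 * c0)))"
      and S: "mild_solution \<mu> \<nu> \<kappa> \<alpha> p a0 u0 a u \<and> X_norm p a u \<le> ennreal R" and t: "0 < t"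
    have "a0 \<in> PM (real CARD('n) - 1) \<inter> PM (real CARD('n)) \<and> u0 \<in> PMv (real CARD('n) - 1) \<and>
       data_norm (real CARD('n) - 1) a0 u0 \<le> ennreal \<rho>" using A le order_trans by blast
    from main[OF this] obtain b w where "\<forall>a' u'. mild_solution \<mu> \<nu> \<kappa> \<alpha> p a0 u0 a' u' \<and> X_norm p a' u' \<le> ennreal R \<longrightarrow>
             (\<forall>t>0. a' t = b t \<and> u' t = w t)" and r: "\<forall>t>0. rad_pair \<sigma> (b t) (w t) \<ge> ennreal (c0 * sqrt t)"
      by blast
    then have "a t = b t" "u t = w t" using S t by blast+
    with r t show "ennreal (c0 * sqrt t) \<le> rad_pair (real CARD('n) - 1 + 2 / p) (a t) (u t)" by (simp add: K_exponents)
  qed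
qed

end
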